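(* Let $k\ge1$ be an integer, $P$ a fixed polynomial with real coefficients, and $y=T^{\theta_k}$ with fixed $0<\theta_k<\frac1{2k}$. Then, as $T\to\infty$, uniformly for complex shifts $\alpha_1,\alpha_2\ll1/\log T$, $$\begin{aligned}\mathcal I_{k,1}(\alpha_1,\alpha_2)={}&a_{k+1}\,T\,\widehat\Phi(0)\left(\frac T{2\pi}\right)^{-\alpha_1}(\log y)^{(k+1)^2}\int_{\mathcal R}y^{\alpha_1\sum_{i=1}^{k+1}w_i-\alpha_2\sum_{i=1}^{k+1}x_i}\\&\times\prod_{i=1}^{k-1}P\left(1-\sum_{j=1}^{k+1}t_{i,j}\right)\prod_{j=1}^{k+1}P\left(1-\sum_{i=1}^{k-1}t_{i,j}-w_j-x_j\right)\\&\times dt_{1,1}\cdots dt_{k-1,k+1}\,dw_1\cdots dw_{k+1}\,dx_1\cdots dx_{k+1}\ +\ O\left(T(\log T)^{(k+1)^2-1}\right),\end{aligned}$$ where $\mathcal R$ is the set of $(t_{i,j})_{1\le i\le k-1,\,1\le j\le k+1},(w_j)_{1\le j\le k+1},(x_j)_{1\le j\le k+1}$ with all entries in $[0,1]$ satisfying $\sum_{j=1}^{k+1}t_{i,j}\le1$ for $1\le i\le k-1$ and $\sum_{i=1}^{k-1}t_{i,j}+w_j+x_j\le1$ for $1\le j\le k+1$. (When $k=1$, sums, products and differentials indexed by $1\le i\le k-1$ are empty.)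
   Context: $\zeta$ is the Riemann zeta function and $\chi$ is the factor in its functional equation $\zeta(s)=\chi(s)\zeta(1-s)$. For $1\le n\le y$ put $P[n]=P\left(\frac{\log(y/n)}{\log y}\right)$, and let $A(s)=\sum_{n\le y}P[n]n^{-s}$. $\Phi$ is a smooth weight (possibly depending on $T$) with $0\le\Phi\le1$, with $\Phi$ supported in $[1/4,2]$, and with $\frac{d^j}{dt^j}\left[\Phi(t/T)\right]\ll_j(T/\log T)^{-j}$ for every integer $j\ge0$; $\widehat\Phi(0)=\int_{\mathbb R}\Phi(u)\,du$. Define $$\mathcal I_{k,1}(\alpha_1,\alpha_2)=\int_{-\infty}^{\infty}\zeta(\tfrac12+\alpha_1+it)\zeta(\tfrac12+\alpha_2-it)\,A(\tfrac12+it)^{k+1}A(\tfrac12-it)^{k-1}\chi(\tfrac12-it)\,\Phi(\tfrac tT)\,dt$$ (equivalently, with $|A(\tfrac12+it)|^{2k-2}A(\tfrac12+it)^2$ in place of $A(\tfrac12+it)^{k+1}A(\tfrac12-it)^{k-1}$). For a positive integer $m$, $$a_m=\prod_p\left(1-\frac1p\right)^{m^2}\sum_{r=0}^\infty\left(\frac{\Gamma(r+m)}{\Gamma(r+1)\Gamma(m)}\right)^2p^{-r}.$$ *)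

theory Defs
  imports
    "HOL-Complex_Analysis.Complex_Analysis"
    "HOL-Computational_Algebra.Computational_Algebra"
begin

(* The analytic continuation of the Dirichlet series to the plane without 1; it is unique
   there, and only the value at the pole s = 1 is left arbitrary. *)
definition zeta :: "complex \<Rightarrow> complex" where
  "zeta = (SOME f. f holomorphic_on (- {1}) \<and>
     (\<forall>s. Re s > 1 \<longrightarrow> (\<lambda>n. of_nat (Suc n) powr (- s)) sums f s))"

(* The factor in the functional equation zeta(s) = chi(s) zeta(1 - s). *)
definition zeta_chi :: "complex \<Rightarrow> complex" where
  "zeta_chi s = 2 powr s * of_real pi powr (s - 1) * sin (of_real pi * s / 2) * Gamma (1 - s)"

definition mollifier_coeff :: "real poly \<Rightarrow> real \<Rightarrow> nat \<Rightarrow> real" where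
  "mollifier_coeff P y n = poly P (ln (y / real n) / ln y)"

definition dirichlet_poly :: "real poly \<Rightarrow> real \<Rightarrow> complex \<Rightarrow> complex" where
  "dirichlet_poly P y s =
     (\<Sum>n\<in>{n::nat. 1 \<le> n \<and> real n \<le> y}. of_real (mollifier_coeff P y n) * of_nat n powr (- s))"

definition smooth_fun :: "(real \<Rightarrow> real) \<Rightarrow> bool" where
  "smooth_fun f \<longleftrightarrow> (\<forall>j x. (deriv ^^ j) f differentiable (at x))"

(* A smooth weight that may depend on T: the weight belonging to T is Phi T.  The constants in
   the derivative bounds depend on j only, not on T. *)
definition weight_family :: "(real \<Rightarrow> real \<Rightarrow> real) \<Rightarrow> bool" where
  "weight_family \<Phi> \<longleftrightarrow> (\<exists>T0>1.
     (\<forall>T\<ge>T0. smooth_fun (\<Phi> T) \<and> (\<forall>u. 0 \<le> \<Phi> T u \<and> \<Phi> T u \<le> 1) \<and>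
        (\<forall>u. u \<notin> {1/4..2} \<longrightarrow> \<Phi> T u = 0)) \<and>
     (\<forall>j::nat. \<exists>c. \<forall>T\<ge>T0. \<forall>t.
        \<bar>(deriv ^^ j) (\<lambda>t. \<Phi> T (t / T)) t\<bar> \<le> c * (T / ln T) powr (- real j)))"

definition twisted_moment ::
  "nat \<Rightarrow> real poly \<Rightarrow> real \<Rightarrow> (real \<Rightarrow> real) \<Rightarrow> real \<Rightarrow> complex \<Rightarrow> complex \<Rightarrow> complex" where
  "twisted_moment k P y \<phi> T \<alpha>1 \<alpha>2 =
     (\<integral>t. zeta (1/2 + \<alpha>1 + \<i> * of_real t) * zeta (1/2 + \<alpha>2 - \<i> * of_real t) *
          dirichlet_poly P y (1/2 + \<i> * of_real t) ^ (k + 1) *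
          dirichlet_poly P y (1/2 - \<i> * of_real t) ^ (k - 1) *
          zeta_chi (1/2 - \<i> * of_real t) * of_real (\<phi> (t / T)) \<partial>lborel)"

(* Gamma(r+m) / (Gamma(r+1) Gamma(m)) is the r-th coefficient of (1 - X)^(-m). *)
definition arith_factor :: "nat \<Rightarrow> real" where
  "arith_factor m = (\<Prod>p. if prime p then
       (1 - 1 / real p) ^ (m\<^sup>2) *
       (\<Sum>r. (Gamma (real r + real m) / (Gamma (real r + 1) * Gamma (real m)))\<^sup>2 *
             real p powr (- real r))
     else 1)"

type_synonym variables = "(nat \<times> nat \<Rightarrow> real) \<times> (nat \<Rightarrow> real) \<times> (nat \<Rightarrow> real)"

(* Lebesgue measure in the variables t(i,j), w(j), x(j); for k = 1 the first factor is the
   one-point space. *)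
definition variables_measure :: "nat \<Rightarrow> variables measure" where
  "variables_measure k =
     (\<Pi>\<^sub>M ij\<in>{1..k-1} \<times> {1..k+1}. lborel) \<Otimes>\<^sub>M ((\<Pi>\<^sub>M j\<in>{1..k+1}. lborel) \<Otimes>\<^sub>M (\<Pi>\<^sub>M j\<in>{1..k+1}. lborel))"

definition region :: "nat \<Rightarrow> variables set" where
  "region k = {(t, w, x).
     t \<in> ({1..k-1} \<times> {1..k+1}) \<rightarrow>\<^sub>E {0..1} \<and>
     w \<in> {1..k+1} \<rightarrow>\<^sub>E {0..1} \<and> x \<in> {1..k+1} \<rightarrow>\<^sub>E {0..1} \<and>
     (\<forall>i\<in>{1..k-1}. (\<Sum>j=1..k+1. t (i, j)) \<le> 1) \<and>
     (\<forall>j\<in>{1..k+1}. (\<Sum>i=1..k-1. t (i, j)) + w j + x j \<le> 1)}"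

definition main_integrand ::
  "nat \<Rightarrow> real poly \<Rightarrow> real \<Rightarrow> complex \<Rightarrow> complex \<Rightarrow> variables \<Rightarrow> complex" where
  "main_integrand k P y \<alpha>1 \<alpha>2 = (\<lambda>(t, w, x).
     of_real y powr (\<alpha>1 * of_real (\<Sum>i=1..k+1. w i) - \<alpha>2 * of_real (\<Sum>i=1..k+1. x i)) *
     of_real ((\<Prod>i=1..k-1. poly P (1 - (\<Sum>j=1..k+1. t (i, j)))) *
              (\<Prod>j=1..k+1. poly P (1 - (\<Sum>i=1..k-1. t (i, j)) - w j - x j))))"

definition main_term ::
  "nat \<Rightarrow> real poly \<Rightarrow> real \<Rightarrow> (real \<Rightarrow> real) \<Rightarrow> real \<Rightarrow> complex \<Rightarrow> complex \<Rightarrow> complex" where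
  "main_term k P y \<phi> T \<alpha>1 \<alpha>2 =
     of_real (arith_factor (k + 1)) * of_real T * of_real (\<integral>u. \<phi> u \<partial>lborel) *
     of_real (T / (2 * pi)) powr (- \<alpha>1) * of_real (ln y ^ ((k + 1)\<^sup>2)) *
     (LINT v:region k|variables_measure k. main_integrand k P y \<alpha>1 \<alpha>2 v)"

end

theory Submission
 imports Defs "HOL-Real_Asymp.Real_Asymp"
begin

text \<open>By the functional equation the integrand becomes a ratio of \<open>\<chi>\<close> factors, which is
 \<open>(T / 2\<pi>) powr (- \<alpha>1)\<close> up to \<open>O(1 / ln T)\<close>, times \<open>\<zeta>(1/2 - \<alpha>1 - i t) \<zeta>(1/2 + \<alpha>2 - i t)\<close> and the Dirichlet
 polynomials. Both zeta values are replaced by Dirichlet polynomials of length a large power of \<open>T\<close>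
 together with a pole term. After multiplying out, a term with frequency \<open>ln (u / v)\<close>, where
 \<open>v \<le> y ^ (k + 1)\<close> is the product of the \<open>k + 1\<close> variables from \<open>A(1/2 + i t)\<close>, has \<open>u = v\<close> or a
 frequency of size at least \<open>1 / (2 v) \<ge> T powr (\<epsilon> - 1)\<close>, because \<open>(k + 1) \<theta> < 1\<close>; integration by
 parts makes the latter terms negligible, however long the polynomials are.

 The solutions of \<open>a 1 * \<dots> * a (k + 1) = c 1 * \<dots> * c (k + 1)\<close> that remain are parametrized by
 \<open>(k + 1) \<times> (k + 1)\<close> matrices subject to coprimality conditions. The diagonal sum is thus a sum of
 \<open>\<Prod> 1 / d v\<close> times a function of the \<open>ln (d v) / ln y\<close> over matrices whose admissible supports are
 prescribed prime by prime. Moebius inversion over the supports splits off an Euler product, the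
 arithmetic factor, and what is left is a Riemann sum for the integral over the polytope.\<close>

section \<open>The functional equation of the zeta function\<close>

text \<open>\<open>zeta\<close> is defined by choice, so nothing is known about it until a
  continuation to the whole punctured plane is exhibited. The trapezoidal rule continues the series
  only to Re s > -1; the functional equation, proved to the left of 0, supplies the rest. The same
  rule gives the approximation of \<open>zeta\<close> used later: its error is polynomial in T times
  a negative power of the length N, and N may be any power of T, because only the k + 1 variables on
  the opposite side limit the frequencies. The condition 2 * k * \<theta> < 1 enters twice: it
  implies (k + 1) * \<theta> < 1, and it bounds the product of the 2 * k Dirichlet polynomials
  trivially by O(T). Only one logarithm has to be saved, so Riemann sums are precise enough. What
  shapes the estimates is that the limiting function may jump on the faces of the polytope (P need
  not vanish at 0) and that no constant may depend on T, the shifts or the weight. Hence explicit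
  sup and Lipschitz constants are carried along, and jumps are allowed at the ends of
  intervals.\<close>

text \<open>The quotient by \<open>s - 1\<close> is the integral of u powr (-s) over [n, n + 1]; the
  first term is its trapezoidal approximation.\<close>

definition trapezoid_error :: "nat \<Rightarrow> complex \<Rightarrow> complex" where
 "trapezoid_error n s = (of_nat n powr (-s) + of_nat (Suc n) powr (-s)) / 2
   - (of_nat n powr (1 - s) - of_nat (Suc n) powr (1 - s)) / (s - 1)"

lemma norm_of_nat_powr:
 assumes "n \<ge> 1"
 shows "norm (of_nat n powr s :: complex) = real n powr Re s"
 using norm_powr_real_powr[of "of_nat n" s] assms by simp

text \<open>With \<open>w u = (u - n) * (n + 1 - u) / 2\<close>, the function
 \<open>w * f' - w' * f - (\<integral> f)\<close> for \<open>f u = u powr (-s)\<close> has derivative \<open>w * f''\<close>, and its increment over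
 \<open>[n, n + 1]\<close> is the error of the trapezoidal rule.\<close>

lemma norm_trapezoid_error_le:
 assumes n: "n \<ge> 1" and s: "s \<noteq> 1" and Re: "Re s \<ge> -2"
 shows "norm (trapezoid_error n s) \<le> norm s * norm (s + 1) * real n powr (- Re s - 2)"
proof -
 define c :: complex where "c = of_nat n"
 define F :: "complex \<Rightarrow> complex" where "F = (\<lambda>z.
   ((z - c) * (c + 1 - z) / 2) * (- s * z powr (-s - 1))
   - ((2 * c + 1 - 2 * z) / 2) * z powr (-s) - z powr (1 - s) / (1 - s))"
 \<comment> \<open>The interval is regarded as a segment in the complex plane, so that the complex
   mean value inequality applies to F.\<close>
 define S where "S = complex_of_real ` {real n..real n + 1}"
 have der: "(F has_field_derivative
   ((z - c) * (c + 1 - z) / 2) * (s * (s + 1) * z powr (-s - 2))) (at z within S)"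
  if z: "z \<in> S" for z
 proof -
  obtain u where u: "z = of_real u" "u \<ge> real n" using z by (auto simp: S_def)
  have u0: "z \<notin> \<real>\<^sub>\<le>\<^sub>0" "z \<noteq> 0" using n u by (auto simp: complex_nonpos_Reals_iff)
  \<comment> \<open>All powers of z become monomials in z times q, and the derivative of F reduces
    to a polynomial identity.\<close>
  define q where "q = z powr (-s - 2)"
  have p: "z powr (-s - 1) = q * z" "z powr (-s) = q * z * z" "z powr (1 - s) = q * z * z * z"
  proof -
   have add: "z powr (e + 1) = z powr e * z" for e
    using u0 by (simp add: powr_add)
   have e: "- s - 2 + 1 = - s - 1" by simp
   show 1: "z powr (-s - 1) = q * z" using add[of "-s - 2"] unfolding e q_def .
   show 2: "z powr (-s) = q * z * z" using add[of "-s - 1"] 1 by simp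
   show "z powr (1 - s) = q * z * z * z" using add[of "-s"] 2 by simp
  qed
  have r: "z powr (-s - 1 - 1) = q" "z powr (- s - 1) = q * z" "z powr (1 - s - 1) = q * z * z"
  proof -
   have e: "- s - 1 - 1 = - s - 2" "1 - s - 1 = - s" by simp_all
   show "z powr (-s - 1 - 1) = q" "z powr (- s - 1) = q * z" "z powr (1 - s - 1) = q * z * z"
    unfolding e by (rule q_def[symmetric] p)+
  qed
  have d: "((\<lambda>z. z powr e) has_field_derivative (e * z powr (e - 1))) (at z within S)" for e
   using u0 by (intro has_field_derivative_at_within[OF has_field_derivative_powr]) auto
  have dA: "((\<lambda>z. (z - c) * (c + 1 - z) / 2) has_field_derivative ((2 * c + 1 - 2 * z) / 2)) (at z within S)"
   by (rule DERIV_cong[OF DERIV_cdivide[OF DERIV_mult[OF DERIV_diff[OF DERIV_ident DERIV_const] DERIV_diff[OF DERIV_const DERIV_ident]]]]) simp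
  have dB: "((\<lambda>z. (2 * c + 1 - 2 * z) / 2) has_field_derivative -1) (at z within S)"
   by (rule DERIV_cong[OF DERIV_cdivide[OF DERIV_diff[OF DERIV_const DERIV_cmult[OF DERIV_ident]]]]) simp
  have "(F has_field_derivative
    ((2 * c + 1 - 2 * z) / 2 * (- s * z powr (-s - 1)) + (- s * ((-s - 1) * z powr (-s - 1 - 1))) * ((z - c) * (c + 1 - z) / 2)
    - ((-1) * z powr (-s) + (-s * z powr (-s - 1)) * ((2 * c + 1 - 2 * z) / 2)) - ((1 - s) * z powr (1 - s - 1)) / (1 - s))) (at z within S)"
   unfolding F_def
   by (rule DERIV_diff[OF DERIV_diff[OF DERIV_mult[OF dA DERIV_cmult[OF d]] DERIV_mult[OF dB d]] DERIV_cdivide[OF d]])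
  moreover have "((1 - s) * z powr (1 - s - 1)) / (1 - s) = q * z * z" using s r by simp
  moreover have "M * (- s * (q * z)) + (- s * ((-s - 1) * q)) * W - ((-1) * (q * z * z) + (- s * (q * z)) * M) - q * z * z
    = W * (s * (s + 1) * q)" for M W
   by (simp add: algebra_simps)
  ultimately show ?thesis
   by (simp only: r p q_def[symmetric])
 qed
 have bnd: "norm (((z - c) * (c + 1 - z) / 2) * (s * (s + 1) * z powr (-s - 2))) \<le>
   norm s * norm (s + 1) * real n powr (- Re s - 2)" if z: "z \<in> S" for z
 proof -
  obtain u where u: "z = of_real u" "u \<ge> real n" "u \<le> real n + 1" using z by (auto simp: S_def)
  have e: "(z - c) * (c + 1 - z) / 2 = of_real ((u - real n) * (real n + 1 - u) / 2)"
   by (simp add: u c_def)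
  have w: "norm ((z - c) * (c + 1 - z) / 2) \<le> 1"
  proof -
   have "(u - real n) * (real n + 1 - u) \<le> 1 * 1" using u by (intro mult_mono) auto
   moreover have "(u - real n) * (real n + 1 - u) \<ge> 0" using u by auto
   ultimately show ?thesis unfolding e norm_of_real by simp
  qed
  have "norm (z powr (-s - 2)) = u powr (- Re s - 2)"
   using u n by (simp add: norm_powr_real_powr)
  also have "\<dots> \<le> real n powr (- Re s - 2)"
   using u n Re by (intro powr_mono2') auto
  finally have "norm ((z - c) * (c + 1 - z) / 2) * (norm s * norm (s + 1) * norm (z powr (-s - 2)))
    \<le> 1 * (norm s * norm (s + 1) * real n powr (- Re s - 2))"
   using w by (intro mult_mono mult_left_mono) auto
  then show ?thesis by (simp add: norm_mult)
 qed
 have conv: "convex S"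
  unfolding S_def by (rule convex_linear_image) (auto intro: bounded_linear.linear bounded_linear_of_real)
 have mem: "c \<in> S" "c + 1 \<in> S" unfolding S_def c_def
  by (force intro!: image_eqI[of _ _ "real n"]) (force intro!: image_eqI[of _ _ "real n + 1"])
 have "norm (F (c + 1) - F c) \<le> (norm s * norm (s + 1) * real n powr (- Re s - 2)) * norm ((c + 1) - c)"
  by (rule field_differentiable_bound[OF conv der bnd]) (use mem in auto)
 moreover have "F (c + 1) - F c = trapezoid_error n s"
 proof -
  have "F (c + 1) = (c + 1) powr (-s) / 2 - (c + 1) powr (1 - s) / (1 - s)"
   "F c = - (c powr (-s) / 2) - c powr (1 - s) / (1 - s)"
   by (simp_all add: F_def)
  moreover have "a / (1 - s) = - (a / (s - 1))" for a
  proof -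
   have "1 - s = - (s - 1)" by simp
   then show ?thesis by (simp only: divide_minus_right)
  qed
  ultimately show ?thesis
   by (simp add: trapezoid_error_def c_def add.commute diff_divide_distrib add_divide_distrib)
 qed
 ultimately show ?thesis by simp
qed

text \<open>Euler-Maclaurin formula summed from n = 1: \<open>1 / (s - 1)\<close> is the integral
  over [1, oo) and \<open>1 / 2\<close> is half of the first term. The errors are O(n powr (- Re s -
  2)), so the formula makes sense for Re s > -1, which includes a strip to the left of 0.\<close>

definition zeta_cont :: "complex \<Rightarrow> complex" where
 "zeta_cont s = 1 / (s - 1) + 1 / 2 + (\<Sum>n. trapezoid_error (Suc n) s)"

lemma summable_Suc_powr: "a < -1 \<Longrightarrow> summable (\<lambda>n. real (Suc n) powr a)"
 using summable_real_powr_iff[of a] by (subst summable_Suc_iff) simp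

lemma summable_trapezoid_error:
 assumes "s \<noteq> 1" "Re s > -1"
 shows "summable (\<lambda>n. trapezoid_error (Suc n) s)"
  and "summable (\<lambda>n. norm (trapezoid_error (Suc n) s))"
proof -
 show "summable (\<lambda>n. norm (trapezoid_error (Suc n) s))"
 proof (rule summable_comparison_test')
  show "summable (\<lambda>n. norm s * norm (s + 1) * real (Suc n) powr (- Re s - 2))"
   using assms by (intro summable_mult summable_Suc_powr) auto
  show "norm (norm (trapezoid_error (Suc n) s)) \<le> norm s * norm (s + 1) * real (Suc n) powr (- Re s - 2)" for n
   using norm_trapezoid_error_le[of "Suc n" s] assms by simp
 qed
 then show "summable (\<lambda>n. trapezoid_error (Suc n) s)" by (rule summable_norm_cancel)
qed

lemma sum_trapezoid_error:
 assumes "s \<noteq> 1"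
 shows "(\<Sum>n<N. trapezoid_error (Suc n) s) =
  (\<Sum>n=1..Suc N. of_nat n powr (-s)) + of_nat (Suc N) powr (1 - s) / (s - 1) - of_nat (Suc N) powr (-s) / 2
   - 1 / (s - 1) - 1 / 2"
proof (induction N)
 case (Suc N)
 have "(\<Sum>n<Suc N. trapezoid_error (Suc n) s) = (\<Sum>n<N. trapezoid_error (Suc n) s) + trapezoid_error (Suc N) s"
  by simp
 also have "\<dots> = (\<Sum>n=1..Suc (Suc N). of_nat n powr (-s)) + of_nat (Suc (Suc N)) powr (1 - s) / (s - 1) - of_nat (Suc (Suc N)) powr (-s) / 2
   - 1 / (s - 1) - 1 / 2"
  unfolding Suc.IH
  by (simp add: trapezoid_error_def diff_divide_distrib add_divide_distrib del: of_nat_Suc)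
 finally show ?case .
qed simp

lemma holomorphic_zeta_cont: "zeta_cont holomorphic_on ({s. Re s > -1} - {1})"
proof -
 define A where "A = {s. Re s > -1} - {1::complex}"
 have op: "open A" unfolding A_def by (intro open_Diff open_halfspace_Re_gt) auto
 have "(\<lambda>s. \<Sum>n. trapezoid_error (Suc n) s) holomorphic_on A"
 proof (rule holomorphic_uniform_sequence[OF op])
  show "(\<lambda>s. \<Sum>n<N. trapezoid_error (Suc n) s) holomorphic_on A" for N
   unfolding trapezoid_error_def by (auto intro!: holomorphic_intros simp: A_def)
  fix s assume s: "s \<in> A"
  then obtain d where d: "d > 0" "cball s d \<subseteq> A" using op open_contains_cball by blast
  have "\<exists>B. \<forall>z\<in>cball s d. norm z * norm (z + 1) \<le> B"
  proof -
   have "compact ((\<lambda>z. norm z * norm (z + 1)) ` cball s d)"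
    by (intro compact_continuous_image continuous_intros compact_cball)
   then have "bdd_above ((\<lambda>z. norm z * norm (z + 1)) ` cball s d)"
    by (intro bounded_imp_bdd_above compact_imp_bounded)
   then show ?thesis unfolding bdd_above_def by blast
  qed
  then obtain B where B: "\<And>z. z \<in> cball s d \<Longrightarrow> norm z * norm (z + 1) \<le> B" by blast
  \<comment> \<open>The smallest real part in the ball; its leftmost point lies in A, hence it still
    exceeds -1 and the majorant converges.\<close>
  define \<sigma> where "\<sigma> = Re s - d"
  have "s - of_real d \<in> A" using d by (intro subsetD[OF d(2)]) (auto simp: dist_norm)
  then have sig: "\<sigma> > -1" by (simp add: A_def \<sigma>_def)
  have "uniform_limit (cball s d) (\<lambda>N z. \<Sum>n<N. trapezoid_error (Suc n) z) (\<lambda>z. \<Sum>n. trapezoid_error (Suc n) z) sequentially"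
  proof (rule Weierstrass_m_test)
   show "summable (\<lambda>n. B * real (Suc n) powr (- \<sigma> - 2))"
    using sig by (intro summable_mult summable_Suc_powr) auto
   fix n z assume z: "z \<in> cball s d"
   have zA: "z \<noteq> 1" "Re z > -1" using z d(2) by (auto simp: A_def)
   have "\<bar>Re (s - z)\<bar> \<le> d" using z abs_Re_le_cmod[of "s - z"] by (simp add: dist_norm)
   then have Rez: "\<sigma> \<le> Re z" by (simp add: \<sigma>_def)
   have "norm (trapezoid_error (Suc n) z) \<le> norm z * norm (z + 1) * real (Suc n) powr (- Re z - 2)"
    using norm_trapezoid_error_le[of "Suc n" z] zA by simp
   also have "\<dots> \<le> B * real (Suc n) powr (- \<sigma> - 2)"
    using Rez B[OF z] order_trans[OF _ B[OF z]] by (intro mult_mono powr_mono) auto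
   finally show "norm (trapezoid_error (Suc n) z) \<le> B * real (Suc n) powr (- \<sigma> - 2)" .
  qed
  then show "\<exists>d>0. cball s d \<subseteq> A \<and> uniform_limit (cball s d) (\<lambda>N z. \<Sum>n<N. trapezoid_error (Suc n) z) (\<lambda>z. \<Sum>n. trapezoid_error (Suc n) z) sequentially"
   using d by blast
 qed
 then have "(\<lambda>s. 1 / (s - 1) + 1 / 2 + (\<Sum>n. trapezoid_error (Suc n) s)) holomorphic_on A"
  by (auto intro!: holomorphic_intros simp: A_def)
 then show ?thesis unfolding zeta_cont_def A_def .
qed

text \<open>Up to half of the last term, the difference is the tail of the error series. The
  quadratic growth in s does no harm, since the length will be a large power of T.\<close>

lemma zeta_cont_approx:
 assumes s: "s \<noteq> 1" "Re s > 0"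
 shows "norm (zeta_cont s - ((\<Sum>n=1..Suc N. of_nat n powr (-s)) + of_nat (Suc N) powr (1 - s) / (s - 1)))
   \<le> (1 + 2 * norm s * norm (s + 1)) * real (Suc N) powr (- Re s)"
proof -
 have sm: "summable (\<lambda>n. trapezoid_error (Suc n) s)" and sn: "summable (\<lambda>n. norm (trapezoid_error (Suc n) s))"
  using summable_trapezoid_error[of s] s by auto
 have split: "(\<Sum>n. trapezoid_error (Suc n) s) = (\<Sum>n. trapezoid_error (Suc (n + N)) s) + (\<Sum>n<N. trapezoid_error (Suc n) s)"
  by (rule suminf_split_initial_segment[OF sm])
 have sm2: "summable (\<lambda>n. inverse ((real (Suc n))\<^sup>2))"
  using inverse_squares_sums by (simp add: sums_iff inverse_eq_divide add.commute)
 have "norm (\<Sum>n. trapezoid_error (Suc (n + N)) s) \<le> (\<Sum>n. norm (trapezoid_error (Suc (n + N)) s))"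
  using summable_iff_shift[of "\<lambda>n. norm (trapezoid_error (Suc n) s)" N] sn by (intro summable_norm) simp
 also have "\<dots> \<le> (\<Sum>n. norm s * norm (s + 1) * real (Suc N) powr (- Re s) * inverse ((real (Suc n))\<^sup>2))"
 proof (rule suminf_le)
  fix n
  have "norm (trapezoid_error (Suc (n + N)) s) \<le> norm s * norm (s + 1) * real (Suc (n + N)) powr (- Re s - 2)"
   using norm_trapezoid_error_le[of "Suc (n + N)" s] s by simp
  \<comment> \<open>Estimating the two factors separately keeps the full saving in N and leaves the
    sum of inverse squares, so the constant does not depend on Re s.\<close>
  also have "real (Suc (n + N)) powr (- Re s - 2) = real (Suc (n + N)) powr (- Re s) * inverse ((real (Suc (n + N)))\<^sup>2)"
   by (simp add: powr_diff field_simps)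
  also have "norm s * norm (s + 1) * (real (Suc (n + N)) powr (- Re s) * inverse ((real (Suc (n + N)))\<^sup>2)) \<le>
    norm s * norm (s + 1) * (real (Suc N) powr (- Re s) * inverse ((real (Suc n))\<^sup>2))"
   using s by (intro mult_left_mono mult_mono powr_mono2' le_imp_inverse_le power_mono) auto
  finally show "norm (trapezoid_error (Suc (n + N)) s) \<le> norm s * norm (s + 1) * real (Suc N) powr (- Re s) * inverse ((real (Suc n))\<^sup>2)"
   by (simp add: mult_ac)
 next
  show "summable (\<lambda>n. norm (trapezoid_error (Suc (n + N)) s))"
   using summable_iff_shift[of "\<lambda>n. norm (trapezoid_error (Suc n) s)" N] sn by simp
  show "summable (\<lambda>n. norm s * norm (s + 1) * real (Suc N) powr (- Re s) * inverse ((real (Suc n))\<^sup>2))"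
   by (intro summable_mult sm2)
 qed
 also have "\<dots> = norm s * norm (s + 1) * real (Suc N) powr (- Re s) * (pi\<^sup>2 / 6)"
 proof -
  have "(\<Sum>n. inverse ((real (Suc n))\<^sup>2)) = pi\<^sup>2 / 6"
   using inverse_squares_sums by (simp add: sums_iff inverse_eq_divide add.commute)
  then show ?thesis by (subst suminf_mult[OF sm2]) simp
 qed
 also have "\<dots> \<le> norm s * norm (s + 1) * real (Suc N) powr (- Re s) * 2"
 proof -
  have "pi\<^sup>2 \<le> 3.2\<^sup>2" using pi_approx by (intro power_mono) auto
  then show ?thesis by (intro mult_left_mono) (auto simp: power2_eq_square)
 qed
 finally have tail: "norm (\<Sum>n. trapezoid_error (Suc (n + N)) s) \<le> 2 * norm s * norm (s + 1) * real (Suc N) powr (- Re s)"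
  by (simp add: mult_ac)
 have "zeta_cont s - ((\<Sum>n=1..Suc N. of_nat n powr (-s)) + of_nat (Suc N) powr (1 - s) / (s - 1))
   = (\<Sum>n. trapezoid_error (Suc (n + N)) s) - of_nat (Suc N) powr (-s) / 2"
  unfolding zeta_cont_def split sum_trapezoid_error[OF s(1)] by simp
 also have "norm \<dots> \<le> 2 * norm s * norm (s + 1) * real (Suc N) powr (- Re s) + real (Suc N) powr (- Re s)"
 proof (rule order_trans[OF norm_triangle_ineq4 add_mono[OF tail]])
  have "norm (of_nat (Suc N) powr (-s) / 2) = real (Suc N) powr (- Re s) / 2"
   by (simp add: norm_divide norm_of_nat_powr del: of_nat_Suc)
  then show "norm (of_nat (Suc N) powr (-s) / 2) \<le> real (Suc N) powr (- Re s)" by simp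
 qed
 finally show ?thesis by (simp add: algebra_simps)
qed

lemma zeta_cont_sums:
 assumes "Re s > 1"
 shows "(\<lambda>n. of_nat (Suc n) powr (- s)) sums zeta_cont s"
proof -
 have s1: "s \<noteq> 1" using assms by auto
 define f where "f = (\<lambda>N. (\<Sum>n=1..Suc N. of_nat n powr (-s)) + of_nat (Suc N) powr (1 - s) / (s - 1))"
 have pw: "(\<lambda>N. real (Suc N) powr a) \<longlonglongrightarrow> 0" if "a < 0" for a
  using that by real_asymp
 have lim1: "(\<lambda>N. f N - zeta_cont s) \<longlonglongrightarrow> 0"
 proof (rule Lim_null_comparison)
  show "\<forall>\<^sub>F N in sequentially. norm (f N - zeta_cont s) \<le> (1 + 2 * norm s * norm (s + 1)) * real (Suc N) powr (- Re s)"
   using zeta_cont_approx[of s] assms s1 by (auto simp: f_def norm_minus_commute)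
  show "(\<lambda>N. (1 + 2 * norm s * norm (s + 1)) * real (Suc N) powr (- Re s)) \<longlonglongrightarrow> 0"
   using assms by (intro tendsto_mult_right_zero pw) auto
 qed
 have lim2: "(\<lambda>N. of_nat (Suc N) powr (1 - s) / (s - 1)) \<longlonglongrightarrow> 0"
 proof (rule Lim_null_comparison)
  show "\<forall>\<^sub>F N in sequentially. norm (of_nat (Suc N) powr (1 - s) / (s - 1)) \<le> real (Suc N) powr (1 - Re s) * (1 / norm (s - 1))"
   by (auto simp: norm_divide norm_of_nat_powr simp del: of_nat_Suc)
  show "(\<lambda>N. real (Suc N) powr (1 - Re s) * (1 / norm (s - 1))) \<longlonglongrightarrow> 0"
   using assms by (intro tendsto_mult_left_zero pw) auto
 qed
 have "(\<lambda>N. (f N - zeta_cont s) - of_nat (Suc N) powr (1 - s) / (s - 1) + zeta_cont s) \<longlonglongrightarrow> 0 - 0 + zeta_cont s"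
  by (intro tendsto_intros lim1 lim2)
 then have "(\<lambda>N. \<Sum>n=1..Suc N. of_nat n powr (-s)) \<longlonglongrightarrow> zeta_cont s" by (simp add: f_def)
 moreover have "(\<Sum>n=1..Suc N. of_nat n powr (-s)) = (\<Sum>n<Suc N. of_nat (Suc n) powr (-s))" for N
  by (simp add: sum.atLeast1_atMost_eq del: of_nat_Suc sum.lessThan_Suc sum.cl_ivl_Suc)
 ultimately have "(\<lambda>N. \<Sum>n<Suc N. of_nat (Suc n) powr (-s)) \<longlonglongrightarrow> zeta_cont s" by simp
 then show ?thesis unfolding sums_def by (rule filterlim_sequentially_Suc[THEN iffD1])
qed

section \<open>Partial fractions of the cotangent\<close>

text \<open>Logarithmic derivative of the reflection formula for Gamma.\<close>

lemma Digamma_reflection: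
 fixes z :: complex
 assumes z: "z \<notin> \<int>"
 shows "Digamma (1 - z) - Digamma z = of_real pi * cos (of_real pi * z) / sin (of_real pi * z)"
proof -
 have "1 - z \<notin> \<int>" using z by (metis Ints_1 Ints_diff diff_diff_eq2 add_diff_cancel_left')
 then have z1: "z \<notin> \<int>\<^sub>\<le>\<^sub>0" "1 - z \<notin> \<int>\<^sub>\<le>\<^sub>0"
  using z nonpos_Ints_Int by blast+
 have sn: "sin (of_real pi * z) \<noteq> 0" using z by (simp add: sin_eq_0 mult.commute) (metis Ints_of_int)
 have "((\<lambda>z. Gamma z * Gamma (1 - z)) has_field_derivative
     Gamma z * Gamma (1 - z) * (Digamma z - Digamma (1 - z))) (at z)"
  using z1 by (auto intro!: derivative_eq_intros simp: algebra_simps)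
 moreover have "((\<lambda>z. of_real pi / sin (of_real pi * z)) has_field_derivative
     (of_real pi / sin (of_real pi * z)) * (- of_real pi * cos (of_real pi * z) / sin (of_real pi * z))) (at z)"
  using sn by (auto intro!: derivative_eq_intros simp: field_simps power2_eq_square)
 moreover have "(\<lambda>z::complex. Gamma z * Gamma (1 - z)) = (\<lambda>z. of_real pi / sin (of_real pi * z))"
  using Gamma_reflection_complex by auto
 ultimately have "Gamma z * Gamma (1 - z) * (Digamma z - Digamma (1 - z)) =
   (of_real pi / sin (of_real pi * z)) * (- of_real pi * cos (of_real pi * z) / sin (of_real pi * z))"
  using DERIV_unique by metis
 moreover have "Gamma z * Gamma (1 - z) = of_real pi / sin (of_real pi * z)" by (rule Gamma_reflection_complex)
 moreover have "of_real pi / sin (of_real pi * z) \<noteq> 0" using sn by simp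
 ultimately have "Digamma z - Digamma (1 - z) = - of_real pi * cos (of_real pi * z) / sin (of_real pi * z)"
  by (metis mult_cancel_left)
 then show ?thesis by (simp add: algebra_simps)
qed

text \<open>The limit formulas for \<open>Digamma\<close> at 1 - z and at z are subtracted; the
  logarithms cancel and the reciprocals pair up.\<close>

lemma cot_partial_fractions:
 fixes z :: complex
 assumes z: "z \<notin> \<int>"
 shows "(\<lambda>n. 2 * z / (z\<^sup>2 - (of_nat (Suc n))\<^sup>2)) sums
  (of_real pi * cos (of_real pi * z) / sin (of_real pi * z) - 1 / z)"
proof -
 have z1: "1 - z \<notin> \<int>" using z by (metis Ints_1 Ints_diff diff_diff_eq2 add_diff_cancel_left')
 have zn: "z + of_nat n \<noteq> 0" "of_nat n - z \<noteq> 0" for n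
  using z by (auto simp: add_eq_0_iff2)
 have z0: "z \<noteq> 0" using z by auto
 have "(\<lambda>m. (of_real (ln (real m)) - (\<Sum>n<m. inverse ((1 - z) + of_nat n))) -
   (of_real (ln (real m)) - (\<Sum>n<m. inverse (z + of_nat n)))) \<longlonglongrightarrow> Digamma (1 - z) - Digamma z"
  using z z1 by (intro tendsto_diff Digamma_LIMSEQ) auto
 then have "(\<lambda>m. (\<Sum>n<m. inverse (z + of_nat n)) - (\<Sum>n<m. inverse ((1 - z) + of_nat n))) \<longlonglongrightarrow> Digamma (1 - z) - Digamma z"
  by (simp add: algebra_simps)
 then have "(\<lambda>m. (\<Sum>n<Suc m. inverse (z + of_nat n)) - (\<Sum>n<Suc m. inverse ((1 - z) + of_nat n))) \<longlonglongrightarrow> Digamma (1 - z) - Digamma z"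
  by (rule LIMSEQ_Suc)
 \<comment> \<open>One index shift pairs 1 / (z + n + 1) with 1 / (n + 1 - z). What stays unpaired
   is 1 / z and a term that tends to 0.\<close>
 moreover have "(\<lambda>m. inverse ((1 - z) + of_nat m)) \<longlonglongrightarrow> 0"
  by (intro tendsto_inverse_0[THEN filterlim_compose] tendsto_add_filterlim_at_infinity[OF tendsto_const] tendsto_of_nat)
 ultimately have "(\<lambda>m. ((\<Sum>n<Suc m. inverse (z + of_nat n)) - (\<Sum>n<Suc m. inverse ((1 - z) + of_nat n)))
   + inverse ((1 - z) + of_nat m) - 1 / z) \<longlonglongrightarrow> Digamma (1 - z) - Digamma z + 0 - 1 / z"
  by (rule tendsto_diff[OF tendsto_add tendsto_const])
 moreover have "((\<Sum>n<Suc m. inverse (z + of_nat n)) - (\<Sum>n<Suc m. inverse ((1 - z) + of_nat n)))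
   + inverse ((1 - z) + of_nat m) - 1 / z = (\<Sum>n<m. 2 * z / (z\<^sup>2 - (of_nat (Suc n))\<^sup>2))" for m
 proof -
  have "(\<Sum>n<Suc m. inverse (z + of_nat n)) = 1 / z + (\<Sum>n<m. inverse (z + of_nat (Suc n)))"
   by (subst sum.lessThan_Suc_shift) (simp add: inverse_eq_divide)
  moreover have "inverse (z + of_nat (Suc n)) - inverse ((1 - z) + of_nat n) = 2 * z / (z\<^sup>2 - (of_nat (Suc n))\<^sup>2)" for n
  proof -
   have "z\<^sup>2 - (of_nat (Suc n))\<^sup>2 = - ((z + of_nat (Suc n)) * (of_nat (Suc n) - z))"
    by (simp add: power2_eq_square algebra_simps)
   moreover have "(1 - z) + of_nat n = of_nat (Suc n) - z" by simp
   moreover have "inverse (z + of_nat (Suc n)) - inverse (of_nat (Suc n) - z) = 2 * z / (- ((z + of_nat (Suc n)) * (of_nat (Suc n) - z)))"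
    using zn[of "Suc n"] by (simp add: divide_simps del: of_nat_Suc)
   ultimately show ?thesis by metis
  qed
  ultimately show ?thesis by (simp add: sum_subtractf[symmetric])
 qed
 ultimately show ?thesis unfolding sums_def using Digamma_reflection[OF z] by simp
qed

text \<open>The cotangent series at z = i * x / (2 * pi). The value is coth (x / 2) / 2 - 1 / x,
  written in terms of exp (-x) because a geometric series in exp (-x) will produce it.\<close>

lemma coth_partial_fractions:
 fixes x :: real
 assumes x: "x > 0"
 shows "(\<lambda>n. 2 * x / (x\<^sup>2 + (2 * pi * real (Suc n))\<^sup>2)) sums
  ((1 + exp (-x)) / (2 * (1 - exp (-x))) - 1 / x)"
proof -
 define z :: complex where "z = \<i> * of_real (x / (2 * pi))"
 have z: "z \<notin> \<int>"
 proof
  assume "z \<in> \<int>"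
  then obtain n where "z = of_int n" by (auto elim: Ints_cases)
  then have "Im z = 0" by simp
  then show False using x by (simp add: z_def)
 qed
 have ex: "exp (-x) < 1" using x by simp
 have piz: "of_real pi * z = \<i> * of_real (x / 2)" by (simp add: z_def)
 define E where "E = exp (x / 2)"
 have E: "E > 1" "exp (-x) = 1 / (E * E)" using x by (simp_all add: E_def exp_minus exp_add[symmetric] field_simps)
 have e1: "exp (\<i> * (of_real pi * z)) = of_real (1 / E)" "exp (- (\<i> * (of_real pi * z))) = of_real E"
  unfolding piz E_def by (simp_all add: exp_of_real[symmetric] exp_minus field_simps flip: mult.assoc)
 have c: "cos (of_real pi * z) = of_real ((1 / E + E) / 2)"
  unfolding cos_exp_eq e1 by simp
 have s: "sin (of_real pi * z) = of_real ((1 / E - E) / 2) / \<i>"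
  unfolding sin_exp_eq e1 by simp
 have EE: "E * E > 1 * 1" using E by (intro mult_strict_mono) auto
 have "(\<lambda>n. \<i> / (2 * of_real pi) * (2 * z / (z\<^sup>2 - (of_nat (Suc n))\<^sup>2))) sums
  (\<i> / (2 * of_real pi) * (of_real pi * cos (of_real pi * z) / sin (of_real pi * z) - 1 / z))"
  by (intro sums_mult cot_partial_fractions z)
 moreover have "\<i> / (2 * of_real pi) * (2 * z / (z\<^sup>2 - (of_nat (Suc n))\<^sup>2)) = of_real (2 * x / (x\<^sup>2 + (2 * pi * real (Suc n))\<^sup>2))" for n
 proof -
  define N where "N = real (Suc n)"
  have N0: "N > 0" by (simp add: N_def)
  have pos: "x\<^sup>2 + (2 * pi * N)\<^sup>2 > 0" using x by (intro add_pos_nonneg) auto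
  have "z\<^sup>2 - (of_nat (Suc n))\<^sup>2 = of_real (- (x\<^sup>2 + (2 * pi * N)\<^sup>2) / (4 * pi\<^sup>2))"
  proof -
   have "of_nat (Suc n) = complex_of_real N" by (simp add: N_def)
   then have "z\<^sup>2 - (of_nat (Suc n))\<^sup>2 = of_real (- (x / (2 * pi))\<^sup>2 - N\<^sup>2)"
    by (simp add: z_def power_mult_distrib power_divide)
   also have "- (x / (2 * pi))\<^sup>2 - N\<^sup>2 = - (x\<^sup>2 + (2 * pi * N)\<^sup>2) / (4 * pi\<^sup>2)"
    by (simp add: power_mult_distrib power_divide divide_simps)
   finally show ?thesis .
  qed
  moreover have "\<i> / (2 * of_real pi) * (2 * z / of_real (- (x\<^sup>2 + (2 * pi * N)\<^sup>2) / (4 * pi\<^sup>2))) = of_real (2 * x / (x\<^sup>2 + (2 * pi * N)\<^sup>2))"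
  proof -
   have "\<i> / (2 * of_real pi) * (2 * z) = of_real (- x / (2 * pi\<^sup>2))"
    by (simp add: z_def power2_eq_square field_simps)
   then have "\<i> / (2 * of_real pi) * (2 * z / of_real (- (x\<^sup>2 + (2 * pi * N)\<^sup>2) / (4 * pi\<^sup>2))) = of_real ((- x / (2 * pi\<^sup>2)) / (- (x\<^sup>2 + (2 * pi * N)\<^sup>2) / (4 * pi\<^sup>2)))"
    by (metis (no_types, lifting) of_real_divide times_divide_eq_right)
   also have "(- x / (2 * pi\<^sup>2)) / (- (x\<^sup>2 + (2 * pi * N)\<^sup>2) / (4 * pi\<^sup>2)) = 2 * x / (x\<^sup>2 + (2 * pi * N)\<^sup>2)"
    using pos by (simp add: field_simps)
   finally show ?thesis .
  qed
  ultimately show ?thesis by (simp only: N_def)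
 qed
 moreover have "\<i> / (2 * of_real pi) * (of_real pi * cos (of_real pi * z) / sin (of_real pi * z) - 1 / z) =
   of_real ((1 + exp (-x)) / (2 * (1 - exp (-x))) - 1 / x)"
 proof -
  have a: "\<i> / (2 * of_real pi) * (1 / z) = of_real (1 / x)" using x by (simp add: z_def field_simps)
  have "\<i> / (2 * of_real pi) * (of_real pi * cos (of_real pi * z) / sin (of_real pi * z)) =
    of_real (- (1 / 2) * (((1 / E + E) / 2) / ((1 / E - E) / 2)))"
  proof -
   have "\<i> / (2 * of_real pi) * (of_real pi * A / (B / \<i>)) = - (1 / 2) * (A / B)" for A B :: complex
    by (cases "B = 0") (simp_all add: field_simps)
   from this[of "of_real ((1 / E + E) / 2)" "of_real ((1 / E - E) / 2)"] show ?thesis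
    unfolding c s by (simp only: of_real_divide of_real_mult of_real_minus of_real_numeral of_real_1)
  qed
  also have "- (1 / 2) * (((1 / E + E) / 2) / ((1 / E - E) / 2)) = (1 + exp (-x)) / (2 * (1 - exp (-x)))"
   using E EE unfolding E(2) by (simp add: divide_simps) (simp add: algebra_simps)
  finally show ?thesis using a by (simp add: right_diff_distrib)
 qed
 ultimately have "(\<lambda>n. complex_of_real (2 * x / (x\<^sup>2 + (2 * pi * real (Suc n))\<^sup>2))) sums of_real ((1 + exp (-x)) / (2 * (1 - exp (-x))) - 1 / x)"
  by simp
 then show ?thesis by (simp only: sums_of_real_iff)
qed

section \<open>Gamma and beta integrals\<close>

lemma nn_integral_powr_exp:
 fixes p u :: real
 assumes "p > 0" "u > 0"
 shows "(\<integral>\<^sup>+x. ennreal (indicator {0<..} x * (x powr (p - 1) * exp (- (u * x)))) \<partial>lborel) = ennreal (Gamma p * u powr (-p))"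
proof -
 have "ennreal (Gamma p) = (\<integral>\<^sup>+x. ennreal (indicator {0..} x * x powr (p - 1) / exp x) \<partial>lborel)"
  using Gamma_conv_nn_integral_real assms by simp
 also have "\<dots> = ennreal \<bar>u\<bar> * (\<integral>\<^sup>+x. ennreal (indicator {0..} (0 + u * x) * (0 + u * x) powr (p - 1) / exp (0 + u * x)) \<partial>lborel)"
  using assms by (intro nn_integral_real_affine) auto
 also have "(\<integral>\<^sup>+x. ennreal (indicator {0..} (0 + u * x) * (0 + u * x) powr (p - 1) / exp (0 + u * x)) \<partial>lborel)
   = (\<integral>\<^sup>+x. ennreal (u powr (p - 1)) * ennreal (indicator {0<..} x * (x powr (p - 1) * exp (- (u * x)))) \<partial>lborel)"
 proof (intro nn_integral_cong)
  fix x :: real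
  show "ennreal (indicator {0..} (0 + u * x) * (0 + u * x) powr (p - 1) / exp (0 + u * x)) =
    ennreal (u powr (p - 1)) * ennreal (indicator {0<..} x * (x powr (p - 1) * exp (- (u * x))))"
  proof (cases "x > 0")
   case True
   then show ?thesis using assms
    by (subst ennreal_mult[symmetric]) (auto simp: powr_mult exp_minus field_simps)
  next
   case False
   then have "x = 0 \<or> x < 0" by auto
   then show ?thesis using assms by (auto simp: indicator_def zero_le_mult_iff)
  qed
 qed
 also have "\<dots> = ennreal (u powr (p - 1)) * (\<integral>\<^sup>+x. ennreal (indicator {0<..} x * (x powr (p - 1) * exp (- (u * x)))) \<partial>lborel)"
  by (intro nn_integral_cmult) auto
 also have "ennreal \<bar>u\<bar> * (ennreal (u powr (p - 1)) * (\<integral>\<^sup>+x. ennreal (indicator {0<..} x * (x powr (p - 1) * exp (- (u * x)))) \<partial>lborel))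
   = ennreal (u powr p) * (\<integral>\<^sup>+x. ennreal (indicator {0<..} x * (x powr (p - 1) * exp (- (u * x)))) \<partial>lborel)"
 proof -
  have "u * u powr (p - 1) = u powr p" using assms by (simp add: powr_diff)
  then show ?thesis using assms by (simp add: mult.assoc[symmetric] ennreal_mult[symmetric])
 qed
 finally have "ennreal (u powr (-p)) * ennreal (Gamma p) = ennreal (u powr (-p)) * (ennreal (u powr p) * (\<integral>\<^sup>+x. ennreal (indicator {0<..} x * (x powr (p - 1) * exp (- (u * x)))) \<partial>lborel))"
  by simp
 also have "\<dots> = ennreal (u powr (-p) * u powr p) * (\<integral>\<^sup>+x. ennreal (indicator {0<..} x * (x powr (p - 1) * exp (- (u * x)))) \<partial>lborel)"
  using assms by (simp add: ennreal_mult mult.assoc)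
 also have "u powr (-p) * u powr p = 1" using assms by (simp add: powr_minus)
 finally show ?thesis using assms by (simp add: ennreal_mult[symmetric] mult.commute Gamma_real_nonneg)
qed

text \<open>Beta integral: 1 / (1 + x) is written as a Laplace transform; after exchanging the
  integrations both are Gamma integrals, with product Gamma p * Gamma (1 - p).\<close>

lemma nn_integral_powr_over_1_plus:
 fixes p :: real
 assumes p: "0 < p" "p < 1"
 shows "(\<integral>\<^sup>+x. ennreal (indicator {0<..} x * (x powr (p - 1) / (1 + x))) \<partial>lborel) = ennreal (pi / sin (pi * p))"
proof -
 have "(\<integral>\<^sup>+x. ennreal (indicator {0<..} x * (x powr (p - 1) / (1 + x))) \<partial>lborel) =
   (\<integral>\<^sup>+x. (\<integral>\<^sup>+v. ennreal (indicator {0<..} x * indicator {0<..} v * (x powr (p - 1) * exp (- (v * (1 + x))))) \<partial>lborel) \<partial>lborel)"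
 proof (intro nn_integral_cong)
  fix x :: real
  show "ennreal (indicator {0<..} x * (x powr (p - 1) / (1 + x))) =
   (\<integral>\<^sup>+v. ennreal (indicator {0<..} x * indicator {0<..} v * (x powr (p - 1) * exp (- (v * (1 + x))))) \<partial>lborel)"
  proof (cases "x > 0")
   case True
   have "(\<integral>\<^sup>+v. ennreal (indicator {0<..} x * indicator {0<..} v * (x powr (p - 1) * exp (- (v * (1 + x))))) \<partial>lborel)
    = (\<integral>\<^sup>+v. ennreal (x powr (p - 1)) * ennreal (indicator {0<..} v * (v powr (1 - 1) * exp (- ((1 + x) * v)))) \<partial>lborel)"
    using True by (intro nn_integral_cong) (auto simp: ennreal_mult[symmetric] indicator_def mult_ac)
   also have "\<dots> = ennreal (x powr (p - 1)) * ennreal (Gamma 1 * (1 + x) powr (-1))"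
    using True nn_integral_powr_exp[of 1 "1 + x"] by (subst nn_integral_cmult) auto
   also have "\<dots> = ennreal (x powr (p - 1) / (1 + x))"
    using True by (simp add: ennreal_mult[symmetric] powr_minus divide_inverse)
   finally show ?thesis using True by simp
  qed simp
 qed
 also have "\<dots> = (\<integral>\<^sup>+v. (\<integral>\<^sup>+x. ennreal (indicator {0<..} x * indicator {0<..} v * (x powr (p - 1) * exp (- (v * (1 + x))))) \<partial>lborel) \<partial>lborel)"
  by (rule lborel_pair.Fubini') measurable
 also have "\<dots> = (\<integral>\<^sup>+v. ennreal (Gamma p) * ennreal (indicator {0<..} v * (v powr ((1 - p) - 1) * exp (- (1 * v)))) \<partial>lborel)"
 proof (intro nn_integral_cong)
  fix v :: real
  show "(\<integral>\<^sup>+x. ennreal (indicator {0<..} x * indicator {0<..} v * (x powr (p - 1) * exp (- (v * (1 + x))))) \<partial>lborel) =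
   ennreal (Gamma p) * ennreal (indicator {0<..} v * (v powr ((1 - p) - 1) * exp (- (1 * v))))"
  proof (cases "v > 0")
   case True
   have e: "exp (- (v * (1 + x))) = exp (- v) * exp (- (v * x))" for x
    by (simp add: mult_exp_exp algebra_simps)
   have "(\<integral>\<^sup>+x. ennreal (indicator {0<..} x * indicator {0<..} v * (x powr (p - 1) * exp (- (v * (1 + x))))) \<partial>lborel)
    = (\<integral>\<^sup>+x. ennreal (exp (-v)) * ennreal (indicator {0<..} x * (x powr (p - 1) * exp (- (v * x)))) \<partial>lborel)"
    unfolding e using True
    by (intro nn_integral_cong, subst ennreal_mult[symmetric]) (auto simp: indicator_def mult.left_commute)
   also have "\<dots> = ennreal (exp (-v)) * ennreal (Gamma p * v powr (-p))"
    using True p nn_integral_powr_exp[of p v] by (subst nn_integral_cmult) auto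
   finally show ?thesis using True p by (simp add: ennreal_mult[symmetric] mult_ac)
  qed simp
 qed
 also have "\<dots> = ennreal (Gamma p) * ennreal (Gamma (1 - p))"
  using p nn_integral_powr_exp[of "1 - p" 1] by (subst nn_integral_cmult) auto
 also have "\<dots> = ennreal (Gamma p * Gamma (1 - p))"
  using p by (simp add: ennreal_mult)
 also have "Gamma p * Gamma (1 - p) = pi / sin (pi * p)"
 proof -
  have "complex_of_real (Gamma p * Gamma (1 - p)) = Gamma (of_real p) * Gamma (1 - of_real p)"
   using Gamma_complex_of_real[of p] Gamma_complex_of_real[of "1 - p"] by simp
  also have "\<dots> = of_real (pi / sin (pi * p))"
   using sin_of_real[of "pi * p", where 'a = complex] by (simp add: Gamma_reflection_complex)
  finally show ?thesis by (simp only: of_real_eq_iff)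
 qed
 finally show ?thesis .
qed

text \<open>Substitution y = x^2 in the beta integral with p = (1 - a) / 2, for which sin (pi * p) =
  cos (pi * a / 2).\<close>

lemma nn_integral_powr_over_1_plus_square:
 fixes a :: real
 assumes a: "0 < a" "a < 1"
 shows "(\<integral>\<^sup>+x. ennreal (indicator {0<..} x * (x powr (-a) / (1 + x\<^sup>2))) \<partial>lborel) = ennreal (pi / (2 * cos (pi * a / 2)))"
proof -
 define p where "p = (1 - a) / 2"
 have p: "0 < p" "p < 1" using a by (auto simp: p_def)
 define f :: "real \<Rightarrow> real" where "f = (\<lambda>y. (1/2) * (y powr (p - 1) / (1 + y)))"
 have f0: "f y \<ge> 0" if "y > 0" for y using that by (simp add: f_def)
 have s: "sin (pi * p) = cos (pi * a / 2)"
  unfolding sin_cos_eq p_def by (rule arg_cong[of _ _ cos]) (simp add: field_simps)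
 have c0: "cos (pi * a / 2) > 0" using a by (intro cos_gt_zero_pi) (auto intro: less_trans[of _ 0])
 have nf: "(\<integral>\<^sup>+x. ennreal (indicator {0<..} x * f x) \<partial>lborel) = ennreal (pi / (2 * cos (pi * a / 2)))"
 proof -
  have "(\<integral>\<^sup>+x. ennreal (indicator {0<..} x * f x) \<partial>lborel) = (\<integral>\<^sup>+x. ennreal (1/2) * ennreal (indicator {0<..} x * (x powr (p - 1) / (1 + x))) \<partial>lborel)"
   by (intro nn_integral_cong, subst ennreal_mult[symmetric]) (auto simp: f_def indicator_def)
  also have "\<dots> = ennreal (1/2) * ennreal (pi / sin (pi * p))"
   using nn_integral_powr_over_1_plus[OF p] by (subst nn_integral_cmult) auto
  also have "\<dots> = ennreal (pi / (2 * cos (pi * a / 2)))"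
   using c0 unfolding s by (subst ennreal_mult[symmetric]) auto
  finally show ?thesis .
 qed
 have int_f: "integrable lborel (\<lambda>x. indicator {0<..} x * f x)"
 proof (rule integrableI_nonneg)
  show "AE x in lborel. 0 \<le> indicator {0<..} x * f x" using f0 by (auto simp: indicator_def)
  show "(\<integral>\<^sup>+x. ennreal (indicator {0<..} x * f x) \<partial>lborel) < \<infinity>" unfolding nf by simp
 qed (simp add: f_def)
 have val_f: "(\<integral>x. indicator {0<..} x * f x \<partial>lborel) = pi / (2 * cos (pi * a / 2))"
  using f0 nf c0 by (subst integral_eq_nn_integral) (auto simp: f_def indicator_def)
 have "set_integrable lborel {0<..} f" using int_f by (simp add: set_integrable_def)
 then have abs: "f absolutely_integrable_on {0<..}" and I: "integral {0<..} f = pi / (2 * cos (pi * a / 2))"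
  using val_f set_borel_integral_eq_integral(2)[of "{0<..}" f]
  by (auto simp: set_integrable_def integrable_completion f_def set_lebesgue_integral_def)
 have "(\<lambda>x. x\<^sup>2) ` {0<..} = {0::real<..}"
 proof (intro equalityI subsetI)
  fix x :: real assume "x \<in> {0<..}"
  then have "x = (sqrt x)\<^sup>2" "sqrt x \<in> {0<..}" by auto
  then show "x \<in> (\<lambda>x. x\<^sup>2) ` {0<..}" by (rule image_eqI)
 qed auto
 moreover have "(\<lambda>x. \<bar>2 * x\<bar> * f (x\<^sup>2)) absolutely_integrable_on {0<..} \<and> integral {0<..} (\<lambda>x. \<bar>2 * x\<bar> * f (x\<^sup>2)) = pi / (2 * cos (pi * a / 2))
   \<longleftrightarrow> f absolutely_integrable_on ((\<lambda>x. x\<^sup>2) ` {0<..}) \<and> integral ((\<lambda>x. x\<^sup>2) ` {0<..}) f = pi / (2 * cos (pi * a / 2))"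
  by (rule has_absolute_integral_change_of_variables_1') (auto intro!: derivative_eq_intros inj_onI)
 ultimately have "(\<lambda>x. \<bar>2 * x\<bar> * f (x\<^sup>2)) absolutely_integrable_on {0<..} \<and> integral {0<..} (\<lambda>x. \<bar>2 * x\<bar> * f (x\<^sup>2)) = pi / (2 * cos (pi * a / 2))"
  using abs I by simp
 then have "((\<lambda>x. \<bar>2 * x\<bar> * f (x\<^sup>2)) has_integral (pi / (2 * cos (pi * a / 2)))) {0<..}"
  using set_lebesgue_integral_eq_integral(1) integrable_integral by metis
 then have "((\<lambda>x. x powr (-a) / (1 + x\<^sup>2)) has_integral (pi / (2 * cos (pi * a / 2)))) {0<..}"
 proof (rule has_integral_eq[rotated])
  fix x :: real assume "x \<in> {0<..}"
  then have x: "x > 0" by simp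
  have "(x\<^sup>2) powr (p - 1) = x powr (2 * (p - 1))" using x by (simp add: powr_powr flip: powr_numeral)
  also have "2 * (p - 1) = -a - 1" by (simp add: p_def field_simps)
  also have "x powr (-a - 1) = x powr (-a) / x" using x by (simp add: powr_diff)
  finally have "x * (x\<^sup>2) powr (p - 1) = x powr (-a)" using x by simp
  moreover have "2 * x * ((1/2) * (X / Y)) = (x * X) / Y" for X Y :: real by simp
  then have "\<bar>2 * x\<bar> * f (x\<^sup>2) = (x * (x\<^sup>2) powr (p - 1)) / (1 + x\<^sup>2)"
   using x by (simp only: f_def abs_of_pos mult_pos_pos zero_less_numeral)
  ultimately show "\<bar>2 * x\<bar> * f (x\<^sup>2) = x powr (-a) / (1 + x\<^sup>2)" by simp
 qed
 then have "(\<integral>\<^sup>+x. ennreal (indicator {0<..} x * (x powr (-a) / (1 + x\<^sup>2))) \<partial>lborel) = ennreal (pi / (2 * cos (pi * a / 2)))"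
  by (intro nn_integral_has_integral_lebesgue) auto
 then show ?thesis .
qed

lemma nn_integral_powr_over_sum_squares:
 fixes a b :: real
 assumes a: "0 < a" "a < 1" and b: "b > 0"
 shows "(\<integral>\<^sup>+x. ennreal (indicator {0<..} x * (x powr (-a) / (x\<^sup>2 + b\<^sup>2))) \<partial>lborel) = ennreal (b powr (- a - 1) * (pi / (2 * cos (pi * a / 2))))"
proof -
 have c0: "cos (pi * a / 2) > 0" using a by (intro cos_gt_zero_pi) (auto intro: less_trans[of _ 0])
 have "(\<integral>\<^sup>+x. ennreal (indicator {0<..} x * (x powr (-a) / (x\<^sup>2 + b\<^sup>2))) \<partial>lborel) =
  ennreal \<bar>b\<bar> * (\<integral>\<^sup>+x. ennreal (indicator {0<..} (0 + b * x) * ((0 + b * x) powr (-a) / ((0 + b * x)\<^sup>2 + b\<^sup>2))) \<partial>lborel)"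
  using b by (intro nn_integral_real_affine) auto
 also have "(\<integral>\<^sup>+x. ennreal (indicator {0<..} (0 + b * x) * ((0 + b * x) powr (-a) / ((0 + b * x)\<^sup>2 + b\<^sup>2))) \<partial>lborel) =
   (\<integral>\<^sup>+x. ennreal (b powr (-a) / b\<^sup>2) * ennreal (indicator {0<..} x * (x powr (-a) / (1 + x\<^sup>2))) \<partial>lborel)"
 proof (intro nn_integral_cong)
  fix x :: real
  show "ennreal (indicator {0<..} (0 + b * x) * ((0 + b * x) powr (-a) / ((0 + b * x)\<^sup>2 + b\<^sup>2))) = ennreal (b powr (-a) / b\<^sup>2) * ennreal (indicator {0<..} x * (x powr (-a) / (1 + x\<^sup>2)))"
  proof (cases "x > 0")
   case True
   have "(b * x)\<^sup>2 + b\<^sup>2 = b\<^sup>2 * (1 + x\<^sup>2)" by (simp add: algebra_simps power_mult_distrib)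
   then show ?thesis using True b by (simp add: ennreal_mult[symmetric] powr_mult)
  next
   case False
   then show ?thesis using b by (auto simp: indicator_def zero_less_mult_iff)
  qed
 qed
 also have "\<dots> = ennreal (b powr (-a) / b\<^sup>2) * ennreal (pi / (2 * cos (pi * a / 2)))"
  using nn_integral_powr_over_1_plus_square[OF a] by (subst nn_integral_cmult) auto
 also have "ennreal \<bar>b\<bar> * \<dots> = ennreal (b powr (- a - 1) * (pi / (2 * cos (pi * a / 2))))"
 proof -
  have "b * (b powr (-a) / b\<^sup>2) = b powr (- a - 1)" using b by (simp add: powr_diff power2_eq_square)
  then have "b * (b powr (-a) / b\<^sup>2 * (pi / (2 * cos (pi * a / 2)))) = b powr (- a - 1) * (pi / (2 * cos (pi * a / 2)))"
   by (metis mult.assoc)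
  then show ?thesis using b c0 by (subst ennreal_mult[symmetric], simp, simp, subst ennreal_mult[symmetric]) auto
 qed
 finally show ?thesis .
qed

text \<open>The trapezoidal rule on \<open>[n, n + 1]\<close> for \<open>u powr a\<close> has error \<open>- a * (1 - a) / 2\<close> times the
 integral of this kernel against \<open>u powr (a - 2)\<close>. Writing that power as a Laplace transform, summing
 over \<open>n\<close> and expanding the resulting \<open>coth\<close> in partial fractions gives the functional equation on
 \<open>-1 < s < 0\<close>.\<close>

definition trapezoid_kernel :: "nat \<Rightarrow> real \<Rightarrow> real" where
 "trapezoid_kernel n u = indicator {real n..real n + 1} u * ((u - real n) * (real n + 1 - u))"

lemma trapezoid_kernel_nonneg: "trapezoid_kernel n u \<ge> 0"
 by (auto simp: trapezoid_kernel_def indicator_def)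

lemma trapezoid_kernel_measurable [measurable]: "trapezoid_kernel n \<in> borel_measurable borel"
 unfolding trapezoid_kernel_def by measurable

lemma nn_integral_trapezoid_kernel_exp:
 fixes x :: real
 assumes x: "x > 0"
 shows "(\<integral>\<^sup>+u. ennreal (trapezoid_kernel n u * exp (- (u * x))) \<partial>lborel) =
  ennreal (exp (- (real n * x)) * ((x * (1 + exp (-x)) - 2 * (1 - exp (-x))) / x ^ 3))"
proof -
 define F where "F = (\<lambda>u. - (((u - real n) * (real n + 1 - u)) / x + (2 * real n + 1 - 2 * u) / x\<^sup>2 - 2 / x ^ 3) * exp (- (u * x)))"
 have der: "(F has_real_derivative ((u - real n) * (real n + 1 - u)) * exp (- (u * x))) (at u)" for u
  unfolding F_def using x
  by (auto intro!: derivative_eq_intros simp: field_simps power2_eq_square power3_eq_cube)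
 have "((\<lambda>u. ((u - real n) * (real n + 1 - u)) * exp (- (u * x))) has_integral (F (real n + 1) - F (real n))) {real n..real n + 1}"
  using der by (intro fundamental_theorem_of_calculus)
   (auto simp: has_real_derivative_iff_has_vector_derivative[symmetric] intro: has_field_derivative_at_within)
 then have "(\<integral>\<^sup>+u. ennreal (indicator {real n..real n + 1} u * (((u - real n) * (real n + 1 - u)) * exp (- (u * x)))) \<partial>lborel) = ennreal (F (real n + 1) - F (real n))"
  by (intro nn_integral_has_integral_lebesgue) auto
 moreover have "F (real n + 1) - F (real n) = exp (- (real n * x)) * ((x * (1 + exp (-x)) - 2 * (1 - exp (-x))) / x ^ 3)"
 proof -
  have e: "exp (- ((real n + 1) * x)) = exp (- (real n * x)) * exp (-x)"
   by (simp add: exp_add[symmetric] algebra_simps)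
  show ?thesis unfolding F_def e using x
   by (simp add: field_simps power2_eq_square power3_eq_cube)
 qed
 ultimately show ?thesis by (simp add: trapezoid_kernel_def mult.assoc)
qed

text \<open>Closed form of the integral of \<open>trapezoid_kernel n u * u powr (a - 2)\<close>; for
  n >= 1 it is the trapezoidal error for u powr a divided by - a * (1 - a) / 2.\<close>

definition trapezoid_moment :: "real \<Rightarrow> nat \<Rightarrow> real" where
 "trapezoid_moment a n = (real (Suc n) powr (a + 1) - real n powr (a + 1)) * (2 / (a * (1 - a) * (1 + a)))
   - (real n powr a + real (Suc n) powr a) / (a * (1 - a))"

lemma nn_integral_trapezoid_kernel_powr:
 fixes a :: real
 assumes a: "0 < a" "a < 1"
 shows "(\<integral>\<^sup>+u. ennreal (trapezoid_kernel n u * u powr (a - 2)) \<partial>lborel) = ennreal (trapezoid_moment a n)"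
  and "trapezoid_moment a n \<ge> 0"
proof -
 define F where "F = (\<lambda>u. - (u powr (a + 1) / (a + 1)) + (2 * real n + 1) * (u powr a / a)
   - real n * (real n + 1) * (u powr (a - 1) / (a - 1)))"
 have der: "(F has_real_derivative ((u - real n) * (real n + 1 - u)) * u powr (a - 2)) (at u)" if u: "u > 0" for u
 proof -
  have "(F has_real_derivative (- (u powr a) + (2 * real n + 1) * u powr (a - 1) - real n * (real n + 1) * u powr (a - 1 - 1))) (at u)"
   unfolding F_def using u a
   by (auto intro!: derivative_eq_intros)
  moreover have "u powr a = u powr (a - 2) * u * u" "u powr (a - 1) = u powr (a - 2) * u" "a - 1 - 1 = a - 2"
   using u by (simp_all add: powr_diff powr_numeral power2_eq_square)
  ultimately show ?thesis by (simp add: algebra_simps)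
 qed
 \<comment> \<open>For n = 0 the integrand is unbounded at 0, so the derivative is used only in the
   interior. The primitive stays continuous there because a > 0 and its term with exponent a - 1 has
   coefficient 0.\<close>
 have hi: "((\<lambda>u. ((u - real n) * (real n + 1 - u)) * u powr (a - 2)) has_integral (F (real n + 1) - F (real n))) {real n..real n + 1}"
 proof (rule fundamental_theorem_of_calculus_interior)
  show "continuous_on {real n..real n + 1} F"
  proof (cases "n = 0")
   case True
   show ?thesis unfolding F_def using a True by (auto intro!: continuous_intros continuous_on_powr')
  next
   case False
   show ?thesis unfolding F_def using a False by (auto intro!: continuous_intros)
  qed
 qed (use der in \<open>auto simp: has_real_derivative_iff_has_vector_derivative[symmetric]\<close>)
 then have "(\<integral>\<^sup>+u. ennreal (indicator {real n..real n + 1} u * (((u - real n) * (real n + 1 - u)) * u powr (a - 2))) \<partial>lborel) = ennreal (F (real n + 1) - F (real n))"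
  by (intro nn_integral_has_integral_lebesgue) auto
 moreover have eq: "F (real n + 1) - F (real n) = trapezoid_moment a n"
 proof -
  have 1: "- (N powr (a + 1) / (a + 1)) + (2 * N - 1) * (N powr a / a) - (N - 1) * N * (N powr (a - 1) / (a - 1))
   = N powr (a + 1) * (2 / (a * (1 - a) * (1 + a))) - N powr a / (a * (1 - a))" if "N > 0" for N
  proof -
   define B where "B = N powr (a - 1)"
   have "N powr a = B * N" "N powr (a + 1) = B * N * N"
    using that by (simp_all add: B_def powr_diff powr_add)
   moreover have "- (B * N * N / (a + 1)) + (2 * N - 1) * (B * N / a) - (N - 1) * N * (B / (a - 1)) = B * N * N * (2 / (a * (1 - a) * (1 + a))) - B * N / (a * (1 - a))"
    using a by (simp add: divide_simps) (simp add: algebra_simps)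
   ultimately show ?thesis by (simp add: B_def)
  qed
  have 2: "- (N powr (a + 1) / (a + 1)) + (2 * N + 1) * (N powr a / a) - N * (N + 1) * (N powr (a - 1) / (a - 1))
   = N powr (a + 1) * (2 / (a * (1 - a) * (1 + a))) + N powr a / (a * (1 - a))" if "N \<ge> 0" for N
  proof (cases "N = 0")
   case False
   define B where "B = N powr (a - 1)"
   have "N powr a = B * N" "N powr (a + 1) = B * N * N"
    using that False by (simp_all add: B_def powr_diff powr_add)
   moreover have "- (B * N * N / (a + 1)) + (2 * N + 1) * (B * N / a) - N * (N + 1) * (B / (a - 1)) = B * N * N * (2 / (a * (1 - a) * (1 + a))) + B * N / (a * (1 - a))"
    using a by (simp add: divide_simps) (simp add: algebra_simps)
   ultimately show ?thesis by (simp add: B_def)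
  qed (use a in simp)
  show ?thesis using 1[of "real n + 1"] 2[of "real n"]
   unfolding F_def trapezoid_moment_def by (simp add: algebra_simps add_divide_distrib)
 qed
 ultimately show "(\<integral>\<^sup>+u. ennreal (trapezoid_kernel n u * u powr (a - 2)) \<partial>lborel) = ennreal (trapezoid_moment a n)"
  by (simp add: trapezoid_kernel_def mult.assoc)
 show "trapezoid_moment a n \<ge> 0" unfolding eq[symmetric] by (rule has_integral_nonneg[OF hi]) auto
qed

lemma zeta_chi_holomorphic: "zeta_chi holomorphic_on {s. Re s < 1}"
proof -
 have "1 - s \<notin> \<int>\<^sub>\<le>\<^sub>0" if "Re s < 1" for s :: complex
  using that nonpos_Ints_subset_nonpos_Reals complex_nonpos_Reals_iff[of "1 - s"] by auto
 then show ?thesis unfolding zeta_chi_def by (auto intro!: holomorphic_intros)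
qed

lemma holomorphic_on_reflect:
 assumes "f holomorphic_on B" "\<And>s. s \<in> A \<Longrightarrow> 1 - s \<in> B"
 shows "(\<lambda>s. f (1 - s :: complex)) holomorphic_on A"
proof -
 have "(f \<circ> (\<lambda>s. 1 - s)) holomorphic_on A"
  by (rule holomorphic_on_compose_gen[OF _ assms(1)]) (use assms(2) in \<open>auto intro!: holomorphic_intros\<close>)
 then show ?thesis by (simp add: o_def)
qed

lemma trapezoid_moment_integral:
 assumes a: "0 < a" "a < 1"
 shows "ennreal (Gamma (2 - a) * trapezoid_moment a n) =
  (\<integral>\<^sup>+x. ennreal (indicator {0<..} x * (x powr (1 - a) * (exp (- (real n * x)) * ((x * (1 + exp (-x)) - 2 * (1 - exp (-x))) / x ^ 3)))) \<partial>lborel)"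
proof -
 have G: "Gamma (2 - a) \<ge> 0" using a by (intro Gamma_real_nonneg) auto
 have "ennreal (Gamma (2 - a) * trapezoid_moment a n) = ennreal (Gamma (2 - a)) * (\<integral>\<^sup>+u. ennreal (trapezoid_kernel n u * u powr (a - 2)) \<partial>lborel)"
  using nn_integral_trapezoid_kernel_powr[OF a, of n] G by (simp add: ennreal_mult)
 also have "\<dots> = (\<integral>\<^sup>+u. ennreal (Gamma (2 - a)) * ennreal (trapezoid_kernel n u * u powr (a - 2)) \<partial>lborel)"
  by (intro nn_integral_cmult[symmetric]) measurable
 also have "\<dots> = (\<integral>\<^sup>+u. (\<integral>\<^sup>+x. ennreal (trapezoid_kernel n u * (indicator {0<..} x * (x powr (1 - a) * exp (- (u * x))))) \<partial>lborel) \<partial>lborel)"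
 proof (intro nn_integral_cong)
  fix u :: real
  show "ennreal (Gamma (2 - a)) * ennreal (trapezoid_kernel n u * u powr (a - 2)) =
   (\<integral>\<^sup>+x. ennreal (trapezoid_kernel n u * (indicator {0<..} x * (x powr (1 - a) * exp (- (u * x))))) \<partial>lborel)"
  proof (cases "u > 0")
   case True
   have "(\<integral>\<^sup>+x. ennreal (trapezoid_kernel n u * (indicator {0<..} x * (x powr (1 - a) * exp (- (u * x))))) \<partial>lborel)
    = (\<integral>\<^sup>+x. ennreal (trapezoid_kernel n u) * ennreal (indicator {0<..} x * (x powr (2 - a - 1) * exp (- (u * x)))) \<partial>lborel)"
    using trapezoid_kernel_nonneg[of n u] by (intro nn_integral_cong) (auto simp: ennreal_mult[symmetric] indicator_def)
   also have "\<dots> = ennreal (trapezoid_kernel n u) * ennreal (Gamma (2 - a) * u powr (- (2 - a)))"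
    using True a nn_integral_powr_exp[of "2 - a" u] by (subst nn_integral_cmult) auto
   finally show ?thesis using G trapezoid_kernel_nonneg[of n u] by (simp add: ennreal_mult[symmetric] mult_ac)
  next
   case False
   then have "trapezoid_kernel n u = 0" by (cases "u = 0") (auto simp: trapezoid_kernel_def indicator_def)
   then show ?thesis by simp
  qed
 qed
 also have "\<dots> = (\<integral>\<^sup>+x. (\<integral>\<^sup>+u. ennreal (trapezoid_kernel n u * (indicator {0<..} x * (x powr (1 - a) * exp (- (u * x))))) \<partial>lborel) \<partial>lborel)"
  by (rule lborel_pair.Fubini') measurable
 also have "\<dots> = (\<integral>\<^sup>+x. ennreal (indicator {0<..} x * (x powr (1 - a) * (exp (- (real n * x)) * ((x * (1 + exp (-x)) - 2 * (1 - exp (-x))) / x ^ 3)))) \<partial>lborel)"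
 proof (intro nn_integral_cong)
  fix x :: real
  show "(\<integral>\<^sup>+u. ennreal (trapezoid_kernel n u * (indicator {0<..} x * (x powr (1 - a) * exp (- (u * x))))) \<partial>lborel) =
   ennreal (indicator {0<..} x * (x powr (1 - a) * (exp (- (real n * x)) * ((x * (1 + exp (-x)) - 2 * (1 - exp (-x))) / x ^ 3))))"
  proof (cases "x > 0")
   case True
   have "(\<integral>\<^sup>+u. ennreal (trapezoid_kernel n u * (indicator {0<..} x * (x powr (1 - a) * exp (- (u * x))))) \<partial>lborel)
     = (\<integral>\<^sup>+u. ennreal (x powr (1 - a)) * ennreal (trapezoid_kernel n u * exp (- (u * x))) \<partial>lborel)"
    using True trapezoid_kernel_nonneg[of n] by (intro nn_integral_cong) (auto simp: ennreal_mult[symmetric] mult_ac)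
   also have "\<dots> = ennreal (x powr (1 - a)) * ennreal (exp (- (real n * x)) * ((x * (1 + exp (-x)) - 2 * (1 - exp (-x))) / x ^ 3))"
    using True by (subst nn_integral_cmult) (auto simp: nn_integral_trapezoid_kernel_exp)
   also have "\<dots> = ennreal (x powr (1 - a) * (exp (- (real n * x)) * ((x * (1 + exp (-x)) - 2 * (1 - exp (-x))) / x ^ 3)))"
    by (rule ennreal_mult'[symmetric]) simp
   finally show ?thesis using True by simp
  qed simp
 qed
 finally show ?thesis .
qed

lemma suminf_trapezoid_moment:
 assumes a: "0 < a" "a < 1"
 shows "(\<Sum>n. ennreal (Gamma (2 - a) * trapezoid_moment a n)) =
  (\<Sum>n. ennreal (4 * ((2 * pi * real (Suc n)) powr (- a - 1) * (pi / (2 * cos (pi * a / 2))))))"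
proof -
 define k where "k = (\<lambda>x::real. (x * (1 + exp (-x)) - 2 * (1 - exp (-x))) / x ^ 3)"
 have "(\<Sum>n. ennreal (Gamma (2 - a) * trapezoid_moment a n)) =
   (\<integral>\<^sup>+x. (\<Sum>n. ennreal (indicator {0<..} x * (x powr (1 - a) * (exp (- (real n * x)) * k x)))) \<partial>lborel)"
  unfolding trapezoid_moment_integral[OF a] k_def by (intro nn_integral_suminf[symmetric]) measurable
 also have "\<dots> = (\<integral>\<^sup>+x. (\<Sum>n. ennreal (4 * (indicator {0<..} x * (x powr (-a) / (x\<^sup>2 + (2 * pi * real (Suc n))\<^sup>2))))) \<partial>lborel)"
 proof (intro nn_integral_cong)
  fix x :: real
  show "(\<Sum>n. ennreal (indicator {0<..} x * (x powr (1 - a) * (exp (- (real n * x)) * k x)))) =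
   (\<Sum>n. ennreal (4 * (indicator {0<..} x * (x powr (-a) / (x\<^sup>2 + (2 * pi * real (Suc n))\<^sup>2)))))"
  proof (cases "x > 0")
   case True
   define c where "c = (1 + exp (-x)) / (2 * (1 - exp (-x))) - 1 / x"
   have ex: "exp (-x) < 1" using True by simp
   have pf: "(\<lambda>n. 2 * x / (x\<^sup>2 + (2 * pi * real (Suc n))\<^sup>2)) sums c"
    unfolding c_def by (rule coth_partial_fractions[OF True])
   have c0: "c \<ge> 0" using pf True by (intro sums_le[OF _ sums_zero pf]) auto
   \<comment> \<open>The geometric series over n contributes 1 / (1 - exp (-x)); this identity
     converts it into the coth expression c. As c is a sum of positive terms, k is nonnegative,
     which the computation in extended nonnegative reals requires.\<close>
   have kc: "k x / (1 - exp (-x)) = 2 / x\<^sup>2 * c"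
    unfolding k_def c_def using True ex by (simp add: divide_simps power2_eq_square power3_eq_cube) (simp add: algebra_simps)
   have k0: "k x \<ge> 0"
   proof -
    have "k x = 2 / x\<^sup>2 * c * (1 - exp (-x))" using kc ex by (simp add: field_simps)
    then show ?thesis using c0 ex by simp
   qed
   have "(\<lambda>n. exp (-x) ^ n) sums (1 / (1 - exp (-x)))" using ex by (intro geometric_sums) auto
   then have "(\<lambda>n. exp (- (real n * x))) sums (1 / (1 - exp (-x)))"
    by (simp add: exp_of_nat_mult[symmetric])
   then have "(\<lambda>n. x powr (1 - a) * (exp (- (real n * x)) * k x)) sums (x powr (1 - a) * (1 / (1 - exp (-x)) * k x))"
    by (intro sums_mult sums_mult2)
   then have 1: "(\<Sum>n. ennreal (x powr (1 - a) * (exp (- (real n * x)) * k x))) = ennreal (x powr (1 - a) * (1 / (1 - exp (-x)) * k x))"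
    using k0 by (intro suminf_ennreal_eq) auto
   have "(\<lambda>n. 2 * x powr (-a) / x * (2 * x / (x\<^sup>2 + (2 * pi * real (Suc n))\<^sup>2))) sums (2 * x powr (-a) / x * c)"
    by (intro sums_mult pf)
   then have "(\<lambda>n. 4 * (x powr (-a) / (x\<^sup>2 + (2 * pi * real (Suc n))\<^sup>2))) sums (2 * x powr (-a) / x * c)"
    using True by simp
   then have 2: "(\<Sum>n. ennreal (4 * (x powr (-a) / (x\<^sup>2 + (2 * pi * real (Suc n))\<^sup>2)))) = ennreal (2 * x powr (-a) / x * c)"
    using True by (intro suminf_ennreal_eq) auto
   have xa: "x powr (1 - a) = x powr (-a) * x" using True by (simp add: powr_diff powr_minus divide_inverse mult.commute)
   have "x powr (1 - a) * (1 / (1 - exp (-x)) * k x) = x powr (1 - a) * (2 / x\<^sup>2 * c)"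
    using kc by simp
   also have "\<dots> = 2 * x powr (-a) / x * c"
    unfolding xa using True by (simp add: power2_eq_square)
   finally have "(\<Sum>n. ennreal (x powr (1 - a) * (exp (- (real n * x)) * k x))) =
     (\<Sum>n. ennreal (4 * (x powr (-a) / (x\<^sup>2 + (2 * pi * real (Suc n))\<^sup>2))))"
    unfolding 1 2 by simp
   then show ?thesis using True by simp
  qed simp
 qed
 also have "\<dots> = (\<Sum>n. \<integral>\<^sup>+x. ennreal (4 * (indicator {0<..} x * (x powr (-a) / (x\<^sup>2 + (2 * pi * real (Suc n))\<^sup>2)))) \<partial>lborel)"
  by (intro nn_integral_suminf) measurable
 also have "\<dots> = (\<Sum>n. ennreal (4 * ((2 * pi * real (Suc n)) powr (- a - 1) * (pi / (2 * cos (pi * a / 2))))))"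
 proof (intro suminf_cong)
  fix n
  have "(\<integral>\<^sup>+x. ennreal (4 * (indicator {0<..} x * (x powr (-a) / (x\<^sup>2 + (2 * pi * real (Suc n))\<^sup>2)))) \<partial>lborel)
   = (\<integral>\<^sup>+x. ennreal 4 * ennreal (indicator {0<..} x * (x powr (-a) / (x\<^sup>2 + (2 * pi * real (Suc n))\<^sup>2))) \<partial>lborel)"
   by (intro nn_integral_cong, subst ennreal_mult[symmetric]) (auto simp: indicator_def)
  also have "\<dots> = ennreal 4 * ennreal ((2 * pi * real (Suc n)) powr (- a - 1) * (pi / (2 * cos (pi * a / 2))))"
   by (subst nn_integral_cmult) (use nn_integral_powr_over_sum_squares[OF a, of "2 * pi * real (Suc n)"] in auto)
  also have "\<dots> = ennreal (4 * ((2 * pi * real (Suc n)) powr (- a - 1) * (pi / (2 * cos (pi * a / 2)))))"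
   by (rule ennreal_mult'[symmetric]) simp
  finally show "(\<integral>\<^sup>+x. ennreal (4 * (indicator {0<..} x * (x powr (-a) / (x\<^sup>2 + (2 * pi * real (Suc n))\<^sup>2)))) \<partial>lborel) =
   ennreal (4 * ((2 * pi * real (Suc n)) powr (- a - 1) * (pi / (2 * cos (pi * a / 2)))))" .
 qed
 finally show ?thesis .
qed

section \<open>The functional equation, first on a real segment, and the existence of zeta\<close>

text \<open>The sum S of all trapezoid moments is evaluated twice: up to the factor r it is
  \<open>zeta_cont (-a)\<close>, and by the coth expansion it is a multiple of zeta (1 + a). The
  Gamma identities turn the quotient into \<open>zeta_chi\<close>.\<close>

lemma zeta_cont_functional_real:
 assumes a: "0 < a" "a < 1"
 shows "zeta_cont (of_real (-a)) = zeta_chi (of_real (-a)) * zeta_cont (1 - of_real (-a))"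
proof -
 define C where "C = pi / (2 * cos (pi * a / 2))"
 define r where "r = - (a * (1 - a) / 2)"
 have c0: "cos (pi * a / 2) > 0" using a by (intro cos_gt_zero_pi) (auto intro: less_trans[of _ 0])
 have s0: "sin (pi * a / 2) > 0" using a by (intro sin_gt_zero) auto
 have G: "Gamma (2 - a) > 0" using a by (intro Gamma_real_pos) auto
 have r0: "r \<noteq> 0" using a by (simp add: r_def)
 have te: "trapezoid_error (Suc n) (of_real (-a)) = of_real (r * trapezoid_moment a (Suc n))" for n
 proof -
  have cp: "of_nat N powr complex_of_real b = of_real (real N powr b)" for N b
   using powr_of_real[of "real N" b] by simp
  have "trapezoid_error (Suc n) (of_real (-a)) =
    of_real ((real (Suc n) powr a + real (Suc (Suc n)) powr a) / 2 - (real (Suc n) powr (1 + a) - real (Suc (Suc n)) powr (1 + a)) / (- a - 1))"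
   unfolding trapezoid_error_def using cp[of _ a] cp[of _ "1 + a"] by (simp del: of_nat_Suc)
  also have "(real (Suc n) powr a + real (Suc (Suc n)) powr a) / 2 - (real (Suc n) powr (1 + a) - real (Suc (Suc n)) powr (1 + a)) / (- a - 1)
    = r * trapezoid_moment a (Suc n)"
   unfolding trapezoid_moment_def r_def using a by (simp add: divide_simps add.commute del: of_nat_Suc) (simp add: algebra_simps del: of_nat_Suc)
  finally show ?thesis .
 qed
 have sm: "summable (\<lambda>n. trapezoid_error (Suc n) (of_real (-a)))"
  using a by (intro summable_trapezoid_error) (auto simp: complex_eq_iff)
 then have "summable (\<lambda>n. r * trapezoid_moment a (Suc n))" unfolding te summable_of_real_iff .
 then have "summable (\<lambda>n. trapezoid_moment a (Suc n))" using r0 by (simp add: summable_cmult_iff)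
 then have sm': "summable (trapezoid_moment a)" by (simp only: summable_Suc_iff)
 define S where "S = (\<Sum>n. trapezoid_moment a n)"
 \<comment> \<open>The series in \<open>zeta_cont\<close> starts at n = 1, the sum S at n = 0; the
   missing term times r is exactly the constant 1 / (s - 1) + 1 / 2 at s = - a.\<close>
 have zS: "zeta_cont (of_real (-a)) = of_real (r * S)"
 proof -
  have "(\<Sum>n. trapezoid_error (Suc n) (of_real (-a))) = of_real (\<Sum>n. r * trapezoid_moment a (Suc n))"
   unfolding te by (rule suminf_of_real[symmetric]) fact
  also have "(\<Sum>n. r * trapezoid_moment a (Suc n)) = r * (S - trapezoid_moment a 0)"
   using suminf_split_head[OF sm'] \<open>summable (\<lambda>n. trapezoid_moment a (Suc n))\<close>
   by (subst suminf_mult) (auto simp: S_def)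
  finally have "zeta_cont (of_real (-a)) = of_real (1 / (- a - 1) + 1 / 2 + r * (S - trapezoid_moment a 0))"
   by (simp add: zeta_cont_def)
  also have "1 / (- a - 1) + 1 / 2 + r * (S - trapezoid_moment a 0) = r * S"
   unfolding trapezoid_moment_def r_def using a by (simp add: divide_simps) (simp add: algebra_simps)
  finally show ?thesis .
 qed
 define Z where "Z = (\<Sum>n. real (Suc n) powr (- a - 1))"
 have Zs: "(\<lambda>n. real (Suc n) powr (- a - 1)) sums Z"
  unfolding Z_def using summable_Suc_powr[of "-a - 1"] a by (intro summable_sums) auto
 have zZ: "zeta_cont (1 - of_real (-a)) = of_real Z"
 proof -
  have "(\<lambda>n. of_nat (Suc n) powr (- (1 - complex_of_real (-a)))) sums zeta_cont (1 - of_real (-a))"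
   using a by (intro zeta_cont_sums) auto
  moreover have "of_nat (Suc n) powr (- (1 - complex_of_real (-a))) = of_real (real (Suc n) powr (- a - 1))" for n
  proof -
   have e: "- (1 - complex_of_real (-a)) = of_real (- a - 1)" by simp
   show ?thesis unfolding e using powr_of_real[of "real (Suc n)" "- a - 1"] by (simp del: of_nat_Suc)
  qed
  ultimately have "(\<lambda>n. complex_of_real (real (Suc n) powr (- a - 1))) sums zeta_cont (1 - of_real (-a))" by simp
  moreover have "(\<lambda>n. complex_of_real (real (Suc n) powr (- a - 1))) sums of_real Z" using Zs by (simp only: sums_of_real_iff)
  ultimately show ?thesis using sums_unique2 by blast
 qed
 have "ennreal (Gamma (2 - a) * S) = (\<Sum>n. ennreal (Gamma (2 - a) * trapezoid_moment a n))"
  using nn_integral_trapezoid_kernel_powr(2)[OF a] G sm' unfolding S_def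
  by (intro suminf_ennreal_eq[symmetric] sums_mult summable_sums) auto
 also have "\<dots> = (\<Sum>n. ennreal (4 * ((2 * pi * real (Suc n)) powr (- a - 1) * C)))"
  unfolding C_def by (rule suminf_trapezoid_moment[OF a])
 also have "\<dots> = ennreal (4 * ((2 * pi) powr (- a - 1) * Z * C))"
 proof (intro suminf_ennreal_eq)
  have "(\<lambda>n. 4 * ((2 * pi) powr (- a - 1) * real (Suc n) powr (- a - 1) * C)) sums (4 * ((2 * pi) powr (- a - 1) * Z * C))"
   by (intro sums_mult sums_mult2 Zs)
  then show "(\<lambda>n. 4 * ((2 * pi * real (Suc n)) powr (- a - 1) * C)) sums (4 * ((2 * pi) powr (- a - 1) * Z * C))"
   by (simp add: powr_mult del: of_nat_Suc)
 qed (use c0 in \<open>auto simp: C_def\<close>)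
 finally have en: "ennreal (Gamma (2 - a) * S) = ennreal (4 * ((2 * pi) powr (- a - 1) * Z * C))" .
 have main: "Gamma (2 - a) * S = 4 * ((2 * pi) powr (- a - 1) * Z * C)"
 proof -
  have "Z \<ge> 0" using Zs by (intro sums_le[OF _ sums_zero Zs]) auto
  moreover have "S \<ge> 0" unfolding S_def using nn_integral_trapezoid_kernel_powr(2)[OF a] sm' by (intro suminf_nonneg) auto
  ultimately show ?thesis using c0 G en
   by (subst (asm) ennreal_inj) (auto simp: C_def)
 qed
 have chi: "zeta_chi (of_real (-a)) = of_real (2 powr (-a) * pi powr (- a - 1) * (- sin (pi * a / 2)) * Gamma (1 + a))"
 proof -
  have "(2::complex) powr (of_real (-a)) = of_real (2 powr (-a))" using powr_of_real[of 2 "-a"] by simp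
  moreover have "of_real pi powr (of_real (-a) - 1) = complex_of_real (pi powr (- a - 1))" using powr_of_real[of pi "-a - 1"] by simp
  moreover have "sin (of_real pi * of_real (-a) / 2) = complex_of_real (- sin (pi * a / 2))"
   using sin_of_real[of "pi * (-a) / 2", where 'a = complex] by simp
  moreover have "Gamma (1 - of_real (-a)) = complex_of_real (Gamma (1 + a))" using Gamma_complex_of_real[of "1 + a"] by simp
  ultimately show ?thesis unfolding zeta_chi_def by simp
 qed
 \<comment> \<open>Doubling the sine in the reflection formula trades 1 / cos (pi * a / 2) for the
   factor sin (pi * a / 2) of \<open>zeta_chi\<close>.\<close>
 have refl: "Gamma a * Gamma (1 - a) * (2 * sin (pi * a / 2) * cos (pi * a / 2)) = pi"
 proof -
  have "complex_of_real (Gamma a * Gamma (1 - a)) = Gamma (of_real a) * Gamma (1 - of_real a)"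
   using Gamma_complex_of_real[of a] Gamma_complex_of_real[of "1 - a"] by simp
  also have "\<dots> = of_real (pi / sin (pi * a))"
   using sin_of_real[of "pi * a", where 'a = complex] by (simp add: Gamma_reflection_complex)
  finally have 1: "Gamma a * Gamma (1 - a) = pi / sin (pi * a)" by (simp only: of_real_eq_iff)
  have 2: "sin (pi * a) = 2 * sin (pi * a / 2) * cos (pi * a / 2)"
   using sin_double[of "pi * a / 2"] by simp
  have nz: "2 * sin (pi * a / 2) * cos (pi * a / 2) \<noteq> 0" using s0 c0 by simp
  show ?thesis unfolding 1 2 times_divide_eq_left by (rule nonzero_mult_div_cancel_right[OF nz])
 qed
 have G2: "Gamma (2 - a) = (1 - a) * Gamma (1 - a)" using Gamma_plus1[of "1 - a"] a nonpos_Ints_nonpos[of "1 - a"]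
  by (auto simp: algebra_simps)
 have G1: "Gamma (1 + a) = a * Gamma a" using Gamma_plus1[of a] a nonpos_Ints_nonpos[of a] by (auto simp: add.commute)
 have Ga: "Gamma a > 0" "Gamma (1 - a) > 0" using a by auto
 have pw: "2 powr (-a) * pi powr (- a - 1) = 2 * (2 * pi) powr (- a - 1)"
  by (simp add: powr_mult powr_diff)
 have "r * S * Gamma (1 - a) = (- a / 2) * (Gamma (2 - a) * S)"
  unfolding r_def G2 by (simp add: field_simps)
 also have "\<dots> = - a * (2 * pi) powr (- a - 1) * Z * (pi / cos (pi * a / 2))"
  unfolding main C_def by simp
 also have "pi / cos (pi * a / 2) = Gamma a * Gamma (1 - a) * (2 * sin (pi * a / 2))"
  using refl c0 by (simp add: field_simps)
 finally have "r * S * Gamma (1 - a) = (2 * (2 * pi) powr (- a - 1) * (- sin (pi * a / 2)) * (a * Gamma a) * Z) * Gamma (1 - a)"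
  by (simp add: algebra_simps)
 then have "r * S = 2 * (2 * pi) powr (- a - 1) * (- sin (pi * a / 2)) * (a * Gamma a) * Z"
  using Ga by (subst (asm) mult_right_cancel) auto
 then show ?thesis unfolding zS chi zZ pw G1 by (simp only: of_real_mult)
qed

text \<open>Identity theorem: the segment (-1, 0), where the equation is known, accumulates at -1/2
  inside the strip.\<close>

lemma zeta_cont_functional:
 assumes "-1 < Re s" "Re s < 0"
 shows "zeta_cont s = zeta_chi s * zeta_cont (1 - s)"
proof -
 define S where "S = {s. Re s > -1} \<inter> {s. Re s < 0}"
 have "zeta_cont s - zeta_chi s * zeta_cont (1 - s) = 0"
 proof (rule analytic_continuation[of "\<lambda>s. zeta_cont s - zeta_chi s * zeta_cont (1 - s)" S "of_real ` {-1<..<0}" "of_real (- 1/2)"])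
  have "(\<lambda>s. zeta_cont (1 - s)) holomorphic_on S"
   by (rule holomorphic_on_reflect[OF holomorphic_zeta_cont]) (auto simp: S_def)
  moreover have "zeta_cont holomorphic_on S" "zeta_chi holomorphic_on S"
   by (auto simp: S_def intro: holomorphic_on_subset[OF holomorphic_zeta_cont] holomorphic_on_subset[OF zeta_chi_holomorphic])
  ultimately show "(\<lambda>s. zeta_cont s - zeta_chi s * zeta_cont (1 - s)) holomorphic_on S" by (intro holomorphic_intros)
  show "open S" unfolding S_def by (intro open_Int open_halfspace_Re_gt open_halfspace_Re_lt)
  show "connected S" unfolding S_def by (intro convex_connected convex_Int convex_halfspace_Re_gt convex_halfspace_Re_lt)
  show "complex_of_real ` {-1<..<0} \<subseteq> S" by (auto simp: S_def)
  show "complex_of_real (- 1/2) \<in> S" by (auto simp: S_def)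
  show "complex_of_real (- 1/2) islimpt complex_of_real ` {-1<..<0}"
   unfolding islimpt_approachable
  proof (intro allI impI)
   fix e :: real assume e: "e > 0"
   define x where "x = - 1/2 + min (e / 2) (1 / 4)"
   have "x \<in> {-1<..<0}" "x \<noteq> - 1/2" "dist x (- 1/2) < e" using e by (auto simp: x_def dist_real_def min_def)
   then have "of_real x \<in> complex_of_real ` {-1<..<0}" "complex_of_real x \<noteq> of_real (- 1/2)"
    "dist (complex_of_real x) (of_real (- 1/2)) < e"
    by (auto simp only: dist_of_real of_real_eq_iff)
   then show "\<exists>x'\<in>complex_of_real ` {-1<..<0}. x' \<noteq> of_real (- 1/2) \<and> dist x' (of_real (- 1/2)) < e" by blast
  qed
  show "zeta_cont z - zeta_chi z * zeta_cont (1 - z) = 0" if "z \<in> complex_of_real ` {-1<..<0}" for z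
   using that zeta_cont_functional_real[of "- _"] by fastforce
  show "s \<in> S" using assms by (simp add: S_def)
 qed
 then show ?thesis by simp
qed

text \<open>To the left of Re s > -1 the right side of the functional equation serves as the
  definition; on the overlap -1 < Re s < 0 both definitions agree, so they glue to a holomorphic
  function.\<close>

lemma zeta_exists:
 "\<exists>f. f holomorphic_on (- {1}) \<and> (\<forall>s. Re s > 1 \<longrightarrow> (\<lambda>n. of_nat (Suc n) powr (- s)) sums f s)"
proof -
 define f where "f = (\<lambda>s. if Re s > -1 then zeta_cont s else zeta_chi s * zeta_cont (1 - s))"
 have "f holomorphic_on ({s. Re s > -1} - {1}) \<union> {s. Re s < 0}"
 proof (rule holomorphic_on_Un)
  show "f holomorphic_on ({s. Re s > -1} - {1})"
   by (rule holomorphic_transform[OF holomorphic_zeta_cont]) (auto simp: f_def)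
  have "(\<lambda>s. zeta_cont (1 - s)) holomorphic_on {s. Re s < 0}"
   by (rule holomorphic_on_reflect[OF holomorphic_zeta_cont]) auto
  moreover have "zeta_chi holomorphic_on {s. Re s < 0}"
   by (auto intro: holomorphic_on_subset[OF zeta_chi_holomorphic])
  ultimately have "(\<lambda>s. zeta_chi s * zeta_cont (1 - s)) holomorphic_on {s. Re s < 0}" by (intro holomorphic_intros)
  then show "f holomorphic_on {s. Re s < 0}"
   by (rule holomorphic_transform) (auto simp: f_def zeta_cont_functional)
  show "open ({s. Re s > -1} - {1::complex})" by (intro open_Diff open_halfspace_Re_gt) auto
  show "open {s. Re s < 0}" by (rule open_halfspace_Re_lt)
 qed
 then have "f holomorphic_on (- {1})" by (rule holomorphic_on_subset) auto
 moreover have "\<forall>s. Re s > 1 \<longrightarrow> (\<lambda>n. of_nat (Suc n) powr (- s)) sums f s"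
  using zeta_cont_sums by (auto simp: f_def)
 ultimately show ?thesis by blast
qed

lemma zeta_holomorphic: "zeta holomorphic_on (- {1})"
 and zeta_sums: "Re s > 1 \<Longrightarrow> (\<lambda>n. of_nat (Suc n) powr (- s)) sums zeta s"
 using someI_ex[OF zeta_exists] unfolding zeta_def by auto

lemma zeta_eq_zeta_cont:
 assumes "s \<noteq> 1" "Re s > -1"
 shows "zeta s = zeta_cont s"
proof -
 define S where "S = {s. Re s > -1} - {1::complex}"
 have op: "open {s. Re s > -1}" by (rule open_halfspace_Re_gt)
 have "zeta s - zeta_cont s = 0"
 proof (rule analytic_continuation[of "\<lambda>s. zeta s - zeta_cont s" S "{s. Re s > 1}" 2])
  show "(\<lambda>s. zeta s - zeta_cont s) holomorphic_on S"
   unfolding S_def by (intro holomorphic_intros holomorphic_zeta_cont holomorphic_on_subset[OF zeta_holomorphic]) auto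
  show "open S" unfolding S_def using op by (intro open_Diff) auto
  show "connected S" unfolding S_def using op
   by (intro connected_open_delete convex_connected convex_halfspace_Re_gt) auto
  show "{s. Re s > 1} \<subseteq> S" by (auto simp: S_def)
  show "2 \<in> S" by (auto simp: S_def)
  show "(2::complex) islimpt {s. Re s > 1}"
   by (intro interior_limit_point) (simp add: interior_open open_halfspace_Re_gt)
  show "zeta z - zeta_cont z = 0" if "z \<in> {s. Re s > 1}" for z
   using zeta_sums zeta_cont_sums sums_unique2 that by fastforce
  show "s \<in> S" using assms by (simp add: S_def)
 qed
 then show ?thesis by simp
qed

text \<open>The half plane Im s > 0 avoids s = 0, where zeta (1 - s) has its pole; it suffices
  because the weight lives on positive t.\<close>

lemma zeta_functional_equation:
 assumes "-1 < Re s" "Re s < 1" "Im s > 0"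
 shows "zeta s = zeta_chi s * zeta (1 - s)"
proof -
 define S where "S = {s. Re s > -1} \<inter> {s. Re s < 1} \<inter> {s. Im s > 0}"
 define U where "U = {s. Re s > -1} \<inter> {s. Re s < 0} \<inter> {s. Im s > 0}"
 have opU: "open U" unfolding U_def by (intro open_Int open_halfspace_Re_gt open_halfspace_Re_lt open_halfspace_Im_gt)
 have "zeta s - zeta_chi s * zeta (1 - s) = 0"
 proof (rule analytic_continuation[of "\<lambda>s. zeta s - zeta_chi s * zeta (1 - s)" S U "- 1 / 2 + \<i>"])
  have "(\<lambda>s. zeta (1 - s)) holomorphic_on S"
   by (rule holomorphic_on_reflect[OF zeta_holomorphic]) (auto simp: S_def)
  moreover have "zeta holomorphic_on S" "zeta_chi holomorphic_on S"
   by (auto simp: S_def intro: holomorphic_on_subset[OF zeta_holomorphic] holomorphic_on_subset[OF zeta_chi_holomorphic])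
  ultimately show "(\<lambda>s. zeta s - zeta_chi s * zeta (1 - s)) holomorphic_on S" by (intro holomorphic_intros)
  show "open S" unfolding S_def by (intro open_Int open_halfspace_Re_gt open_halfspace_Re_lt open_halfspace_Im_gt)
  show "connected S" unfolding S_def
   by (intro convex_connected convex_Int convex_halfspace_Re_gt convex_halfspace_Re_lt convex_halfspace_Im_gt)
  show "U \<subseteq> S" by (auto simp: S_def U_def)
  show "- 1 / 2 + \<i> \<in> S" by (auto simp: S_def)
  show "(- 1 / 2 + \<i>) islimpt U"
   using opU by (intro interior_limit_point) (simp add: interior_open, simp add: U_def)
  show "zeta z - zeta_chi z * zeta (1 - z) = 0" if "z \<in> U" for z
  proof -
   have "z \<noteq> 1" "1 - z \<noteq> 1" using that by (auto simp: U_def)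
   then show ?thesis using zeta_cont_functional[of z] that by (auto simp: U_def zeta_eq_zeta_cont)
  qed
  show "s \<in> S" using assms by (simp add: S_def)
 qed
 then show ?thesis by simp
qed

lemma zeta_approx:
 assumes s: "s \<noteq> 1" "Re s > 0"
 shows "norm (zeta s - ((\<Sum>n=1..Suc N. of_nat n powr (-s)) + of_nat (Suc N) powr (1 - s) / (s - 1)))
   \<le> (1 + 2 * norm s * norm (s + 1)) * real (Suc N) powr (- Re s)"
 using zeta_cont_approx[OF s, of N] zeta_eq_zeta_cont[of s] s by simp

section \<open>Factorization matrices\<close>

text \<open>Factorizations \<open>\<Prod>a j = \<Prod>c i\<close> correspond to matrices with column products \<open>a\<close> and row products
 \<open>c\<close>; the coprimality condition selects exactly one matrix for each pair of margins. At every prime it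
 says that the support of the exponents is a lattice path.\<close>

definition noncrossing :: "(nat \<times> nat) set \<Rightarrow> bool" where
 "noncrossing U \<longleftrightarrow> (\<forall>i i' j j'. i < i' \<and> j < j' \<longrightarrow> \<not> ((i, j') \<in> U \<and> (i', j) \<in> U))"

definition staircase :: "nat \<Rightarrow> nat \<Rightarrow> (nat \<times> nat \<Rightarrow> nat) \<Rightarrow> bool" where
 "staircase m n d \<longleftrightarrow> (\<forall>i\<in>{1..m}. \<forall>i'\<in>{1..m}. \<forall>j\<in>{1..n}. \<forall>j'\<in>{1..n}.
   i < i' \<and> j < j' \<longrightarrow> coprime (d (i, j')) (d (i', j)))"

text \<open>The corner products of a staircase matrix are greatest common divisors of partial products of
 its margins; hence the margins determine the matrix.\<close>

lemma staircase_corner_gcd: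
 assumes d: "staircase m n d" and I: "I \<le> m" and J: "J \<le> n"
 shows "(\<Prod>i\<in>{1..I}. \<Prod>j\<in>{1..J}. d (i, j)) =
  gcd (\<Prod>i\<in>{1..I}. \<Prod>j\<in>{1..n}. d (i, j)) (\<Prod>j\<in>{1..J}. \<Prod>i\<in>{1..m}. d (i, j))"
proof -
 define P where "P = (\<Prod>i\<in>{1..I}. \<Prod>j\<in>{1..J}. d (i, j))"
 define Y where "Y = (\<Prod>i\<in>{1..I}. \<Prod>j\<in>{J<..n}. d (i, j))"
 define Z where "Z = (\<Prod>j\<in>{1..J}. \<Prod>i\<in>{I<..m}. d (i, j))"
 have sn: "{1..n} = {1..J} \<union> {J<..n}" and sm: "{1..m} = {1..I} \<union> {I<..m}" using I J by auto
 have "(\<Prod>i\<in>{1..I}. \<Prod>j\<in>{1..n}. d (i, j)) = P * Y"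
  unfolding P_def Y_def sn prod.distrib[symmetric] by (intro prod.cong refl prod.union_disjoint) auto
 moreover have "(\<Prod>j\<in>{1..J}. \<Prod>i\<in>{1..m}. d (i, j)) = P * Z"
 proof -
  have "P = (\<Prod>j\<in>{1..J}. \<Prod>i\<in>{1..I}. d (i, j))" unfolding P_def by (rule prod.swap)
  then show ?thesis unfolding Z_def sm
   by (simp only: prod.distrib[symmetric]) (intro prod.cong refl prod.union_disjoint, auto)
 qed
 moreover have "coprime Y Z"
  unfolding Y_def Z_def using d I J by (intro prod_coprime_left prod_coprime_right) (auto simp: staircase_def)
 ultimately show ?thesis unfolding P_def[symmetric] by (simp add: gcd_mult_distrib_nat[symmetric] coprime_iff_gcd_eq_1)
qed

text \<open>An entry is a quotient of partial row products, and these are quotients of corner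
  products, which the margins determine. Positivity justifies the cancellations.\<close>

lemma staircase_unique:
 fixes d d' :: "nat \<times> nat \<Rightarrow> nat"
 assumes d: "staircase m n d" "\<And>i j. i \<in> {1..m} \<Longrightarrow> j \<in> {1..n} \<Longrightarrow> d (i, j) > 0"
  and d': "staircase m n d'" "\<And>i j. i \<in> {1..m} \<Longrightarrow> j \<in> {1..n} \<Longrightarrow> d' (i, j) > 0"
  and row: "\<And>i. i \<in> {1..m} \<Longrightarrow> (\<Prod>j\<in>{1..n}. d (i, j)) = (\<Prod>j\<in>{1..n}. d' (i, j))"
  and col: "\<And>j. j \<in> {1..n} \<Longrightarrow> (\<Prod>i\<in>{1..m}. d (i, j)) = (\<Prod>i\<in>{1..m}. d' (i, j))"
  and i: "i \<in> {1..m}" and j: "j \<in> {1..n}"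
 shows "d (i, j) = d' (i, j)"
proof -
 have P: "(\<Prod>i\<in>{1..I}. \<Prod>j\<in>{1..J}. d (i, j)) = (\<Prod>i\<in>{1..I}. \<Prod>j\<in>{1..J}. d' (i, j))"
  if "I \<le> m" "J \<le> n" for I J
 proof -
  have "(\<Prod>i\<in>{1..I}. \<Prod>j\<in>{1..n}. d (i, j)) = (\<Prod>i\<in>{1..I}. \<Prod>j\<in>{1..n}. d' (i, j))"
   using that by (intro prod.cong refl row) auto
  moreover have "(\<Prod>j\<in>{1..J}. \<Prod>i\<in>{1..m}. d (i, j)) = (\<Prod>j\<in>{1..J}. \<Prod>i\<in>{1..m}. d' (i, j))"
   using that by (intro prod.cong refl col) auto
  ultimately show ?thesis
   by (simp only: staircase_corner_gcd[OF d(1) that] staircase_corner_gcd[OF d'(1) that])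
 qed
 have R: "(\<Prod>j\<in>{1..J}. d (Suc I, j)) = (\<Prod>j\<in>{1..J}. d' (Suc I, j))"
  if "Suc I \<le> m" "J \<le> n" for I J
 proof -
  have 1: "(\<Prod>i\<in>{1..Suc I}. \<Prod>j\<in>{1..J}. f (i, j)) = (\<Prod>i\<in>{1..I}. \<Prod>j\<in>{1..J}. f (i, j)) * (\<Prod>j\<in>{1..J}. f (Suc I, j))"
   for f :: "nat \<times> nat \<Rightarrow> nat" by simp
  have "(\<Prod>i\<in>{1..I}. \<Prod>j\<in>{1..J}. d (i, j)) > 0"
   using that by (intro prod_pos ballI d(2)) auto
  moreover have "(\<Prod>i\<in>{1..I}. \<Prod>j\<in>{1..J}. d (i, j)) = (\<Prod>i\<in>{1..I}. \<Prod>j\<in>{1..J}. d' (i, j))"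
   by (intro P) (use that in auto)
  ultimately show ?thesis using P[OF that, unfolded 1] by (metis mult_cancel_left not_gr_zero)
 qed
 obtain I where I: "i = Suc I" using i by (cases i) auto
 obtain J where J: "j = Suc J" using j by (cases j) auto
 have 1: "(\<Prod>j\<in>{1..Suc J}. f (i, j)) = (\<Prod>j\<in>{1..J}. f (i, j)) * f (i, Suc J)"
  for f :: "nat \<times> nat \<Rightarrow> nat" by simp
 have "(\<Prod>j\<in>{1..J}. d (i, j)) > 0"
  using i j J by (intro prod_pos ballI d(2)) auto
 moreover have "(\<Prod>j\<in>{1..Suc J}. d (i, j)) = (\<Prod>j\<in>{1..Suc J}. d' (i, j))" "(\<Prod>j\<in>{1..J}. d (i, j)) = (\<Prod>j\<in>{1..J}. d' (i, j))"
  using R[of I "Suc J"] R[of I J] i j I J by auto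
 ultimately have "d (i, Suc J) = d' (i, Suc J)" unfolding 1 by (metis mult_cancel_left not_gr_zero)
 then show ?thesis by (simp add: J)
qed

text \<open>A row with product c is filled greedily from the left: the first n numbers absorb gcd
  (c, their product) and the last one takes the rest.\<close>

lemma greedy_divisors:
 fixes a :: "nat \<Rightarrow> nat"
 assumes "\<And>j. j \<in> {1..n} \<Longrightarrow> a j > 0" "c dvd (\<Prod>j\<in>{1..n}. a j)"
 shows "\<exists>e. (\<Prod>j\<in>{1..n}. e j) = c \<and> (\<forall>j\<in>{1..n}. e j dvd a j) \<and>
  (\<forall>j\<in>{1..n}. \<forall>j'\<in>{1..n}. j < j' \<longrightarrow> coprime (e j') (a j div e j))"
 using assms
proof (induction n arbitrary: c)
 case (Suc n)
 define A where "A = (\<Prod>j\<in>{1..n}. a j)"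
 have A0: "A > 0" unfolding A_def using Suc.prems(1) by (intro prod_pos) auto
 define g where "g = gcd c A"
 have g0: "g > 0" using A0 by (simp add: g_def)
 obtain e where e: "(\<Prod>j\<in>{1..n}. e j) = g" "\<And>j. j \<in> {1..n} \<Longrightarrow> e j dvd a j"
  "\<And>j j'. j \<in> {1..n} \<Longrightarrow> j' \<in> {1..n} \<Longrightarrow> j < j' \<Longrightarrow> coprime (e j') (a j div e j)"
  using Suc.IH[of g] Suc.prems(1) unfolding g_def A_def by auto
 \<comment> \<open>What remains of c is coprime to what remains of the first n numbers. This forces
   the rest of c into the last number and is also the coprimality claimed for it.\<close>
 have cop: "coprime (c div g) (A div g)"
  unfolding g_def using A0 by (intro div_gcd_coprime) auto
 have "c div g dvd (A div g) * a (Suc n)"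
 proof -
  have "c dvd A * a (Suc n)" using Suc.prems(2) by (simp add: A_def)
  then have "g * (c div g) dvd g * ((A div g) * a (Suc n))"
   by (simp add: g_def mult.assoc[symmetric])
  then show ?thesis using g0 by simp
 qed
 then have last: "c div g dvd a (Suc n)" using cop by (simp add: coprime_dvd_mult_right_iff)
 have Ag: "A div g = (\<Prod>j\<in>{1..n}. a j div e j)"
 proof -
  have "(\<Prod>j\<in>{1..n}. e j) * (\<Prod>j\<in>{1..n}. a j div e j) = A"
   unfolding A_def prod.distrib[symmetric] using e(2) by (intro prod.cong) auto
  then show ?thesis using g0 unfolding e(1) by (metis nonzero_mult_div_cancel_left less_numeral_extra(3))
 qed
 define e' where "e' = e(Suc n := c div g)"
 have "(\<Prod>j\<in>{1..Suc n}. e' j) = (\<Prod>j\<in>{1..n}. e j) * (c div g)"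
  by (simp add: e'_def)
 also have "\<dots> = c" unfolding e(1) by (simp add: g_def)
 finally have "(\<Prod>j\<in>{1..Suc n}. e' j) = c" .
 moreover have "e' j dvd a j" if "j \<in> {1..Suc n}" for j
  using that last e(2) by (cases "j = Suc n") (auto simp: e'_def)
 moreover have "coprime (e' j') (a j div e' j)" if "j \<in> {1..Suc n}" "j' \<in> {1..Suc n}" "j < j'" for j j'
 proof (cases "j' = Suc n")
  case True
  have j: "j \<in> {1..n}" using that True by auto
  then have "a j div e j dvd A div g" unfolding Ag by (intro dvd_prodI) auto
  then have "coprime (c div g) (a j div e j)" by (rule coprime_divisors[OF dvd_refl _ cop])
  then show ?thesis using True j by (simp add: e'_def)
 next
  case False
  then show ?thesis using that e(3) by (auto simp: e'_def)
 qed
 ultimately show ?case by blast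
qed auto

text \<open>Row by row: the first row is filled greedily, and the cofactors a' are the column
  products of a smaller problem. Every entry below row 1 divides a cofactor, so the greedy
  coprimality passes to it.\<close>

lemma staircase_exists:
 fixes a c :: "nat \<Rightarrow> nat"
 assumes "\<And>j. j \<in> {1..n} \<Longrightarrow> a j > 0" "\<And>i. i \<in> {1..m} \<Longrightarrow> c i > 0"
  and "(\<Prod>j\<in>{1..n}. a j) = (\<Prod>i\<in>{1..m}. c i)"
 shows "\<exists>d. staircase m n d \<and> (\<forall>i\<in>{1..m}. (\<Prod>j\<in>{1..n}. d (i, j)) = c i) \<and>
   (\<forall>j\<in>{1..n}. (\<Prod>i\<in>{1..m}. d (i, j)) = a j)"
 using assms
proof (induction m arbitrary: a c)
 case 0
 have "prod a {1..n} = 1" using 0(3) by simp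
 then have "\<forall>j\<in>{1..n}. a j = 1" using prod_eq_1_iff[of "{1..n}" a] by blast
 then show ?case by (intro exI[of _ "\<lambda>_. 1"]) (auto simp: staircase_def)
next
 case (Suc m)
 have prodc: "(\<Prod>i\<in>{1..Suc m}. c i) = c 1 * (\<Prod>i\<in>{1..m}. c (Suc i))"
  using prod.atLeast_Suc_atMost_Suc_shift[of c 1 m] by (subst prod.atLeast_Suc_atMost) auto
 have "c 1 dvd (\<Prod>j\<in>{1..n}. a j)" unfolding Suc.prems(3) prodc by simp
 then obtain e where e: "(\<Prod>j\<in>{1..n}. e j) = c 1" "\<And>j. j \<in> {1..n} \<Longrightarrow> e j dvd a j"
  "\<And>j j'. j \<in> {1..n} \<Longrightarrow> j' \<in> {1..n} \<Longrightarrow> j < j' \<Longrightarrow> coprime (e j') (a j div e j)"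
  using greedy_divisors[of n a "c 1"] Suc.prems(1) by auto
 define a' where "a' = (\<lambda>j. a j div e j)"
 have ae: "e j * a' j = a j" if "j \<in> {1..n}" for j using e(2)[OF that] by (simp add: a'_def)
 have "c 1 * (\<Prod>j\<in>{1..n}. a' j) = (\<Prod>j\<in>{1..n}. a j)"
  unfolding e(1)[symmetric] prod.distrib[symmetric] using ae by (intro prod.cong) auto
 then have "c 1 * (\<Prod>j\<in>{1..n}. a' j) = c 1 * (\<Prod>i\<in>{1..m}. c (Suc i))"
  unfolding Suc.prems(3) prodc .
 then have pr: "(\<Prod>j\<in>{1..n}. a' j) = (\<Prod>i\<in>{1..m}. c (Suc i))"
  using Suc.prems(2)[of 1] by simp
 have a'0: "a' j > 0" if "j \<in> {1..n}" for j using ae[OF that] Suc.prems(1)[OF that] by (metis mult_0_right neq0_conv)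
 have "c (Suc i) > 0" if "i \<in> {1..m}" for i using that Suc.prems(2)[of "Suc i"] by simp
 from Suc.IH[OF a'0 this pr] obtain d where d: "staircase m n d"
  "\<And>i. i \<in> {1..m} \<Longrightarrow> (\<Prod>j\<in>{1..n}. d (i, j)) = c (Suc i)" "\<And>j. j \<in> {1..n} \<Longrightarrow> (\<Prod>i\<in>{1..m}. d (i, j)) = a' j"
  by blast
 define d' where "d' = (\<lambda>(i, j). if i = 1 then e j else d (i - 1, j))"
 have "(\<Prod>j\<in>{1..n}. d' (i, j)) = c i" if "i \<in> {1..Suc m}" for i
 proof (cases "i = 1")
  case False
  then obtain i0 where "i = Suc i0" "i0 \<in> {1..m}" using \<open>i \<in> {1..Suc m}\<close> by (cases i) auto
  then show ?thesis using d(2)[of i0] by (simp add: d'_def)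
 qed (use e(1) in \<open>simp add: d'_def\<close>)
 moreover have "(\<Prod>i\<in>{1..Suc m}. d' (i, j)) = a j" if j: "j \<in> {1..n}" for j
 proof -
  have "(\<Prod>i\<in>{1..Suc m}. d' (i, j)) = d' (1, j) * (\<Prod>i\<in>{1..m}. d' (Suc i, j))"
   using prod.atLeast_Suc_atMost_Suc_shift[of "\<lambda>i. d' (i, j)" 1 m] by (subst prod.atLeast_Suc_atMost) auto
  also have "(\<Prod>i\<in>{1..m}. d' (Suc i, j)) = (\<Prod>i\<in>{1..m}. d (i, j))"
   by (intro prod.cong) (auto simp: d'_def)
  also have "d' (1, j) * \<dots> = a j" using d(3)[OF j] ae[OF j] by (simp add: d'_def)
  finally show ?thesis .
 qed
 moreover have "staircase (Suc m) n d'"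
  unfolding staircase_def
 proof (intro ballI impI)
  fix i i' j j' assume *: "i \<in> {1..Suc m}" "i' \<in> {1..Suc m}" "j \<in> {1..n}" "j' \<in> {1..n}" "i < i' \<and> j < j'"
  have i': "i' \<noteq> 1" "i' - 1 \<in> {1..m}" using * by auto
  show "coprime (d' (i, j')) (d' (i', j))"
  proof (cases "i = 1")
   case True
   have "d (i' - 1, j) dvd a' j" unfolding d(3)[OF *(3), symmetric] by (rule dvd_prodI) (use i' in auto)
   moreover have "coprime (e j') (a' j)" using e(3)[of j j'] * by (simp add: a'_def)
   ultimately have "coprime (e j') (d (i' - 1, j))" by (rule coprime_divisors[OF dvd_refl])
   then show ?thesis using True i' by (simp add: d'_def)
  next
   case False
   then have "i - 1 \<in> {1..m}" "i - 1 < i' - 1" using * by auto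
   then show ?thesis using d(1) * False i' by (auto simp: d'_def staircase_def)
  qed
 qed
 ultimately show ?case by blast
qed

section \<open>Matrices and pairs of margins\<close>

text \<open>Restricted to the index range, so that the margins are elements of extensional function
  spaces and equality of margins is equality of functions.\<close>

definition col_prods :: "nat \<Rightarrow> nat \<Rightarrow> (nat \<times> nat \<Rightarrow> nat) \<Rightarrow> nat \<Rightarrow> nat" where
 "col_prods m n d = (\<lambda>j\<in>{1..n}. \<Prod>i\<in>{1..m}. d (i, j))"

definition row_prods :: "nat \<Rightarrow> nat \<Rightarrow> (nat \<times> nat \<Rightarrow> nat) \<Rightarrow> nat \<Rightarrow> nat" where
 "row_prods m n d = (\<lambda>i\<in>{1..m}. \<Prod>j\<in>{1..n}. d (i, j))"

lemma bij_betw_staircase_margins: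
 "bij_betw (\<lambda>d. (col_prods m n d, row_prods m n d))
   {d \<in> {1..m} \<times> {1..n} \<rightarrow>\<^sub>E {1..}. staircase m n d}
   {(a, c). a \<in> {1..n} \<rightarrow>\<^sub>E {1..} \<and> c \<in> {1..m} \<rightarrow>\<^sub>E {1..} \<and> (\<Prod>j\<in>{1..n}. a j) = (\<Prod>i\<in>{1..m}. c i)}"
  (is "bij_betw ?f ?Y ?X")
 unfolding bij_betw_def
proof (intro conjI)
 show "inj_on ?f ?Y"
 proof (rule inj_onI)
  fix d d' assume d: "d \<in> ?Y" and d': "d' \<in> ?Y" and eq: "?f d = ?f d'"
  have eqs: "col_prods m n d = col_prods m n d'" "row_prods m n d = row_prods m n d'" using eq by auto
  have dP: "d \<in> {1..m} \<times> {1..n} \<rightarrow>\<^sub>E {1..}" "d' \<in> {1..m} \<times> {1..n} \<rightarrow>\<^sub>E {1..}" using d d' by auto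
  have pos: "d (i, j) > 0" "d' (i, j) > 0" if "i \<in> {1..m}" "j \<in> {1..n}" for i j
   using that PiE_mem[OF dP(1), of "(i, j)"] PiE_mem[OF dP(2), of "(i, j)"] by simp_all
  have "d (i, j) = d' (i, j)" if ij: "i \<in> {1..m}" "j \<in> {1..n}" for i j
  proof (rule staircase_unique[OF _ _ _ _ _ _ ij])
   show "staircase m n d" "staircase m n d'" using d d' by auto
   show "(\<Prod>j\<in>{1..n}. d (i, j)) = (\<Prod>j\<in>{1..n}. d' (i, j))" if "i \<in> {1..m}" for i
    using fun_cong[OF eqs(2), of i] that by (simp add: row_prods_def)
   show "(\<Prod>i\<in>{1..m}. d (i, j)) = (\<Prod>i\<in>{1..m}. d' (i, j))" if "j \<in> {1..n}" for j
    using fun_cong[OF eqs(1), of j] that by (simp add: col_prods_def)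
  qed (use pos in auto)
  then show "d = d'" by (intro PiE_ext[OF dP]) auto
 qed
 show "?f ` ?Y = ?X"
 proof (intro equalityI subsetI)
  fix x assume "x \<in> ?f ` ?Y"
  then obtain d where d: "d \<in> ?Y" "x = ?f d" by blast
  have dP: "d \<in> {1..m} \<times> {1..n} \<rightarrow>\<^sub>E {1..}" using d by auto
  have pos: "d (i, j) \<ge> 1" if "i \<in> {1..m}" "j \<in> {1..n}" for i j
   using that PiE_mem[OF dP, of "(i, j)"] by simp
  have "(\<Prod>j\<in>{1..n}. \<Prod>i\<in>{1..m}. d (i, j)) = (\<Prod>i\<in>{1..m}. \<Prod>j\<in>{1..n}. d (i, j))" by (rule prod.swap)
  moreover have "col_prods m n d \<in> {1..n} \<rightarrow>\<^sub>E {1..}" unfolding col_prods_def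
   by (intro restrict_PiE_iff[THEN iffD2] ballI) (simp only: atLeast_iff, intro prod_ge_1 pos)
  moreover have "row_prods m n d \<in> {1..m} \<rightarrow>\<^sub>E {1..}" unfolding row_prods_def
   by (intro restrict_PiE_iff[THEN iffD2] ballI) (simp only: atLeast_iff, intro prod_ge_1 pos)
  ultimately show "x \<in> ?X" unfolding d(2) by (simp add: col_prods_def row_prods_def)
 next
  fix x assume "x \<in> ?X"
  then obtain a c where x: "x = (a, c)" and a: "a \<in> {1..n} \<rightarrow>\<^sub>E {1..}" and c: "c \<in> {1..m} \<rightarrow>\<^sub>E {1..}"
   and eq: "(\<Prod>j\<in>{1..n}. a j) = (\<Prod>i\<in>{1..m}. c i)" by blast
  have a0: "a j > 0" if "j \<in> {1..n}" for j using PiE_mem[OF a that] by simp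
  have c0: "c i > 0" if "i \<in> {1..m}" for i using PiE_mem[OF c that] by simp
  obtain d where d: "staircase m n d" "\<And>i. i \<in> {1..m} \<Longrightarrow> (\<Prod>j\<in>{1..n}. d (i, j)) = c i"
    "\<And>j. j \<in> {1..n} \<Longrightarrow> (\<Prod>i\<in>{1..m}. d (i, j)) = a j"
   using staircase_exists[OF a0 c0 eq] by blast
  define d' where "d' = restrict d ({1..m} \<times> {1..n})"
  have "d (i, j) \<ge> 1" if ij: "i \<in> {1..m}" "j \<in> {1..n}" for i j
  proof (rule ccontr)
   assume "\<not> d (i, j) \<ge> 1"
   then have "(\<Prod>j\<in>{1..n}. d (i, j)) = 0" using ij by (intro prod_zero bexI[of _ j]) auto
   then show False using d(2)[OF ij(1)] c0[OF ij(1)] by (metis less_irrefl_nat)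
  qed
  then have "d' \<in> {1..m} \<times> {1..n} \<rightarrow>\<^sub>E {1..}" by (auto simp: d'_def)
  moreover have "staircase m n d'" using d(1) by (simp add: d'_def staircase_def)
  ultimately have dY: "d' \<in> ?Y" by blast
  have fx: "?f d' = x"
  proof -
   have "col_prods m n d' = a"
   proof
    fix j show "col_prods m n d' j = a j"
    proof (cases "j \<in> {1..n}")
     case True
     then have "col_prods m n d' j = (\<Prod>i\<in>{1..m}. d (i, j))" by (simp add: col_prods_def d'_def)
     then show ?thesis using d(3)[OF True] by simp
    next
     case False
     then show ?thesis using PiE_arb[OF a False] by (auto simp: col_prods_def)
    qed
   qed
   moreover have "row_prods m n d' = c"
   proof
    fix i show "row_prods m n d' i = c i"
    proof (cases "i \<in> {1..m}")
     case True
     then have "row_prods m n d' i = (\<Prod>j\<in>{1..n}. d (i, j))" by (simp add: row_prods_def d'_def)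
     then show ?thesis using d(2)[OF True] by simp
    next
     case False
     then show ?thesis using PiE_arb[OF c False] by (auto simp: row_prods_def)
    qed
   qed
   ultimately show ?thesis by (simp add: x)
  qed
  show "x \<in> ?f ` ?Y" unfolding fx[symmetric] using dY by (rule imageI)
 qed
qed

text \<open>Stars and bars, with functions on V turned into lists by an enumeration of V. The
  truncated subtraction gives the right count also for empty V.\<close>

lemma card_PiE_sum_eq:
 assumes "finite V"
 shows "card {e \<in> V \<rightarrow>\<^sub>E (UNIV :: nat set). sum e V = r} = (r + card V - 1) choose r"
proof -
 obtain xs where xs: "distinct xs" "set xs = V" using finite_distinct_list[OF assms] by blast
 have len: "length xs = card V" using xs distinct_card by metis
 have "bij_betw (\<lambda>e. map e xs) {e \<in> V \<rightarrow>\<^sub>E (UNIV :: nat set). sum e V = r} {l. length l = card V \<and> sum_list l = r}"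
  unfolding bij_betw_def
 proof (intro conjI equalityI subsetI inj_onI)
  fix e e' assume *: "e \<in> {e \<in> V \<rightarrow>\<^sub>E (UNIV :: nat set). sum e V = r}" "e' \<in> {e \<in> V \<rightarrow>\<^sub>E (UNIV :: nat set). sum e V = r}" "map e xs = map e' xs"
  then have "e v = e' v" if "v \<in> V" for v using that xs by (auto simp: map_eq_conv)
  then show "e = e'" using * by (intro PiE_ext[of e V "\<lambda>_. UNIV" e']) auto
 next
  fix l assume "l \<in> (\<lambda>e. map e xs) ` {e \<in> V \<rightarrow>\<^sub>E (UNIV :: nat set). sum e V = r}"
  then show "l \<in> {l. length l = card V \<and> sum_list l = r}"
   using xs len by (auto simp: sum_list_distinct_conv_sum_set)
 next
  fix l :: "nat list" assume l: "l \<in> {l. length l = card V \<and> sum_list l = r}"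
  define e where "e = (\<lambda>v\<in>V. l ! (THE k. k < length xs \<and> xs ! k = v))"
  have nth: "e (xs ! k) = l ! k" if "k < length xs" for k
  proof -
   have "(THE k'. k' < length xs \<and> xs ! k' = xs ! k) = k"
    using that xs(1) by (intro the_equality) (auto simp: nth_eq_iff_index_eq)
   then show ?thesis using that xs by (auto simp: e_def)
  qed
  have m: "map e xs = l" using l len nth by (intro nth_equalityI) auto
  have "sum e V = sum_list (map e xs)" using xs by (simp add: sum_list_distinct_conv_sum_set)
  then have "sum e V = r" using m l by simp
  then show "l \<in> (\<lambda>e. map e xs) ` {e \<in> V \<rightarrow>\<^sub>E (UNIV :: nat set). sum e V = r}"
   using m by (intro image_eqI[of _ _ e]) (auto simp: e_def)
 qed
 then have "card {e \<in> V \<rightarrow>\<^sub>E (UNIV :: nat set). sum e V = r} = card {l :: nat list. length l = card V \<and> sum_list l = r}"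
  by (rule bij_betw_same_card)
 then show ?thesis using card_length_sum_list[of "card V" r] by simp
qed

text \<open>Count by margins: exponent matrices of weight \<open>r\<close> are pairs of compositions of \<open>r\<close> into \<open>m\<close> parts,
 which produces the square of the coefficient of \<open>(1 - X) ^ (-m)\<close> in the arithmetic factor.\<close>

lemma card_noncrossing_exponents:
 "card {e \<in> {1..m} \<times> {1..m} \<rightarrow>\<^sub>E (UNIV :: nat set). sum e ({1..m} \<times> {1..m}) = r \<and> noncrossing {v \<in> {1..m} \<times> {1..m}. e v > 0}}
  = ((r + m - 1) choose r)\<^sup>2"
proof -
 define V where "V = {1..m} \<times> {1..m}"
 define W where "W = {e \<in> V \<rightarrow>\<^sub>E (UNIV :: nat set). sum e V = r \<and> noncrossing {v \<in> V. e v > 0}}"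
 define A where "A = {a \<in> {1..m} \<rightarrow>\<^sub>E (UNIV :: nat set). sum a {1..m} = r}"
 \<comment> \<open>Exponents are encoded as powers of 2, for which coprimality means that not both
   exponents are positive. Thus existence and uniqueness of staircase matrices apply to exponent
   matrices.\<close>
 define pw where "pw = (\<lambda>(e :: nat \<times> nat \<Rightarrow> nat) v. (2::nat) ^ e v)"
 define pw1 where "pw1 = (\<lambda>(e :: nat \<Rightarrow> nat) v. (2::nat) ^ e v)"
 have st: "staircase m m (pw e) \<longleftrightarrow> noncrossing {v \<in> V. e v > 0}" for e :: "nat \<times> nat \<Rightarrow> nat"
 proof -
  have cp: "coprime ((2::nat) ^ a) (2 ^ b) \<longleftrightarrow> \<not> (a > 0 \<and> b > 0)" for a b by (cases a; cases b) auto
  show ?thesis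
   unfolding staircase_def noncrossing_def V_def pw_def cp mem_Collect_eq mem_Times_iff fst_conv snd_conv by blast
 qed
 define f where "f = (\<lambda>e :: nat \<times> nat \<Rightarrow> nat. (\<lambda>j\<in>{1..m}. \<Sum>i\<in>{1..m}. e (i, j), \<lambda>i\<in>{1..m}. \<Sum>j\<in>{1..m}. e (i, j)))"
 have "bij_betw f W (A \<times> A)"
  unfolding bij_betw_def
 proof (intro conjI inj_onI equalityI subsetI)
  fix e e' assume e: "e \<in> W" and e': "e' \<in> W" and eq: "f e = f e'"
  have rows: "(\<Sum>j\<in>{1..m}. e (i, j)) = (\<Sum>j\<in>{1..m}. e' (i, j))" if "i \<in> {1..m}" for i
   using arg_cong[OF eq, of "\<lambda>z. snd z i"] that by (simp add: f_def)
  have cols: "(\<Sum>i\<in>{1..m}. e (i, j)) = (\<Sum>i\<in>{1..m}. e' (i, j))" if "j \<in> {1..m}" for j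
   using arg_cong[OF eq, of "\<lambda>z. fst z j"] that by (simp add: f_def)
  have "pw e (i, j) = pw e' (i, j)" if ij: "i \<in> {1..m}" "j \<in> {1..m}" for i j
  proof (rule staircase_unique[OF _ _ _ _ _ _ ij])
   show "staircase m m (pw e)" "staircase m m (pw e')" using e e' by (simp_all add: st W_def)
   show "(\<Prod>j\<in>{1..m}. pw e (i, j)) = (\<Prod>j\<in>{1..m}. pw e' (i, j))" if "i \<in> {1..m}" for i
    using rows[OF that] by (simp add: pw_def power_sum[symmetric])
   show "(\<Prod>i\<in>{1..m}. pw e (i, j)) = (\<Prod>i\<in>{1..m}. pw e' (i, j))" if "j \<in> {1..m}" for j
    using cols[OF that] by (simp add: pw_def power_sum[symmetric])
  qed (auto simp: pw_def)
  then have "e (i, j) = e' (i, j)" if ij: "i \<in> {1..m}" "j \<in> {1..m}" for i j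
   using ij by (simp add: pw_def)
  moreover have "e \<in> V \<rightarrow>\<^sub>E UNIV" "e' \<in> V \<rightarrow>\<^sub>E UNIV" using e e' by (auto simp: W_def)
  ultimately show "e = e'" by (intro PiE_ext[of e V "\<lambda>_. UNIV" e']) (auto simp: V_def)
 next
  fix x assume "x \<in> f ` W"
  then obtain e where e: "e \<in> W" "x = f e" by blast
  have s: "sum e V = (\<Sum>i\<in>{1..m}. \<Sum>j\<in>{1..m}. e (i, j))" unfolding V_def by (simp add: sum.cartesian_product)
  also have "\<dots> = (\<Sum>j\<in>{1..m}. \<Sum>i\<in>{1..m}. e (i, j))" by (rule sum.swap)
  finally show "x \<in> A \<times> A" using e s by (auto simp: W_def A_def f_def)
 next
  fix x assume "x \<in> A \<times> A"
  then obtain a c where x: "x = (a, c)" and a: "a \<in> A" and c: "c \<in> A" by blast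
  have "(\<Prod>j\<in>{1..m}. pw1 a j) = (\<Prod>i\<in>{1..m}. pw1 c i)"
   using a c by (simp add: A_def pw1_def power_sum[symmetric])
  then obtain d where d: "staircase m m d" "\<And>i. i \<in> {1..m} \<Longrightarrow> (\<Prod>j\<in>{1..m}. d (i, j)) = pw1 c i"
    "\<And>j. j \<in> {1..m} \<Longrightarrow> (\<Prod>i\<in>{1..m}. d (i, j)) = pw1 a j"
   using staircase_exists[of m "pw1 a" m "pw1 c"] by (auto simp: pw1_def)
  \<comment> \<open>Entries of the matrix provided by \<open>staircase_exists\<close> divide a row
    product, which is a power of 2, so exponents can be read off.\<close>
  have "\<exists>k. d (i, j) = 2 ^ k" if ij: "i \<in> {1..m}" "j \<in> {1..m}" for i j
  proof -
   have "d (i, j) dvd (\<Prod>j\<in>{1..m}. d (i, j))" using ij by (intro dvd_prodI) auto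
   then have "d (i, j) dvd 2 ^ c i" unfolding d(2)[OF ij(1)] by (simp add: pw1_def)
   then show ?thesis using divides_primepow_nat[of 2 "d (i, j)" "c i"] by auto
  qed
  then have "\<forall>v\<in>V. \<exists>k. d v = 2 ^ k" by (auto simp: V_def)
  then obtain k where "\<forall>v\<in>V. d v = 2 ^ k v" using bchoice[of V "\<lambda>v k. d v = 2 ^ k"] by blast
  then have k: "\<And>i j. i \<in> {1..m} \<Longrightarrow> j \<in> {1..m} \<Longrightarrow> d (i, j) = 2 ^ k (i, j)" by (auto simp: V_def)
  define e where "e = restrict k V"
  have de: "d (i, j) = pw e (i, j)" if "i \<in> {1..m}" "j \<in> {1..m}" for i j
   using that k by (simp add: pw_def e_def V_def)
  have rows: "(\<Sum>j\<in>{1..m}. e (i, j)) = c i" if i: "i \<in> {1..m}" for i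
  proof -
   have "2 ^ (\<Sum>j\<in>{1..m}. e (i, j)) = (\<Prod>j\<in>{1..m}. d (i, j))"
    using de[OF i] by (simp add: power_sum pw_def)
   also have "\<dots> = 2 ^ c i" using d(2)[OF i] by (simp add: pw1_def)
   finally show ?thesis by simp
  qed
  have cols: "(\<Sum>i\<in>{1..m}. e (i, j)) = a j" if j: "j \<in> {1..m}" for j
  proof -
   have "2 ^ (\<Sum>i\<in>{1..m}. e (i, j)) = (\<Prod>i\<in>{1..m}. d (i, j))"
    using de[OF _ j] by (simp add: power_sum pw_def)
   also have "\<dots> = 2 ^ a j" using d(3)[OF j] by (simp add: pw1_def)
   finally show ?thesis by simp
  qed
  have fx: "f e = x"
  proof -
   have aE: "a \<in> {1..m} \<rightarrow>\<^sub>E UNIV" and cE: "c \<in> {1..m} \<rightarrow>\<^sub>E UNIV" using a c by (auto simp: A_def)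
   have "(\<lambda>j\<in>{1..m}. \<Sum>i\<in>{1..m}. e (i, j)) = a"
   proof
    fix j show "(\<lambda>j\<in>{1..m}. \<Sum>i\<in>{1..m}. e (i, j)) j = a j"
     using cols[of j] PiE_arb[OF aE, of j] by (cases "j \<in> {1..m}") auto
   qed
   moreover have "(\<lambda>i\<in>{1..m}. \<Sum>j\<in>{1..m}. e (i, j)) = c"
   proof
    fix i show "(\<lambda>i\<in>{1..m}. \<Sum>j\<in>{1..m}. e (i, j)) i = c i"
     using rows[of i] PiE_arb[OF cE, of i] by (cases "i \<in> {1..m}") auto
   qed
   ultimately show ?thesis by (simp add: f_def x)
  qed
  have "staircase m m (pw e)" using d(1) de by (auto simp: staircase_def)
  then have "noncrossing {v \<in> V. e v > 0}" by (simp add: st)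
  moreover have "sum e V = r"
  proof -
   have "sum e V = (\<Sum>i\<in>{1..m}. \<Sum>j\<in>{1..m}. e (i, j))" unfolding V_def by (simp add: sum.cartesian_product)
   also have "\<dots> = sum c {1..m}" by (intro sum.cong refl rows)
   finally show ?thesis using c by (simp add: A_def)
  qed
  ultimately have "e \<in> W" by (simp add: W_def e_def)
  then show "x \<in> f ` W" unfolding fx[symmetric] by (rule imageI)
 qed
 then have "card W = card A * card A" by (simp add: bij_betw_same_card card_cartesian_product)
 then show ?thesis unfolding W_def A_def V_def using card_PiE_sum_eq[of "{1..m}" r] by (simp add: power2_eq_square)
qed

section \<open>The arithmetic factor\<close>

text \<open>Moebius transform of the indicator of \<open>good\<close> on the lattice of subsets: the
  two signs multiply to (-1) ^ card (S - T).\<close>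

definition moebius_coeff :: "('v set \<Rightarrow> bool) \<Rightarrow> 'v set \<Rightarrow> real" where
 "moebius_coeff good S = (-1) ^ card S * (\<Sum>T\<in>Pow S. (-1) ^ card T * of_bool (good T))"

lemma sum_moebius_coeff:
 assumes "finite U"
 shows "(\<Sum>S\<in>Pow U. moebius_coeff good S) = of_bool (good U)"
proof -
 have "of_bool (good U) = (\<Sum>S\<in>Pow U. (-1) ^ card S * (\<Sum>T\<in>Pow S. (-1) ^ card T * of_bool (good T)) :: real)"
  by (rule inclusion_exclusion_symmetric[OF refl assms])
 then show ?thesis by (simp add: moebius_coeff_def)
qed

lemma moebius_coeff_empty: "good {} \<Longrightarrow> moebius_coeff good {} = 1"
 by (simp add: moebius_coeff_def)

lemma moebius_coeff_singleton: "good {} \<Longrightarrow> good {v} \<Longrightarrow> moebius_coeff good {v} = 0"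
 by (simp add: moebius_coeff_def Pow_insert)

lemma abs_moebius_coeff_le:
 assumes "finite S"
 shows "\<bar>moebius_coeff good S\<bar> \<le> 2 ^ card S"
proof -
 have "\<bar>moebius_coeff good S\<bar> = \<bar>\<Sum>T\<in>Pow S. (-1) ^ card T * of_bool (good T)\<bar>"
  by (simp add: moebius_coeff_def abs_mult)
 also have "\<dots> \<le> (\<Sum>T\<in>Pow S. \<bar>(-1) ^ card T * of_bool (good T)\<bar>)" by (rule sum_abs)
 also have "\<dots> \<le> (\<Sum>T\<in>Pow S. 1)" by (intro sum_mono) (auto simp: abs_mult)
 finally show ?thesis using assms by (simp add: card_Pow)
qed

text \<open>The probability that a random subset of V is good if every element is chosen
  independently with probability x. For x = 1 / p this models the coordinates divisible by the prime
  p.\<close>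

definition local_density :: "'v set \<Rightarrow> ('v set \<Rightarrow> bool) \<Rightarrow> real \<Rightarrow> real" where
 "local_density V good x = (\<Sum>S\<in>Pow V. moebius_coeff good S * x ^ card S)"

text \<open>There is no linear term because singletons are good.\<close>

lemma sum_abs_moebius_coeff_le:
 assumes V: "finite V" and good: "good {}" "\<And>v. good {v}" and x: "0 \<le> x" "x \<le> 1"
 shows "(\<Sum>S\<in>Pow V - {{}}. \<bar>moebius_coeff good S\<bar> * x ^ card S) \<le> 4 ^ card V * x\<^sup>2"
proof -
 have "(\<Sum>S\<in>Pow V - {{}}. \<bar>moebius_coeff good S\<bar> * x ^ card S) \<le> (\<Sum>S\<in>Pow V - {{}}. 2 ^ card V * x\<^sup>2)"
 proof (rule sum_mono)
  fix S assume S: "S \<in> Pow V - {{}}"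
  have fS: "finite S" using S V finite_subset by blast
  show "\<bar>moebius_coeff good S\<bar> * x ^ card S \<le> 2 ^ card V * x\<^sup>2"
  proof (cases "card S = 1")
   case True
   then obtain v where "S = {v}" by (auto simp: card_1_singleton_iff)
   then show ?thesis using good by (simp add: moebius_coeff_singleton)
  next
   case False
   have "card S \<noteq> 0" using S fS by simp
   then have "card S \<ge> 2" using False by linarith
   then have "x ^ card S \<le> x\<^sup>2" using x by (intro power_decreasing) auto
   moreover have "\<bar>moebius_coeff good S\<bar> \<le> 2 ^ card V"
   proof -
    have "(2::real) ^ card S \<le> 2 ^ card V" using S V by (intro power_increasing card_mono) auto
    then show ?thesis using abs_moebius_coeff_le[OF fS, of good] by linarith
   qed
   ultimately show ?thesis using x by (intro mult_mono) auto
  qed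
 qed
 also have "\<dots> \<le> (\<Sum>S\<in>Pow V. 2 ^ card V * x\<^sup>2)" using V by (intro sum_mono2) auto
 also have "\<dots> = 4 ^ card V * x\<^sup>2" using V by (simp add: card_Pow power_mult_distrib[symmetric])
 finally show ?thesis .
qed

lemma local_density_minus_1:
 assumes V: "finite V" and good: "good {}"
 shows "local_density V good x - 1 = (\<Sum>S\<in>Pow V - {{}}. moebius_coeff good S * x ^ card S)"
proof -
 have "local_density V good x = moebius_coeff good {} * x ^ card {} + (\<Sum>S\<in>Pow V - {{}}. moebius_coeff good S * x ^ card S)"
  unfolding local_density_def using V sum.remove[of "Pow V" "{}" "\<lambda>S. moebius_coeff good S * x ^ card S"] by simp
 then show ?thesis using good by (simp add: moebius_coeff_empty)
qed

lemma abs_local_density_minus_1_le: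
 assumes "finite V" "good {}" "\<And>v. good {v}" "0 \<le> x" "x \<le> 1"
 shows "\<bar>local_density V good x - 1\<bar> \<le> 4 ^ card V * x\<^sup>2"
proof -
 have "\<bar>local_density V good x - 1\<bar> \<le> (\<Sum>S\<in>Pow V - {{}}. \<bar>moebius_coeff good S * x ^ card S\<bar>)"
  unfolding local_density_minus_1[of V good x, OF assms(1,2)] by (rule sum_abs)
 also have "\<dots> = (\<Sum>S\<in>Pow V - {{}}. \<bar>moebius_coeff good S\<bar> * x ^ card S)"
  using assms by (simp add: abs_mult)
 also have "\<dots> \<le> 4 ^ card V * x\<^sup>2" by (rule sum_abs_moebius_coeff_le[OF assms])
 finally show ?thesis .
qed

text \<open>Lowering the exponents on S by 1 removes the support condition and lowers the weight by
  card S.\<close>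

lemma card_PiE_sum_support:
 assumes V: "finite V" and S: "S \<subseteq> V"
 shows "card {e \<in> V \<rightarrow>\<^sub>E (UNIV :: nat set). sum e V = r \<and> S \<subseteq> {v \<in> V. e v > 0}} =
  (if card S \<le> r then (r - card S + card V - 1) choose (r - card S) else 0)"
proof -
 define W where "W = {e \<in> V \<rightarrow>\<^sub>E (UNIV :: nat set). sum e V = r \<and> S \<subseteq> {v \<in> V. e v > 0}}"
 have ind: "(\<Sum>v\<in>V. of_bool (v \<in> S)) = card S" using V S by (simp add: Int_absorb1)
 show ?thesis
 proof (cases "card S \<le> r")
  case True
  have "bij_betw (\<lambda>e. \<lambda>v\<in>V. e v + of_bool (v \<in> S)) {e \<in> V \<rightarrow>\<^sub>E (UNIV :: nat set). sum e V = r - card S} W"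
  proof (rule bij_betw_byWitness[where f' = "\<lambda>e. \<lambda>v\<in>V. e v - of_bool (v \<in> S)"])
   show "\<forall>a\<in>{e \<in> V \<rightarrow>\<^sub>E (UNIV :: nat set). sum e V = r - card S}. (\<lambda>v\<in>V. (\<lambda>v\<in>V. a v + of_bool (v \<in> S)) v - of_bool (v \<in> S)) = a"
   proof
    fix a assume "a \<in> {e \<in> V \<rightarrow>\<^sub>E (UNIV :: nat set). sum e V = r - card S}"
    then have "a \<in> V \<rightarrow>\<^sub>E UNIV" by simp
    then show "(\<lambda>v\<in>V. (\<lambda>v\<in>V. a v + of_bool (v \<in> S)) v - of_bool (v \<in> S)) = a"
     by (intro ext) (auto simp: restrict_def PiE_def extensional_def)
   qed
   show "\<forall>a\<in>W. (\<lambda>v\<in>V. (\<lambda>v\<in>V. a v - of_bool (v \<in> S)) v + of_bool (v \<in> S)) = a"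
   proof
    fix a assume "a \<in> W"
    then have a: "a \<in> V \<rightarrow>\<^sub>E UNIV" "\<And>v. v \<in> S \<Longrightarrow> a v > 0" by (auto simp: W_def)
    then show "(\<lambda>v\<in>V. (\<lambda>v\<in>V. a v - of_bool (v \<in> S)) v + of_bool (v \<in> S)) = a"
     by (intro ext) (auto simp: restrict_def PiE_def extensional_def)
   qed
   show "(\<lambda>e. \<lambda>v\<in>V. e v + of_bool (v \<in> S)) ` {e \<in> V \<rightarrow>\<^sub>E (UNIV :: nat set). sum e V = r - card S} \<subseteq> W"
    using True S ind by (auto simp: W_def sum.distrib)
   show "(\<lambda>e. \<lambda>v\<in>V. e v - of_bool (v \<in> S)) ` W \<subseteq> {e \<in> V \<rightarrow>\<^sub>E (UNIV :: nat set). sum e V = r - card S}"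
   proof (intro subsetI)
    fix x assume "x \<in> (\<lambda>e. \<lambda>v\<in>V. e v - of_bool (v \<in> S)) ` W"
    then obtain e where e: "e \<in> W" "x = (\<lambda>v\<in>V. e v - of_bool (v \<in> S))" by blast
    have pos: "\<And>v. v \<in> S \<Longrightarrow> e v > 0" using e(1) by (auto simp: W_def)
    have "sum x V = (\<Sum>v\<in>V. e v - of_bool (v \<in> S))" by (simp add: e(2))
    also have "\<dots> = sum e V - (\<Sum>v\<in>V. of_bool (v \<in> S))" by (rule sum_subtractf_nat) (use pos in \<open>auto simp: Suc_le_eq\<close>)
    also have "\<dots> = r - card S" using e(1) ind by (simp add: W_def)
    finally show "x \<in> {e \<in> V \<rightarrow>\<^sub>E (UNIV :: nat set). sum e V = r - card S}" by (simp add: e(2))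
   qed
  qed
  then have "card W = card {e \<in> V \<rightarrow>\<^sub>E (UNIV :: nat set). sum e V = r - card S}" by (simp add: bij_betw_same_card)
  then show ?thesis using True card_PiE_sum_eq[OF V] by (simp add: W_def)
 next
  case False
  have "W = {}"
  proof (rule ccontr)
   assume "W \<noteq> {}"
   then obtain e where e: "e \<in> W" by blast
   have "(\<Sum>v\<in>V. of_bool (v \<in> S)) \<le> sum e V" using e by (intro sum_mono) (auto simp: W_def Suc_le_eq)
   then show False using False ind e by (simp add: W_def)
  qed
  then show ?thesis unfolding W_def[symmetric] using False by simp
 qed
qed

lemma binomial_series_sums:
 fixes x :: real
 assumes x: "0 \<le> x" "x < 1" and M: "M \<ge> 1"
 shows "(\<lambda>r. real ((r + M - 1) choose r) * x ^ r) sums (1 / (1 - x) ^ M)"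
proof -
 have "(\<lambda>n. (- real M gchoose n) * (-x) ^ n) sums (1 + (-x)) powr (- real M)"
  using x by (intro gen_binomial_real) auto
 moreover have "(- real M gchoose n) * (-x) ^ n = real ((n + M - 1) choose n) * x ^ n" for n
 proof -
  have "real M + real n - 1 = real (n + M - 1)" using M by (simp add: of_nat_diff)
  then have "(- real M gchoose n) = (-1) ^ n * real ((n + M - 1) choose n)"
   unfolding gbinomial_minus by (simp add: binomial_gbinomial)
  moreover have "(-1) ^ n * c * ((-1) ^ n * x ^ n) = ((-1) ^ n * (-1) ^ n) * (c * x ^ n)" for c :: real
   by (simp only: mult_ac)
  moreover have "(-1) ^ n * (-1) ^ n = (1 :: real)" by (simp flip: power_mult_distrib)
  ultimately show ?thesis by (simp only: power_minus[of x n] mult_1_left)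
 qed
 moreover have "(1 + (-x)) powr (- real M) = 1 / (1 - x) ^ M"
  using x by (simp add: powr_minus powr_realpow divide_inverse)
 ultimately show ?thesis by simp
qed

text \<open>In the Moebius expansion of the support condition, requiring positive exponents on S
  multiplies the full series 1 / (1 - x) ^ card V by x ^ card S.\<close>

lemma local_density_sums:
 fixes x :: real and V :: "'v set"
 assumes V: "finite V" "V \<noteq> {}" and x: "0 \<le> x" "x < 1"
 shows "(\<lambda>r. real (card {e \<in> V \<rightarrow>\<^sub>E (UNIV :: nat set). sum e V = r \<and> good {v \<in> V. e v > 0}}) * x ^ r) sums
   (local_density V good x / (1 - x) ^ card V)"
proof -
 define M where "M = card V"
 have M: "M \<ge> 1" using V by (simp add: M_def Suc_le_eq card_gt_0_iff)
 define c where "c = (\<lambda>(S :: 'v set) r. if card S \<le> r then (r - card S + M - 1) choose (r - card S) else (0::nat))"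
 have tm: "real (card {e \<in> V \<rightarrow>\<^sub>E (UNIV :: nat set). sum e V = r \<and> good {v \<in> V. e v > 0}}) =
   (\<Sum>S\<in>Pow V. moebius_coeff good S * real (c S r))" for r
 proof -
  define W where "W = {e \<in> V \<rightarrow>\<^sub>E (UNIV :: nat set). sum e V = r}"
  have fW: "finite W"
  proof (rule finite_subset)
   show "W \<subseteq> V \<rightarrow>\<^sub>E {..r}"
   proof
    fix e assume e: "e \<in> W"
    have "e v \<le> r" if "v \<in> V" for v using e member_le_sum[of v V e] that V by (auto simp: W_def)
    then show "e \<in> V \<rightarrow>\<^sub>E {..r}" using e by (auto simp: W_def PiE_def Pi_def)
   qed
   show "finite (V \<rightarrow>\<^sub>E {..r})" using V by (intro finite_PiE) auto
  qed
  have "real (card {e \<in> V \<rightarrow>\<^sub>E (UNIV :: nat set). sum e V = r \<and> good {v \<in> V. e v > 0}}) =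
    (\<Sum>e\<in>W. of_bool (good {v \<in> V. e v > 0}))"
   using fW by (simp add: W_def Int_def conj_ac)
  also have "\<dots> = (\<Sum>e\<in>W. \<Sum>S\<in>Pow V. moebius_coeff good S * of_bool (S \<subseteq> {v \<in> V. e v > 0}))"
  proof (intro sum.cong refl)
   fix e
   have "of_bool (good {v \<in> V. e v > 0}) = (\<Sum>S\<in>Pow {v \<in> V. e v > 0}. moebius_coeff good S)"
    using V by (simp add: sum_moebius_coeff)
   also have "\<dots> = (\<Sum>S\<in>Pow V. moebius_coeff good S * of_bool (S \<subseteq> {v \<in> V. e v > 0}))"
    using V by (intro sum.mono_neutral_cong_left) auto
   finally show "of_bool (good {v \<in> V. e v > 0}) = (\<Sum>S\<in>Pow V. moebius_coeff good S * of_bool (S \<subseteq> {v \<in> V. e v > 0}))" .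
  qed
  also have "\<dots> = (\<Sum>S\<in>Pow V. moebius_coeff good S * (\<Sum>e\<in>W. of_bool (S \<subseteq> {v \<in> V. e v > 0})))"
   by (subst sum.swap) (simp add: sum_distrib_left)
  also have "\<dots> = (\<Sum>S\<in>Pow V. moebius_coeff good S * real (c S r))"
  proof (intro sum.cong refl arg_cong2[of _ _ _ _ "(*)"])
   fix S assume S: "S \<in> Pow V"
   have "(\<Sum>e\<in>W. of_bool (S \<subseteq> {v \<in> V. e v > 0})) = real (card {e \<in> V \<rightarrow>\<^sub>E (UNIV :: nat set). sum e V = r \<and> S \<subseteq> {v \<in> V. e v > 0}})"
    using fW by (simp add: W_def Int_def conj_ac)
   then show "(\<Sum>e\<in>W. of_bool (S \<subseteq> {v \<in> V. e v > 0})) = real (c S r)"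
    using card_PiE_sum_support[OF V(1), of S r] S by (simp add: c_def M_def)
  qed
  finally show ?thesis .
 qed
 have "(\<lambda>r. \<Sum>S\<in>Pow V. moebius_coeff good S * (real (c S r) * x ^ r)) sums (\<Sum>S\<in>Pow V. moebius_coeff good S * (x ^ card S * (1 / (1 - x) ^ M)))"
 proof (intro sums_sum sums_mult)
  fix S :: "'v set"
  have "(\<lambda>r. x ^ card S * (real ((r + M - 1) choose r) * x ^ r)) sums (x ^ card S * (1 / (1 - x) ^ M))"
   by (intro sums_mult binomial_series_sums x M)
  then have "(\<lambda>r. real (c S (r + card S)) * x ^ (r + card S)) sums (x ^ card S * (1 / (1 - x) ^ M))"
   by (simp add: c_def power_add mult_ac)
  then show "(\<lambda>r. real (c S r) * x ^ r) sums (x ^ card S * (1 / (1 - x) ^ M))"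
   by (subst (asm) sums_zero_iff_shift) (auto simp: c_def)
 qed
 moreover have "(\<Sum>S\<in>Pow V. moebius_coeff good S * real (c S r)) * x ^ r = (\<Sum>S\<in>Pow V. moebius_coeff good S * (real (c S r) * x ^ r))" for r
  by (simp only: sum_distrib_right mult.assoc)
 moreover have "local_density V good x / (1 - x) ^ card V = (\<Sum>S\<in>Pow V. moebius_coeff good S * (x ^ card S * (1 / (1 - x) ^ M)))"
  by (simp add: local_density_def M_def sum_divide_distrib)
 ultimately show ?thesis unfolding tm by simp
qed

section \<open>The Euler product of the arithmetic factor\<close>

lemma noncrossing_empty: "noncrossing {}" and noncrossing_singleton: "noncrossing {v}"
 by (auto simp: noncrossing_def)

text \<open>The Gamma quotient is the binomial coefficient (r + m - 1 choose r), and its square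
  counts the noncrossing exponent matrices of weight r. The power of 1 - 1 / p cancels the
  denominator of the generating function.\<close>

lemma arith_factor_local:
 fixes p m :: nat
 assumes p: "p \<ge> 2" and m: "m \<ge> 1"
 shows "(1 - 1 / real p) ^ (m\<^sup>2) *
    (\<Sum>r. (Gamma (real r + real m) / (Gamma (real r + 1) * Gamma (real m)))\<^sup>2 *
       real p powr (- real r)) = local_density ({1..m} \<times> {1..m}) noncrossing (1 / real p)"
proof -
 define x where "x = 1 / real p"
 have x: "0 \<le> x" "x < 1" using p by (auto simp: x_def)
 define V where "V = {1..m} \<times> {1..m}"
 have V: "finite V" "V \<noteq> {}" "card V = m\<^sup>2" using m by (auto simp: V_def card_cartesian_product power2_eq_square)
 have "(Gamma (real r + real m) / (Gamma (real r + 1) * Gamma (real m)))\<^sup>2 * real p powr (- real r) =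
  real (card {e \<in> V \<rightarrow>\<^sub>E (UNIV :: nat set). sum e V = r \<and> noncrossing {v \<in> V. e v > 0}}) * x ^ r" for r
 proof -
  obtain n where n: "m = Suc n" using m by (cases m) auto
  have "Gamma (real r + real m) = fact (r + n)" using Gamma_fact[of "r + n", where 'a = real] by (simp add: n algebra_simps)
  moreover have "Gamma (real r + 1) = fact r" using Gamma_fact[of r, where 'a = real] by (simp add: algebra_simps)
  moreover have "Gamma (real m) = fact n" using Gamma_fact[of n, where 'a = real] by (simp add: n algebra_simps)
  moreover have "real ((r + n) choose r) = fact (r + n) / (fact r * fact n)" using binomial_fact[of r "r + n", where 'a = real] by simp
  ultimately have "Gamma (real r + real m) / (Gamma (real r + 1) * Gamma (real m)) = real ((r + m - 1) choose r)"
   by (simp add: n)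
  moreover have "real p powr (- real r) = x ^ r" using p by (simp add: x_def powr_minus powr_realpow power_one_over divide_inverse power_inverse)
  ultimately show ?thesis using card_noncrossing_exponents[of m r] by (simp add: V_def)
 qed
 then have "(\<lambda>r. (Gamma (real r + real m) / (Gamma (real r + 1) * Gamma (real m)))\<^sup>2 * real p powr (- real r)) sums
   (local_density V noncrossing x / (1 - x) ^ (m\<^sup>2))"
  using local_density_sums[OF V(1,2) x, of noncrossing] V(3) by simp
 then have eq: "(\<Sum>r. (Gamma (real r + real m) / (Gamma (real r + 1) * Gamma (real m)))\<^sup>2 * real p powr (- real r)) =
   local_density V noncrossing x / (1 - x) ^ (m\<^sup>2)" by (simp only: sums_iff)
 have nz: "(1 - x) ^ (m\<^sup>2) \<noteq> 0" using x by simp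
 have "(1 - x) ^ (m\<^sup>2) * (\<Sum>r. (Gamma (real r + real m) / (Gamma (real r + 1) * Gamma (real m)))\<^sup>2 * real p powr (- real r)) =
   local_density V noncrossing x"
  unfolding eq times_divide_eq_right by (rule nonzero_mult_div_cancel_left[OF nz])
 then show ?thesis by (simp only: x_def V_def)
qed

lemma sum_inverse_squares_tail:
 fixes Y N :: nat
 assumes "Y \<ge> 1" "Y \<le> N"
 shows "(\<Sum>i\<in>{Y<..N}. 1 / (real i)\<^sup>2) \<le> 1 / real Y"
proof -
 have "(\<Sum>i\<in>{Y<..N}. 1 / (real i)\<^sup>2) \<le> 1 / real Y - 1 / real N"
  using assms(2)
proof (induction N rule: dec_induct)
 case base
 then show ?case by simp
next
 case (step N)
 have N: "real N > 0" using step assms by simp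
 have "{Y<..Suc N} = insert (Suc N) {Y<..N}" using step by auto
 then have "(\<Sum>i\<in>{Y<..Suc N}. 1 / (real i)\<^sup>2) = 1 / (real (Suc N))\<^sup>2 + (\<Sum>i\<in>{Y<..N}. 1 / (real i)\<^sup>2)" by simp
 also have "\<dots> \<le> 1 / (real (Suc N))\<^sup>2 + (1 / real Y - 1 / real N)" using step by simp
 also have "1 / (real (Suc N))\<^sup>2 \<le> 1 / real N - 1 / real (Suc N)"
 proof -
  have "1 / real N - 1 / real (Suc N) = 1 / (real N * real (Suc N))" using N by (simp add: field_simps)
  also have "\<dots> \<ge> 1 / (real (Suc N))\<^sup>2" using N unfolding power2_eq_square by (intro divide_left_mono mult_right_mono mult_pos_pos) auto
  finally show ?thesis .
 qed
 finally show ?case by simp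
qed
 moreover have "1 / real N \<ge> 0" by simp
 ultimately show ?thesis by linarith
qed

text \<open>Each factor is 1 + O(1 / p^2), so the factors beyond Y multiply to 1 + O(1 / Y).\<close>

lemma arith_factor_approx:
 assumes m: "m \<ge> 1"
 shows "\<exists>K\<ge>0. \<forall>Y\<ge>1. \<bar>arith_factor m - (\<Prod>p\<in>{p. prime p \<and> p \<le> Y}. local_density ({1..m} \<times> {1..m}) noncrossing (1 / real p))\<bar> \<le> K / real Y"
proof -
 define V where "V = {1..m} \<times> {1..m}"
 define B where "B = (4::real) ^ card V"
 have B: "B \<ge> 1" by (simp add: B_def)
 \<comment> \<open>Factor 1 at nonprimes turns the Euler product into a product over all naturals,
   as in \<open>arith_factor\<close>.\<close>
 define f where "f = (\<lambda>p::nat. if prime p then local_density V noncrossing (1 / real p) else 1)"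
 have fb: "\<bar>f p - 1\<bar> \<le> B * (1 / (real p)\<^sup>2)" for p
 proof (cases "prime p")
  case True
  then have p: "real p \<ge> 2" using prime_ge_2_nat by (simp add: numeral_le_real_of_nat_iff)
  have "\<bar>local_density V noncrossing (1 / real p) - 1\<bar> \<le> B * (1 / real p)\<^sup>2"
   unfolding B_def using p by (intro abs_local_density_minus_1_le noncrossing_empty noncrossing_singleton) (auto simp: V_def)
  then show ?thesis using True by (simp add: f_def power_divide)
 qed (use B in \<open>simp add: f_def\<close>)
 have sm: "summable (\<lambda>p. norm (f p - 1))"
 proof (rule summable_comparison_test')
  show "summable (\<lambda>p. B * (1 / (real p)\<^sup>2))"
   by (intro summable_mult) (use inverse_power_summable[of 2, where 'a = real] in \<open>simp add: divide_inverse\<close>)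
  show "norm (norm (f p - 1)) \<le> B * (1 / (real p)\<^sup>2)" for p using fb by simp
 qed
 then have conv: "convergent_prod f"
  by (intro abs_convergent_prod_imp_convergent_prod summable_imp_abs_convergent_prod)
 have lim: "(\<lambda>n. \<Prod>i\<le>n. f i) \<longlonglongrightarrow> prodinf f" by (rule convergent_prod_LIMSEQ[OF conv])
 have af: "arith_factor m = prodinf f"
  unfolding arith_factor_def f_def using arith_factor_local[OF prime_ge_2_nat m]
  by (intro arg_cong[of _ _ prodinf] ext) (simp add: V_def)
 have partial: "(\<Prod>p\<in>{p. prime p \<and> p \<le> Y}. local_density V noncrossing (1 / real p)) = (\<Prod>i\<le>Y. f i)" for Y
  unfolding f_def by (subst prod.If_cases) (auto intro!: prod.cong)
 have fle: "norm (f i) \<le> 1 + B * (1 / (real i)\<^sup>2)" for i using fb[of i] by simp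
 have s2: "(\<Sum>i\<le>Y. B * (1 / (real i)\<^sup>2)) \<le> 2 * B" for Y
 proof (cases "Y = 0")
  case False
  then have "{..Y} = insert 0 (insert 1 {1<..Y})" by auto
  then have "(\<Sum>i\<le>Y. 1 / (real i)\<^sup>2) = 1 + (\<Sum>i\<in>{1<..Y}. 1 / (real i)\<^sup>2)" by simp
  also have "\<dots> \<le> 2" using sum_inverse_squares_tail[of 1 Y] False by simp
  finally have "B * (\<Sum>i\<le>Y. 1 / (real i)\<^sup>2) \<le> B * 2" using B by (intro mult_left_mono) auto
  then show ?thesis by (simp only: sum_distrib_left mult.commute)
 qed (use B in simp)
 have bound: "norm (\<Prod>i\<le>Y. f i) \<le> exp (2 * B)" for Y
 proof -
  have "norm (\<Prod>i\<le>Y. f i) \<le> (\<Prod>i\<le>Y. 1 + B * (1 / (real i)\<^sup>2))"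
   unfolding prod_norm[symmetric] by (intro prod_mono) (use fle in auto)
  also have "\<dots> \<le> exp (\<Sum>i\<le>Y. B * (1 / (real i)\<^sup>2))" by (rule prod_le_exp_sum) (use B in auto)
  also have "\<dots> \<le> exp (2 * B)" using s2 by simp
  finally show ?thesis .
 qed
 define K where "K = exp (2 * B) * (B * exp B)"
 have "\<bar>prodinf f - (\<Prod>i\<le>Y. f i)\<bar> \<le> K / real Y" if Y: "Y \<ge> 1" for Y
 proof (rule tendsto_le[OF _ tendsto_const tendsto_rabs[OF tendsto_diff[OF lim tendsto_const]]])
  show "\<forall>\<^sub>F N in sequentially. \<bar>(\<Prod>i\<le>N. f i) - (\<Prod>i\<le>Y. f i)\<bar> \<le> K / real Y"
   using eventually_ge_at_top[of Y]
  proof eventually_elim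
   case (elim N)
   have "{..N} = {..Y} \<union> {Y<..N}" using elim by auto
   moreover have "{..Y} \<inter> {Y<..N} = {}" by auto
   ultimately have "(\<Prod>i\<le>N. f i) = (\<Prod>i\<le>Y. f i) * (\<Prod>i\<in>{Y<..N}. f i)"
    by (simp only: prod.union_disjoint finite_atMost finite_greaterThanAtMost)
   then have "\<bar>(\<Prod>i\<le>N. f i) - (\<Prod>i\<le>Y. f i)\<bar> = norm (\<Prod>i\<le>Y. f i) * norm ((\<Prod>i\<in>{Y<..N}. 1 + (f i - 1)) - 1)"
    by (simp add: abs_mult[symmetric] algebra_simps)
   also have "norm ((\<Prod>i\<in>{Y<..N}. 1 + (f i - 1)) - 1) \<le> (\<Prod>i\<in>{Y<..N}. 1 + norm (f i - 1)) - 1"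
    by (rule norm_prod_minus1_le_prod_minus1)
   also have "(\<Prod>i\<in>{Y<..N}. 1 + norm (f i - 1)) \<le> exp (\<Sum>i\<in>{Y<..N}. norm (f i - 1))"
    by (rule prod_le_exp_sum) auto
   also have "(\<Sum>i\<in>{Y<..N}. norm (f i - 1)) \<le> B * (1 / real Y)"
   proof -
    have "(\<Sum>i\<in>{Y<..N}. norm (f i - 1)) \<le> (\<Sum>i\<in>{Y<..N}. B * (1 / (real i)\<^sup>2))" using fb by (intro sum_mono) simp
    also have "\<dots> = B * (\<Sum>i\<in>{Y<..N}. 1 / (real i)\<^sup>2)" by (simp add: sum_distrib_left)
    also have "\<dots> \<le> B * (1 / real Y)"
     using sum_inverse_squares_tail[OF Y elim] B by (intro mult_left_mono) auto
    finally show ?thesis .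
   qed
   also have "exp (B * (1 / real Y)) - 1 \<le> (B * (1 / real Y)) * exp B"
   proof -
    define t where "t = B * (1 / real Y)"
    have t: "t \<ge> 0" "t \<le> B" using B Y by (auto simp: t_def divide_simps mult_le_cancel_left1)
    have "1 - t \<le> exp (-t)" using exp_ge_add_one_self[of "-t"] by simp
    then have "(1 - t) * exp t \<le> exp (-t) * exp t" by (intro mult_right_mono) auto
    then have "exp t - 1 \<le> t * exp t" by (simp add: algebra_simps exp_minus)
    also have "\<dots> \<le> t * exp B" using t by (intro mult_left_mono) auto
    finally show ?thesis by (simp add: t_def)
   qed
   finally have "\<bar>(\<Prod>i\<le>N. f i) - (\<Prod>i\<le>Y. f i)\<bar> \<le> norm (\<Prod>i\<le>Y. f i) * ((B * (1 / real Y)) * exp B)"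
    by (simp add: mult_left_mono)
   also have "\<dots> \<le> exp (2 * B) * ((B * (1 / real Y)) * exp B)"
    using bound B by (intro mult_right_mono) auto
   finally show ?case by (simp add: K_def)
  qed
 qed auto
 moreover have "K \<ge> 0" using B by (simp add: K_def)
 ultimately show ?thesis unfolding af partial[symmetric] V_def by blast
qed

section \<open>Sums over tuples with prescribed supports\<close>

abbreviation good_tuples :: "'v set \<Rightarrow> nat \<Rightarrow> ('v set \<Rightarrow> bool) \<Rightarrow> ('v \<Rightarrow> nat) set" where
 "good_tuples V Y good \<equiv> {d \<in> V \<rightarrow>\<^sub>E {1..Y}. \<forall>p. prime p \<longrightarrow> good {v\<in>V. p dvd d v}}"

text \<open>An assignment \<open>\<sigma>\<close> of a set of coordinates to every prime encodes the tuple of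
 squarefree numbers whose \<open>v\<close>-th entry is the product of the primes \<open>p\<close> with \<open>v \<in> \<sigma> p\<close>.\<close>

definition squarefree_tuple :: "nat set \<Rightarrow> (nat \<Rightarrow> 'v set) \<Rightarrow> 'v \<Rightarrow> nat" where
 "squarefree_tuple Q \<sigma> v = (\<Prod>p\<in>{p\<in>Q. v \<in> \<sigma> p}. p)"

lemma prod_primes_dvd_nat:
 fixes A :: "nat set"
 assumes "finite A" "\<forall>p\<in>A. prime p \<and> p dvd d"
 shows "\<Prod>A dvd d"
 using assms
proof (induction A rule: finite_induct)
 case (insert p A)
 have "coprime p (\<Prod>A)"
  using insert by (intro prod_coprime_right) (auto intro: primes_coprime)
 then show ?case using insert by (simp add: divides_mult)
qed auto

lemma squarefree_tuple_pos: "finite Q \<Longrightarrow> \<forall>p\<in>Q. prime p \<Longrightarrow> squarefree_tuple Q \<sigma> v > 0"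
 unfolding squarefree_tuple_def by (intro prod_pos) (auto intro: prime_gt_0_nat)

lemma squarefree_tuple_dvd_iff:
 assumes "finite Q" "\<forall>p\<in>Q. prime p"
 shows "squarefree_tuple Q \<sigma> v dvd d \<longleftrightarrow> (\<forall>p\<in>Q. v \<in> \<sigma> p \<longrightarrow> p dvd d)"
proof
 assume *: "\<forall>p\<in>Q. v \<in> \<sigma> p \<longrightarrow> p dvd d"
 show "squarefree_tuple Q \<sigma> v dvd d"
  unfolding squarefree_tuple_def
  by (rule prod_primes_dvd_nat) (use assms * in auto)
next
 assume *: "squarefree_tuple Q \<sigma> v dvd d"
 show "\<forall>p\<in>Q. v \<in> \<sigma> p \<longrightarrow> p dvd d"
 proof (intro ballI impI)
  fix p assume "p \<in> Q" "v \<in> \<sigma> p"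
  then have "p dvd squarefree_tuple Q \<sigma> v" unfolding squarefree_tuple_def using assms(1) by (intro dvd_prodI) auto
  then show "p dvd d" using * by (rule dvd_trans)
 qed
qed

lemma prod_squarefree_tuple_eq:
 assumes V: "finite V" and Q: "finite Q" and s: "\<And>p. p \<in> Q \<Longrightarrow> \<sigma> p \<subseteq> V"
 shows "(\<Prod>v\<in>V. squarefree_tuple Q \<sigma> v) = (\<Prod>p\<in>Q. p ^ card (\<sigma> p))"
proof -
 have "(\<Prod>v\<in>V. squarefree_tuple Q \<sigma> v) = (\<Prod>v\<in>V. \<Prod>p\<in>Q. if v \<in> \<sigma> p then p else 1)"
  unfolding squarefree_tuple_def using Q by (intro prod.cong refl prod.inter_filter)
 also have "\<dots> = (\<Prod>p\<in>Q. \<Prod>v\<in>V. if v \<in> \<sigma> p then p else 1)" by (rule prod.swap)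
 also have "\<dots> = (\<Prod>p\<in>Q. p ^ card (\<sigma> p))"
 proof (intro prod.cong refl)
  fix p assume p: "p \<in> Q"
  have "(\<Prod>v\<in>V. if v \<in> \<sigma> p then p else 1) = (\<Prod>v\<in>{v\<in>V. v \<in> \<sigma> p}. p)" using V by (intro prod.inter_filter[symmetric])
  also have "{v\<in>V. v \<in> \<sigma> p} = \<sigma> p" using s[OF p] by auto
  finally show "(\<Prod>v\<in>V. if v \<in> \<sigma> p then p else 1) = p ^ card (\<sigma> p)" by simp
 qed
 finally show ?thesis .
qed

lemma sum_ln_squarefree_tuple:
 assumes V: "finite V" and Q: "finite Q" "\<forall>p\<in>Q. prime p" and s: "\<And>p. p \<in> Q \<Longrightarrow> \<sigma> p \<subseteq> V"
 shows "(\<Sum>v\<in>V. ln (real (squarefree_tuple Q \<sigma> v))) = (\<Sum>p\<in>Q. real (card (\<sigma> p)) * ln (real p))"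
proof -
 have pos: "real (squarefree_tuple Q \<sigma> v) > 0" for v using squarefree_tuple_pos[OF Q] by simp
 have "(\<Sum>v\<in>V. ln (real (squarefree_tuple Q \<sigma> v))) = ln (\<Prod>v\<in>V. real (squarefree_tuple Q \<sigma> v))"
  using V pos by (intro ln_prod[symmetric]) auto
 also have "(\<Prod>v\<in>V. real (squarefree_tuple Q \<sigma> v)) = (\<Prod>p\<in>Q. real p ^ card (\<sigma> p))"
  using prod_squarefree_tuple_eq[OF V Q(1) s] by (simp flip: of_nat_prod of_nat_power)
 also have "ln \<dots> = (\<Sum>p\<in>Q. ln (real p ^ card (\<sigma> p)))"
  using Q prime_gt_0_nat by (intro ln_prod) auto
 also have "\<dots> = (\<Sum>p\<in>Q. real (card (\<sigma> p)) * ln (real p))"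
  by (intro sum.cong refl ln_realpow)
 finally show ?thesis .
qed

section \<open>Moebius expansion over all primes\<close>

text \<open>Since h vanishes once an entry exceeds Y, tuples with e v * d v > Y may be included, and
  the range after rescaling stays independent of e.\<close>

lemma sum_multiples:
 fixes h :: "('v \<Rightarrow> nat) \<Rightarrow> complex"
 assumes V: "finite V" and e: "\<And>v. v \<in> V \<Longrightarrow> e v > 0"
  and h: "\<And>d v. d \<in> V \<rightarrow>\<^sub>E {1..} \<Longrightarrow> v \<in> V \<Longrightarrow> d v > Y \<Longrightarrow> h d = 0"
 shows "(\<Sum>d\<in>{d \<in> V \<rightarrow>\<^sub>E {1..Y}. \<forall>v\<in>V. e v dvd d v}. h d) = (\<Sum>d\<in>V \<rightarrow>\<^sub>E {1..Y}. h (\<lambda>v\<in>V. e v * d v))"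
proof -
 define A where "A = {d \<in> V \<rightarrow>\<^sub>E {1..Y}. \<forall>v\<in>V. e v * d v \<le> Y}"
 have "(\<Sum>d\<in>V \<rightarrow>\<^sub>E {1..Y}. h (\<lambda>v\<in>V. e v * d v)) = (\<Sum>d\<in>A. h (\<lambda>v\<in>V. e v * d v))"
 proof (rule sum.mono_neutral_right)
  show "finite (V \<rightarrow>\<^sub>E {1..Y})" using V by (intro finite_PiE) auto
  show "A \<subseteq> V \<rightarrow>\<^sub>E {1..Y}" by (auto simp: A_def)
  show "\<forall>d\<in>(V \<rightarrow>\<^sub>E {1..Y}) - A. h (\<lambda>v\<in>V. e v * d v) = 0"
  proof
   fix d assume d: "d \<in> (V \<rightarrow>\<^sub>E {1..Y}) - A"
   then obtain v where v: "v \<in> V" "e v * d v > Y" by (auto simp: A_def not_le)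
   have "(\<lambda>v\<in>V. e v * d v) \<in> V \<rightarrow>\<^sub>E {1..}"
    using d e by (auto simp: Suc_le_eq PiE_def Pi_def)
   then show "h (\<lambda>v\<in>V. e v * d v) = 0" using v by (intro h[of _ v]) auto
  qed
 qed
 also have "\<dots> = (\<Sum>d\<in>{d \<in> V \<rightarrow>\<^sub>E {1..Y}. \<forall>v\<in>V. e v dvd d v}. h d)"
 proof (rule sum.reindex_bij_witness[of _ "\<lambda>d. \<lambda>v\<in>V. d v div e v" "\<lambda>d. \<lambda>v\<in>V. e v * d v"])
  fix d assume d: "d \<in> A"
  then show "(\<lambda>v\<in>V. (\<lambda>v\<in>V. e v * d v) v div e v) = d"
   using e by (intro ext) (auto simp: A_def PiE_def extensional_def restrict_def)
  show "(\<lambda>v\<in>V. e v * d v) \<in> {d \<in> V \<rightarrow>\<^sub>E {1..Y}. \<forall>v\<in>V. e v dvd d v}"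
   using d e by (auto simp: A_def Suc_le_eq PiE_def Pi_def)
 next
  fix d assume d: "d \<in> {d \<in> V \<rightarrow>\<^sub>E {1..Y}. \<forall>v\<in>V. e v dvd d v}"
  then show "(\<lambda>v\<in>V. e v * (\<lambda>v\<in>V. d v div e v) v) = d"
   by (intro ext) (auto simp: PiE_def extensional_def restrict_def)
  have "d v div e v \<in> {1..Y}" if v: "v \<in> V" for v
  proof -
   have dv: "e v dvd d v" "d v \<ge> 1" "d v \<le> Y" using d v by (auto simp: PiE_def Pi_def)
   have "d v div e v \<noteq> 0" using dv e[OF v] by (auto simp: div_eq_0_iff dest: dvd_imp_le)
   moreover have "d v div e v \<le> Y" using div_le_dividend dv(3) by (rule le_trans)
   ultimately show ?thesis by simp
  qed
  then show "(\<lambda>v\<in>V. d v div e v) \<in> A" using d by (auto simp: A_def PiE_def Pi_def)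
 qed (auto)
 finally show ?thesis ..
qed

text \<open>The condition is a product over primes. Expanding every factor gives one term for each
  assignment \<sigma>, and its divisibility conditions at the various primes combine into
  divisibility by a squarefree tuple.\<close>

lemma sum_good_expand:
 fixes h :: "('v \<Rightarrow> nat) \<Rightarrow> complex"
  and Y :: nat
 assumes V: "finite V" and good: "good {}"
 defines "Q \<equiv> {p. prime p \<and> p \<le> Y}"
 shows "(\<Sum>d\<in>good_tuples V Y good. h d) =
  (\<Sum>\<sigma>\<in>Q \<rightarrow>\<^sub>E Pow V. of_real (\<Prod>p\<in>Q. moebius_coeff good (\<sigma> p)) *
    (\<Sum>d\<in>{d \<in> V \<rightarrow>\<^sub>E {1..Y}. \<forall>v\<in>V. squarefree_tuple Q \<sigma> v dvd d v}. h d))"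
proof -
 have fQ: "finite Q" by (rule finite_subset[of _ "{..Y}"]) (auto simp: Q_def)
 have pQ: "\<forall>p\<in>Q. prime p" by (simp add: Q_def)
 define B where "B = (V \<rightarrow>\<^sub>E {1..Y})"
 have fB: "finite B" unfolding B_def using V by (intro finite_PiE) auto
 have ind: "(of_bool (\<forall>p. prime p \<longrightarrow> good {v\<in>V. p dvd d v}) :: real) =
   (\<Sum>\<sigma>\<in>Q \<rightarrow>\<^sub>E Pow V. (\<Prod>p\<in>Q. moebius_coeff good (\<sigma> p)) * of_bool (\<forall>v\<in>V. squarefree_tuple Q \<sigma> v dvd d v))"
  if d: "d \<in> B" for d
 proof -
  have "(\<forall>p. prime p \<longrightarrow> good {v\<in>V. p dvd d v}) \<longleftrightarrow> (\<forall>p\<in>Q. good {v\<in>V. p dvd d v})"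
  proof (intro iffI allI impI ballI)
   fix p :: nat assume *: "\<forall>p\<in>Q. good {v\<in>V. p dvd d v}" "prime p"
   show "good {v\<in>V. p dvd d v}"
   \<comment> \<open>A prime above Y divides no entry, so its support is empty and good; only
     finitely many primes matter.\<close>
   proof (cases "p \<le> Y")
    case False
    have "\<not> p dvd d v" if "v \<in> V" for v
    proof
     assume "p dvd d v"
     moreover have "1 \<le> d v" "d v \<le> Y" using d that by (auto simp: B_def PiE_def Pi_def)
     ultimately have "p \<le> Y" by (metis dvd_imp_le le_trans less_le_trans zero_less_one)
     then show False using False by simp
    qed
    then have "{v\<in>V. p dvd d v} = {}" by auto
    then show ?thesis using good by (simp only:)
   qed (use * in \<open>auto simp: Q_def\<close>)
  qed (auto simp: Q_def)
  then have "(of_bool (\<forall>p. prime p \<longrightarrow> good {v\<in>V. p dvd d v}) :: real) = (\<Prod>p\<in>Q. of_bool (good {v\<in>V. p dvd d v}))"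
   using fQ by (simp add: of_bool_def)
  also have "\<dots> = (\<Prod>p\<in>Q. \<Sum>S\<in>Pow V. moebius_coeff good S * of_bool (\<forall>v\<in>S. p dvd d v))"
  proof (intro prod.cong refl)
   fix p
   have "of_bool (good {v\<in>V. p dvd d v}) = (\<Sum>S\<in>Pow {v\<in>V. p dvd d v}. moebius_coeff good S)"
    using V by (simp add: sum_moebius_coeff)
   also have "\<dots> = (\<Sum>S\<in>Pow V. moebius_coeff good S * of_bool (\<forall>v\<in>S. p dvd d v))"
    using V by (intro sum.mono_neutral_cong_left) auto
   finally show "of_bool (good {v\<in>V. p dvd d v}) = (\<Sum>S\<in>Pow V. moebius_coeff good S * of_bool (\<forall>v\<in>S. p dvd d v))" .
  qed
  also have "\<dots> = (\<Sum>\<sigma>\<in>Q \<rightarrow>\<^sub>E Pow V. \<Prod>p\<in>Q. moebius_coeff good (\<sigma> p) * of_bool (\<forall>v\<in>\<sigma> p. p dvd d v))"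
   using fQ V by (intro prod_sum_PiE) auto
  also have "\<dots> = (\<Sum>\<sigma>\<in>Q \<rightarrow>\<^sub>E Pow V. (\<Prod>p\<in>Q. moebius_coeff good (\<sigma> p)) * of_bool (\<forall>v\<in>V. squarefree_tuple Q \<sigma> v dvd d v))"
  proof (intro sum.cong refl)
   fix \<sigma> assume s: "\<sigma> \<in> Q \<rightarrow>\<^sub>E Pow V"
   have "(\<forall>v\<in>V. squarefree_tuple Q \<sigma> v dvd d v) \<longleftrightarrow> (\<forall>p\<in>Q. \<forall>v\<in>\<sigma> p. p dvd d v)"
    unfolding squarefree_tuple_dvd_iff[OF fQ pQ] using s by (auto simp: PiE_def Pi_def)
   then have "(of_bool (\<forall>v\<in>V. squarefree_tuple Q \<sigma> v dvd d v) :: real) = (\<Prod>p\<in>Q. of_bool (\<forall>v\<in>\<sigma> p. p dvd d v))"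
    using fQ by (simp add: of_bool_def)
   then show "(\<Prod>p\<in>Q. moebius_coeff good (\<sigma> p) * of_bool (\<forall>v\<in>\<sigma> p. p dvd d v)) =
     (\<Prod>p\<in>Q. moebius_coeff good (\<sigma> p)) * of_bool (\<forall>v\<in>V. squarefree_tuple Q \<sigma> v dvd d v)"
    by (simp add: prod.distrib)
  qed
  finally show ?thesis .
 qed
 have "(\<Sum>d\<in>{d \<in> B. \<forall>p. prime p \<longrightarrow> good {v\<in>V. p dvd d v}}. h d) = (\<Sum>d\<in>B. of_real (of_bool (\<forall>p. prime p \<longrightarrow> good {v\<in>V. p dvd d v})) * h d)"
  using fB by (subst sum.inter_filter) (auto intro!: sum.cong)
 also have "\<dots> = (\<Sum>d\<in>B. \<Sum>\<sigma>\<in>Q \<rightarrow>\<^sub>E Pow V. of_real (\<Prod>p\<in>Q. moebius_coeff good (\<sigma> p)) * (of_bool (\<forall>v\<in>V. squarefree_tuple Q \<sigma> v dvd d v) * h d))"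
 proof (intro sum.cong refl)
  fix d assume d: "d \<in> B"
  show "of_real (of_bool (\<forall>p. prime p \<longrightarrow> good {v\<in>V. p dvd d v})) * h d =
   (\<Sum>\<sigma>\<in>Q \<rightarrow>\<^sub>E Pow V. of_real (\<Prod>p\<in>Q. moebius_coeff good (\<sigma> p)) * (of_bool (\<forall>v\<in>V. squarefree_tuple Q \<sigma> v dvd d v) * h d))"
   unfolding ind[OF d] of_real_sum of_real_mult sum_distrib_right mult.assoc
   by (intro sum.cong refl) (auto simp: of_bool_def)
 qed
 also have "\<dots> = (\<Sum>\<sigma>\<in>Q \<rightarrow>\<^sub>E Pow V. of_real (\<Prod>p\<in>Q. moebius_coeff good (\<sigma> p)) *
    (\<Sum>d\<in>B. of_bool (\<forall>v\<in>V. squarefree_tuple Q \<sigma> v dvd d v) * h d))"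
  by (subst sum.swap) (simp only: sum_distrib_left)
 also have "\<dots> = (\<Sum>\<sigma>\<in>Q \<rightarrow>\<^sub>E Pow V. of_real (\<Prod>p\<in>Q. moebius_coeff good (\<sigma> p)) *
    (\<Sum>d\<in>{d \<in> B. \<forall>v\<in>V. squarefree_tuple Q \<sigma> v dvd d v}. h d))"
 proof -
  have "(\<Sum>d\<in>B. of_bool (\<forall>v\<in>V. squarefree_tuple Q \<sigma> v dvd d v) * h d) = (\<Sum>d\<in>{d \<in> B. \<forall>v\<in>V. squarefree_tuple Q \<sigma> v dvd d v}. h d)" for \<sigma>
   using fB by (subst sum.inter_filter, simp, intro sum.cong refl, simp add: of_bool_def)
  then show ?thesis by (simp only:)
 qed
 finally show ?thesis by (simp only: B_def)
qed

lemma sum_ln_over_squares_le: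
 fixes Q :: "nat set"
 assumes "finite Q" "\<And>p. p \<in> Q \<Longrightarrow> p \<ge> 1"
 shows "(\<Sum>p\<in>Q. ln (real p) / (real p)\<^sup>2) \<le> 2 * (\<Sum>n. real (Suc n) powr (-3/2))"
proof -
 have sm: "summable (\<lambda>n. real (Suc n) powr (-3/2))" by (rule summable_Suc_powr) simp
 have "ln (real p) / (real p)\<^sup>2 \<le> 2 * real p powr (-3/2)" if "p \<in> Q" for p
 proof -
  have p: "real p \<ge> 1" using assms(2)[OF that] by simp
  have "ln (real p) = 2 * ln (sqrt (real p))" using p by (simp add: ln_sqrt)
  also have "\<dots> \<le> 2 * sqrt (real p)" using p ln_le_minus_one[of "sqrt (real p)"] by simp
  finally have "ln (real p) / (real p)\<^sup>2 \<le> 2 * sqrt (real p) / (real p)\<^sup>2" by (intro divide_right_mono) auto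
  also have "2 * sqrt (real p) / (real p)\<^sup>2 = 2 * real p powr (-3/2)"
   using p powr_diff[of "real p" "1/2" 2] by (simp add: powr_half_sqrt)
  finally show ?thesis .
 qed
 then have "(\<Sum>p\<in>Q. ln (real p) / (real p)\<^sup>2) \<le> (\<Sum>p\<in>Q. 2 * real p powr (-3/2))" by (rule sum_mono)
 also have "\<dots> = 2 * (\<Sum>p\<in>Q. real p powr (-3/2))" by (simp add: sum_distrib_left)
 also have "(\<Sum>p\<in>Q. real p powr (-3/2)) = (\<Sum>n\<in>(\<lambda>p. p - 1) ` Q. real (Suc n) powr (-3/2))"
 proof -
  have "inj_on (\<lambda>p. p - 1) Q"
  proof (rule inj_onI)
   fix p q assume "p \<in> Q" "q \<in> Q" "p - 1 = q - 1"
   then show "p = q" using assms(2)[of p] assms(2)[of q] by linarith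
  qed
  then show ?thesis using assms(2) by (simp add: sum.reindex Suc_le_eq del: of_nat_Suc)
 qed
 also have "\<dots> \<le> (\<Sum>n. real (Suc n) powr (-3/2))"
  using assms(1) by (intro sum_le_suminf sm) auto
 finally show ?thesis by simp
qed

text \<open>The weights \<open>\<mu> p S = |moebius_coeff S| / p ^ card S\<close> behave like independent sources of mass
 \<open>1 + O(1 / p\<^sup>2)\<close>; a prime contributes to the logarithm only with mass \<open>O(1 / p\<^sup>2)\<close>.\<close>

lemma sum_weights_bounded:
 fixes V :: "'v set"
 assumes V: "finite V" and good: "good {}" "\<And>v. good {v}"
 shows "\<exists>K\<ge>0. \<forall>Y. \<forall>Q. Q = {p. prime p \<and> p \<le> Y} \<longrightarrow>
  (\<Sum>\<sigma>\<in>Q \<rightarrow>\<^sub>E Pow V. (\<Prod>p\<in>Q. \<bar>moebius_coeff good (\<sigma> p)\<bar> * (1 / real p) ^ card (\<sigma> p)) *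
    (1 + (\<Sum>p\<in>Q. real (card (\<sigma> p)) * ln (real p)))) \<le> K"
proof -
 define B where "B = (4::real) ^ card V"
 have B: "B \<ge> 1" by (simp add: B_def)
 define M where "M = real (card V)"
 define K where "K = exp (2 * B) * (1 + M * B * (2 * (\<Sum>n. real (Suc n) powr (-3/2))))"
 have K0: "K \<ge> 0" unfolding K_def M_def using B
  by (intro mult_nonneg_nonneg add_nonneg_nonneg suminf_nonneg summable_Suc_powr) auto
 have "(\<Sum>\<sigma>\<in>Q \<rightarrow>\<^sub>E Pow V. (\<Prod>p\<in>Q. \<bar>moebius_coeff good (\<sigma> p)\<bar> * (1 / real p) ^ card (\<sigma> p)) *
    (1 + (\<Sum>p\<in>Q. real (card (\<sigma> p)) * ln (real p)))) \<le> K" if Q: "Q = {p. prime p \<and> p \<le> Y}" for Q Y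
 proof -
  have fQ: "finite Q" by (rule finite_subset[of _ "{..Y}"]) (auto simp: Q)
  have pQ: "\<And>p. p \<in> Q \<Longrightarrow> prime p" by (simp add: Q)
  have p2: "real p \<ge> 2" if "p \<in> Q" for p using prime_ge_2_nat[OF pQ[OF that]] by (simp add: numeral_le_real_of_nat_iff)
  define w where "w = (\<lambda>p S. \<bar>moebius_coeff good S\<bar> * (1 / real p) ^ card S)"
  define W where "W = (\<lambda>p. \<Sum>S\<in>Pow V. w p S)"
  have w0: "w p S \<ge> 0" for p S by (simp add: w_def)
  have nonempty: "(\<Sum>S\<in>Pow V - {{}}. w p S) \<le> B * (1 / (real p)\<^sup>2)" if "p \<in> Q" for p
   using sum_abs_moebius_coeff_le[of V good "1 / real p"] V good p2[OF that] by (simp add: w_def B_def power_divide)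
  have Wsplit: "W p = 1 + (\<Sum>S\<in>Pow V - {{}}. w p S)" for p
   unfolding W_def using V sum.remove[of "Pow V" "{}" "w p"] good by (simp add: w_def moebius_coeff_empty)
  have W1: "W p \<ge> 1" for p unfolding Wsplit using w0 by (simp add: sum_nonneg)
  have Wle: "W p \<le> 1 + B * (1 / (real p)\<^sup>2)" if "p \<in> Q" for p unfolding Wsplit using nonempty[OF that] by simp
  have prodW: "(\<Prod>p\<in>Q. W p) \<le> exp (2 * B)"
  proof -
   have "(\<Prod>p\<in>Q. W p) \<le> (\<Prod>p\<in>Q. 1 + B * (1 / (real p)\<^sup>2))" using Wle W1 by (intro prod_mono) (auto intro: order_trans[of 0 1])
   also have "\<dots> \<le> exp (\<Sum>p\<in>Q. B * (1 / (real p)\<^sup>2))" by (rule prod_le_exp_sum) (use B in auto)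
   also have "(\<Sum>p\<in>Q. B * (1 / (real p)\<^sup>2)) \<le> B * 2"
   proof -
    \<comment> \<open>The upper limit \<open>Suc Y\<close> keeps the tail estimate applicable when Y
      = 0.\<close>
    have "(\<Sum>p\<in>Q. 1 / (real p)\<^sup>2) \<le> (\<Sum>p\<in>{1<..Suc Y}. 1 / (real p)\<^sup>2)"
     by (rule sum_mono2) (use prime_gt_1_nat in \<open>auto simp: Q le_Suc_eq\<close>)
    also have "\<dots> \<le> 1 / real 1" by (rule sum_inverse_squares_tail) auto
    finally have "B * (\<Sum>p\<in>Q. 1 / (real p)\<^sup>2) \<le> B * 2" using B by (intro mult_left_mono) auto
    then show ?thesis by (simp only: sum_distrib_left)
   qed
   finally show ?thesis by (simp add: mult.commute)
  qed
  have all: "(\<Sum>\<sigma>\<in>Q \<rightarrow>\<^sub>E Pow V. \<Prod>p\<in>Q. w p (\<sigma> p)) = (\<Prod>p\<in>Q. W p)"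
   unfolding W_def using fQ V by (intro prod_sum_PiE[symmetric]) auto
  \<comment> \<open>A single logarithm alters only the factor at q. Its empty set contributes 0,
    which leaves O(ln q / q^2); the other factors are bounded by the full product because every W p
    is at least 1.\<close>
  have one: "(\<Sum>\<sigma>\<in>Q \<rightarrow>\<^sub>E Pow V. (\<Prod>p\<in>Q. w p (\<sigma> p)) * (real (card (\<sigma> q)) * ln (real q))) \<le> exp (2 * B) * (M * B * (ln (real q) / (real q)\<^sup>2))"
   if q: "q \<in> Q" for q
  proof -
   have lq: "ln (real q) \<ge> 0" using p2[OF q] by simp
   have "(\<Sum>\<sigma>\<in>Q \<rightarrow>\<^sub>E Pow V. (\<Prod>p\<in>Q. w p (\<sigma> p)) * (real (card (\<sigma> q)) * ln (real q))) =
     (\<Sum>\<sigma>\<in>Q \<rightarrow>\<^sub>E Pow V. \<Prod>p\<in>Q. (if p = q then w p (\<sigma> p) * (real (card (\<sigma> p)) * ln (real p)) else w p (\<sigma> p)))"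
   proof (intro sum.cong refl)
    fix \<sigma>
    show "(\<Prod>p\<in>Q. w p (\<sigma> p)) * (real (card (\<sigma> q)) * ln (real q)) = (\<Prod>p\<in>Q. (if p = q then w p (\<sigma> p) * (real (card (\<sigma> p)) * ln (real p)) else w p (\<sigma> p)))"
     using fQ q by (simp add: prod.remove[of Q q] mult_ac)
   qed
   also have "\<dots> = (\<Prod>p\<in>Q. \<Sum>S\<in>Pow V. (if p = q then w p S * (real (card S) * ln (real p)) else w p S))"
    using fQ V by (intro prod_sum_PiE[symmetric]) auto
   also have "\<dots> = (\<Sum>S\<in>Pow V. w q S * (real (card S) * ln (real q))) * (\<Prod>p\<in>Q - {q}. W p)"
    using fQ q by (simp add: prod.remove[of Q q] W_def)
   also have "\<dots> \<le> (M * B * (ln (real q) / (real q)\<^sup>2)) * exp (2 * B)"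
   proof (intro mult_mono)
    have "(\<Sum>S\<in>Pow V. w q S * (real (card S) * ln (real q))) = (\<Sum>S\<in>Pow V - {{}}. w q S * (real (card S) * ln (real q)))"
     using V by (intro sum.mono_neutral_right) auto
    also have "\<dots> \<le> (\<Sum>S\<in>Pow V - {{}}. w q S * (M * ln (real q)))"
     unfolding M_def using w0 lq V by (intro sum_mono mult_left_mono mult_right_mono) (auto intro: card_mono)
    also have "\<dots> = (\<Sum>S\<in>Pow V - {{}}. w q S) * (M * ln (real q))" by (simp add: sum_distrib_right)
    also have "\<dots> \<le> (B * (1 / (real q)\<^sup>2)) * (M * ln (real q))"
     using nonempty[OF q] lq by (intro mult_right_mono) (auto simp: M_def)
    finally show "(\<Sum>S\<in>Pow V. w q S * (real (card S) * ln (real q))) \<le> M * B * (ln (real q) / (real q)\<^sup>2)" by (simp add: mult_ac)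
    have "(\<Prod>p\<in>Q - {q}. W p) \<le> (\<Prod>p\<in>Q. W p)"
    proof -
     have "0 \<le> (\<Prod>p\<in>Q - {q}. W p)" using W1 by (intro prod_nonneg) (auto intro: order_trans[of 0 1])
     then have "1 * (\<Prod>p\<in>Q - {q}. W p) \<le> W q * (\<Prod>p\<in>Q - {q}. W p)" using W1 by (intro mult_right_mono)
     then show ?thesis using fQ q by (simp add: prod.remove[of Q q])
    qed
    then show "(\<Prod>p\<in>Q - {q}. W p) \<le> exp (2 * B)" using prodW by simp
    show "0 \<le> (\<Prod>p\<in>Q - {q}. W p)" using W1 by (intro prod_nonneg) (auto intro: order_trans[of 0 1])
    show "0 \<le> M * B * (ln (real q) / (real q)\<^sup>2)" using lq B by (simp add: M_def)
   qed
   finally show ?thesis by (simp add: mult_ac)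
  qed
  have "(\<Sum>\<sigma>\<in>Q \<rightarrow>\<^sub>E Pow V. (\<Prod>p\<in>Q. w p (\<sigma> p)) * (1 + (\<Sum>p\<in>Q. real (card (\<sigma> p)) * ln (real p))))
   = (\<Sum>\<sigma>\<in>Q \<rightarrow>\<^sub>E Pow V. \<Prod>p\<in>Q. w p (\<sigma> p)) + (\<Sum>q\<in>Q. \<Sum>\<sigma>\<in>Q \<rightarrow>\<^sub>E Pow V. (\<Prod>p\<in>Q. w p (\<sigma> p)) * (real (card (\<sigma> q)) * ln (real q)))"
  proof -
   have "(\<Sum>q\<in>Q. \<Sum>\<sigma>\<in>Q \<rightarrow>\<^sub>E Pow V. (\<Prod>p\<in>Q. w p (\<sigma> p)) * (real (card (\<sigma> q)) * ln (real q))) =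
     (\<Sum>\<sigma>\<in>Q \<rightarrow>\<^sub>E Pow V. \<Sum>q\<in>Q. (\<Prod>p\<in>Q. w p (\<sigma> p)) * (real (card (\<sigma> q)) * ln (real q)))"
    by (rule sum.swap)
   then show ?thesis by (simp only: distrib_left sum.distrib sum_distrib_left mult_1_right)
  qed
  also have "\<dots> \<le> exp (2 * B) + (\<Sum>q\<in>Q. exp (2 * B) * (M * B * (ln (real q) / (real q)\<^sup>2)))"
   unfolding all using prodW one by (intro add_mono sum_mono) auto
  also have "\<dots> = exp (2 * B) * (1 + M * B * (\<Sum>q\<in>Q. ln (real q) / (real q)\<^sup>2))"
   by (simp add: sum_distrib_left distrib_left mult_ac)
  also have "\<dots> \<le> K" unfolding K_def
  proof (intro mult_left_mono add_left_mono)
   show "(\<Sum>q\<in>Q. ln (real q) / (real q)\<^sup>2) \<le> 2 * (\<Sum>n. real (Suc n) powr (-3/2))"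
    using fQ pQ prime_ge_1_nat by (intro sum_ln_over_squares_le) auto
  qed (use B in \<open>auto simp: M_def\<close>)
  finally show ?thesis by (simp only: w_def)
 qed
 then show ?thesis using K0 by blast
qed

text \<open>Transfer principle: if the sums of h over multiples of e behave like I / (product of e),
  then the local densities multiply I. After the expansion over \<sigma> the main terms reassemble
  to the product of densities, and the errors, linear in the logarithms of e, are what
  \<open>sum_weights_bounded\<close> controls. K depends only on V and \<open>good\<close>.\<close>

lemma sum_good_asymptotic:
 fixes V :: "'v set"
 assumes V: "finite V" and good: "good {}" "\<And>v. good {v}"
 shows "\<exists>K\<ge>0. \<forall>Y. \<forall>h :: ('v \<Rightarrow> nat) \<Rightarrow> complex. \<forall>I R.
  (\<forall>d v. d \<in> V \<rightarrow>\<^sub>E {1..} \<longrightarrow> v \<in> V \<longrightarrow> d v > Y \<longrightarrow> h d = 0) \<longrightarrow>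
  (\<forall>e. (\<forall>v\<in>V. e v > 0) \<longrightarrow> norm ((\<Sum>d\<in>V \<rightarrow>\<^sub>E {1..Y}. h (\<lambda>v\<in>V. e v * d v)) - I / (\<Prod>v\<in>V. of_nat (e v)))
    \<le> R * (1 + (\<Sum>v\<in>V. ln (real (e v)))) / (\<Prod>v\<in>V. real (e v))) \<longrightarrow>
  norm ((\<Sum>d\<in>good_tuples V Y good. h d)
    - I * of_real (\<Prod>p\<in>{p. prime p \<and> p \<le> Y}. local_density V good (1 / real p))) \<le> K * R"
proof -
 obtain K where K: "K \<ge> 0" "\<And>Y Q. Q = {p. prime p \<and> p \<le> Y} \<Longrightarrow>
  (\<Sum>\<sigma>\<in>Q \<rightarrow>\<^sub>E Pow V. (\<Prod>p\<in>Q. \<bar>moebius_coeff good (\<sigma> p)\<bar> * (1 / real p) ^ card (\<sigma> p)) *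
    (1 + (\<Sum>p\<in>Q. real (card (\<sigma> p)) * ln (real p)))) \<le> K"
  using sum_weights_bounded[of V good, OF V good] by blast
 have "norm ((\<Sum>d\<in>good_tuples V Y good. h d)
    - I * of_real (\<Prod>p\<in>{p. prime p \<and> p \<le> Y}. local_density V good (1 / real p))) \<le> K * R"
  if h: "\<forall>d v. d \<in> V \<rightarrow>\<^sub>E {1..} \<longrightarrow> v \<in> V \<longrightarrow> d v > Y \<longrightarrow> h d = 0"
  and J: "\<forall>e. (\<forall>v\<in>V. e v > 0) \<longrightarrow> norm ((\<Sum>d\<in>V \<rightarrow>\<^sub>E {1..Y}. h (\<lambda>v\<in>V. e v * d v)) - I / (\<Prod>v\<in>V. of_nat (e v)))
    \<le> R * (1 + (\<Sum>v\<in>V. ln (real (e v)))) / (\<Prod>v\<in>V. real (e v))"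
  for Y and h :: "('v \<Rightarrow> nat) \<Rightarrow> complex" and I R
 proof -
  define Q where "Q = {p. prime p \<and> p \<le> Y}"
  have fQ: "finite Q" by (rule finite_subset[of _ "{..Y}"]) (auto simp: Q_def)
  have pQ: "\<forall>p\<in>Q. prime p" by (simp add: Q_def)
  define E where "E = (\<lambda>\<sigma>. squarefree_tuple Q \<sigma> :: 'v \<Rightarrow> nat)"
  define g where "g = (\<lambda>\<sigma>. \<Prod>p\<in>Q. moebius_coeff good (\<sigma> p))"
  have gs: "g \<sigma> = (\<Prod>p\<in>Q. moebius_coeff good (\<sigma> p))" for \<sigma> by (simp add: g_def)
  have Epos: "E \<sigma> v > 0" for \<sigma> v unfolding E_def by (rule squarefree_tuple_pos[OF fQ pQ])
  \<comment> \<open>The hypothesis for e = 1 bounds a norm by R.\<close>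
  have R0: "R \<ge> 0"
  proof -
   have "0 \<le> R * (1 + (\<Sum>v\<in>V. ln (real 1))) / (\<Prod>v\<in>V. real 1)"
    using J[rule_format, of "\<lambda>_. 1"] norm_ge_zero order_trans by blast
   then show ?thesis by simp
  qed
  have prodE: "(\<Prod>v\<in>V. real (E \<sigma> v)) = (\<Prod>p\<in>Q. real p ^ card (\<sigma> p))" if "\<sigma> \<in> Q \<rightarrow>\<^sub>E Pow V" for \<sigma>
   using prod_squarefree_tuple_eq[OF V fQ, of \<sigma>] that by (auto simp: E_def PiE_def Pi_def simp flip: of_nat_prod of_nat_power)
  have 1: "(\<Sum>d\<in>good_tuples V Y good. h d) =
    (\<Sum>\<sigma>\<in>Q \<rightarrow>\<^sub>E Pow V. of_real (g \<sigma>) * (\<Sum>d\<in>V \<rightarrow>\<^sub>E {1..Y}. h (\<lambda>v\<in>V. E \<sigma> v * d v)))"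
   unfolding sum_good_expand[where V = V and good = good and Y = Y and h = h, OF V good(1)] Q_def[symmetric]
   unfolding gs[symmetric]
  proof -
   have "(\<Sum>d\<in>{d \<in> V \<rightarrow>\<^sub>E {1..Y}. \<forall>v\<in>V. squarefree_tuple Q \<sigma> v dvd d v}. h d) = (\<Sum>d\<in>V \<rightarrow>\<^sub>E {1..Y}. h (\<lambda>v\<in>V. E \<sigma> v * d v))" for \<sigma>
    unfolding E_def using h Epos by (intro sum_multiples[OF V]) (auto simp: E_def)
   then show "(\<Sum>\<sigma>\<in>Q \<rightarrow>\<^sub>E Pow V. complex_of_real (g \<sigma>) * (\<Sum>d\<in>{d \<in> V \<rightarrow>\<^sub>E {1..Y}. \<forall>v\<in>V. squarefree_tuple Q \<sigma> v dvd d v}. h d)) =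
     (\<Sum>\<sigma>\<in>Q \<rightarrow>\<^sub>E Pow V. of_real (g \<sigma>) * (\<Sum>d\<in>V \<rightarrow>\<^sub>E {1..Y}. h (\<lambda>v\<in>V. E \<sigma> v * d v)))"
    by (simp only:)
  qed
  have 2: "I * of_real (\<Prod>p\<in>Q. local_density V good (1 / real p)) = (\<Sum>\<sigma>\<in>Q \<rightarrow>\<^sub>E Pow V. of_real (g \<sigma>) * (I / (\<Prod>v\<in>V. of_nat (E \<sigma> v))))"
  proof -
   have "(\<Prod>p\<in>Q. local_density V good (1 / real p)) = (\<Sum>\<sigma>\<in>Q \<rightarrow>\<^sub>E Pow V. \<Prod>p\<in>Q. moebius_coeff good (\<sigma> p) * (1 / real p) ^ card (\<sigma> p))"
    unfolding local_density_def using fQ V by (intro prod_sum_PiE) auto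
   also have "\<dots> = (\<Sum>\<sigma>\<in>Q \<rightarrow>\<^sub>E Pow V. g \<sigma> * (1 / (\<Prod>v\<in>V. real (E \<sigma> v))))"
    by (intro sum.cong refl) (simp add: prodE g_def prod.distrib power_one_over prod_dividef)
   finally have "I * of_real (\<Prod>p\<in>Q. local_density V good (1 / real p)) = (\<Sum>\<sigma>\<in>Q \<rightarrow>\<^sub>E Pow V. I * (of_real (g \<sigma>) * (1 / (\<Prod>v\<in>V. of_nat (E \<sigma> v)))))"
    by (simp add: sum_distrib_left)
   then show ?thesis by (simp add: mult_ac)
  qed
  have "norm ((\<Sum>d\<in>good_tuples V Y good. h d) - I * of_real (\<Prod>p\<in>Q. local_density V good (1 / real p)))
   = norm (\<Sum>\<sigma>\<in>Q \<rightarrow>\<^sub>E Pow V. of_real (g \<sigma>) * ((\<Sum>d\<in>V \<rightarrow>\<^sub>E {1..Y}. h (\<lambda>v\<in>V. E \<sigma> v * d v)) - I / (\<Prod>v\<in>V. of_nat (E \<sigma> v))))"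
   unfolding 1 2 by (simp only: sum_subtractf right_diff_distrib)
  also have "\<dots> \<le> (\<Sum>\<sigma>\<in>Q \<rightarrow>\<^sub>E Pow V. \<bar>g \<sigma>\<bar> * (R * (1 + (\<Sum>v\<in>V. ln (real (E \<sigma> v)))) / (\<Prod>v\<in>V. real (E \<sigma> v))))"
  proof (intro sum_norm_le)
   fix \<sigma>
   have "norm ((\<Sum>d\<in>V \<rightarrow>\<^sub>E {1..Y}. h (\<lambda>v\<in>V. E \<sigma> v * d v)) - I / (\<Prod>v\<in>V. of_nat (E \<sigma> v))) \<le> R * (1 + (\<Sum>v\<in>V. ln (real (E \<sigma> v)))) / (\<Prod>v\<in>V. real (E \<sigma> v))"
    using J Epos by blast
   then show "norm (of_real (g \<sigma>) * ((\<Sum>d\<in>V \<rightarrow>\<^sub>E {1..Y}. h (\<lambda>v\<in>V. E \<sigma> v * d v)) - I / (\<Prod>v\<in>V. of_nat (E \<sigma> v))))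
    \<le> \<bar>g \<sigma>\<bar> * (R * (1 + (\<Sum>v\<in>V. ln (real (E \<sigma> v)))) / (\<Prod>v\<in>V. real (E \<sigma> v)))"
    unfolding norm_mult norm_of_real by (rule mult_left_mono) simp
  qed
  also have "\<dots> = (\<Sum>\<sigma>\<in>Q \<rightarrow>\<^sub>E Pow V. R * ((\<Prod>p\<in>Q. \<bar>moebius_coeff good (\<sigma> p)\<bar> * (1 / real p) ^ card (\<sigma> p)) *
    (1 + (\<Sum>p\<in>Q. real (card (\<sigma> p)) * ln (real p)))))"
  proof (intro sum.cong refl)
   fix \<sigma> assume s: "\<sigma> \<in> Q \<rightarrow>\<^sub>E Pow V"
   have a: "(\<Sum>v\<in>V. ln (real (E \<sigma> v))) = (\<Sum>p\<in>Q. real (card (\<sigma> p)) * ln (real p))"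
    unfolding E_def using s by (intro sum_ln_squarefree_tuple[OF V fQ pQ]) (auto simp: PiE_def Pi_def)
   have b: "(\<Prod>p\<in>Q. \<bar>moebius_coeff good (\<sigma> p)\<bar> * (1 / real p) ^ card (\<sigma> p)) = \<bar>g \<sigma>\<bar> / (\<Prod>p\<in>Q. real p ^ card (\<sigma> p))"
    by (simp add: prod.distrib g_def abs_prod power_one_over prod_dividef)
   show "\<bar>g \<sigma>\<bar> * (R * (1 + (\<Sum>v\<in>V. ln (real (E \<sigma> v)))) / (\<Prod>v\<in>V. real (E \<sigma> v))) =
     R * ((\<Prod>p\<in>Q. \<bar>moebius_coeff good (\<sigma> p)\<bar> * (1 / real p) ^ card (\<sigma> p)) * (1 + (\<Sum>p\<in>Q. real (card (\<sigma> p)) * ln (real p))))"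
    unfolding a b prodE[OF s] by simp
  qed
  also have "\<dots> \<le> R * K" unfolding sum_distrib_left[symmetric] using K(2)[OF Q_def] R0 by (intro mult_left_mono) auto
  finally show ?thesis by (simp add: Q_def mult.commute)
 qed
 then show ?thesis using K(1) by blast
qed

section \<open>Logarithmic Riemann sums\<close>

abbreviation lborel_on :: "'v set \<Rightarrow> ('v \<Rightarrow> real) measure" where
 "lborel_on V \<equiv> PiM V (\<lambda>_. lborel)"

lemma lborel_integral_eq_integral:
 fixes f :: "real \<Rightarrow> 'a::euclidean_space"
 assumes "continuous_on {a..b} f" "\<And>t. t \<notin> {a..b} \<Longrightarrow> f t = 0"
 shows "(\<integral>t. f t \<partial>lborel) = integral {a..b} f"
proof -
 have "f = (\<lambda>t. indicator {a..b} t *\<^sub>R f t)" using assms(2) by (auto simp: indicator_def fun_eq_iff)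
 then have "(\<integral>t. f t \<partial>lborel) = (LINT t:{a..b}|lborel. f t)" unfolding set_lebesgue_integral_def by simp
 also have "\<dots> = integral {a..b} f"
  by (rule set_borel_integral_eq_integral(2)[OF borel_integrable_atLeastAtMost'[OF assms(1)]])
 finally show ?thesis .
qed

text \<open>The sum is compared with the integral over each interval between consecutive nodes
 \<open>u n = (ln n + l) / L\<close>; the interval containing \<open>b\<close> is the only one with an error that is not
 \<open>O(1 / n\<^sup>2)\<close>.\<close>

lemma log_sum_integral:
 fixes h :: "real \<Rightarrow> complex"
 assumes L: "L \<ge> 1" and l: "l \<ge> 0" and B: "B \<ge> 0" and K: "K \<ge> 0" and b: "b \<le> 1"
  and bnd: "\<And>u. norm (h u) \<le> B"
  and lip: "\<And>u u'. u \<in> {0..b} \<Longrightarrow> u' \<in> {0..b} \<Longrightarrow> norm (h u - h u') \<le> K * \<bar>u - u'\<bar>"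
  and z: "\<And>u. u \<notin> {0..b} \<Longrightarrow> h u = 0"
  and Y: "L \<le> ln (real (Suc Y))"
 shows "norm ((\<Sum>n\<in>{1..Y}. h ((ln (real n) + l) / L) / of_nat n) - of_real L * (\<integral>u. h u \<partial>lborel)) \<le> (4 * B + 2 * K) * (1 + l)"
proof (cases "b < 0")
 case True
 then have "h = (\<lambda>_. 0)" using z by auto
 then show ?thesis using B K l by simp
next
 case False
 have cont: "continuous_on {0..b} h"
 proof (rule lipschitz_on_continuous_on[of K])
  show "K-lipschitz_on {0..b} h" using lip K by (auto simp: lipschitz_on_def dist_norm)
 qed
 define u where "u = (\<lambda>n. (ln (real n) + l) / L)"
 define v where "v = (\<lambda>n. min (u n) b)"
 define I where "I = (\<lambda>x. integral {0..x} h)"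
 have u0: "u n \<ge> 0" if "n \<ge> 1" for n using that L l by (simp add: u_def)
 have v01: "0 \<le> v n" "v n \<le> b" if "n \<ge> 1" for n using u0[OF that] False by (auto simp: v_def)
 have int: "h integrable_on {x..x'}" if "0 \<le> x" "x' \<le> b" for x x'
  using that by (intro integrable_continuous_real continuous_on_subset[OF cont]) auto
 have Idiff: "I x' - I x = integral {x..x'} h" if "0 \<le> x" "x \<le> x'" "x' \<le> b" for x x'
  using Henstock_Kurzweil_Integration.integral_combine[of 0 x x' h] int[of 0 x'] that by (simp add: I_def algebra_simps)
 have Ib: "norm (I x' - I x) \<le> B * (x' - x)" if "0 \<le> x" "x \<le> x'" "x' \<le> b" for x x'
  unfolding Idiff[OF that] using that bnd by (intro integral_bound continuous_on_subset[OF cont]) auto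
 have Ilip: "norm (I x' - I x - of_real (x' - x) * h x) \<le> K * (x' - x) * (x' - x)" if "0 \<le> x" "x \<le> x'" "x' \<le> b" for x x'
 proof -
  have "I x' - I x - of_real (x' - x) * h x = integral {x..x'} (\<lambda>t. h t - h x)"
   unfolding Idiff[OF that] using int that by (subst integral_diff) (auto simp: scaleR_conv_of_real)
  also have "norm \<dots> \<le> (K * (x' - x)) * (x' - x)"
  proof (intro integral_bound)
   show "continuous_on {x..x'} (\<lambda>t. h t - h x)" using that by (intro continuous_intros continuous_on_subset[OF cont]) auto
   show "norm (h t - h x) \<le> K * (x' - x)" if "t \<in> {x..x'}" for t
   proof -
    have "norm (h t - h x) \<le> K * \<bar>t - x\<bar>" using that \<open>0 \<le> x\<close> \<open>x' \<le> b\<close> by (intro lip) auto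
    also have "\<dots> \<le> K * (x' - x)" using that K by (intro mult_left_mono) auto
    finally show ?thesis .
   qed
  qed (use that in auto)
  finally show ?thesis .
 qed
 \<comment> \<open>The nodes increase, so the difference of indicators is 1 exactly for the interval
   containing b; in the sum over n it telescopes to at most 1.\<close>
 have step: "norm (h (u n) / of_nat n - of_real L * (I (v (Suc n)) - I (v n))) \<le>
   (B + K) / (real n)\<^sup>2 + 2 * B * (of_bool (u n \<le> b) - of_bool (u (Suc n) \<le> b))" if n: "n \<ge> 1" for n
 proof -
  define \<delta> where "\<delta> = ln (1 + 1 / real n)"
  have n0: "real n > 0" using n by simp
  have "ln (real (Suc n)) - ln (real n) = \<delta>"
  proof -
   have "1 + 1 / real n = real (Suc n) / real n" using n by (simp add: field_simps)
   then show ?thesis unfolding \<delta>_def using n by (simp add: ln_div del: of_nat_Suc)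
  qed
  then have du: "L * (u (Suc n) - u n) = \<delta>" using L by (simp add: u_def field_simps)
  have d0: "0 \<le> \<delta>" "\<delta> \<le> 1 / real n" using ln_add_one_self_le_self[of "1 / real n"] n by (auto simp: \<delta>_def)
  have d1: "1 / real n - \<delta> \<le> 1 / (real n)\<^sup>2"
  proof -
   have "1 / real n - (1 / real n)\<^sup>2 \<le> \<delta>" unfolding \<delta>_def using n by (intro ln_one_plus_pos_lower_bound) auto
   then show ?thesis by (simp add: power_divide)
  qed
  have mono: "u n \<le> u (Suc n)" using n L by (simp add: u_def divide_right_mono)
  have dsmall: "u (Suc n) - u n \<le> \<delta>"
  proof -
   have "1 * (u (Suc n) - u n) \<le> L * (u (Suc n) - u n)" using L mono by (intro mult_right_mono) auto
   then show ?thesis using du by simp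
  qed
  consider (full) "u (Suc n) \<le> b" | (out) "u n > b" | (part) "u n \<le> b" "u (Suc n) > b" by linarith
  then show ?thesis
  proof cases
   case full
   then have v: "v n = u n" "v (Suc n) = u (Suc n)" using mono by (auto simp: v_def)
   have "h (u n) / of_nat n - of_real L * (I (v (Suc n)) - I (v n)) =
     of_real (1 / real n - \<delta>) * h (u n) - of_real L * (I (u (Suc n)) - I (u n) - of_real (u (Suc n) - u n) * h (u n))"
    unfolding v du[symmetric] by (simp add: algebra_simps)
   also have "norm \<dots> \<le> (1 / (real n)\<^sup>2) * B + L * (K * (u (Suc n) - u n) * (u (Suc n) - u n))"
   proof (intro order_trans[OF norm_triangle_ineq4] add_mono)
    show "norm (of_real (1 / real n - \<delta>) * h (u n)) \<le> (1 / (real n)\<^sup>2) * B"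
     unfolding norm_mult norm_of_real using d0 d1 bnd[of "u n"] by (intro mult_mono) auto
    show "norm (of_real L * (I (u (Suc n)) - I (u n) - of_real (u (Suc n) - u n) * h (u n))) \<le> L * (K * (u (Suc n) - u n) * (u (Suc n) - u n))"
     unfolding norm_mult norm_of_real using Ilip[OF u0[OF n] mono full] L by (simp add: mult_left_mono)
   qed
   also have "L * (K * (u (Suc n) - u n) * (u (Suc n) - u n)) = K * (\<delta> * (u (Suc n) - u n))"
    unfolding du[symmetric] by (simp add: algebra_simps)
   also have "\<dots> \<le> K * (1 / real n * (1 / real n))"
    using K d0 dsmall mono by (intro mult_left_mono mult_mono) auto
   finally show ?thesis using full mono by (simp add: power2_eq_square add_divide_distrib)
  next
   case out
   then have "v n = b" "v (Suc n) = b" "h (u n) = 0" using mono z by (auto simp: v_def)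
   then show ?thesis using out mono B K by simp
  next
   case part
   then have v: "v n = u n" "v (Suc n) = b" by (auto simp: v_def)
   have "norm (h (u n) / of_nat n - of_real L * (I (v (Suc n)) - I (v n))) \<le> norm (h (u n)) / real n + L * norm (I b - I (u n))"
    unfolding v using L by (intro order_trans[OF norm_triangle_ineq4]) (simp add: norm_mult norm_divide)
   also have "\<dots> \<le> B + L * (B * (u (Suc n) - u n))"
   proof (intro add_mono mult_left_mono)
    have "norm (h (u n)) / real n \<le> norm (h (u n)) / 1" using n by (intro divide_left_mono) auto
    then show "norm (h (u n)) / real n \<le> B" using bnd[of "u n"] by simp
    have "norm (I b - I (u n)) \<le> B * (b - u n)" using part u0[OF n] by (intro Ib) auto
    also have "\<dots> \<le> B * (u (Suc n) - u n)" using part B by (intro mult_left_mono) auto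
    finally show "norm (I b - I (u n)) \<le> B * (u (Suc n) - u n)" .
   qed (use L in auto)
   also have "L * (B * (u (Suc n) - u n)) = B * \<delta>" unfolding du[symmetric] by simp
   also have "B * \<delta> \<le> B * 1"
   proof (intro mult_left_mono)
    have "1 / real n \<le> 1" using n by simp
    then show "\<delta> \<le> 1" using d0 by linarith
   qed (use B in auto)
   finally have "norm (h (u n) / of_nat n - of_real L * (I (v (Suc n)) - I (v n))) \<le> 2 * B" by simp
   moreover have "(B + K) / (real n)\<^sup>2 \<ge> 0" using B K by simp
   ultimately show ?thesis using part by simp
  qed
 qed
 \<comment> \<open>As b <= 1 and L <= ln (Y + 1), the last node is at or beyond b, so the intervals
   exhaust [0, b] up to their starting point.\<close>
 have uY: "u (Suc Y) \<ge> b"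
 proof -
  have "L * b \<le> L * 1" using b L by (intro mult_left_mono) auto
  then have "b * L \<le> ln (real (Suc Y)) + l" using Y l by (simp only: mult.commute[of b] mult_1_right)
  then show ?thesis using L by (simp add: u_def pos_le_divide_eq del: of_nat_Suc)
 qed
 have tele: "(\<Sum>n\<in>{1..Y}. I (v (Suc n)) - I (v n)) = I b - I (v 1)"
 proof -
  have "(\<Sum>n\<in>{1..Y}. I (v (Suc n)) - I (v n)) = I (v (Suc Y)) - I (v 1)"
   by (induction Y) (auto simp: algebra_simps)
  moreover have "v (Suc Y) = b" using uY by (simp add: v_def)
  ultimately show ?thesis by simp
 qed
 have "(\<Sum>n\<in>{1..Y}. h (u n) / of_nat n) - of_real L * I b =
   (\<Sum>n\<in>{1..Y}. h (u n) / of_nat n - of_real L * (I (v (Suc n)) - I (v n))) - of_real L * (I (v 1) - I 0)"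
 proof -
  have "I 0 = 0" by (simp add: I_def)
  moreover have "(\<Sum>n\<in>{1..Y}. h (u n) / of_nat n - of_real L * (I (v (Suc n)) - I (v n))) =
    (\<Sum>n\<in>{1..Y}. h (u n) / of_nat n) - of_real L * (I b - I (v 1))"
   unfolding tele[symmetric] sum_distrib_left by (rule sum_subtractf)
  ultimately show ?thesis by (simp add: algebra_simps)
 qed
 also have "norm \<dots> \<le> (\<Sum>n\<in>{1..Y}. (B + K) / (real n)\<^sup>2 + 2 * B * (of_bool (u n \<le> b) - of_bool (u (Suc n) \<le> b))) + B * l"
 proof (intro order_trans[OF norm_triangle_ineq4] add_mono)
  show "norm (\<Sum>n\<in>{1..Y}. h (u n) / of_nat n - of_real L * (I (v (Suc n)) - I (v n))) \<le>
   (\<Sum>n\<in>{1..Y}. (B + K) / (real n)\<^sup>2 + 2 * B * (of_bool (u n \<le> b) - of_bool (u (Suc n) \<le> b)))"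
   using step by (intro sum_norm_le) auto
  \<comment> \<open>The nodes start at l / L instead of 0. The missing initial piece has length at
    most l / L and costs B * l, the source of the factor 1 + l.\<close>
  have "norm (I (v 1) - I 0) \<le> B * (v 1 - 0)" using v01[of 1] by (intro Ib) auto
  also have "\<dots> \<le> B * (l / L)" using B by (intro mult_left_mono) (auto simp: v_def u_def)
  finally have "L * norm (I (v 1) - I 0) \<le> L * (B * (l / L))" using L by (intro mult_left_mono) auto
  then show "norm (of_real L * (I (v 1) - I 0)) \<le> B * l" using L by (simp add: norm_mult)
 qed
 also have "(\<Sum>n\<in>{1..Y}. (B + K) / (real n)\<^sup>2 + 2 * B * (of_bool (u n \<le> b) - of_bool (u (Suc n) \<le> b)))
   = (B + K) * (\<Sum>n\<in>{1..Y}. 1 / (real n)\<^sup>2) + 2 * B * (\<Sum>n\<in>{1..Y}. of_bool (u n \<le> b) - of_bool (u (Suc n) \<le> b))"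
  by (simp add: sum.distrib sum_distrib_left)
 also have "\<dots> \<le> (B + K) * 2 + 2 * B * 1"
 proof (intro add_mono mult_left_mono)
  show "(\<Sum>n\<in>{1..Y}. 1 / (real n)\<^sup>2) \<le> 2"
  proof (cases "Y = 0")
   case False
   then have "{1..Y} = insert 1 {1<..Y}" by auto
   then have "(\<Sum>n\<in>{1..Y}. 1 / (real n)\<^sup>2) = 1 + (\<Sum>n\<in>{1<..Y}. 1 / (real n)\<^sup>2)" by simp
   then show ?thesis using sum_inverse_squares_tail[of 1 Y] False by simp
  qed simp
  have "(\<Sum>n\<in>{1..Y}. of_bool (u n \<le> b) - of_bool (u (Suc n) \<le> b)) = (of_bool (u 1 \<le> b) - of_bool (u (Suc Y) \<le> b) :: real)"
   by (induction Y) (auto simp: algebra_simps)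
  then show "(\<Sum>n\<in>{1..Y}. of_bool (u n \<le> b) - of_bool (u (Suc n) \<le> b)) \<le> (1::real)" by simp
 qed (use B K in auto)
 also have "(B + K) * 2 + 2 * B * 1 + B * l \<le> (4 * B + 2 * K) * (1 + l)"
 proof -
  have "B * l \<le> (4 * B + 2 * K) * l" using l B K by (intro mult_right_mono) auto
  then show ?thesis by (simp add: algebra_simps)
 qed
 finally have "norm ((\<Sum>n\<in>{1..Y}. h (u n) / of_nat n) - of_real L * I b) \<le> (4 * B + 2 * K) * (1 + l)" by simp
 moreover have "(\<integral>u. h u \<partial>lborel) = I b"
  unfolding I_def by (rule lborel_integral_eq_integral[OF cont]) (rule z)
 ultimately show ?thesis by (simp only: u_def)
qed

text \<open>In each variable the function is Lipschitz on an interval \<open>{0..b}\<close> with \<open>b \<le> 1\<close> and vanishes outside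
 of it; it may jump at the end points. The bound \<open>b\<close> may be negative, and then the section is zero.\<close>

definition box_lipschitz :: "'v set \<Rightarrow> (('v \<Rightarrow> real) \<Rightarrow> complex) \<Rightarrow> real \<Rightarrow> real \<Rightarrow> bool" where
 "box_lipschitz V H B K \<longleftrightarrow> H \<in> borel_measurable (lborel_on V) \<and>
   (\<forall>x\<in>V \<rightarrow>\<^sub>E UNIV. norm (H x) \<le> B) \<and>
   (\<forall>x\<in>V \<rightarrow>\<^sub>E UNIV. \<forall>v\<in>V. \<exists>b\<le>1.
    (\<forall>u\<in>{0..b}. \<forall>u'\<in>{0..b}. norm (H (x(v := u)) - H (x(v := u'))) \<le> K * \<bar>u - u'\<bar>) \<and>
    (\<forall>u. u \<notin> {0..b} \<longrightarrow> H (x(v := u)) = 0))"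

lemma box_lipschitz_outside:
 assumes "box_lipschitz V H B K" "x \<in> V \<rightarrow>\<^sub>E UNIV" "x \<notin> V \<rightarrow>\<^sub>E {0..1}"
 shows "H x = 0"
proof -
 obtain v where v: "v \<in> V" "x v \<notin> {0..1}" using assms(2,3) by (auto simp: PiE_def Pi_def)
 obtain b where b: "b \<le> 1" "\<forall>u. u \<notin> {0..b} \<longrightarrow> H (x(v := u)) = 0"
  using assms(1,2) v(1) unfolding box_lipschitz_def by blast
 have "x v \<notin> {0..b}" using v b by auto
 then have "H (x(v := x v)) = 0" using b(2) by blast
 then show ?thesis by simp
qed

interpretation lborel_prod: product_sigma_finite "\<lambda>_. lborel :: real measure" ..

section \<open>Several variables\<close>

lemma integral_PiM_box:
 fixes f :: "('v \<Rightarrow> real) \<Rightarrow> complex"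
 assumes V: "finite V" and meas: "f \<in> borel_measurable (lborel_on V)"
  and bnd: "\<And>x. x \<in> V \<rightarrow>\<^sub>E UNIV \<Longrightarrow> norm (f x) \<le> C"
  and z: "\<And>x. x \<in> V \<rightarrow>\<^sub>E UNIV \<Longrightarrow> x \<notin> V \<rightarrow>\<^sub>E {0..1} \<Longrightarrow> f x = 0"
 shows "integrable (lborel_on V) f" "norm (\<integral>x. f x \<partial>lborel_on V) \<le> C"
proof -
 define M :: "('v \<Rightarrow> real) measure" where "M = lborel_on V"
 define A where "A = V \<rightarrow>\<^sub>E {0..1::real}"
 have sp: "space M = V \<rightarrow>\<^sub>E UNIV" by (simp add: M_def space_PiM)
 have A: "A \<in> sets M" unfolding A_def M_def using V by (intro sets_PiM_I_finite) auto
 have eA: "emeasure M A = 1"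
  unfolding M_def A_def using V by (subst lborel_prod.emeasure_PiM) auto
 then have mA: "measure M A = 1" by (simp add: measure_def)
 have ind: "integrable M (\<lambda>x. C * indicator A x)"
  using A eA by (intro integrable_mult_right) (auto simp: integrable_indicator_iff)
 have le: "norm (f x) \<le> C * indicator A x" if "x \<in> space M" for x
  using that bnd[of x] z[of x] by (auto simp: sp A_def indicator_def)
 show i: "integrable (lborel_on V) f"
  unfolding M_def[symmetric]
 proof (rule Bochner_Integration.integrable_bound[OF ind])
  show "f \<in> borel_measurable M" using meas by (simp add: M_def)
  show "AE x in M. norm (f x) \<le> norm (C * indicator A x)" using order_trans[OF le abs_ge_self] by (intro AE_I2) simp
 qed
 have "norm (\<integral>x. f x \<partial>M) \<le> (\<integral>x. norm (f x) \<partial>M)" by (rule integral_norm_bound)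
 also have "\<dots> \<le> (\<integral>x. C * indicator A x \<partial>M)"
  using i le ind by (intro integral_mono) (auto simp: M_def)
 also have "\<dots> = C" using A mA eA by simp
 finally show "norm (\<integral>x. f x \<partial>lborel_on V) \<le> C" by (simp add: M_def)
qed

lemma measurable_fun_upd_PiM:
 "(\<lambda>x. x(v := u)) \<in> measurable (lborel_on V) (lborel_on (insert v V))"
proof -
 have "(\<lambda>x. (\<lambda>(f, y). f(v := y)) (x, u)) \<in> measurable (lborel_on V) (lborel_on (insert v V))"
  by (rule measurable_compose[OF _ measurable_add_dim]) measurable
 then show ?thesis by simp
qed

lemma box_lipschitz_upd:
 assumes H: "box_lipschitz (insert v V) H B K" and v: "v \<notin> V"
 shows "box_lipschitz V (\<lambda>x. H (x(v := u))) B K"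
proof -
 have ins: "x(v := t) \<in> insert v V \<rightarrow>\<^sub>E UNIV" if "x \<in> V \<rightarrow>\<^sub>E UNIV" for x :: "'a \<Rightarrow> real" and t
  using that by (auto simp: PiE_def extensional_def)
 show ?thesis
  unfolding box_lipschitz_def
 proof (intro conjI ballI)
  show "(\<lambda>x. H (x(v := u))) \<in> borel_measurable (lborel_on V)"
   using H by (intro measurable_compose[OF measurable_fun_upd_PiM]) (auto simp: box_lipschitz_def)
  fix x :: "'a \<Rightarrow> real" assume x: "x \<in> V \<rightarrow>\<^sub>E UNIV"
  show "norm (H (x(v := u))) \<le> B" using H ins[OF x] by (auto simp: box_lipschitz_def)
  fix w assume w: "w \<in> V"
  have tw: "x(w := t, v := u) = (x(v := u))(w := t)" for t using w v by (intro fun_upd_twist) auto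
  show "\<exists>b\<le>1. (\<forall>t\<in>{0..b}. \<forall>t'\<in>{0..b}. norm (H (x(w := t, v := u)) - H (x(w := t', v := u))) \<le> K * \<bar>t - t'\<bar>) \<and>
    (\<forall>t. t \<notin> {0..b} \<longrightarrow> H (x(w := t, v := u)) = 0)"
   unfolding tw using H ins[OF x, of u] w unfolding box_lipschitz_def by blast
 qed
qed

lemma sum_PiE_insert:
 assumes "v \<notin> V"
 shows "(\<Sum>d\<in>insert v V \<rightarrow>\<^sub>E A. F d) = (\<Sum>n\<in>A. \<Sum>d\<in>V \<rightarrow>\<^sub>E A. F (d(v := n)))"
proof -
 have "(\<Sum>d\<in>insert v V \<rightarrow>\<^sub>E A. F d) = (\<Sum>(n, d)\<in>A \<times> (V \<rightarrow>\<^sub>E A). F (d(v := n)))"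
  unfolding PiE_insert_eq using inj_combinator[OF assms, of "\<lambda>_. A"]
  by (subst sum.reindex) (auto simp: case_prod_beta intro!: sum.cong)
 then show ?thesis by (simp add: sum.cartesian_product)
qed

lemma sum_inverse_le_log:
 assumes L: "L \<ge> 1"
 shows "(\<Sum>n\<in>{n\<in>{1..Y}. ln (real n) \<le> L}. 1 / real n) \<le> 2 * L"
proof -
 define N where "N = nat \<lfloor>exp L\<rfloor>"
 have "exp L \<ge> 1" using L by (simp add: order_trans[OF _ one_le_exp_iff[THEN iffD2]])
 then have N: "N \<ge> 1" "real N \<le> exp L" unfolding N_def by (auto simp: le_nat_iff le_floor_iff)
 have "(\<Sum>n\<in>{n\<in>{1..Y}. ln (real n) \<le> L}. 1 / real n) \<le> (\<Sum>n\<in>{1..N}. 1 / real n)"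
 proof (rule sum_mono2)
  show "{n\<in>{1..Y}. ln (real n) \<le> L} \<subseteq> {1..N}"
  proof
   fix n assume n: "n \<in> {n\<in>{1..Y}. ln (real n) \<le> L}"
   then have "real n \<le> exp L" using ln_ge_iff[of "real n"] by (metis (mono_tags, lifting) atLeastAtMost_iff exp_ln exp_le_cancel_iff mem_Collect_eq of_nat_0_less_iff zero_less_one order_less_le_trans)
   then show "n \<in> {1..N}" using n by (auto simp: N_def le_nat_floor)
  qed
 qed auto
 also have "\<dots> = harm N" by (simp add: harm_def divide_inverse)
 also have "\<dots> \<le> 1 + ln (real N)"
  using N(1)
 proof (induction N rule: dec_induct)
  case base
  then show ?case by (simp add: harm_def)
 next
  case (step n)
  have n0: "real n > 0" using step by simp
  have "1 - real n / real (Suc n) \<le> - ln (real n / real (Suc n))"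
   using ln_le_minus_one[of "real n / real (Suc n)"] n0 by (simp del: of_nat_Suc)
  also have "\<dots> = ln (real (Suc n)) - ln (real n)" using n0 by (subst ln_div) auto
  also have "1 - real n / real (Suc n) = inverse (real (Suc n))" by (simp add: field_simps)
  finally show ?case using step by (simp add: harm_Suc)
 qed
 also have "\<dots> \<le> 1 + ln (exp L)" using N by (intro add_left_mono ln_mono) auto
 also have "\<dots> \<le> 2 * L" using L by simp
 finally show ?thesis .
qed

text \<open>One variable v is split off: for each of its values the inner sum becomes an integral by
  induction, and then the sum over v is compared with its integral pointwise in the remaining
  variables. The shifts l v will be the logarithms of the divisors from the Moebius
  expansion.\<close>

lemma multi_log_sum_integral:
 fixes H :: "('v \<Rightarrow> real) \<Rightarrow> complex"
 assumes L: "L \<ge> 1" and B: "B \<ge> 0" and K: "K \<ge> 0" and Y: "L \<le> ln (real (Suc Y))" and V: "finite V"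
  and l: "\<And>v. v \<in> V \<Longrightarrow> l v \<ge> 0" and H: "box_lipschitz V H B K"
 shows "norm ((\<Sum>d\<in>V \<rightarrow>\<^sub>E {1..Y}. (\<Prod>v\<in>V. 1 / of_nat (d v)) * H (\<lambda>v\<in>V. (ln (real (d v)) + l v) / L))
   - of_real (L ^ card V) * (\<integral>x. H x \<partial>lborel_on V))
  \<le> (2 + 4 * B + 2 * K) ^ card V * (\<Sum>v\<in>V. 1 + l v) * L ^ (card V - 1)"
 using V l H
proof (induction V arbitrary: H rule: finite_induct)
 case empty
 have "(\<integral>x. H x \<partial>PiM {} (\<lambda>_. lborel :: real measure)) = H (\<lambda>_. undefined)"
  by (simp add: PiM_empty lebesgue_integral_count_space_finite)
 then show ?case by (simp add: restrict_def)
next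
 case (insert v V)
 define C where "C = 2 + 4 * B + 2 * K"
 have C: "C \<ge> 1" using B K by (simp add: C_def)
 define u where "u = (\<lambda>n::nat. (ln (real n) + l v) / L)"
 have lv: "l v \<ge> 0" using insert.prems(1) by simp
 define M where "M = lborel_on V"
 define S where "S = (\<lambda>t. \<Sum>d\<in>V \<rightarrow>\<^sub>E {1..Y}. (\<Prod>w\<in>V. 1 / of_nat (d w)) * H ((\<lambda>w\<in>V. (ln (real (d w)) + l w) / L)(v := t)))"
 define J where "J = (\<lambda>t. \<integral>x. H (x(v := t)) \<partial>M)"
 define E where "E = C ^ card V * (\<Sum>w\<in>V. 1 + l w) * L ^ (card V - 1)"
 have E0: "E \<ge> 0" unfolding E_def using C L insert.prems(1) by (intro mult_nonneg_nonneg sum_nonneg) (auto simp: add_nonneg_nonneg)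
 have Hu: "box_lipschitz V (\<lambda>x. H (x(v := t))) B K" for t
  by (rule box_lipschitz_upd[OF insert.prems(2) insert.hyps(2)])
 have ins: "x(v := t) \<in> insert v V \<rightarrow>\<^sub>E UNIV" if "x \<in> V \<rightarrow>\<^sub>E UNIV" for x :: "'v \<Rightarrow> real" and t
  using that by (auto simp: PiE_def extensional_def)
 have sumS: "(\<Sum>d\<in>insert v V \<rightarrow>\<^sub>E {1..Y}. (\<Prod>w\<in>insert v V. 1 / of_nat (d w)) * H (\<lambda>w\<in>insert v V. (ln (real (d w)) + l w) / L))
   = (\<Sum>n\<in>{1..Y}. 1 / of_nat n * S (u n))"
 proof -
  have "(\<Prod>w\<in>insert v V. 1 / of_nat ((d(v := n)) w)) = 1 / of_nat n * (\<Prod>w\<in>V. 1 / (of_nat (d w) :: complex))" for d n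
   using insert.hyps by (simp) (intro disjI2 prod.cong, auto)
  moreover have "(\<lambda>w\<in>insert v V. (ln (real ((d(v := n)) w)) + l w) / L) = (\<lambda>w\<in>V. (ln (real (d w)) + l w) / L)(v := u n)" for d n
   using insert.hyps by (auto simp: u_def restrict_def)
  ultimately show ?thesis
   unfolding sum_PiE_insert[OF insert.hyps(2)] S_def by (simp only: sum_distrib_left mult.assoc)
 qed
 have IH: "norm (S t - of_real (L ^ card V) * J t) \<le> E" for t
  unfolding S_def J_def E_def C_def M_def by (rule insert.IH[OF _ Hu]) (use insert.prems(1) in auto)
 have out: "S t = 0 \<and> J t = 0" if t: "t \<notin> {0..1}" for t
 proof -
  have z: "H (x(v := t)) = 0" if "x \<in> V \<rightarrow>\<^sub>E UNIV" for x
   using t by (intro box_lipschitz_outside[OF insert.prems(2) ins[OF that]]) (auto simp: PiE_def Pi_def)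
  have "S t = 0" unfolding S_def by (intro sum.neutral ballI) (simp add: z)
  moreover have "J t = (\<integral>x. 0 \<partial>M)" unfolding J_def
   by (intro Bochner_Integration.integral_cong refl z) (simp add: M_def space_PiM)
  ultimately show ?thesis by simp
 qed
 \<comment> \<open>Values with ln n > L lie outside the unit interval and contribute 0, so the
   inductive error is multiplied only by a harmonic sum of size 2 * L.\<close>
 have part1: "norm ((\<Sum>n\<in>{1..Y}. 1 / of_nat n * S (u n)) - (\<Sum>n\<in>{1..Y}. 1 / of_nat n * (of_real (L ^ card V) * J (u n)))) \<le> 2 * L * E"
 proof -
  have "norm ((\<Sum>n\<in>{1..Y}. 1 / of_nat n * S (u n)) - (\<Sum>n\<in>{1..Y}. 1 / of_nat n * (of_real (L ^ card V) * J (u n)))) =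
    norm (\<Sum>n\<in>{1..Y}. 1 / of_nat n * (S (u n) - of_real (L ^ card V) * J (u n)))"
   by (simp add: sum_subtractf right_diff_distrib)
  also have "\<dots> \<le> (\<Sum>n\<in>{1..Y}. (if ln (real n) \<le> L then 1 / real n else 0) * E)"
  proof (intro sum_norm_le)
   fix n assume n: "n \<in> {1..Y}"
   show "norm (1 / of_nat n * (S (u n) - of_real (L ^ card V) * J (u n))) \<le> (if ln (real n) \<le> L then 1 / real n else 0) * E"
   proof (cases "ln (real n) \<le> L")
    case True
    then show ?thesis using IH[of "u n"] by (simp add: norm_mult norm_divide divide_right_mono)
   next
    case False
    then have "u n > 1" using lv L by (simp add: u_def field_simps)
    then have "S (u n) = 0" "J (u n) = 0" using out[of "u n"] by auto
    then show ?thesis using False by simp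
   qed
  qed
  also have "\<dots> = (\<Sum>n\<in>{n\<in>{1..Y}. ln (real n) \<le> L}. 1 / real n) * E"
   by (simp only: sum_distrib_right[symmetric] sum.inter_filter[OF finite_atLeastAtMost])
  also have "\<dots> \<le> 2 * L * E" using E0 by (intro mult_right_mono sum_inverse_le_log L)
  finally show ?thesis .
 qed
 have meas: "H \<in> borel_measurable (lborel_on (insert v V))" using insert.prems(2) by (simp add: box_lipschitz_def)
 have meas2: "(\<lambda>(x, t). H (x(v := t))) \<in> borel_measurable (M \<Otimes>\<^sub>M lborel)"
  using measurable_compose[OF measurable_add_dim meas] unfolding M_def by (simp add: case_prod_beta)
 \<comment> \<open>The one-dimensional error in v as a function of the other variables. It is
   bounded and supported in the unit cube, so its integral obeys the same bound.\<close>
 define D where "D = (\<lambda>x. (\<Sum>n\<in>{1..Y}. H (x(v := u n)) / of_nat n) - of_real L * (\<integral>t. H (x(v := t)) \<partial>lborel))"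
 have Dle: "norm (D x) \<le> (4 * B + 2 * K) * (1 + l v)" if x: "x \<in> V \<rightarrow>\<^sub>E UNIV" for x
 proof -
  obtain b where b: "b \<le> 1" "\<forall>t\<in>{0..b}. \<forall>t'\<in>{0..b}. norm (H (x(v := t)) - H (x(v := t'))) \<le> K * \<bar>t - t'\<bar>"
   "\<forall>t. t \<notin> {0..b} \<longrightarrow> H (x(v := t)) = 0"
  proof -
   have "\<exists>b\<le>1. (\<forall>t\<in>{0..b}. \<forall>t'\<in>{0..b}. norm (H ((x(v := 0))(v := t)) - H ((x(v := 0))(v := t'))) \<le> K * \<bar>t - t'\<bar>) \<and>
    (\<forall>t. t \<notin> {0..b} \<longrightarrow> H ((x(v := 0))(v := t)) = 0)"
    using insert.prems(2) ins[OF x, of 0] unfolding box_lipschitz_def by blast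
   then show ?thesis using that by auto
  qed
  have "norm (H (x(v := t))) \<le> B" for t using insert.prems(2) ins[OF x] by (auto simp: box_lipschitz_def)
  then show ?thesis unfolding D_def u_def using b by (intro log_sum_integral[OF L lv B K b(1) _ _ _ Y]) auto
 qed
 have Dz: "D x = 0" if x: "x \<in> V \<rightarrow>\<^sub>E UNIV" "x \<notin> V \<rightarrow>\<^sub>E {0..1}" for x
 proof -
  have "H (x(v := t)) = 0" for t
   by (rule box_lipschitz_outside[OF Hu x])
  then show ?thesis by (simp add: D_def)
 qed
 have Dm: "D \<in> borel_measurable M"
  unfolding D_def
 proof (intro borel_measurable_diff borel_measurable_sum borel_measurable_times borel_measurable_divide borel_measurable_const)
  show "(\<lambda>x. H (x(v := u n))) \<in> borel_measurable M" for n using Hu[of "u n"] by (simp add: box_lipschitz_def M_def)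
  show "(\<lambda>x. \<integral>t. H (x(v := t)) \<partial>lborel) \<in> borel_measurable M"
   by (rule sigma_finite_measure.borel_measurable_lebesgue_integral[OF _ meas2]) (rule sigma_finite_lborel)
 qed
 have intH: "integrable M (\<lambda>x. H (x(v := t)))" for t
  unfolding M_def using Hu[of t] box_lipschitz_outside[OF Hu[of t]]
  by (intro integral_PiM_box(1)[OF insert.hyps(1), of _ B]) (auto simp: box_lipschitz_def)
 have intD: "integrable M D" and normD: "norm (\<integral>x. D x \<partial>M) \<le> (4 * B + 2 * K) * (1 + l v)"
  unfolding M_def by (rule integral_PiM_box[OF insert.hyps(1) Dm[unfolded M_def] Dle Dz]; assumption)+
 have intHH: "integrable (lborel_on (insert v V)) H"
  using insert.prems(2) box_lipschitz_outside[OF insert.prems(2)] insert.hyps(1)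
  by (intro integral_PiM_box(1)[of _ _ B]) (auto simp: box_lipschitz_def)
 have full: "(\<integral>x. H x \<partial>lborel_on (insert v V)) = (\<integral>x. (\<integral>t. H (x(v := t)) \<partial>lborel) \<partial>M)"
  unfolding M_def by (rule lborel_prod.product_integral_insert[OF insert.hyps intHH])
 have part2: "(\<Sum>n\<in>{1..Y}. 1 / of_nat n * (of_real (L ^ card V) * J (u n))) - of_real (L ^ Suc (card V)) * (\<integral>x. H x \<partial>lborel_on (insert v V))
   = of_real (L ^ card V) * (\<integral>x. D x \<partial>M)"
 proof -
  have sm: "integrable M (\<lambda>x. \<Sum>n\<in>{1..Y}. H (x(v := u n)) / of_nat n)"
   by (intro Bochner_Integration.integrable_sum integrable_divide_zero intH)
  have "integrable M (\<lambda>x. (\<Sum>n\<in>{1..Y}. H (x(v := u n)) / of_nat n) - D x)" by (intro Bochner_Integration.integrable_diff sm intD)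
  then have i2: "integrable M (\<lambda>x. of_real L * (\<integral>t. H (x(v := t)) \<partial>lborel))" by (simp add: D_def)
  have "(\<integral>x. D x \<partial>M) = (\<integral>x. (\<Sum>n\<in>{1..Y}. H (x(v := u n)) / of_nat n) \<partial>M) - (\<integral>x. of_real L * (\<integral>t. H (x(v := t)) \<partial>lborel) \<partial>M)"
   unfolding D_def by (rule Bochner_Integration.integral_diff[OF sm i2])
  also have "(\<integral>x. (\<Sum>n\<in>{1..Y}. H (x(v := u n)) / of_nat n) \<partial>M) = (\<Sum>n\<in>{1..Y}. J (u n) / of_nat n)"
   unfolding J_def by (subst Bochner_Integration.integral_sum) (auto intro!: integrable_divide_zero intH)
  also have "(\<integral>x. of_real L * (\<integral>t. H (x(v := t)) \<partial>lborel) \<partial>M) = of_real L * (\<integral>x. H x \<partial>lborel_on (insert v V))"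
   unfolding full by simp
  finally have e: "(\<integral>x. D x \<partial>M) = (\<Sum>n\<in>{1..Y}. J (u n) / of_nat n) - of_real L * (\<integral>x. H x \<partial>lborel_on (insert v V))" .
  show ?thesis unfolding e by (simp add: sum_distrib_left right_diff_distrib mult_ac)
 qed
 have "norm ((\<Sum>n\<in>{1..Y}. 1 / of_nat n * S (u n)) - of_real (L ^ Suc (card V)) * (\<integral>x. H x \<partial>lborel_on (insert v V)))
  = norm (((\<Sum>n\<in>{1..Y}. 1 / of_nat n * S (u n)) - (\<Sum>n\<in>{1..Y}. 1 / of_nat n * (of_real (L ^ card V) * J (u n)))) + of_real (L ^ card V) * (\<integral>x. D x \<partial>M))"
  unfolding part2[symmetric] by simp
 also have "\<dots> \<le> 2 * L * E + L ^ card V * ((4 * B + 2 * K) * (1 + l v))"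
 proof (intro order_trans[OF norm_triangle_ineq] add_mono part1)
  show "norm (of_real (L ^ card V) * (\<integral>x. D x \<partial>M)) \<le> L ^ card V * ((4 * B + 2 * K) * (1 + l v))"
   unfolding norm_mult norm_of_real using normD L by (intro mult_mono) auto
 qed
 also have "\<dots> \<le> C ^ Suc (card V) * (\<Sum>w\<in>V. 1 + l w) * L ^ card V + L ^ card V * (C ^ Suc (card V) * (1 + l v))"
 proof (intro add_mono)
  have sl: "(\<Sum>w\<in>V. 1 + l w) \<ge> 0" using insert.prems(1) by (intro sum_nonneg) (auto simp: add_nonneg_nonneg)
  show "2 * L * E \<le> C ^ Suc (card V) * (\<Sum>w\<in>V. 1 + l w) * L ^ card V"
  \<comment> \<open>For empty V the truncated exponent card V - 1 does no harm, since E contains an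
    empty sum and vanishes.\<close>
  proof (cases "V = {}")
   case False
   then have "L * L ^ (card V - 1) = L ^ card V" using insert.hyps(1) by (metis card_gt_0_iff power_eq_if less_irrefl_nat)
   then have "2 * L * E = 2 * (C ^ card V * (\<Sum>w\<in>V. 1 + l w) * L ^ card V)" by (simp add: E_def)
   also have "\<dots> \<le> C * (C ^ card V * (\<Sum>w\<in>V. 1 + l w) * L ^ card V)"
    using C B K L sl by (intro mult_right_mono mult_nonneg_nonneg) (auto simp: C_def)
   finally show ?thesis by (simp add: mult.assoc)
  qed (simp add: E_def)
  have "4 * B + 2 * K \<le> C" by (simp add: C_def)
  also have "C \<le> C ^ Suc (card V)" using C by (simp add: mult_le_cancel_left1 one_le_power)
  finally show "L ^ card V * ((4 * B + 2 * K) * (1 + l v)) \<le> L ^ card V * (C ^ Suc (card V) * (1 + l v))"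
   using L lv by (intro mult_left_mono mult_right_mono) auto
 qed
 also have "\<dots> = C ^ card (insert v V) * (\<Sum>w\<in>insert v V. 1 + l w) * L ^ (card (insert v V) - 1)"
  using insert.hyps by (simp add: algebra_simps)
 finally show ?case unfolding sumS C_def using insert.hyps by simp
qed

section \<open>Sums over staircase matrices\<close>

abbreviation grid :: "nat \<Rightarrow> (nat \<times> nat) set" where
 "grid m \<equiv> {1..m} \<times> {1..m}"

text \<open>Two entries fail to be coprime iff some prime divides both, so the condition localizes
  at the primes.\<close>

lemma staircase_iff_noncrossing:
 assumes "\<And>v. v \<in> {1..m} \<times> {1..n} \<Longrightarrow> d v > 0"
 shows "staircase m n d \<longleftrightarrow> (\<forall>p. prime p \<longrightarrow> noncrossing {v \<in> {1..m} \<times> {1..n}. p dvd d v})"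
proof
 assume d: "staircase m n d"
 show "\<forall>p. prime p \<longrightarrow> noncrossing {v \<in> {1..m} \<times> {1..n}. p dvd d v}"
 proof (intro allI impI)
  fix p :: nat assume p: "prime p"
  show "noncrossing {v \<in> {1..m} \<times> {1..n}. p dvd d v}"
   unfolding noncrossing_def
  proof (intro allI impI notI)
   fix i i' j j' assume *: "i < i' \<and> j < j'" "(i, j') \<in> {v \<in> {1..m} \<times> {1..n}. p dvd d v} \<and> (i', j) \<in> {v \<in> {1..m} \<times> {1..n}. p dvd d v}"
   then have "coprime (d (i, j')) (d (i', j))" using d unfolding staircase_def by blast
   then show False using * p coprime_common_divisor[of "d (i, j')" "d (i', j)" p] not_prime_unit[of p] by auto
  qed
 qed
next
 assume *: "\<forall>p. prime p \<longrightarrow> noncrossing {v \<in> {1..m} \<times> {1..n}. p dvd d v}"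
 show "staircase m n d"
  unfolding staircase_def
 proof (intro ballI impI)
  fix i i' j j' assume a: "i \<in> {1..m}" "i' \<in> {1..m}" "j \<in> {1..n}" "j' \<in> {1..n}" "i < i' \<and> j < j'"
  show "coprime (d (i, j')) (d (i', j))"
  proof (rule ccontr)
   assume "\<not> coprime (d (i, j')) (d (i', j))"
   then have "gcd (d (i, j')) (d (i', j)) \<noteq> 1" by (simp add: coprime_iff_gcd_eq_1)
   then obtain p where p0: "prime p" "p dvd gcd (d (i, j')) (d (i', j))" using prime_factor_nat by blast
   then have p: "prime p" "p dvd d (i, j')" "p dvd d (i', j)" using dvd_trans gcd_dvd1 gcd_dvd2 by blast+
   then have "noncrossing {v \<in> {1..m} \<times> {1..n}. p dvd d v}" using * by blast
   then show False using a p unfolding noncrossing_def by blast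
  qed
 qed
qed

text \<open>The logarithmic Riemann sum feeds the transfer principle; the truncated product of
  densities is then completed to \<open>arith_factor\<close>. The constant depends on H only through
  B and K, which gives uniformity in the shifts later.\<close>

theorem matrix_sum_asymptotic:
 fixes B K :: real
 assumes m: "m \<ge> 1" and B: "B \<ge> 0" and K: "K \<ge> 0"
 shows "\<exists>C\<ge>0. \<forall>L\<ge>1. \<forall>Y H. L < ln (real (Suc Y)) \<and> box_lipschitz (grid m) H B K \<longrightarrow>
  norm ((\<Sum>d\<in>{d \<in> grid m \<rightarrow>\<^sub>E {1..Y}. staircase m m d}.
    (\<Prod>v\<in>grid m. 1 / of_nat (d v)) * H (\<lambda>v\<in>grid m. ln (real (d v)) / L))
   - of_real (arith_factor m * L ^ (m\<^sup>2)) * (\<integral>x. H x \<partial>lborel_on (grid m)))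
  \<le> C * L ^ (m\<^sup>2 - 1)"
proof -
 define V where "V = grid m"
 have V: "finite V" "card V = m\<^sup>2" "card V \<ge> 1" using m by (auto simp: V_def card_cartesian_product power2_eq_square)
 obtain C1 where C1: "C1 \<ge> 0" "\<And>Y (h :: (nat \<times> nat \<Rightarrow> nat) \<Rightarrow> complex) I R.
  (\<forall>d v. d \<in> V \<rightarrow>\<^sub>E {1..} \<longrightarrow> v \<in> V \<longrightarrow> d v > Y \<longrightarrow> h d = 0) \<Longrightarrow>
  (\<forall>e. (\<forall>v\<in>V. e v > 0) \<longrightarrow> norm ((\<Sum>d\<in>V \<rightarrow>\<^sub>E {1..Y}. h (\<lambda>v\<in>V. e v * d v)) - I / (\<Prod>v\<in>V. of_nat (e v)))
    \<le> R * (1 + (\<Sum>v\<in>V. ln (real (e v)))) / (\<Prod>v\<in>V. real (e v))) \<Longrightarrow>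
  norm ((\<Sum>d\<in>{d \<in> V \<rightarrow>\<^sub>E {1..Y}. \<forall>p. prime p \<longrightarrow> noncrossing {v\<in>V. p dvd d v}}. h d)
    - I * of_real (\<Prod>p\<in>{p. prime p \<and> p \<le> Y}. local_density V noncrossing (1 / real p))) \<le> C1 * R"
  using sum_good_asymptotic[OF V(1), of noncrossing] noncrossing_empty noncrossing_singleton by blast
 obtain C2 where C2: "C2 \<ge> 0" "\<And>Y. Y \<ge> 1 \<Longrightarrow> \<bar>arith_factor m - (\<Prod>p\<in>{p. prime p \<and> p \<le> Y}. local_density V noncrossing (1 / real p))\<bar> \<le> C2 / real Y"
  using arith_factor_approx[OF m] unfolding V_def by blast
 define R0 where "R0 = (2 + 4 * B + 2 * K) ^ card V * real (card V)"
 have R0: "R0 \<ge> 0" using B K by (simp add: R0_def)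
 define C where "C = C1 * R0 + C2 * B"
 have "norm ((\<Sum>d\<in>{d \<in> V \<rightarrow>\<^sub>E {1..Y}. staircase m m d}.
    (\<Prod>v\<in>V. 1 / of_nat (d v)) * H (\<lambda>v\<in>V. ln (real (d v)) / L))
   - of_real (arith_factor m * L ^ (m\<^sup>2)) * (\<integral>x. H x \<partial>lborel_on V)) \<le> C * L ^ (m\<^sup>2 - 1)"
  if L: "L \<ge> 1" and Y: "L < ln (real (Suc Y))" and H: "box_lipschitz V H B K" for L Y H
 proof -
  define h where "h = (\<lambda>d. (\<Prod>v\<in>V. 1 / complex_of_nat (d v)) * H (\<lambda>v\<in>V. ln (real (d v)) / L))"
  define J where "J = (\<integral>x. H x \<partial>lborel_on V)"
  define I where "I = of_real (L ^ card V) * J"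
  define R where "R = R0 * L ^ (card V - 1)"
  \<comment> \<open>This uses the strict inequality L < ln (Y + 1): an entry above Y has a scaled
    logarithm above 1, outside the support of H.\<close>
  have hz: "\<forall>d v. d \<in> V \<rightarrow>\<^sub>E {1..} \<longrightarrow> v \<in> V \<longrightarrow> d v > Y \<longrightarrow> h d = 0"
  proof (intro allI impI)
   fix d v assume d: "d \<in> V \<rightarrow>\<^sub>E {1..}" "v \<in> V" "d v > Y"
   have "ln (real (Suc Y)) \<le> ln (real (d v))" using d by (intro ln_mono) auto
   then have "ln (real (d v)) / L > 1" using Y L by (simp add: less_divide_eq)
   then have "H (\<lambda>v\<in>V. ln (real (d v)) / L) = 0"
   proof (intro box_lipschitz_outside[OF H])
    show "(\<lambda>v\<in>V. ln (real (d v)) / L) \<notin> V \<rightarrow>\<^sub>E {0..1}"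
    proof
     assume "(\<lambda>v\<in>V. ln (real (d v)) / L) \<in> V \<rightarrow>\<^sub>E {0..1}"
     from PiE_mem[OF this d(2)] show False using \<open>ln (real (d v)) / L > 1\<close> d(2) by simp
    qed
   qed simp
   then show "h d = 0" by (simp add: h_def)
  qed
  \<comment> \<open>Scaling the tuple by e translates the logarithms by ln (e v) and splits off the
    product of the 1 / e v.\<close>
  have hJ: "\<forall>e. (\<forall>v\<in>V. e v > 0) \<longrightarrow> norm ((\<Sum>d\<in>V \<rightarrow>\<^sub>E {1..Y}. h (\<lambda>v\<in>V. e v * d v)) - I / (\<Prod>v\<in>V. of_nat (e v)))
    \<le> R * (1 + (\<Sum>v\<in>V. ln (real (e v)))) / (\<Prod>v\<in>V. real (e v))"
  proof (intro allI impI)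
   fix e :: "nat \<times> nat \<Rightarrow> nat" assume e: "\<forall>v\<in>V. e v > 0"
   define pe where "pe = (\<Prod>v\<in>V. real (e v))"
   have pe: "pe > 0" unfolding pe_def using e by (intro prod_pos) auto
   have le: "ln (real (e v)) \<ge> 0" if "v \<in> V" for v using e that by (simp add: Suc_le_eq)
   define S where "S = (\<Sum>d\<in>V \<rightarrow>\<^sub>E {1..Y}. (\<Prod>v\<in>V. 1 / of_nat (d v)) * H (\<lambda>v\<in>V. (ln (real (d v)) + ln (real (e v))) / L))"
   have "(\<Sum>d\<in>V \<rightarrow>\<^sub>E {1..Y}. h (\<lambda>v\<in>V. e v * d v)) = (\<Sum>d\<in>V \<rightarrow>\<^sub>E {1..Y}. (1 / of_real pe) * ((\<Prod>v\<in>V. 1 / of_nat (d v)) * H (\<lambda>v\<in>V. (ln (real (d v)) + ln (real (e v))) / L)))"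
   proof (intro sum.cong refl)
    fix d assume d: "d \<in> V \<rightarrow>\<^sub>E {1..Y}"
    have dpos: "d v > 0" if "v \<in> V" for v using PiE_mem[OF d that] by simp
    have "(\<lambda>v\<in>V. ln (real ((\<lambda>v\<in>V. e v * d v) v)) / L) = (\<lambda>v\<in>V. (ln (real (d v)) + ln (real (e v))) / L)"
     by (intro restrict_ext) (use e dpos in \<open>simp add: ln_mult add.commute\<close>)
    moreover have "(\<Prod>v\<in>V. 1 / complex_of_nat ((\<lambda>v\<in>V. e v * d v) v)) = (1 / of_real pe) * (\<Prod>v\<in>V. 1 / of_nat (d v))"
     by (simp add: pe_def prod_dividef prod.distrib)
    ultimately show "h (\<lambda>v\<in>V. e v * d v) = (1 / of_real pe) * ((\<Prod>v\<in>V. 1 / of_nat (d v)) * H (\<lambda>v\<in>V. (ln (real (d v)) + ln (real (e v))) / L))"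
     by (simp add: h_def)
   qed
   also have "\<dots> = S / of_real pe" by (simp add: S_def sum_divide_distrib)
   finally have 1: "(\<Sum>d\<in>V \<rightarrow>\<^sub>E {1..Y}. h (\<lambda>v\<in>V. e v * d v)) = S / of_real pe" .
   have 2: "I / (\<Prod>v\<in>V. of_nat (e v)) = I / of_real pe" by (simp add: pe_def)
   have 3: "norm (S - I) \<le> R * (1 + (\<Sum>v\<in>V. ln (real (e v))))"
   proof -
    have "norm (S - I) \<le> (2 + 4 * B + 2 * K) ^ card V * (\<Sum>v\<in>V. 1 + ln (real (e v))) * L ^ (card V - 1)"
     unfolding S_def I_def J_def using Y le by (intro multi_log_sum_integral[OF L B K _ V(1) _ H]) auto
    also have "\<dots> \<le> (2 + 4 * B + 2 * K) ^ card V * (real (card V) * (1 + (\<Sum>v\<in>V. ln (real (e v))))) * L ^ (card V - 1)"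
    proof (intro mult_left_mono mult_right_mono)
     have "0 \<le> (\<Sum>v\<in>V. ln (real (e v)))" using le by (intro sum_nonneg)
     then have "1 * (\<Sum>v\<in>V. ln (real (e v))) \<le> real (card V) * (\<Sum>v\<in>V. ln (real (e v)))" using V(3) by (intro mult_right_mono) auto
     then show "(\<Sum>v\<in>V. 1 + ln (real (e v))) \<le> real (card V) * (1 + (\<Sum>v\<in>V. ln (real (e v))))"
      by (simp add: sum.distrib distrib_left)
    qed (use B K L in auto)
    finally show ?thesis by (simp add: R_def R0_def mult_ac)
   qed
   have "norm (S / of_real pe - I / of_real pe) = norm (S - I) / pe"
    using pe by (simp add: diff_divide_distrib[symmetric] norm_divide)
   then show "norm ((\<Sum>d\<in>V \<rightarrow>\<^sub>E {1..Y}. h (\<lambda>v\<in>V. e v * d v)) - I / (\<Prod>v\<in>V. of_nat (e v)))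
    \<le> R * (1 + (\<Sum>v\<in>V. ln (real (e v)))) / (\<Prod>v\<in>V. real (e v))"
    unfolding 1 2 pe_def[symmetric] using 3 pe by (simp add: divide_right_mono)
  qed
  define E where "E = (\<Prod>p\<in>{p. prime p \<and> p \<le> Y}. local_density V noncrossing (1 / real p))"
  have sets: "{d \<in> V \<rightarrow>\<^sub>E {1..Y}. staircase m m d} = {d \<in> V \<rightarrow>\<^sub>E {1..Y}. \<forall>p. prime p \<longrightarrow> noncrossing {v\<in>V. p dvd d v}}"
  proof (intro Collect_cong conj_cong refl)
   fix d assume d: "d \<in> V \<rightarrow>\<^sub>E {1..Y}"
   have "d v > 0" if "v \<in> V" for v using PiE_mem[OF d that] by simp
   then show "staircase m m d \<longleftrightarrow> (\<forall>p. prime p \<longrightarrow> noncrossing {v\<in>V. p dvd d v})"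
    unfolding V_def by (intro staircase_iff_noncrossing) auto
  qed
  have main: "norm ((\<Sum>d\<in>{d \<in> V \<rightarrow>\<^sub>E {1..Y}. staircase m m d}. h d) - I * of_real E) \<le> C1 * R"
   unfolding sets E_def by (rule C1(2)[OF hz hJ])
  have Ypos: "Y \<ge> 1" using Y L by (cases Y) auto
  \<comment> \<open>Truncating the product of densities costs O(L ^ card V / Y); L <= ln (Y + 1) <=
    Y absorbs the one power of L that must be saved.\<close>
  have LY: "L / real Y \<le> 1"
  proof -
   have "ln (real (Suc Y)) \<le> real Y" using ln_add_one_self_le_self[of "real Y"] by (simp add: add.commute)
   then show ?thesis using Y Ypos by simp
  qed
  have Jb: "norm J \<le> B" unfolding J_def
   using H box_lipschitz_outside[OF H] V(1) by (intro integral_PiM_box(2)) (auto simp: box_lipschitz_def)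
  have "norm (I * of_real E - of_real (arith_factor m * L ^ (m\<^sup>2)) * J) = norm J * L ^ card V * \<bar>arith_factor m - E\<bar>"
  proof -
   have eq: "I * of_real E - of_real (arith_factor m * L ^ (m\<^sup>2)) * J = J * of_real (L ^ card V * (E - arith_factor m))"
    by (simp add: I_def V(2) algebra_simps)
   show ?thesis unfolding eq norm_mult norm_of_real abs_mult using L by (simp add: abs_minus_commute)
  qed
  also have "\<dots> \<le> B * L ^ card V * (C2 / real Y)"
   using Jb C2(2)[OF Ypos] L B by (intro mult_mono) (auto simp: E_def)
  also have "L ^ card V = L ^ (card V - 1) * L" using V(3) by (metis power_minus_mult less_le_trans zero_less_one)
  also have "B * (L ^ (card V - 1) * L) * (C2 / real Y) = (C2 * B * L ^ (card V - 1)) * (L / real Y)" by simp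
  also have "\<dots> \<le> (C2 * B * L ^ (card V - 1)) * 1" using LY C2(1) B L by (intro mult_left_mono) auto
  finally have second: "norm (I * of_real E - of_real (arith_factor m * L ^ (m\<^sup>2)) * J) \<le> C2 * B * L ^ (card V - 1)" by simp
  have "norm ((\<Sum>d\<in>{d \<in> V \<rightarrow>\<^sub>E {1..Y}. staircase m m d}. h d) - of_real (arith_factor m * L ^ (m\<^sup>2)) * J) \<le> C1 * R + C2 * B * L ^ (card V - 1)"
   using norm_triangle_mono[OF main second] by simp
  also have "\<dots> = C * L ^ (m\<^sup>2 - 1)" by (simp add: C_def R_def V(2) algebra_simps)
  finally show ?thesis by (simp only: h_def J_def)
 qed
 moreover have "C \<ge> 0" using C1 C2 R0 B by (simp add: C_def)
 ultimately show ?thesis unfolding V_def by blast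
qed

section \<open>The integral over the polytope\<close>

definition polytope_fun ::
 "'v set \<Rightarrow> 'i set \<Rightarrow> ('i \<Rightarrow> 'v set) \<Rightarrow> real poly \<Rightarrow> ('v \<Rightarrow> complex) \<Rightarrow> ('v \<Rightarrow> real) \<Rightarrow> complex" where
 "polytope_fun V I c P \<beta> z =
  (if (\<forall>v\<in>V. 0 \<le> z v) \<and> (\<forall>i\<in>I. sum z (c i) \<le> 1)
   then exp (\<Sum>v\<in>V. \<beta> v * of_real (z v)) * of_real (\<Prod>i\<in>I. poly P (1 - sum z (c i))) else 0)"

lemma poly_bounded_lipschitz:
 fixes P :: "real poly"
 shows "\<exists>B\<ge>1. \<exists>K\<ge>0. (\<forall>x\<in>{0..1}. \<bar>poly P x\<bar> \<le> B) \<and> (\<forall>x\<in>{0..1}. \<forall>x'\<in>{0..1}. \<bar>poly P x - poly P x'\<bar> \<le> K * \<bar>x - x'\<bar>)"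
proof -
 have bnd: "\<exists>B. \<forall>x\<in>{0..1}. \<bar>poly Q x\<bar> \<le> B" for Q :: "real poly"
 proof -
  have "compact ((\<lambda>x. \<bar>poly Q x\<bar>) ` {0..1})" by (intro compact_continuous_image continuous_intros) auto
  then have "bdd_above ((\<lambda>x. \<bar>poly Q x\<bar>) ` {0..1})" by (intro bounded_imp_bdd_above compact_imp_bounded)
  then show ?thesis unfolding bdd_above_def by blast
 qed
 obtain B where B: "\<forall>x\<in>{0..1}. \<bar>poly P x\<bar> \<le> B" using bnd by blast
 obtain K where K: "\<forall>x\<in>{0..1}. \<bar>poly (pderiv P) x\<bar> \<le> K" using bnd by blast
 have K0: "K \<ge> 0" using K[rule_format, of 0] by (meson abs_ge_zero atLeastAtMost_iff order_refl order_trans zero_le_one)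
 have "\<bar>poly P x - poly P x'\<bar> \<le> K * \<bar>x - x'\<bar>" if x: "x \<in> {0..1}" "x' \<in> {0..1}" for x x'
 proof -
  have "norm (poly P x - poly P x') \<le> K * norm (x - x')"
  proof (rule field_differentiable_bound[of "{0..1}" "poly P" "poly (pderiv P)"])
   show "norm (poly (pderiv P) z) \<le> K" if "z \<in> {0..1}" for z using K that by simp
   show "(poly P has_field_derivative poly (pderiv P) z) (at z within {0..1})" for z
    by (rule has_field_derivative_at_within[OF poly_DERIV])
  qed (use x in auto)
  then show ?thesis by simp
 qed
 moreover have "\<forall>x\<in>{0..1}. \<bar>poly P x\<bar> \<le> max 1 B" using B by (auto intro: le_max_iff_disj[THEN iffD2])
 ultimately show ?thesis using K0 by (intro exI[of _ "max 1 B"] conjI exI[of _ K]) auto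
qed

lemma abs_prod_diff_le:
 fixes a b :: "'i \<Rightarrow> real"
 assumes "finite I" "B \<ge> 1" "\<And>i. i \<in> I \<Longrightarrow> \<bar>a i\<bar> \<le> B" "\<And>i. i \<in> I \<Longrightarrow> \<bar>b i\<bar> \<le> B"
 shows "\<bar>prod a I - prod b I\<bar> \<le> B ^ card I * (\<Sum>i\<in>I. \<bar>a i - b i\<bar>)"
 using assms(1,3,4)
proof (induction I rule: finite_induct)
 case (insert i I)
 have pb: "\<bar>prod b I\<bar> \<le> B ^ card I"
  unfolding abs_prod using insert.prems assms(2) prod_mono[of I "\<lambda>i. \<bar>b i\<bar>" "\<lambda>_. B"] by simp
 have "prod a (insert i I) - prod b (insert i I) = a i * (prod a I - prod b I) + (a i - b i) * prod b I"
  using insert.hyps by (simp add: algebra_simps)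
 also have "\<bar>\<dots>\<bar> \<le> \<bar>a i\<bar> * \<bar>prod a I - prod b I\<bar> + \<bar>a i - b i\<bar> * \<bar>prod b I\<bar>"
  using abs_triangle_ineq[of "a i * (prod a I - prod b I)" "(a i - b i) * prod b I"] by (simp add: abs_mult)
 also have "\<dots> \<le> B * (B ^ card I * (\<Sum>i\<in>I. \<bar>a i - b i\<bar>)) + \<bar>a i - b i\<bar> * (B * B ^ card I)"
 proof (intro add_mono mult_mono)
  have "1 * B ^ card I \<le> B * B ^ card I" using assms(2) by (intro mult_right_mono) auto
  then show "\<bar>prod b I\<bar> \<le> B * B ^ card I" using pb by simp
 qed (use insert assms(2) in \<open>auto\<close>)
 also have "\<dots> = B ^ card (insert i I) * (\<Sum>i\<in>insert i I. \<bar>a i - b i\<bar>)"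
  using insert.hyps by (simp add: algebra_simps)
 finally show ?case .
qed simp

lemma norm_exp_diff_le:
 fixes x y :: complex
 assumes "norm x \<le> R" "norm y \<le> R"
 shows "norm (exp x - exp y) \<le> exp R * norm (x - y)"
proof (rule field_differentiable_bound[of "cball 0 R" exp exp])
 show "norm (exp z) \<le> exp R" if "z \<in> cball 0 R" for z
  using that norm_exp[of z] by (auto intro: order_trans)
qed (use assms in \<open>auto intro: DERIV_exp has_field_derivative_at_within\<close>)

lemma polytope_fun_measurable:
 fixes V :: "'v set"
 assumes V: "finite V" and I: "finite I" and c: "\<And>i. i \<in> I \<Longrightarrow> c i \<subseteq> V"
 shows "polytope_fun V I c P \<beta> \<in> borel_measurable (lborel_on V)"
proof -
 have comp: "(\<lambda>z. z v) \<in> borel_measurable (lborel_on V)" if "v \<in> V" for v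
  using measurable_component_singleton[OF that, of "\<lambda>_. lborel :: real measure"] by simp
 have of_real_m: "(\<lambda>z. of_real (f z) :: complex) \<in> borel_measurable M" if "f \<in> borel_measurable M" for f :: "('v \<Rightarrow> real) \<Rightarrow> real" and M
 proof -
  have "(of_real :: real \<Rightarrow> complex) \<in> borel_measurable borel" by (intro borel_measurable_continuous_onI continuous_intros)
  from measurable_compose[OF that this] show ?thesis .
 qed
 have s: "(\<lambda>z. sum z (c i)) \<in> borel_measurable (lborel_on V)" if "i \<in> I" for i
  using c[OF that] by (intro borel_measurable_sum comp) auto
 have "Measurable.pred (lborel_on V) (\<lambda>z. \<forall>v\<in>V. 0 \<le> z v)"
 proof (rule pred_intros_finite(3)[OF V])
  fix v assume v: "v \<in> V"
  show "Measurable.pred (lborel_on V) (\<lambda>z. 0 \<le> z v)"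
   unfolding pred_def using borel_measurable_le[OF borel_measurable_const[of 0] comp[OF v]] by simp
 qed
 moreover have "Measurable.pred (lborel_on V) (\<lambda>z. \<forall>i\<in>I. sum z (c i) \<le> 1)"
 proof (rule pred_intros_finite(3)[OF I])
  fix i assume "i \<in> I"
  from s[OF this] show "Measurable.pred (lborel_on V) (\<lambda>z. sum z (c i) \<le> 1)" by measurable
 qed
 ultimately have "Measurable.pred (lborel_on V) (\<lambda>z. (\<forall>v\<in>V. 0 \<le> z v) \<and> (\<forall>i\<in>I. sum z (c i) \<le> 1))"
  by (rule pred_intros_logic(3))
 moreover have "(\<lambda>z. exp (\<Sum>v\<in>V. \<beta> v * of_real (z v)) * of_real (\<Prod>i\<in>I. poly P (1 - sum z (c i)))) \<in> borel_measurable (lborel_on V)"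
 proof (rule borel_measurable_times)
  have m: "(\<lambda>z. \<Sum>v\<in>V. \<beta> v * of_real (z v)) \<in> borel_measurable (lborel_on V)"
   by (intro borel_measurable_sum borel_measurable_times borel_measurable_const of_real_m comp)
  have "exp \<in> borel_measurable (borel :: complex measure)" by (intro borel_measurable_continuous_onI continuous_intros)
  from measurable_compose[OF m this] show "(\<lambda>z. exp (\<Sum>v\<in>V. \<beta> v * of_real (z v))) \<in> borel_measurable (lborel_on V)" .
  have "(\<lambda>z. poly P (1 - sum z (c i))) \<in> borel_measurable (lborel_on V)" if i: "i \<in> I" for i
  proof -
   have "(\<lambda>u. poly P (1 - u)) \<in> borel_measurable (borel :: real measure)" by (intro borel_measurable_continuous_onI continuous_intros)
   from measurable_compose[OF s[OF i] this] show ?thesis .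
  qed
  then show "(\<lambda>z. of_real (\<Prod>i\<in>I. poly P (1 - sum z (c i))) :: complex) \<in> borel_measurable (lborel_on V)"
   by (intro of_real_m borel_measurable_prod)
 qed
 ultimately show ?thesis unfolding polytope_fun_def by (intro measurable_If) (auto simp: pred_def)
qed

text \<open>Along a coordinate v the polytope is cut in an interval from 0 to the least slack of the
  constraints containing v; the covering hypothesis provides such a constraint and hence the end
  point at most 1. B and K depend on \<beta> only through b0.\<close>

lemma box_lipschitz_polytope_fun:
 fixes V :: "'v set" and I :: "'i set" and P :: "real poly"
 assumes V: "finite V" and I: "finite I" and c: "\<And>i. i \<in> I \<Longrightarrow> c i \<subseteq> V" and cov: "\<And>v. v \<in> V \<Longrightarrow> \<exists>i\<in>I. v \<in> c i"
  and b0: "b0 \<ge> 0"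
 shows "\<exists>B\<ge>0. \<exists>K\<ge>0. \<forall>\<beta>. (\<forall>v\<in>V. norm (\<beta> v) \<le> b0) \<longrightarrow> box_lipschitz V (polytope_fun V I c P \<beta>) B K"
proof -
 obtain B1 K1 where B1: "B1 \<ge> 1" "\<And>x. x \<in> {0..1} \<Longrightarrow> \<bar>poly P x\<bar> \<le> B1" and K1: "K1 \<ge> 0"
  "\<And>x x'. x \<in> {0..1} \<Longrightarrow> x' \<in> {0..1} \<Longrightarrow> \<bar>poly P x - poly P x'\<bar> \<le> K1 * \<bar>x - x'\<bar>"
  using poly_bounded_lipschitz[of P] by blast
 define R where "R = b0 * real (card V)"
 define B where "B = exp R * B1 ^ card I"
 define K where "K = exp R * b0 * B1 ^ card I + exp R * (B1 ^ card I * (real (card I) * K1))"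
 have B0: "B \<ge> 0" using B1 by (simp add: B_def)
 have K0: "K \<ge> 0" using B1 K1 b0 by (simp add: K_def)
 have fc: "finite (c i)" if "i \<in> I" for i using c[OF that] V finite_subset by blast
 have "box_lipschitz V (polytope_fun V I c P \<beta>) B K" if \<beta>: "\<forall>v\<in>V. norm (\<beta> v) \<le> b0" for \<beta>
 proof -
  define S where "S = {z :: 'v \<Rightarrow> real. (\<forall>v\<in>V. 0 \<le> z v) \<and> (\<forall>i\<in>I. sum z (c i) \<le> 1)}"
  define X where "X = (\<lambda>z. \<Sum>v\<in>V. \<beta> v * of_real (z v))"
  define Q where "Q = (\<lambda>z. \<Prod>i\<in>I. poly P (1 - sum z (c i)))"
  have f: "polytope_fun V I c P \<beta> z = (if z \<in> S then exp (X z) * of_real (Q z) else 0)" for z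
   by (simp add: polytope_fun_def S_def X_def Q_def)
  have arg: "1 - sum z (c i) \<in> {0..1}" if "z \<in> S" "i \<in> I" for z i
   using that c[OF that(2)] by (auto simp: S_def intro!: sum_nonneg)
  have z1: "0 \<le> z v \<and> z v \<le> 1" if z: "z \<in> S" and v: "v \<in> V" for z v
  proof -
   obtain i where i: "i \<in> I" "v \<in> c i" using cov[OF v] by blast
   have "z v \<le> sum z (c i)" using i fc c z by (intro member_le_sum) (auto simp: S_def)
   then show ?thesis using z i v by (auto simp: S_def)
  qed
  have Xb: "norm (X z) \<le> R" if z: "z \<in> S" for z
  proof -
   have "norm (X z) \<le> (\<Sum>v\<in>V. b0 * 1)" unfolding X_def
   proof (intro sum_norm_le)
    fix v assume v: "v \<in> V"
    have "norm (of_real (z v) :: complex) \<le> 1" using z1[OF z v] by simp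
    then show "norm (\<beta> v * of_real (z v)) \<le> b0 * 1" unfolding norm_mult using \<beta> v b0 by (intro mult_mono) auto
   qed
   then show ?thesis by (simp add: R_def mult.commute)
  qed
  have Qb: "\<bar>Q z\<bar> \<le> B1 ^ card I" if z: "z \<in> S" for z
   unfolding Q_def abs_prod using prod_mono[of I "\<lambda>i. \<bar>poly P (1 - sum z (c i))\<bar>" "\<lambda>_. B1"] B1(2)[OF arg[OF z]] by simp
  have eb: "norm (exp (X z)) \<le> exp R" if z: "z \<in> S" for z
   using norm_exp[of "X z"] Xb[OF z] by (meson exp_le_cancel_iff order_trans)
  show ?thesis
   unfolding box_lipschitz_def
  proof (intro conjI ballI)
   show "polytope_fun V I c P \<beta> \<in> borel_measurable (lborel_on V)" by (rule polytope_fun_measurable[OF V I c])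
   show "norm (polytope_fun V I c P \<beta> z) \<le> B" for z
   proof (cases "z \<in> S")
    case True
    then show ?thesis unfolding f B_def using eb[OF True] Qb[OF True] by (simp add: norm_mult del: norm_exp_eq_Re) (intro mult_mono, auto)
   qed (use B0 in \<open>simp add: f\<close>)
   fix x v assume x: "x \<in> V \<rightarrow>\<^sub>E (UNIV :: real set)" and v: "v \<in> V"
   have su: "sum (x(v := u)) (c i) = (if v \<in> c i then u + sum x (c i - {v}) else sum x (c i))" if i: "i \<in> I" for u i
   proof (cases "v \<in> c i")
    case True
    then have "sum (x(v := u)) (c i) = u + sum (x(v := u)) (c i - {v})" using sum.remove[OF fc[OF i] True, of "x(v := u)"] by simp
    also have "sum (x(v := u)) (c i - {v}) = sum x (c i - {v})" by (intro sum.cong) auto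
    finally show ?thesis using True by simp
   next
    case False
    then show ?thesis by (auto intro!: sum.cong)
   qed
   have "\<exists>b\<le>1. \<forall>u. x(v := u) \<in> S \<longleftrightarrow> u \<in> {0..b}"
   proof (cases "(\<forall>w\<in>V - {v}. 0 \<le> x w) \<and> (\<forall>i\<in>I. v \<notin> c i \<longrightarrow> sum x (c i) \<le> 1)")
    case False
    then have "x(v := u) \<notin> S" for u using su by (auto simp: S_def)
    \<comment> \<open>A violated condition not involving v makes the whole section empty; b = -1
      encodes this.\<close>
    then show ?thesis by (intro exI[of _ "-1"]) auto
   next
    case True
    define J where "J = {i\<in>I. v \<in> c i}"
    have J: "finite J" "J \<noteq> {}" using I cov[OF v] by (auto simp: J_def)
    \<comment> \<open>The least slack left for v by the constraints that contain it.\<close>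
    define b where "b = Min ((\<lambda>i. 1 - sum x (c i - {v})) ` J)"
    have "b \<in> (\<lambda>i. 1 - sum x (c i - {v})) ` J" unfolding b_def using J by (intro Min_in) auto
    then obtain i where i: "i \<in> J" "b = 1 - sum x (c i - {v})" by blast
    have "sum x (c i - {v}) \<ge> 0" using True i c by (intro sum_nonneg) (auto simp: J_def)
    then have b1: "b \<le> 1" using i by simp
    have "x(v := u) \<in> S \<longleftrightarrow> u \<in> {0..b}" for u
    proof -
     have "x(v := u) \<in> S \<longleftrightarrow> 0 \<le> u \<and> (\<forall>i\<in>J. u + sum x (c i - {v}) \<le> 1)"
      using True v su by (auto simp: S_def J_def)
     also have "(\<forall>i\<in>J. u + sum x (c i - {v}) \<le> 1) \<longleftrightarrow> u \<le> b"
      unfolding b_def using J by (subst Min_ge_iff) (auto simp: algebra_simps)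
     finally show ?thesis by (simp only: atLeastAtMost_iff)
    qed
    then show ?thesis using b1 by blast
   qed
   then obtain b where b: "b \<le> 1" "\<And>u. x(v := u) \<in> S \<longleftrightarrow> u \<in> {0..b}" by blast
   have lip: "norm (polytope_fun V I c P \<beta> (x(v := u)) - polytope_fun V I c P \<beta> (x(v := u'))) \<le> K * \<bar>u - u'\<bar>"
    if u: "u \<in> {0..b}" "u' \<in> {0..b}" for u u'
   proof -
    define z where "z = x(v := u)"
    define z' where "z' = x(v := u')"
    have zS: "z \<in> S" "z' \<in> S" using b(2) u by (auto simp: z_def z'_def)
    have "X z - X z' = (\<Sum>w\<in>V. \<beta> w * of_real (z w - z' w))"
     by (simp add: X_def sum_subtractf right_diff_distrib)
    also have "\<dots> = (\<Sum>w\<in>V. if w = v then \<beta> v * of_real (u - u') else 0)"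
     by (intro sum.cong) (auto simp: z_def z'_def)
    also have "\<dots> = \<beta> v * of_real (u - u')" using V v by simp
    finally have Xd: "norm (X z - X z') \<le> b0 * \<bar>u - u'\<bar>"
     using \<beta> v by (simp add: norm_mult mult_right_mono del: of_real_diff)
    have sd: "\<bar>sum z (c i) - sum z' (c i)\<bar> \<le> \<bar>u - u'\<bar>" if "i \<in> I" for i
     unfolding z_def z'_def su[OF that] by auto
    have Qd: "\<bar>Q z - Q z'\<bar> \<le> B1 ^ card I * (real (card I) * K1) * \<bar>u - u'\<bar>"
    proof -
     have "\<bar>Q z - Q z'\<bar> \<le> B1 ^ card I * (\<Sum>i\<in>I. \<bar>poly P (1 - sum z (c i)) - poly P (1 - sum z' (c i))\<bar>)"
      unfolding Q_def using B1(2)[OF arg[OF zS(1)]] B1(2)[OF arg[OF zS(2)]] by (intro abs_prod_diff_le I B1(1))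
     also have "\<dots> \<le> B1 ^ card I * (\<Sum>i\<in>I. K1 * \<bar>u - u'\<bar>)"
     proof (intro mult_left_mono sum_mono)
      fix i assume i: "i \<in> I"
      have "\<bar>poly P (1 - sum z (c i)) - poly P (1 - sum z' (c i))\<bar> \<le> K1 * \<bar>(1 - sum z (c i)) - (1 - sum z' (c i))\<bar>"
       by (intro K1(2) arg zS i)
      also have "\<dots> \<le> K1 * \<bar>u - u'\<bar>" using sd[OF i] K1(1) by (intro mult_left_mono) auto
      finally show "\<bar>poly P (1 - sum z (c i)) - poly P (1 - sum z' (c i))\<bar> \<le> K1 * \<bar>u - u'\<bar>" .
     qed (use B1 in auto)
     finally show ?thesis by simp
    qed
    have "exp (X z) * of_real (Q z) - exp (X z') * of_real (Q z') = (exp (X z) - exp (X z')) * of_real (Q z) + exp (X z') * of_real (Q z - Q z')"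
     by (simp add: algebra_simps)
    also have "norm \<dots> \<le> norm (exp (X z) - exp (X z')) * \<bar>Q z\<bar> + norm (exp (X z')) * \<bar>Q z - Q z'\<bar>"
     by (rule order_trans[OF norm_triangle_ineq]) (simp only: norm_mult norm_of_real order_refl)
    also have "\<dots> \<le> (exp R * (b0 * \<bar>u - u'\<bar>)) * B1 ^ card I + exp R * (B1 ^ card I * (real (card I) * K1) * \<bar>u - u'\<bar>)"
    proof (intro add_mono mult_mono Qd Qb eb zS)
     have "norm (exp (X z) - exp (X z')) \<le> exp R * norm (X z - X z')" by (intro norm_exp_diff_le Xb zS)
     also have "\<dots> \<le> exp R * (b0 * \<bar>u - u'\<bar>)" using Xd by (intro mult_left_mono) auto
     finally show "norm (exp (X z) - exp (X z')) \<le> exp R * (b0 * \<bar>u - u'\<bar>)" .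
    qed (use b0 in auto)
    also have "\<dots> = K * \<bar>u - u'\<bar>" by (simp add: K_def algebra_simps)
    finally show ?thesis unfolding z_def[symmetric] z'_def[symmetric] f using zS by simp
   qed
   show "\<exists>b\<le>1. (\<forall>u\<in>{0..b}. \<forall>u'\<in>{0..b}. norm (polytope_fun V I c P \<beta> (x(v := u)) - polytope_fun V I c P \<beta> (x(v := u'))) \<le> K * \<bar>u - u'\<bar>) \<and>
     (\<forall>u. u \<notin> {0..b} \<longrightarrow> polytope_fun V I c P \<beta> (x(v := u)) = 0)"
    using b lip by (intro exI[of _ b]) (auto simp: f)
  qed
 qed
 then show ?thesis using B0 K0 by blast
qed

text \<open>\<open>Inl j\<close> stands for the column \<open>j\<close> and \<open>Inr i\<close> for the row \<open>i\<close>. In the application the rows \<open>1..k-1\<close>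
 carry the variables \<open>t\<close>, row \<open>k\<close> carries \<open>w\<close> and row \<open>k + 1\<close> carries \<open>x\<close>; the last two rows come from
 the two zeta factors and have no polynomial attached to them.\<close>

definition margin :: "nat \<Rightarrow> nat + nat \<Rightarrow> (nat \<times> nat) set" where
 "margin m = case_sum (\<lambda>j. (\<lambda>i. (i, j)) ` {1..m}) (\<lambda>i. (\<lambda>j. (i, j)) ` {1..m})"

lemma sum_margin: "sum z (margin m (Inl j)) = (\<Sum>i=1..m. z (i, j))" "sum z (margin m (Inr i)) = (\<Sum>j=1..m. z (i, j))"
 by (simp_all add: margin_def sum.reindex inj_on_def)

section \<open>Matrix coordinates and the variables t, w, x\<close>

definition shift_weight :: "nat \<Rightarrow> complex \<Rightarrow> complex \<Rightarrow> nat \<times> nat \<Rightarrow> complex" where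
 "shift_weight k a1 a2 = (\<lambda>(i, j). if i = k then a1 else if i = k + 1 then a2 else 0)"

text \<open>Coordinates are logarithms to base y, so a power c powr \<delta> of a row product
  becomes the exponential of \<delta> * ln y times the row sum.\<close>

abbreviation scaled_shift :: "nat \<Rightarrow> real \<Rightarrow> complex \<Rightarrow> complex \<Rightarrow> nat \<times> nat \<Rightarrow> complex" where
 "scaled_shift k y a1 a2 \<equiv> shift_weight k (a1 * of_real (ln y)) (a2 * of_real (ln y))"

definition glue :: "nat \<Rightarrow> variables \<Rightarrow> nat \<times> nat \<Rightarrow> real" where
 "glue k = (\<lambda>(t, w, x). \<lambda>ij\<in>grid (k+1).
   if fst ij \<le> k - 1 then t ij else if fst ij = k then w (snd ij) else x (snd ij))"

lemma index_split:
 assumes "k \<ge> (1::nat)"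
 shows "{1..k+1} = insert (k+1) (insert k {1..k-1})" "k + 1 \<notin> insert k {1..k-1}" "k \<notin> {1..k-1}"
 using assms by auto

lemma glue_simps:
 assumes "k \<ge> 1" "j \<in> {1..k+1}"
 shows "i \<in> {1..k-1} \<Longrightarrow> glue k (t, w, x) (i, j) = t (i, j)" "glue k (t, w, x) (k, j) = w j" "glue k (t, w, x) (k+1, j) = x j"
 using assms by (auto simp: glue_def)

lemma glue_measurable:
 assumes k: "k \<ge> 1"
 shows "glue k \<in> measurable (variables_measure k) (lborel_on (grid (k+1)))"
proof -
 define M1 where "M1 = lborel_on ({1..k-1} \<times> {1..k+1})"
 define M2 where "M2 = PiM {1..k+1} (\<lambda>_. lborel :: real measure)"
 have VM: "variables_measure k = M1 \<Otimes>\<^sub>M (M2 \<Otimes>\<^sub>M M2)" by (simp add: variables_measure_def M1_def M2_def)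
 have "(\<lambda>v. \<lambda>ij\<in>grid (k+1). if fst ij \<le> k - 1 then fst v ij else if fst ij = k then fst (snd v) (snd ij) else snd (snd v) (snd ij))
   \<in> measurable (variables_measure k) (lborel_on (grid (k+1)))"
 proof (rule measurable_restrict)
  fix ij assume ij: "ij \<in> grid (k+1)"
  obtain i j where e: "ij = (i, j)" "i \<in> {1..k+1}" "j \<in> {1..k+1}" using ij by auto
  consider "i \<le> k - 1" | "i = k" | "i = k + 1" using e k by force
  then show "(\<lambda>v. if fst ij \<le> k - 1 then fst v ij else if fst ij = k then fst (snd v) (snd ij) else snd (snd v) (snd ij)) \<in> measurable (variables_measure k) lborel"
  proof cases
   case 1
   then have "ij \<in> {1..k-1} \<times> {1..k+1}" using e by auto
   from measurable_compose[OF measurable_fst measurable_component_singleton[OF this]]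
   have "(\<lambda>v. fst v ij) \<in> measurable (variables_measure k) lborel" unfolding VM M1_def .
   then show ?thesis using 1 e by simp
  next
   case 2
   have "(\<lambda>v. fst (snd v) j) \<in> measurable (variables_measure k) lborel"
    unfolding VM M2_def
    by (rule measurable_compose[OF measurable_snd measurable_compose[OF measurable_fst measurable_component_singleton[OF e(3)]]])
   moreover have "\<not> k \<le> k - 1" using k by simp
   ultimately show ?thesis using 2 e by (simp only: fst_conv snd_conv if_False if_True refl)
  next
   case 3
   have "(\<lambda>v. snd (snd v) j) \<in> measurable (variables_measure k) lborel"
    unfolding VM M2_def
    by (rule measurable_compose[OF measurable_snd measurable_compose[OF measurable_snd measurable_component_singleton[OF e(3)]]])
   moreover have "\<not> k + 1 \<le> k - 1" "k + 1 \<noteq> k" using k by simp_all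
   ultimately show ?thesis using 3 e by (simp only: fst_conv snd_conv if_False)
  qed
 qed
 then show ?thesis by (simp add: glue_def case_prod_beta)
qed

lemma space_variables_measure:
 "space (variables_measure k) = ({1..k-1} \<times> {1..k+1} \<rightarrow>\<^sub>E UNIV) \<times> (({1..k+1} \<rightarrow>\<^sub>E UNIV) \<times> ({1..k+1} \<rightarrow>\<^sub>E UNIV))"
 by (simp add: variables_measure_def space_pair_measure space_PiM)

text \<open>Product measures are determined on boxes, and the preimage of a box under
  \<open>glue\<close> is a product of three boxes.\<close>

lemma distr_glue:
 assumes k: "k \<ge> 1"
 shows "distr (variables_measure k) (lborel_on (grid (k+1))) (glue k) = lborel_on (grid (k+1))"
proof (rule lborel_prod.PiM_eqI)
 fix A :: "nat \<times> nat \<Rightarrow> real set" assume A: "\<And>i. i \<in> grid (k+1) \<Longrightarrow> A i \<in> sets lborel"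
 define M1 where "M1 = lborel_on ({1..k-1} \<times> {1..k+1})"
 define M2 where "M2 = PiM {1..k+1} (\<lambda>_. lborel :: real measure)"
 have VM: "variables_measure k = M1 \<Otimes>\<^sub>M (M2 \<Otimes>\<^sub>M M2)" by (simp add: variables_measure_def M1_def M2_def)
 have sf2: "sigma_finite_measure M2" unfolding M2_def by (rule lborel_prod.sigma_finite) simp
 interpret P: pair_sigma_finite M2 M2 using sf2 by (simp add: pair_sigma_finite_def)
 have sf22: "sigma_finite_measure (M2 \<Otimes>\<^sub>M M2)" by (rule P.sigma_finite_measure_axioms)
 define X1 where "X1 = PiE ({1..k-1} \<times> {1..k+1}) A"
 define X2 where "X2 = PiE {1..k+1} (\<lambda>j. A (k, j))"
 define X3 where "X3 = PiE {1..k+1} (\<lambda>j. A (k+1, j))"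
 have X1: "X1 \<in> sets M1" "emeasure M1 X1 = (\<Prod>ij\<in>{1..k-1} \<times> {1..k+1}. emeasure lborel (A ij))"
  unfolding X1_def M1_def using A by (auto intro!: sets_PiM_I_finite lborel_prod.emeasure_PiM)
 have X2: "X2 \<in> sets M2" "emeasure M2 X2 = (\<Prod>j\<in>{1..k+1}. emeasure lborel (A (k, j)))"
  unfolding X2_def M2_def using A k by (intro sets_PiM_I_finite lborel_prod.emeasure_PiM; force)+
 have X3: "X3 \<in> sets M2" "emeasure M2 X3 = (\<Prod>j\<in>{1..k+1}. emeasure lborel (A (k+1, j)))"
  unfolding X3_def M2_def using A k by (intro sets_PiM_I_finite lborel_prod.emeasure_PiM; force)+
 have pre: "glue k -` PiE (grid (k+1)) A \<inter> space (variables_measure k) = X1 \<times> (X2 \<times> X3)"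
 proof (intro equalityI subsetI)
  fix v assume "v \<in> glue k -` PiE (grid (k+1)) A \<inter> space (variables_measure k)"
  then obtain t w x where v: "v = (t, w, x)" and g: "glue k (t, w, x) \<in> PiE (grid (k+1)) A"
   and sp: "t \<in> {1..k-1} \<times> {1..k+1} \<rightarrow>\<^sub>E UNIV" "w \<in> {1..k+1} \<rightarrow>\<^sub>E UNIV" "x \<in> {1..k+1} \<rightarrow>\<^sub>E UNIV"
   by (auto simp: space_variables_measure)
  have "t (i, j) \<in> A (i, j)" if "i \<in> {1..k-1}" "j \<in> {1..k+1}" for i j
   using PiE_mem[OF g, of "(i, j)"] that glue_simps(1)[OF k that(2,1), of t w x] by auto
  moreover have "w j \<in> A (k, j)" "x j \<in> A (k+1, j)" if "j \<in> {1..k+1}" for j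
   using PiE_mem[OF g, of "(k, j)"] PiE_mem[OF g, of "(k+1, j)"] that k glue_simps(2,3)[OF k that, of t w x] by auto
  ultimately show "v \<in> X1 \<times> (X2 \<times> X3)" using sp by (auto simp: v X1_def X2_def X3_def PiE_def Pi_def)
 next
  fix v assume "v \<in> X1 \<times> (X2 \<times> X3)"
  then obtain t w x where v: "v = (t, w, x)" and m: "t \<in> X1" "w \<in> X2" "x \<in> X3" by auto
  have "glue k (t, w, x) (i, j) \<in> A (i, j)" if i: "i \<in> {1..k+1}" and j: "j \<in> {1..k+1}" for i j
  proof -
   consider "i \<in> {1..k-1}" | "i = k" | "i = k + 1" using i k by force
   then show ?thesis
   proof cases
    case 1
    then show ?thesis using glue_simps(1)[OF k j 1, of t w x] m(1) j PiE_mem[of t _ A "(i, j)"] by (auto simp: X1_def)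
   next
    case 2
    then show ?thesis using glue_simps(2)[OF k j, of t w x] m(2) j by (auto simp: X2_def)
   next
    case 3
    then show ?thesis using glue_simps(3)[OF k j, of t w x] m(3) j by (auto simp: X3_def)
   qed
  qed
  moreover have "glue k (t, w, x) \<in> extensional (grid (k+1))" by (simp add: glue_def)
  ultimately have "glue k v \<in> PiE (grid (k+1)) A" by (auto simp: v PiE_def Pi_def)
  moreover have "v \<in> space (variables_measure k)" using m by (auto simp: v space_variables_measure X1_def X2_def X3_def PiE_def Pi_def)
  ultimately show "v \<in> glue k -` PiE (grid (k+1)) A \<inter> space (variables_measure k)" by simp
 qed
 have "emeasure (distr (variables_measure k) (lborel_on (grid (k+1))) (glue k)) (PiE (grid (k+1)) A)
   = emeasure (M1 \<Otimes>\<^sub>M (M2 \<Otimes>\<^sub>M M2)) (X1 \<times> (X2 \<times> X3))"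
  unfolding VM[symmetric] pre[symmetric] by (rule emeasure_distr[OF glue_measurable[OF k]]) (use A in \<open>intro sets_PiM_I_finite; simp\<close>)
 also have "\<dots> = emeasure M1 X1 * (emeasure M2 X2 * emeasure M2 X3)"
  using X1(1) X2(1) X3(1) by (simp add: sigma_finite_measure.emeasure_pair_measure_Times[OF sf22] sigma_finite_measure.emeasure_pair_measure_Times[OF sf2])
 also have "\<dots> = (\<Prod>ij\<in>grid (k+1). emeasure lborel (A ij))"
 proof -
  have "(\<Prod>ij\<in>grid (k+1). emeasure lborel (A ij)) = (\<Prod>i\<in>{1..k+1}. \<Prod>j\<in>{1..k+1}. emeasure lborel (A (i, j)))"
   by (subst prod.cartesian_product) (simp only: case_prod_unfold prod.collapse)
  also have "\<dots> = (\<Prod>j\<in>{1..k+1}. emeasure lborel (A (k+1, j))) * ((\<Prod>j\<in>{1..k+1}. emeasure lborel (A (k, j))) * (\<Prod>i\<in>{1..k-1}. \<Prod>j\<in>{1..k+1}. emeasure lborel (A (i, j))))"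
   by (subst index_split(1)[OF k]) (use index_split(2,3)[OF k] in simp)
  also have "(\<Prod>i\<in>{1..k-1}. \<Prod>j\<in>{1..k+1}. emeasure lborel (A (i, j))) = (\<Prod>ij\<in>{1..k-1} \<times> {1..k+1}. emeasure lborel (A ij))"
   by (subst prod.cartesian_product) (simp only: case_prod_unfold prod.collapse)
  finally show ?thesis unfolding X1 X2 X3 by (simp add: mult_ac)
 qed
 finally show "emeasure (distr (variables_measure k) (lborel_on (grid (k+1))) (glue k)) (PiE (grid (k+1)) A) = (\<Prod>ij\<in>grid (k+1). emeasure lborel (A ij))" .
qed auto

text \<open>The row k exponent is \<alpha>1 and the row k + 1 exponent is - \<alpha>2, which gives
  the two signs in the power of y. Columns yield the k + 1 polynomials in t, w, x, rows the
  remaining k - 1.\<close>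

lemma polytope_fun_glue:
 fixes P :: "real poly"
 assumes k: "k \<ge> 1" and y: "y > 0" and v: "v \<in> space (variables_measure k)"
 shows "polytope_fun (grid (k+1)) ({1..k+1} <+> {1..k-1}) (margin (k+1)) P
   (scaled_shift k y \<alpha>1 (- \<alpha>2)) (glue k v)
  = indicator (region k) v *\<^sub>R main_integrand k P y \<alpha>1 \<alpha>2 v"
proof -
 obtain t w x where vv: "v = (t, w, x)" and sp: "t \<in> {1..k-1} \<times> {1..k+1} \<rightarrow>\<^sub>E UNIV" "w \<in> {1..k+1} \<rightarrow>\<^sub>E UNIV" "x \<in> {1..k+1} \<rightarrow>\<^sub>E UNIV"
  using v by (auto simp: space_variables_measure)
 define z where "z = glue k (t, w, x)"
 have zt: "z (i, j) = t (i, j)" if "i \<in> {1..k-1}" "j \<in> {1..k+1}" for i j unfolding z_def using that by (intro glue_simps(1)[OF k])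
 have zw: "z (k, j) = w j" if "j \<in> {1..k+1}" for j unfolding z_def by (rule glue_simps(2)[OF k that])
 have zx: "z (k+1, j) = x j" if "j \<in> {1..k+1}" for j unfolding z_def by (rule glue_simps(3)[OF k that])
 have col: "sum z (margin (k+1) (Inl j)) = (\<Sum>i=1..k-1. t (i, j)) + w j + x j" if j: "j \<in> {1..k+1}" for j
 proof -
  have "sum z (margin (k+1) (Inl j)) = z (k+1, j) + (z (k, j) + (\<Sum>i=1..k-1. z (i, j)))"
   unfolding sum_margin by (subst index_split(1)[OF k]) (use index_split(2,3)[OF k] in simp)
  also have "(\<Sum>i=1..k-1. z (i, j)) = (\<Sum>i=1..k-1. t (i, j))" using zt j by (intro sum.cong) auto
  finally show ?thesis using zw[OF j] zx[OF j] by simp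
 qed
 have row: "sum z (margin (k+1) (Inr i)) = (\<Sum>j=1..k+1. t (i, j))" if i: "i \<in> {1..k-1}" for i
  unfolding sum_margin using zt i by (intro sum.cong) auto
 have nonneg: "(\<forall>v\<in>grid (k+1). 0 \<le> z v) \<longleftrightarrow> (\<forall>i\<in>{1..k-1}. \<forall>j\<in>{1..k+1}. 0 \<le> t (i, j)) \<and> (\<forall>j\<in>{1..k+1}. 0 \<le> w j) \<and> (\<forall>j\<in>{1..k+1}. 0 \<le> x j)"
 proof -
  have "(\<forall>v\<in>grid (k+1). 0 \<le> z v) \<longleftrightarrow> (\<forall>i\<in>{1..k+1}. \<forall>j\<in>{1..k+1}. 0 \<le> z (i, j))" by blast
  also have "\<dots> \<longleftrightarrow> (\<forall>j\<in>{1..k+1}. 0 \<le> z (k+1, j)) \<and> (\<forall>j\<in>{1..k+1}. 0 \<le> z (k, j)) \<and> (\<forall>i\<in>{1..k-1}. \<forall>j\<in>{1..k+1}. 0 \<le> z (i, j))"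
   unfolding index_split(1)[OF k, THEN arg_cong[where f = "\<lambda>A. \<forall>i\<in>A. \<forall>j\<in>{1..k+1}. 0 \<le> z (i, j)"]] by simp
  finally show ?thesis using zt zw zx by auto
 qed
 have reg: "v \<in> region k \<longleftrightarrow> (\<forall>v\<in>grid (k+1). 0 \<le> z v) \<and> (\<forall>i\<in>{1..k+1} <+> {1..k-1}. sum z (margin (k+1) i) \<le> 1)" (is "?l \<longleftrightarrow> ?r")
 proof
  assume ?l
  then have r: "t \<in> ({1..k-1} \<times> {1..k+1}) \<rightarrow>\<^sub>E {0..1}" "w \<in> {1..k+1} \<rightarrow>\<^sub>E {0..1}" "x \<in> {1..k+1} \<rightarrow>\<^sub>E {0..1}"
   "\<forall>i\<in>{1..k-1}. (\<Sum>j=1..k+1. t (i, j)) \<le> 1" "\<forall>j\<in>{1..k+1}. (\<Sum>i=1..k-1. t (i, j)) + w j + x j \<le> 1"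
   by (auto simp: region_def vv)
  have "\<forall>i\<in>{1..k-1}. \<forall>j\<in>{1..k+1}. 0 \<le> t (i, j)" using PiE_mem[OF r(1)] by fastforce
  moreover have "\<forall>j\<in>{1..k+1}. 0 \<le> w j" "\<forall>j\<in>{1..k+1}. 0 \<le> x j" using PiE_mem[OF r(2)] PiE_mem[OF r(3)] by auto
  moreover have "\<forall>i\<in>{1..k+1} <+> {1..k-1}. sum z (margin (k+1) i) \<le> 1"
  proof
   fix i assume "i \<in> {1..k+1} <+> {1..k-1}"
   then show "sum z (margin (k+1) i) \<le> 1"
   proof
    fix j assume "j \<in> {1..k+1}" "i = Inl j"
    then show ?thesis using col[of j] r(5) by simp
   next
    fix j assume "j \<in> {1..k-1}" "i = Inr j"
    then show ?thesis using row[of j] r(4) by simp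
   qed
  qed
  ultimately show ?r unfolding nonneg by blast
 next
  assume r: ?r
  have n: "\<forall>i\<in>{1..k-1}. \<forall>j\<in>{1..k+1}. 0 \<le> t (i, j)" "\<forall>j\<in>{1..k+1}. 0 \<le> w j" "\<forall>j\<in>{1..k+1}. 0 \<le> x j"
   using r unfolding nonneg by blast+
  have cs: "(\<Sum>i=1..k-1. t (i, j)) + w j + x j \<le> 1" if j: "j \<in> {1..k+1}" for j
   using r j unfolding col[OF j, symmetric] by (auto intro: InlI)
  have rs: "(\<Sum>j=1..k+1. t (i, j)) \<le> 1" if i: "i \<in> {1..k-1}" for i
   using r i unfolding row[OF i, symmetric] by (auto intro: InrI)
  have s0: "0 \<le> (\<Sum>i=1..k-1. t (i, j))" if j: "j \<in> {1..k+1}" for j using n(1) j by (intro sum_nonneg) auto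
  \<comment> \<open>The upper bounds 1 in \<open>region\<close> follow from nonnegativity and the
    row or column sums, so only the linear constraints define the region.\<close>
  have t1: "t (i, j) \<le> 1" if i: "i \<in> {1..k-1}" and j: "j \<in> {1..k+1}" for i j
  proof -
   have "t (i, j) \<le> (\<Sum>j=1..k+1. t (i, j))" using n(1) i j by (intro member_le_sum[of j "{1..k+1}" "\<lambda>j. t (i, j)"]) auto
   then show ?thesis using rs[OF i] by linarith
  qed
  have "w j \<le> 1" "x j \<le> 1" if j: "j \<in> {1..k+1}" for j
   using cs[OF j] s0[OF j] bspec[OF n(2) j] bspec[OF n(3) j] by linarith+
  then show ?l unfolding region_def vv using n t1 cs rs sp by (auto simp: PiE_def Pi_def)
 qed
 have lin: "(\<Sum>v\<in>grid (k+1). scaled_shift k y \<alpha>1 (- \<alpha>2) v * of_real (z v))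
   = (\<alpha>1 * of_real (\<Sum>i=1..k+1. w i) - \<alpha>2 * of_real (\<Sum>i=1..k+1. x i)) * of_real (ln y)"
 proof -
  have "(\<Sum>v\<in>grid (k+1). scaled_shift k y \<alpha>1 (- \<alpha>2) v * of_real (z v))
   = (\<Sum>i\<in>{1..k+1}. \<Sum>j\<in>{1..k+1}. scaled_shift k y \<alpha>1 (- \<alpha>2) (i, j) * of_real (z (i, j)))"
   by (subst sum.cartesian_product) (simp only: case_prod_unfold prod.collapse)
  also have "\<dots> = (\<Sum>j\<in>{1..k+1}. (- \<alpha>2 * of_real (ln y)) * of_real (x j)) + ((\<Sum>j\<in>{1..k+1}. (\<alpha>1 * of_real (ln y)) * of_real (w j)) + 0)"
  proof -
   have "(\<Sum>j\<in>{1..k+1}. scaled_shift k y \<alpha>1 (- \<alpha>2) (k+1, j) * of_real (z (k+1, j))) = (\<Sum>j\<in>{1..k+1}. (- \<alpha>2 * of_real (ln y)) * of_real (x j))"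
    using zx by (intro sum.cong refl) (simp add: shift_weight_def)
   moreover have "(\<Sum>j\<in>{1..k+1}. scaled_shift k y \<alpha>1 (- \<alpha>2) (k, j) * of_real (z (k, j))) = (\<Sum>j\<in>{1..k+1}. (\<alpha>1 * of_real (ln y)) * of_real (w j))"
    using zw by (intro sum.cong refl) (simp add: shift_weight_def)
   moreover have "(\<Sum>i\<in>{1..k-1}. \<Sum>j\<in>{1..k+1}. scaled_shift k y \<alpha>1 (- \<alpha>2) (i, j) * of_real (z (i, j))) = 0"
    using k by (intro sum.neutral ballI) (auto simp: shift_weight_def)
   ultimately show ?thesis
    by (subst index_split(1)[OF k]) (simp only: sum.insert[OF _ index_split(2)[OF k]] sum.insert[OF _ index_split(3)[OF k]] finite_insert finite_atLeastAtMost)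
  qed
  finally show ?thesis by (simp only: sum_distrib_left[symmetric] of_real_sum[symmetric]) (simp add: algebra_simps)
 qed
 have "exp (\<Sum>v\<in>grid (k+1). scaled_shift k y \<alpha>1 (- \<alpha>2) v * of_real (z v))
   = of_real y powr (\<alpha>1 * of_real (\<Sum>i=1..k+1. w i) - \<alpha>2 * of_real (\<Sum>i=1..k+1. x i))"
  unfolding lin using y by (simp only: powr_def of_real_eq_0_iff Ln_of_real) simp
 moreover have "(\<Prod>i\<in>{1..k+1} <+> {1..k-1}. poly P (1 - sum z (margin (k+1) i))) =
   (\<Prod>i=1..k-1. poly P (1 - (\<Sum>j=1..k+1. t (i, j)))) * (\<Prod>j=1..k+1. poly P (1 - (\<Sum>i=1..k-1. t (i, j)) - w j - x j))"
 proof -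
  have "(\<Prod>i\<in>{1..k+1} <+> {1..k-1}. poly P (1 - sum z (margin (k+1) i))) =
    (\<Prod>j\<in>{1..k+1}. poly P (1 - sum z (margin (k+1) (Inl j)))) * (\<Prod>i\<in>{1..k-1}. poly P (1 - sum z (margin (k+1) (Inr i))))"
   by (simp only: prod.Plus finite_atLeastAtMost o_def)
  also have "(\<Prod>j\<in>{1..k+1}. poly P (1 - sum z (margin (k+1) (Inl j)))) = (\<Prod>j=1..k+1. poly P (1 - (\<Sum>i=1..k-1. t (i, j)) - w j - x j))"
   by (intro prod.cong refl arg_cong[of _ _ "poly P"]) (simp only: col diff_diff_eq add.assoc)
  also have "(\<Prod>i\<in>{1..k-1}. poly P (1 - sum z (margin (k+1) (Inr i)))) = (\<Prod>i=1..k-1. poly P (1 - (\<Sum>j=1..k+1. t (i, j))))"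
   by (intro prod.cong refl arg_cong[of _ _ "poly P"]) (simp only: row)
  finally show ?thesis by (simp only: mult.commute)
 qed
 ultimately show ?thesis
  unfolding polytope_fun_def vv z_def[symmetric] main_integrand_def case_prod_conv reg[unfolded vv, symmetric]
  by (auto simp: indicator_def simp del: of_real_mult of_real_prod of_real_sum)
qed

lemma integral_polytope_fun:
 assumes k: "k \<ge> 1" and y: "y > 0"
 shows "(LINT v:region k|variables_measure k. main_integrand k P y \<alpha>1 \<alpha>2 v) =
  (\<integral>z. polytope_fun (grid (k+1)) ({1..k+1} <+> {1..k-1}) (margin (k+1)) P
   (scaled_shift k y \<alpha>1 (- \<alpha>2)) z \<partial>lborel_on (grid (k+1)))"
proof -
 define f where "f = polytope_fun (grid (k+1)) ({1..k+1} <+> {1..k-1}) (margin (k+1)) P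
   (scaled_shift k y \<alpha>1 (- \<alpha>2))"
 have meas: "f \<in> borel_measurable (lborel_on (grid (k+1)))"
  unfolding f_def by (rule polytope_fun_measurable) (auto simp: margin_def)
 have "(\<integral>z. f z \<partial>lborel_on (grid (k+1))) = (\<integral>z. f z \<partial>distr (variables_measure k) (lborel_on (grid (k+1))) (glue k))"
  by (simp only: distr_glue[OF k])
 also have "\<dots> = (\<integral>v. f (glue k v) \<partial>variables_measure k)" by (rule integral_distr[OF glue_measurable[OF k] meas])
 also have "\<dots> = (LINT v:region k|variables_measure k. main_integrand k P y \<alpha>1 \<alpha>2 v)"
  unfolding set_lebesgue_integral_def f_def
  by (intro Bochner_Integration.integral_cong refl polytope_fun_glue[OF k y])
 finally show ?thesis by (simp add: f_def)
qed

section \<open>Oscillatory integrals\<close>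

text \<open>The weight in the variable t itself. The constants c are a parameter, so that estimates
  depend on c but not on T or on the particular weight.\<close>

definition good_weight :: "(nat \<Rightarrow> real) \<Rightarrow> real \<Rightarrow> (real \<Rightarrow> real) \<Rightarrow> bool" where
 "good_weight c T \<phi> \<longleftrightarrow> (\<forall>j x. (deriv ^^ j) \<phi> differentiable (at x)) \<and>
   (\<forall>t. t \<notin> {T / 4..2 * T} \<longrightarrow> \<phi> t = 0) \<and>
   (\<forall>j t. \<bar>(deriv ^^ j) \<phi> t\<bar> \<le> c j * (ln T / T) ^ j)"

text \<open>The interval contains the support [T/4, 2 T] in its interior, so boundary terms vanish.
  A tube of width proportional to T lets Cauchy's estimate bound a derivative at the cost of a
  factor O(1 / T).\<close>

definition complex_nbhd :: "real \<Rightarrow> real \<Rightarrow> complex set" where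
 "complex_nbhd T \<rho> = (\<Union>t\<in>{T / 8..4 * T}. ball (of_real t) (\<rho> * T))"

abbreviation osc_integral :: "real \<Rightarrow> (real \<Rightarrow> real) \<Rightarrow> (complex \<Rightarrow> complex) \<Rightarrow> real \<Rightarrow> complex" where
 "osc_integral T \<phi> g lam \<equiv> integral {T / 8..4 * T} (\<lambda>t. of_real (\<phi> t) * g (of_real t) * exp (\<i> * of_real (lam * t)))"

lemma open_complex_nbhd: "open (complex_nbhd T \<rho>)"
 by (auto simp: complex_nbhd_def)

lemma cball_subset_complex_nbhd:
 assumes "z \<in> complex_nbhd T (\<rho> / 2)"
 shows "cball z (\<rho> / 2 * T) \<subseteq> complex_nbhd T \<rho>"
proof
 fix w assume w: "w \<in> cball z (\<rho> / 2 * T)"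
 obtain t where t: "t \<in> {T / 8..4 * T}" "dist (of_real t) z < \<rho> / 2 * T" using assms by (auto simp: complex_nbhd_def)
 have "dist (of_real t) w \<le> dist (of_real t) z + dist z w" by (rule dist_triangle)
 also have "\<dots> < \<rho> / 2 * T + \<rho> / 2 * T" using t(2) w by (intro add_less_le_mono) auto
 also have "\<dots> = \<rho> * T" by (simp add: algebra_simps)
 finally show "w \<in> complex_nbhd T \<rho>" using t(1) by (auto simp: complex_nbhd_def)
qed

lemma iterated_deriv_eq_0:
 fixes f :: "real \<Rightarrow> real"
 assumes "open S" "\<And>t. t \<in> S \<Longrightarrow> f t = 0" "t \<in> S"
 shows "(deriv ^^ j) f t = 0"
 using assms(3)
proof (induction j arbitrary: t)
 case (Suc j)
 have "((deriv ^^ j) f has_field_derivative 0) (at t)"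
  by (rule has_field_derivative_transform_within_open[OF DERIV_const[of 0] assms(1) Suc.prems]) (simp add: Suc.IH)
 then show ?case by (simp add: DERIV_imp_deriv)
qed (use assms in auto)

lemma good_weight_outside:
 assumes "good_weight c T \<phi>" "t \<notin> {T / 4..2 * T}"
 shows "(deriv ^^ j) \<phi> t = 0"
 by (rule iterated_deriv_eq_0[of "- {T / 4..2 * T}"]) (use assms in \<open>auto simp: good_weight_def\<close>)

lemma good_weight_has_deriv:
 assumes "good_weight c T \<phi>"
 shows "((deriv ^^ j) \<phi> has_real_derivative (deriv ^^ Suc j) \<phi> t) (at t)"
 using assms by (simp add: good_weight_def DERIV_deriv_iff_real_differentiable)

lemma good_weight_continuous:
 assumes "good_weight c T \<phi>"
 shows "continuous_on A ((deriv ^^ j) \<phi>)"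
 using good_weight_has_deriv[OF assms] by (meson DERIV_continuous_on has_field_derivative_at_within)

lemma complex_nbhd_of_real: "T > 0 \<Longrightarrow> \<rho> > 0 \<Longrightarrow> t \<in> {T / 8..4 * T} \<Longrightarrow> of_real t \<in> complex_nbhd T \<rho>"
 by (auto simp: complex_nbhd_def intro!: bexI[of _ t])

lemma holomorphic_has_vector_derivative:
 assumes "g holomorphic_on S" "open S" "of_real t \<in> S"
 shows "((\<lambda>t. g (of_real t)) has_vector_derivative deriv g (of_real t)) (at t within A)"
proof -
 have "(g has_field_derivative deriv g (of_real t)) (at (of_real t) within of_real ` A)"
  using holomorphic_derivI[OF assms] by (rule has_field_derivative_at_within)
 moreover have "(of_real has_vector_derivative (1::complex)) (at t within A)"
  using has_vector_derivative_of_real[of "\<lambda>x. x" 1 "at t within A"] by simp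
 ultimately show ?thesis
  using field_vector_diff_chain_within[of of_real 1 t A g] by (simp add: o_def)
qed

text \<open>Integration by parts \<open>j\<close> times; the statement is for all derivatives of the weight and all
 holomorphic amplitudes at once, so that the two terms of the product rule are again of this form
 (Cauchy's inequality controls \<open>g'\<close> at the price of a smaller neighbourhood).\<close>

lemma oscillatory_integral:
 "\<forall>\<rho>>0. \<forall>l. \<exists>K\<ge>0. \<forall>T \<phi> g M lam. T > 0 \<and> ln T \<ge> 1 \<and> good_weight c T \<phi> \<and> g holomorphic_on complex_nbhd T \<rho> \<and>
   (\<forall>z\<in>complex_nbhd T \<rho>. norm (g z) \<le> M) \<and> lam \<noteq> 0 \<longrightarrow>
   norm (osc_integral T ((deriv ^^ l) \<phi>) g lam)
    \<le> K * (M * T * (ln T / T) ^ l * (ln T / T / \<bar>lam\<bar>) ^ j)"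
proof (induction j)
 case 0
 show ?case
 proof (intro allI impI)
  fix \<rho> :: real and l assume \<rho>: "\<rho> > 0"
  have "norm (osc_integral T ((deriv ^^ l) \<phi>) g lam)
    \<le> 4 * \<bar>c l\<bar> * (M * T * (ln T / T) ^ l * (ln T / T / \<bar>lam\<bar>) ^ 0)"
   if T: "T > 0" "ln T \<ge> 1" and w: "good_weight c T \<phi>" and g: "g holomorphic_on complex_nbhd T \<rho>"
    "\<forall>z\<in>complex_nbhd T \<rho>. norm (g z) \<le> M" for T \<phi> g M lam
  proof -
   have T1: "T \<ge> 1" using T(2) ln_ge_zero_iff[OF T(1)] by linarith
   have M: "M \<ge> 0" using order_trans[OF norm_ge_zero bspec[OF g(2) complex_nbhd_of_real[OF T(1) \<rho>, of T]]] T by simp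
   have "norm (osc_integral T ((deriv ^^ l) \<phi>) g lam)
    \<le> (\<bar>c l\<bar> * (ln T / T) ^ l * M) * (4 * T - T / 8)"
   proof (rule integral_bound)
    show "continuous_on {T / 8..4 * T} (\<lambda>t. of_real ((deriv ^^ l) \<phi> t) * g (of_real t) * exp (\<i> * of_real (lam * t)))"
     using good_weight_continuous[OF w] complex_nbhd_of_real[OF T(1) \<rho>]
     by (intro continuous_intros continuous_on_compose2[OF holomorphic_on_imp_continuous_on[OF g(1)]]) auto
    fix t assume t: "t \<in> {T / 8..4 * T}"
    have "\<bar>(deriv ^^ l) \<phi> t\<bar> \<le> \<bar>c l\<bar> * (ln T / T) ^ l"
    proof -
     have "\<bar>(deriv ^^ l) \<phi> t\<bar> \<le> c l * (ln T / T) ^ l" using w by (auto simp: good_weight_def)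
     also have "\<dots> \<le> \<bar>c l\<bar> * (ln T / T) ^ l"
      by (intro mult_right_mono zero_le_power divide_nonneg_pos abs_ge_self; use T in linarith)
     finally show ?thesis .
    qed
    then have "norm (of_real ((deriv ^^ l) \<phi> t) :: complex) * norm (g (of_real t)) \<le> \<bar>c l\<bar> * (ln T / T) ^ l * M"
     using g(2) complex_nbhd_of_real[OF T(1) \<rho> t] T T1 by (intro mult_mono) auto
    then show "norm (of_real ((deriv ^^ l) \<phi> t) * g (of_real t) * exp (\<i> * of_real (lam * t))) \<le> \<bar>c l\<bar> * (ln T / T) ^ l * M"
     by (simp add: norm_mult)
   qed (use T in auto)
   also have "\<dots> \<le> (\<bar>c l\<bar> * (ln T / T) ^ l * M) * (4 * T)" using T T1 M by (intro mult_left_mono) auto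
   finally show ?thesis by (simp add: mult_ac)
  qed
  then show "\<exists>K\<ge>0. \<forall>T \<phi> g M lam. T > 0 \<and> ln T \<ge> 1 \<and> good_weight c T \<phi> \<and> g holomorphic_on complex_nbhd T \<rho> \<and>
   (\<forall>z\<in>complex_nbhd T \<rho>. norm (g z) \<le> M) \<and> lam \<noteq> 0 \<longrightarrow>
   norm (osc_integral T ((deriv ^^ l) \<phi>) g lam)
    \<le> K * (M * T * (ln T / T) ^ l * (ln T / T / \<bar>lam\<bar>) ^ 0)"
   by (intro exI[of _ "4 * \<bar>c l\<bar>"]) auto
 qed
next
 case (Suc j)
 show ?case
 proof (intro allI impI)
  fix \<rho> :: real and l assume \<rho>: "\<rho> > 0"
  define P where "P = (\<lambda>\<rho> l j K. \<forall>T \<phi> g M lam. T > 0 \<and> ln T \<ge> 1 \<and> good_weight c T \<phi> \<and> g holomorphic_on complex_nbhd T \<rho> \<and>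
   (\<forall>z\<in>complex_nbhd T \<rho>. norm (g z) \<le> M) \<and> lam \<noteq> 0 \<longrightarrow>
   norm (osc_integral T ((deriv ^^ l) \<phi>) g lam)
    \<le> K * (M * T * (ln T / T) ^ l * (ln T / T / \<bar>lam\<bar>) ^ j))"
  obtain K1 where K1: "K1 \<ge> 0" "P \<rho> (Suc l) j K1" using Suc.IH \<rho> unfolding P_def by blast
  obtain K2 where K2: "K2 \<ge> 0" "P (\<rho> / 2) l j K2" using Suc.IH[rule_format, of "\<rho> / 2" l] \<rho> unfolding P_def by auto
  have "P \<rho> l (Suc j) (K1 + 2 / \<rho> * K2)"
   unfolding P_def
  proof (intro allI impI, elim conjE)
   fix T M lam :: real and \<phi> g
   assume T: "T > 0" "ln T \<ge> 1" and w: "good_weight c T \<phi>" and g: "g holomorphic_on complex_nbhd T \<rho>"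
    and gM: "\<forall>z\<in>complex_nbhd T \<rho>. norm (g z) \<le> M" and lam: "lam \<noteq> 0"
   have M: "M \<ge> 0" using order_trans[OF norm_ge_zero bspec[OF gM complex_nbhd_of_real[OF T(1) \<rho>, of T]]] T by simp
   have T1: "T \<ge> 1" using T(2) ln_ge_zero_iff[OF T(1)] by linarith
   define a where "a = T / 8"
   define b where "b = 4 * T"
   have ab: "a \<le> b" using T by (simp add: a_def b_def)
   define f where "f = (\<lambda>l t. complex_of_real ((deriv ^^ l) \<phi> t))"
   define E where "E = (\<lambda>t. exp (\<i> * complex_of_real (lam * t)))"
   have sub: "complex_nbhd T (\<rho> / 2) \<subseteq> complex_nbhd T \<rho>"
    using cball_subset_complex_nbhd[of _ T \<rho>] T \<rho> by (force simp: mult_nonneg_nonneg)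
   have g'hol: "deriv g holomorphic_on complex_nbhd T (\<rho> / 2)"
    using holomorphic_deriv[OF g open_complex_nbhd] sub by (rule holomorphic_on_subset)
   have g'M: "norm (deriv g z) \<le> M / (\<rho> / 2 * T)" if z: "z \<in> complex_nbhd T (\<rho> / 2)" for z
   proof -
    note cb = cball_subset_complex_nbhd[OF z]
    have "norm ((deriv ^^ 1) g z) \<le> fact 1 * M / (\<rho> / 2 * T) ^ 1"
    proof (rule Cauchy_inequality)
     show "g holomorphic_on ball z (\<rho> / 2 * T)" using g cb ball_subset_cball holomorphic_on_subset by blast
     show "continuous_on (cball z (\<rho> / 2 * T)) g" using g cb holomorphic_on_imp_continuous_on holomorphic_on_subset by blast
     show "norm (g x) \<le> M" if "norm (z - x) = \<rho> / 2 * T" for x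
     proof -
      have "x \<in> cball z (\<rho> / 2 * T)" using that by (simp add: dist_norm)
      then show ?thesis using gM cb by blast
     qed
    qed (use T \<rho> in auto)
    then show ?thesis by simp
   qed
   have df: "(f l has_vector_derivative f (Suc l) t) (at t within A)" for l t A
    unfolding f_def
    by (rule has_vector_derivative_of_real[OF has_field_derivative_at_within[OF good_weight_has_deriv[OF w]]])
   have dg: "((\<lambda>t. g (of_real t)) has_vector_derivative deriv g (of_real t)) (at t within {a..b})" if "t \<in> {a..b}" for t
    by (rule holomorphic_has_vector_derivative[OF g open_complex_nbhd]) (use that complex_nbhd_of_real[OF T(1) \<rho>] in \<open>auto simp: a_def b_def\<close>)
   have dE: "(E has_vector_derivative (\<i> * of_real lam * E t)) (at t within A)" for t A
   proof -
    have "((\<lambda>z. exp (\<i> * (of_real lam * z))) has_field_derivative (\<i> * of_real lam * exp (\<i> * (of_real lam * of_real t)))) (at (of_real t) within of_real ` A)"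
     by (auto intro!: derivative_eq_intros)
    moreover have "(of_real has_vector_derivative (1::complex)) (at t within A)"
     using has_vector_derivative_of_real[of "\<lambda>x. x" 1 "at t within A"] by simp
    ultimately show ?thesis
     using field_vector_diff_chain_within[of of_real 1 t A "\<lambda>z. exp (\<i> * (of_real lam * z))"] by (simp add: o_def E_def)
   qed
   define F where "F = (\<lambda>t. f l t * g (of_real t) * E t)"
   have dF: "(F has_vector_derivative (f (Suc l) t * g (of_real t) * E t + f l t * deriv g (of_real t) * E t + \<i> * of_real lam * (f l t * g (of_real t) * E t))) (at t within {a..b})" if "t \<in> {a..b}" for t
   proof -
    have "(F has_vector_derivative (f l t * g (of_real t)) * (\<i> * of_real lam * E t) + (f l t * deriv g (of_real t) + f (Suc l) t * g (of_real t)) * E t) (at t within {a..b})"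
     unfolding F_def by (intro has_vector_derivative_mult df dg[OF that] dE)
    then show ?thesis by (simp add: algebra_simps)
   qed
   have "((\<lambda>t. f (Suc l) t * g (of_real t) * E t + f l t * deriv g (of_real t) * E t + \<i> * of_real lam * (f l t * g (of_real t) * E t)) has_integral (F b - F a)) {a..b}"
    by (rule fundamental_theorem_of_calculus[OF ab dF])
   moreover have "F a = 0" "F b = 0" using good_weight_outside[OF w, of a l] good_weight_outside[OF w, of b l] T
    by (auto simp: F_def f_def a_def b_def)
   ultimately have I0: "((\<lambda>t. f (Suc l) t * g (of_real t) * E t + f l t * deriv g (of_real t) * E t + \<i> * of_real lam * (f l t * g (of_real t) * E t)) has_integral 0) {a..b}"
    by simp
   have cf: "continuous_on {a..b} (f l)" for l unfolding f_def by (intro continuous_intros good_weight_continuous[OF w])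
   have cE: "continuous_on {a..b} E" unfolding E_def by (intro continuous_intros)
   have cg: "continuous_on {a..b} (\<lambda>t. g (of_real t))"
    using complex_nbhd_of_real[OF T(1) \<rho>]
    by (intro continuous_on_compose2[OF holomorphic_on_imp_continuous_on[OF g]] continuous_intros) (auto simp: a_def b_def)
   have cg': "continuous_on {a..b} (\<lambda>t. deriv g (of_real t))"
    using complex_nbhd_of_real[OF T(1), of "\<rho> / 2"] \<rho>
    by (intro continuous_on_compose2[OF holomorphic_on_imp_continuous_on[OF g'hol]] continuous_intros) (auto simp: a_def b_def)
   have i1: "(\<lambda>t. f (Suc l) t * g (of_real t) * E t) integrable_on {a..b}"
    and i2: "(\<lambda>t. f l t * deriv g (of_real t) * E t) integrable_on {a..b}"
    and i3: "(\<lambda>t. f l t * g (of_real t) * E t) integrable_on {a..b}"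
    by (intro integrable_continuous_real continuous_intros cf cE cg cg')+
   define I1 where "I1 = integral {a..b} (\<lambda>t. f (Suc l) t * g (of_real t) * E t)"
   define I2 where "I2 = integral {a..b} (\<lambda>t. f l t * deriv g (of_real t) * E t)"
   define I3 where "I3 = integral {a..b} (\<lambda>t. f l t * g (of_real t) * E t)"
   have "((\<lambda>t. f (Suc l) t * g (of_real t) * E t + f l t * deriv g (of_real t) * E t + \<i> * of_real lam * (f l t * g (of_real t) * E t)) has_integral (I1 + I2 + \<i> * of_real lam * I3)) {a..b}"
    unfolding I1_def I2_def I3_def by (intro has_integral_add has_integral_mult_right integrable_integral i1 i2 i3)
   then have "I1 + I2 + \<i> * of_real lam * I3 = 0" using I0 has_integral_unique by blast
   then have "\<i> * of_real lam * I3 = - (I1 + I2)" by (metis add_eq_0_iff)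
   then have "norm (\<i> * of_real lam * I3) = norm (I1 + I2)" by (metis norm_minus_cancel)
   then have "\<bar>lam\<bar> * norm I3 \<le> norm I1 + norm I2" using norm_triangle_ineq[of I1 I2] by (simp add: norm_mult)
   also have "norm I1 \<le> K1 * (M * T * (ln T / T) ^ Suc l * (ln T / T / \<bar>lam\<bar>) ^ j)"
    using K1(2) T w g gM lam unfolding P_def I1_def f_def E_def a_def b_def by blast
   also have "norm I2 \<le> K2 * (M / (\<rho> / 2 * T) * T * (ln T / T) ^ l * (ln T / T / \<bar>lam\<bar>) ^ j)"
    using K2(2)[unfolded P_def, rule_format, of T \<phi> "deriv g" "M / (\<rho> / 2 * T)" lam] T w g'hol g'M lam unfolding I2_def f_def E_def a_def b_def by blast
   finally have "norm I3 \<le> (K1 * (M * T * (ln T / T) ^ Suc l * (ln T / T / \<bar>lam\<bar>) ^ j) + K2 * (M / (\<rho> / 2 * T) * T * (ln T / T) ^ l * (ln T / T / \<bar>lam\<bar>) ^ j)) / \<bar>lam\<bar>"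
    using lam by (simp add: field_simps)
   also have "\<dots> = K1 * (M * T * (ln T / T) ^ l * (ln T / T / \<bar>lam\<bar>) ^ Suc j) + 2 / \<rho> * K2 * (M * (ln T / T) ^ l * (ln T / T / \<bar>lam\<bar>) ^ j * (1 / \<bar>lam\<bar>))"
    using T \<rho> lam by (simp add: field_simps)
   \<comment> \<open>Differentiating g costs only 1 / T. Weakening this to ln T / T, the cost of
     differentiating the weight, gives both terms the same shape.\<close>
   also have "\<dots> \<le> K1 * (M * T * (ln T / T) ^ l * (ln T / T / \<bar>lam\<bar>) ^ Suc j) + 2 / \<rho> * K2 * (M * (ln T / T) ^ l * (ln T / T / \<bar>lam\<bar>) ^ j * (ln T / \<bar>lam\<bar>))"
    using T T1 \<rho> lam M K2(1) by (intro add_left_mono mult_left_mono divide_right_mono) auto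
   also have "\<dots> = (K1 + 2 / \<rho> * K2) * (M * T * (ln T / T) ^ l * (ln T / T / \<bar>lam\<bar>) ^ Suc j)"
    using T by (simp add: algebra_simps add_divide_distrib)
   finally show "norm (osc_integral T ((deriv ^^ l) \<phi>) g lam)
    \<le> (K1 + 2 / \<rho> * K2) * (M * T * (ln T / T) ^ l * (ln T / T / \<bar>lam\<bar>) ^ Suc j)"
    unfolding I3_def f_def E_def a_def b_def .
  qed
  then show "\<exists>K\<ge>0. \<forall>T \<phi> g M lam. T > 0 \<and> ln T \<ge> 1 \<and> good_weight c T \<phi> \<and> g holomorphic_on complex_nbhd T \<rho> \<and>
   (\<forall>z\<in>complex_nbhd T \<rho>. norm (g z) \<le> M) \<and> lam \<noteq> 0 \<longrightarrow>
   norm (osc_integral T ((deriv ^^ l) \<phi>) g lam)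
    \<le> K * (M * T * (ln T / T) ^ l * (ln T / T / \<bar>lam\<bar>) ^ Suc j)"
   unfolding P_def using K1(1) K2(1) \<rho> by (intro exI[of _ "K1 + 2 / \<rho> * K2"]) auto
 qed
qed

text \<open>Each integration by parts gains ln T / (T * |lam|) <= T powr (- \<epsilon> / 2); the
  number of steps is fixed by the desired power.\<close>

lemma oscillatory_integral_negligible:
 assumes \<epsilon>: "\<epsilon> > 0" and \<rho>: "\<rho> > 0"
 shows "\<exists>K\<ge>0. \<exists>T0\<ge>3. \<forall>T\<ge>T0. \<forall>\<phi> g M lam. good_weight c T \<phi> \<and> g holomorphic_on complex_nbhd T \<rho> \<and>
   (\<forall>z\<in>complex_nbhd T \<rho>. norm (g z) \<le> M) \<and> \<bar>lam\<bar> \<ge> T powr (\<epsilon> - 1) \<longrightarrow>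
   norm (osc_integral T \<phi> g lam) \<le> K * M * T powr (- A)"
proof -
 \<comment> \<open>Chosen so that j * \<epsilon> / 2 >= A + 1, the 1 paying for the length T of the
   interval; the absolute value keeps the ceiling nonnegative.\<close>
 define j where "j = nat \<lceil>2 * (\<bar>A\<bar> + 1) / \<epsilon>\<rceil>"
 have j: "real j * (\<epsilon> / 2) \<ge> A + 1"
 proof -
  have "2 * (\<bar>A\<bar> + 1) / \<epsilon> \<le> real j" unfolding j_def using \<epsilon> by linarith
  then have "2 * (\<bar>A\<bar> + 1) / \<epsilon> * (\<epsilon> / 2) \<le> real j * (\<epsilon> / 2)" using \<epsilon> by (intro mult_right_mono) auto
  then show ?thesis using \<epsilon> by simp
 qed
 obtain K where K: "K \<ge> 0" "\<And>T \<phi> g M lam. T > 0 \<and> ln T \<ge> 1 \<and> good_weight c T \<phi> \<and> g holomorphic_on complex_nbhd T \<rho> \<and>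
   (\<forall>z\<in>complex_nbhd T \<rho>. norm (g z) \<le> M) \<and> lam \<noteq> 0 \<Longrightarrow>
   norm (integral {T / 8..4 * T} (\<lambda>t. of_real ((deriv ^^ 0) \<phi> t) * g (of_real t) * exp (\<i> * of_real (lam * t))))
    \<le> K * (M * T * (ln T / T) ^ 0 * (ln T / T / \<bar>lam\<bar>) ^ j)"
  using oscillatory_integral[of c j] \<rho> by blast
 have "eventually (\<lambda>T. ln T \<le> T powr (\<epsilon> / 2)) at_top" using \<epsilon> by real_asymp
 then obtain T1 where T1: "\<And>T. T \<ge> T1 \<Longrightarrow> ln T \<le> T powr (\<epsilon> / 2)" by (auto simp: eventually_at_top_linorder)
 have "norm (osc_integral T \<phi> g lam) \<le> K * M * T powr (- A)"
  if T: "T \<ge> max 3 T1" and h: "good_weight c T \<phi>" "g holomorphic_on complex_nbhd T \<rho>"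
   "\<forall>z\<in>complex_nbhd T \<rho>. norm (g z) \<le> M" "\<bar>lam\<bar> \<ge> T powr (\<epsilon> - 1)" for T \<phi> g M lam
 proof -
  have T0: "T > 0" "T \<ge> 1" using T by auto
  have lT: "ln T \<ge> 1" using T exp_le by (subst ln_ge_iff) auto
  have M: "M \<ge> 0" using order_trans[OF norm_ge_zero bspec[OF h(3) complex_nbhd_of_real[OF T0(1) \<rho>, of T]]] T0 by simp
  have lam: "lam \<noteq> 0" "\<bar>lam\<bar> > 0" using h(4) T0 by (auto intro: less_le_trans[of 0 "T powr (\<epsilon> - 1)"])
  have q: "ln T / T / \<bar>lam\<bar> \<le> T powr (- \<epsilon> / 2)"
  proof -
   have "ln T / T / \<bar>lam\<bar> \<le> T powr (\<epsilon> / 2) / T / T powr (\<epsilon> - 1)"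
    using T1[of T] T T0 h(4) lT by (intro frac_le divide_right_mono) auto
   also have "\<dots> = T powr (\<epsilon> / 2 - 1 - (\<epsilon> - 1))"
   proof -
    have "T powr 1 = T" using T0 by simp
    then show ?thesis by (simp only: powr_diff)
   qed
   also have "\<epsilon> / 2 - 1 - (\<epsilon> - 1) = - \<epsilon> / 2" by (simp add: field_simps)
   finally show ?thesis .
  qed
  have "norm (osc_integral T \<phi> g lam) \<le> K * (M * T * (ln T / T / \<bar>lam\<bar>) ^ j)"
   using K(2)[of T \<phi> g M lam] T0 lT h lam by simp
  also have "\<dots> \<le> K * (M * T * (T powr (- \<epsilon> / 2)) ^ j)"
   using q K(1) M T0 lT lam by (intro mult_left_mono power_mono) auto
  finally have fin: "norm (osc_integral T \<phi> g lam) \<le> K * (M * T * (T powr (- \<epsilon> / 2)) ^ j)" .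
  have "T * (T powr (- \<epsilon> / 2)) ^ j = T powr (1 - real j * (\<epsilon> / 2))"
  proof -
   have "(T powr (- \<epsilon> / 2)) ^ j = T powr (- \<epsilon> / 2 * real j)" using T0 by (simp add: powr_realpow[symmetric] powr_powr)
   then have "T * (T powr (- \<epsilon> / 2)) ^ j = T powr 1 * T powr (- \<epsilon> / 2 * real j)" using T0 by simp
   also have "\<dots> = T powr (1 + - \<epsilon> / 2 * real j)" by (simp only: powr_add)
   also have "1 + - \<epsilon> / 2 * real j = 1 - real j * (\<epsilon> / 2)" by (simp add: field_simps)
   finally show ?thesis .
  qed
  also have "\<dots> \<le> T powr (- A)" using T0 j by (intro powr_mono) auto
  finally have "K * M * (T * (T powr (- \<epsilon> / 2)) ^ j) \<le> K * M * T powr (- A)" using K(1) M by (intro mult_left_mono) auto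
  then show ?thesis using fin by (simp only: mult.assoc)
 qed
 then show ?thesis using K(1) by (intro exI[of _ K] conjI exI[of _ "max 3 T1"]) auto
qed

lemma iterated_deriv_scale:
 fixes f :: "real \<Rightarrow> real"
 assumes f: "smooth_fun f" and T: "T \<noteq> 0"
 shows "(deriv ^^ j) (\<lambda>t. f (t / T)) = (\<lambda>t. (deriv ^^ j) f (t / T) / T ^ j)"
proof (induction j)
 case (Suc j)
 have "((\<lambda>t. (deriv ^^ j) f (t / T) / T ^ j) has_field_derivative (deriv ((deriv ^^ j) f) (t / T) * (1 / T) / T ^ j)) (at t)" for t
 proof -
  have "((deriv ^^ j) f has_field_derivative deriv ((deriv ^^ j) f) (t / T)) (at (t / T))"
   using f by (simp add: smooth_fun_def DERIV_deriv_iff_real_differentiable)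
  then have "((\<lambda>t. (deriv ^^ j) f (t / T)) has_field_derivative (deriv ((deriv ^^ j) f) (t / T) * (1 / T))) (at t)"
   by (rule DERIV_chain2) (use T in \<open>auto intro!: derivative_eq_intros\<close>)
  then show ?thesis by (rule DERIV_cdivide)
 qed
 then have "deriv (\<lambda>t. (deriv ^^ j) f (t / T) / T ^ j) = (\<lambda>t. deriv ((deriv ^^ j) f) (t / T) * (1 / T) / T ^ j)"
  by (intro ext DERIV_imp_deriv)
 then show ?case using Suc.IH by (simp add: field_simps)
qed simp

text \<open>The derivative bounds for each order are collected into one sequence c, fixed before T,
  which is what the uniform oscillatory estimates need.\<close>

lemma good_weight_of_family:
 assumes "weight_family \<Phi>"
 shows "\<exists>c. \<exists>T0>1. \<forall>T\<ge>T0. good_weight c T (\<lambda>t. \<Phi> T (t / T)) \<and> (\<forall>u. 0 \<le> \<Phi> T u \<and> \<Phi> T u \<le> 1) \<and> smooth_fun (\<Phi> T) \<and>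
  (\<forall>u. u \<notin> {1/4..2} \<longrightarrow> \<Phi> T u = 0)"
proof -
 obtain T0 where T0: "T0 > 1" "\<And>T. T \<ge> T0 \<Longrightarrow> smooth_fun (\<Phi> T)" "\<And>T u. T \<ge> T0 \<Longrightarrow> 0 \<le> \<Phi> T u \<and> \<Phi> T u \<le> 1"
   "\<And>T u. T \<ge> T0 \<Longrightarrow> u \<notin> {1/4..2} \<Longrightarrow> \<Phi> T u = 0"
   and ex: "\<forall>j::nat. \<exists>c. \<forall>T\<ge>T0. \<forall>t. \<bar>(deriv ^^ j) (\<lambda>t. \<Phi> T (t / T)) t\<bar> \<le> c * (T / ln T) powr (- real j)"
  using assms unfolding weight_family_def by blast
 obtain c where c: "\<And>j T t. T \<ge> T0 \<Longrightarrow> \<bar>(deriv ^^ j) (\<lambda>t. \<Phi> T (t / T)) t\<bar> \<le> c j * (T / ln T) powr (- real j)"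
  using choice[OF ex] by blast
 have "good_weight c T (\<lambda>t. \<Phi> T (t / T))" if T: "T \<ge> T0" for T
  unfolding good_weight_def
 proof (intro conjI allI impI)
  have T1: "T > 1" using T T0 by simp
  fix j t
  show "(deriv ^^ j) (\<lambda>t. \<Phi> T (t / T)) differentiable at t"
  proof -
   have "(deriv ^^ j) (\<Phi> T) differentiable at (t / T)" using T0(2)[OF T] by (simp add: smooth_fun_def)
   then have "(\<lambda>t. (deriv ^^ j) (\<Phi> T) (t / T)) differentiable at t"
    by (rule differentiable_compose[of "(deriv ^^ j) (\<Phi> T)" "\<lambda>t. t / T"]) (use T1 in \<open>auto intro!: derivative_intros\<close>)
   moreover have Tn: "T \<noteq> 0" using T1 by simp
   ultimately show ?thesis unfolding iterated_deriv_scale[OF T0(2)[OF T] Tn] by (intro differentiable_divide) (use Tn in auto)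
  qed
  have "(T / ln T) powr (- real j) = (ln T / T) ^ j"
   using T1 by (simp add: powr_minus powr_realpow divide_inverse power_mult_distrib power_inverse)
  then show "\<bar>(deriv ^^ j) (\<lambda>t. \<Phi> T (t / T)) t\<bar> \<le> c j * (ln T / T) ^ j" using c[OF T, of j t] by simp
  assume "t \<notin> {T / 4..2 * T}"
  then have "t / T \<notin> {1/4..2}" using T1 by (auto simp: field_simps)
  then show "\<Phi> T (t / T) = 0" using T0(4)[OF T] by blast
 qed
 then show ?thesis using T0 by blast
qed

section \<open>The ratio of the functional equation factors\<close>

text \<open>Radius T / 16 is half of the least abscissa T / 8. Hence Re z >= T / 16 and |Im z| <= T
  / 16, and 1/2 + i * z stays in the region of the digamma estimate.\<close>

abbreviation wide_nbhd :: "real \<Rightarrow> complex set" where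
 "wide_nbhd T \<equiv> complex_nbhd T (1/16)"

lemma sum_inverse_log_bounds:
 fixes T :: real
 assumes T: "T \<ge> 1"
 shows "ln ((T + real m) / T) \<le> (\<Sum>n<m. 1 / (T + real n))" "(\<Sum>n<m. 1 / (T + real n)) \<le> 1 / T + ln ((T + real m) / T)"
proof -
 have step: "1 / (x + 1) \<le> ln (x + 1) - ln x" "ln (x + 1) - ln x \<le> 1 / x" if "x > 0" for x :: real
 proof -
  have "ln (x / (x + 1)) \<le> x / (x + 1) - 1" using that by (intro ln_le_minus_one) auto
  moreover have "x / (x + 1) - 1 = - (1 / (x + 1))" using that by (simp add: field_simps)
  ultimately show "1 / (x + 1) \<le> ln (x + 1) - ln x" using that by (simp add: ln_div)
  have "ln ((x + 1) / x) \<le> (x + 1) / x - 1" using that by (intro ln_le_minus_one) auto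
  moreover have "(x + 1) / x - 1 = 1 / x" using that by (simp add: field_simps)
  ultimately show "ln (x + 1) - ln x \<le> 1 / x" using that by (simp add: ln_div)
 qed
 show "ln ((T + real m) / T) \<le> (\<Sum>n<m. 1 / (T + real n))"
 proof (induction m)
  case (Suc m)
  have p: "T + real m > 0" using T by simp
  have "ln ((T + real (Suc m)) / T) = ln ((T + real m) / T) + (ln ((T + real m) + 1) - ln (T + real m))"
   using T p by (simp add: ln_div add_ac)
  also have "\<dots> \<le> (\<Sum>n<Suc m. 1 / (T + real n))" using Suc.IH step(2)[OF p] by simp
  finally show ?case .
 qed (use T in simp)
 have "(\<Sum>n<m. 1 / (T + real n)) \<le> 1 / T - 1 / (T + real m) + ln ((T + real m) / T)"
 proof (induction m)
  case (Suc m)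
  have p: "T + real m > 0" using T by simp
  have e: "ln ((T + real (Suc m)) / T) = ln ((T + real m) / T) + (ln ((T + real m) + 1) - ln (T + real m))"
   using T p by (simp add: ln_div add_ac)
  have "(\<Sum>n<Suc m. 1 / (T + real n)) \<le> 1 / T - 1 / (T + real m) + ln ((T + real m) / T) + 1 / (T + real m)"
   using Suc.IH by simp
  also have "\<dots> = 1 / T + ln ((T + real m) / T)" by simp
  also have "\<dots> \<le> 1 / T - 1 / (T + real m + 1) + ln ((T + real (Suc m)) / T)"
   unfolding e using step(1)[OF p] by simp
  finally show ?case by (simp add: add_ac)
 qed (use T in simp)
 moreover have "1 / (T + real m) \<ge> 0" using T by simp
 ultimately show "(\<Sum>n<m. 1 / (T + real n)) \<le> 1 / T + ln ((T + real m) / T)" by linarith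
qed

text \<open>Only the order of magnitude matters: for \<open>|z| \<asymp> T\<close> away from the negative real axis the digamma
 function is \<open>ln T + O(1)\<close>, by comparing the series at \<open>z\<close> and at \<open>T\<close>.\<close>

lemma Digamma_bound:
 fixes z :: complex and T :: real
 assumes T: "T \<ge> 1" and Im: "Im z \<ge> T / 20" and Re: "\<bar>Re z\<bar> \<le> T / 8" and nz: "norm z \<le> 6 * T"
 shows "norm (Digamma z - of_real (ln T)) \<le> 1200"
proof -
 have z0: "z \<notin> \<int>\<^sub>\<le>\<^sub>0" using Im T by (auto elim!: nonpos_Ints_cases)
 \<comment> \<open>For n <= T the imaginary part of z gives the bound, for larger n the real part of
   z + n.\<close>
 have lower: "norm (z + of_nat n) \<ge> (T + real n) / 40" for n
 proof (cases "real n \<le> T")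
  case True
  have "(T + real n) / 40 \<le> T / 20" using True by simp
  also have "\<dots> \<le> \<bar>Im (z + of_nat n)\<bar>" using Im by simp
  also have "\<dots> \<le> norm (z + of_nat n)" by (rule abs_Im_le_cmod)
  finally show ?thesis .
 next
  case False
  have "(T + real n) / 40 \<le> Re z + real n" using False Re T by (simp add: abs_le_iff)
  also have "\<dots> \<le> \<bar>Re (z + of_nat n)\<bar>" by simp
  also have "\<dots> \<le> norm (z + of_nat n)" by (rule abs_Re_le_cmod)
  finally show ?thesis .
 qed
 have sq: "(\<Sum>n<m. 1 / (T + real n)\<^sup>2) \<le> 2 / T" for m
 proof (cases m)
  case (Suc m')
  have "(\<Sum>n<Suc k. 1 / (T + real n)\<^sup>2) \<le> 1 / T\<^sup>2 + 1 / T - 1 / (T + real k)" for k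
  proof (induction k)
   case (Suc k)
   have p: "T + real k > 0" using T by simp
   have "1 / (T + real (Suc k))\<^sup>2 \<le> 1 / ((T + real k) * (T + real (Suc k)))"
    unfolding power2_eq_square using p by (intro divide_left_mono mult_right_mono mult_pos_pos) auto
   also have "\<dots> = 1 / (T + real k) - 1 / (T + real (Suc k))" using p by (simp add: field_simps)
   finally have "1 / (T + real (Suc k))\<^sup>2 \<le> 1 / (T + real k) - 1 / (T + real (Suc k))" .
   then show ?case using Suc.IH by (subst sum.lessThan_Suc) linarith
  qed (use T in \<open>simp add: power2_eq_square\<close>)
  then have "(\<Sum>n<m. 1 / (T + real n)\<^sup>2) \<le> 1 / T\<^sup>2 + 1 / T - 1 / (T + real m')" unfolding Suc .
  moreover have "1 / (T + real m') \<ge> 0" using T by simp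
  moreover have "1 / T\<^sup>2 \<le> 1 / T" using T by (intro divide_left_mono) (auto simp: power2_eq_square)
  moreover have "2 / T = 1 / T + 1 / T" by simp
  ultimately show ?thesis by linarith
 qed (use T in simp)
 define S where "S = (\<lambda>m. of_real (ln (real m)) - (\<Sum>n<m. inverse (z + of_nat n)))"
 have lim: "S \<longlonglongrightarrow> Digamma z" unfolding S_def by (rule Digamma_LIMSEQ) (use z0 in auto)
 have bound: "norm (S m - of_real (ln T)) \<le> 600 * 1 + 1 + \<bar>ln (real m / (T + real m))\<bar>" if m: "m \<ge> 1" for m
 proof -
  have "norm (1 / of_real (T + real n) - inverse (z + of_nat n)) \<le> 280 * T * (1 / (T + real n)\<^sup>2)" for n
  proof -
   have p: "T + real n > 0" using T by simp
   have "0 < (T + real n) / 40" using p by simp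
   then have zn: "norm (z + of_nat n) > 0" using lower[of n] by (rule less_le_trans)
   then have zn0: "z + of_nat n \<noteq> 0" by auto
   have "complex_of_real (T + real n) \<noteq> 0" using p by (metis of_real_eq_0_iff less_irrefl)
   then have "1 / of_real (T + real n) - inverse (z + of_nat n) = (z - of_real T) / (of_real (T + real n) * (z + of_nat n))"
    using zn0 by (simp add: field_simps)
   then have "norm (1 / of_real (T + real n) - inverse (z + of_nat n)) = norm (z - of_real T) / ((T + real n) * norm (z + of_nat n))"
    using p by (simp only: norm_divide norm_mult norm_of_real abs_of_pos)
   \<comment> \<open>|z - T| <= 6 * T + T, and the factor 40 comes from the lower bound; 280 times
     the sum 2 / T of inverse squares stays below 600.\<close>
   also have "\<dots> \<le> (7 * T) / ((T + real n) * ((T + real n) / 40))"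
    using lower[of n] p zn T norm_triangle_ineq4[of z "of_real T"] nz by (intro frac_le mult_left_mono mult_pos_pos) auto
   also have "\<dots> = 280 * T * (1 / (T + real n)\<^sup>2)" by (simp add: power2_eq_square)
   finally show ?thesis .
  qed
  then have "norm (\<Sum>n<m. 1 / of_real (T + real n) - inverse (z + of_nat n)) \<le> (\<Sum>n<m. 280 * T * (1 / (T + real n)\<^sup>2))"
   by (intro sum_norm_le)
  also have "\<dots> = 280 * T * (\<Sum>n<m. 1 / (T + real n)\<^sup>2)" by (simp add: sum_distrib_left)
  also have "\<dots> \<le> 280 * T * (2 / T)" using sq T by (intro mult_left_mono) auto
  also have "\<dots> \<le> 600" using T by simp
  finally have a: "norm (\<Sum>n<m. 1 / of_real (T + real n) - inverse (z + of_nat n)) \<le> 600" .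
  have "ln ((T + real m) / T) \<le> (\<Sum>n<m. 1 / (T + real n))" "(\<Sum>n<m. 1 / (T + real n)) \<le> 1 / T + ln ((T + real m) / T)"
   by (rule sum_inverse_log_bounds[OF T])+
  moreover have "1 / T \<le> 1" using T by simp
  moreover have "ln ((T + real m) / T) = ln (T + real m) - ln T" "ln (real m / (T + real m)) = ln (real m) - ln (T + real m)"
  proof -
   have "T + real m > 0" using T by simp
   then show "ln ((T + real m) / T) = ln (T + real m) - ln T" "ln (real m / (T + real m)) = ln (real m) - ln (T + real m)"
    using T m by (simp_all add: ln_div)
  qed
  ultimately have b: "\<bar>ln (real m) - (\<Sum>n<m. 1 / (T + real n)) - ln T\<bar> \<le> 1 + \<bar>ln (real m / (T + real m))\<bar>" by linarith
  have "S m - of_real (ln T) = (\<Sum>n<m. 1 / of_real (T + real n) - inverse (z + of_nat n)) + of_real (ln (real m) - (\<Sum>n<m. 1 / (T + real n)) - ln T)"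
   by (simp add: S_def sum_subtractf)
  also have "norm \<dots> \<le> 600 + (1 + \<bar>ln (real m / (T + real m))\<bar>)"
   by (intro order_trans[OF norm_triangle_ineq] add_mono a) (use b in \<open>simp only: norm_of_real\<close>)
  finally show ?thesis by simp
 qed
 have l2: "(\<lambda>m. 600 * 1 + 1 + \<bar>ln (real m / (T + real m))\<bar>) \<longlonglongrightarrow> 601" using T by real_asymp
 have "norm (Digamma z - of_real (ln T)) \<le> 601"
 proof (rule tendsto_le[OF _ l2 tendsto_norm[OF tendsto_diff[OF lim tendsto_const]]])
  show "\<forall>\<^sub>F m in sequentially. norm (S m - of_real (ln T)) \<le> 600 * 1 + 1 + \<bar>ln (real m / (T + real m))\<bar>"
   using bound by (auto simp: eventually_at_top_linorder intro!: exI[of _ 1])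
 qed simp
 then show ?thesis by simp
qed

lemma norm_exp_mult_minus_1_le:
 fixes d e :: complex
 assumes "norm d \<le> 1"
 shows "norm (exp d * (1 + e) - 1) \<le> 3 * (norm d + norm e)"
proof -
 have e3: "exp (1::real) \<le> 3" by (rule exp_le)
 have "norm (exp d - 1) \<le> exp (norm d) * norm d"
 proof -
  have "norm (exp d - exp 0) \<le> exp (norm d) * norm (d - 0)"
  proof (rule field_differentiable_bound[of "cball 0 (norm d)" exp exp])
   show "norm (exp z) \<le> exp (norm d)" if "z \<in> cball 0 (norm d)" for z
    using that norm_exp[of z] by (auto intro: order_trans)
  qed (auto intro: DERIV_exp has_field_derivative_at_within)
  then show ?thesis by simp
 qed
 also have "\<dots> \<le> 3 * norm d"
 proof (intro mult_right_mono)
  have "exp (norm d) \<le> exp 1" using assms by simp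
  then show "exp (norm d) \<le> 3" using e3 by linarith
 qed simp
 finally have 1: "norm (exp d - 1) \<le> 3 * norm d" .
 have "norm (exp d * e) \<le> 3 * norm e"
 proof -
  have "norm (exp d) \<le> exp 1" using norm_exp[of d] assms by (meson exp_le_cancel_iff order_trans)
  then have "norm (exp d) \<le> 3" using e3 by (rule order_trans)
  then show ?thesis unfolding norm_mult by (rule mult_right_mono) simp
 qed
 moreover have eq: "exp d * (1 + e) - 1 = (exp d - 1) + exp d * e" by (simp add: algebra_simps)
 ultimately show ?thesis unfolding eq using 1 norm_triangle_ineq[of "exp d - 1" "exp d * e"] by argo
qed

text \<open>Because chi (s) * chi (1 - s) = 1, the left side is the quotient chi (w) / chi (s). The
  reflection formula with doubled sine eliminates Gamma (1 - w).\<close>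

lemma zeta_chi_ratio:
 assumes s: "Im s > 0" and w: "Im w > 0"
 shows "zeta_chi w * zeta_chi (1 - s) =
  2 powr (w - s) * of_real pi powr (w - s) * (cos (of_real pi * s / 2) / cos (of_real pi * w / 2)) * (Gamma s / Gamma w)"
proof -
 have ni: "x \<notin> \<int>" if "Im x \<noteq> 0" for x :: complex using that by (auto elim!: Ints_cases)
 have sin0: "sin (of_real pi * w / 2) \<noteq> 0"
 proof
  assume "sin (of_real pi * w / 2) = 0"
  then obtain n where "of_real pi * w / 2 = of_real (of_int n * pi)" by (auto simp: sin_eq_0)
  then have "Im (of_real pi * w / 2) = 0" by (metis Im_complex_of_real)
  then show False using w by simp
 qed
 have cos0: "cos (of_real pi * w / 2) \<noteq> 0"
 proof
  assume "cos (of_real pi * w / 2) = 0"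
  then have "Im (of_real pi * w / 2) = 0" unfolding cos_eq_0 by (metis Im_complex_of_real of_real_add of_real_mult of_real_of_int_eq of_real_divide of_real_numeral)
  then show False using w by simp
 qed
 have Gw: "Gamma w \<noteq> 0" using ni[of w] w nonpos_Ints_Int by (auto simp: Gamma_eq_zero_iff)
 have refl: "Gamma (1 - w) = of_real pi / (2 * sin (of_real pi * w / 2) * cos (of_real pi * w / 2) * Gamma w)"
 proof -
  have "Gamma w * Gamma (1 - w) = of_real pi / sin (of_real pi * w)" by (rule Gamma_reflection_complex)
  also have "sin (of_real pi * w) = 2 * sin (of_real pi * w / 2) * cos (of_real pi * w / 2)"
   using sin_double[of "of_real pi * w / 2"] by simp
  finally show ?thesis using Gw sin0 cos0 by (simp add: field_simps)
 qed
 have sc: "sin (of_real pi * (1 - s) / 2) = cos (of_real pi * s / 2)"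
 proof -
  have e: "of_real pi * (1 - s) / 2 = of_real pi / 2 - of_real pi * s / 2" by (simp add: field_simps)
  show ?thesis unfolding e sin_diff by simp
 qed
 have p2: "2 powr (w - s) = 2 powr w * 2 powr (1 - s) / (2 :: complex)" by (simp add: powr_diff)
 have pp: "complex_of_real pi powr (w - s) = of_real pi powr (w - 1) * of_real pi powr (1 - s - 1) * of_real pi" by (simp add: powr_diff powr_minus inverse_eq_divide)
 show ?thesis unfolding zeta_chi_def refl sc p2 pp using sin0 cos0 Gw by (simp add: field_simps)
qed

text \<open>With s = 1/2 + i * z this is chi (s + \<alpha>) / chi (s), continued holomorphically in
  z; it has no oscillation in z to leading order.\<close>

definition chi_ratio :: "complex \<Rightarrow> complex \<Rightarrow> complex" where
 "chi_ratio \<alpha> z = zeta_chi (1/2 + \<alpha> + \<i> * z) * zeta_chi (1/2 - \<i> * z)"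

lemma zeta_chi_holomorphic_Im: "zeta_chi holomorphic_on {s. Im s \<noteq> 0}"
proof -
 have "1 - s \<notin> \<int>\<^sub>\<le>\<^sub>0" if "Im s \<noteq> 0" for s :: complex
  using that by (auto elim!: nonpos_Ints_cases simp: complex_eq_iff)
 then show ?thesis unfolding zeta_chi_def by (auto intro!: holomorphic_intros)
qed

lemma complex_nbhd_coords:
 assumes "z \<in> wide_nbhd T" "T > 0"
 shows "Re z \<ge> T / 16" "\<bar>Im z\<bar> \<le> T / 16" "norm z \<le> 5 * T"
proof -
 obtain t where t: "t \<in> {T / 8..4 * T}" "norm (z - of_real t) < 1/16 * T"
  using assms by (auto simp: complex_nbhd_def dist_norm norm_minus_commute)
 have "\<bar>Re z - t\<bar> < 1/16 * T" "\<bar>Im z\<bar> < 1/16 * T" "T / 8 \<le> t"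
  using abs_Re_le_cmod[of "z - of_real t"] abs_Im_le_cmod[of "z - of_real t"] t by simp_all
 then show "Re z \<ge> T / 16" "\<bar>Im z\<bar> \<le> T / 16" by linarith+
 have "norm z \<le> norm (z - of_real t) + norm (of_real t :: complex)" using norm_triangle_ineq[of "z - of_real t" "of_real t"] by simp
 also have "\<dots> \<le> 1/16 * T + 4 * T" using t assms(2) by (intro add_mono) auto
 finally show "norm z \<le> 5 * T" using assms(2) by simp
qed

lemma chi_ratio_holomorphic:
 assumes T: "T > 16" and \<alpha>: "norm \<alpha> \<le> 1"
 shows "chi_ratio \<alpha> holomorphic_on wide_nbhd T"
proof -
 have "(\<lambda>z. zeta_chi (1/2 + \<alpha> + \<i> * z)) holomorphic_on wide_nbhd T"
 proof -
  have "(zeta_chi \<circ> (\<lambda>z. 1/2 + \<alpha> + \<i> * z)) holomorphic_on wide_nbhd T"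
  proof (rule holomorphic_on_compose_gen[OF _ zeta_chi_holomorphic_Im])
   show "(\<lambda>z. 1/2 + \<alpha> + \<i> * z) ` wide_nbhd T \<subseteq> {s. Im s \<noteq> 0}"
   proof (intro image_subsetI CollectI)
    fix z assume z: "z \<in> wide_nbhd T"
    show "Im (1/2 + \<alpha> + \<i> * z) \<noteq> 0" using complex_nbhd_coords(1)[OF z] T \<alpha> abs_Im_le_cmod[of \<alpha>] by simp
   qed
  qed (intro holomorphic_intros)
  then show ?thesis by (simp add: o_def)
 qed
 moreover have "(\<lambda>z. zeta_chi (1/2 - \<i> * z)) holomorphic_on wide_nbhd T"
 proof -
  have "(zeta_chi \<circ> (\<lambda>z. 1/2 - \<i> * z)) holomorphic_on wide_nbhd T"
  proof (rule holomorphic_on_compose_gen[OF _ zeta_chi_holomorphic_Im])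
   show "(\<lambda>z. 1/2 - \<i> * z) ` wide_nbhd T \<subseteq> {s. Im s \<noteq> 0}"
   proof (intro image_subsetI CollectI)
    fix z assume z: "z \<in> wide_nbhd T"
    show "Im (1/2 - \<i> * z) \<noteq> 0" using complex_nbhd_coords(1)[OF z] T by simp
   qed
  qed (intro holomorphic_intros)
  then show ?thesis by (simp add: o_def)
 qed
 ultimately show ?thesis unfolding chi_ratio_def by (intro holomorphic_intros)
qed

text \<open>The Gamma quotient contributes T powr (- \<alpha>) and the powers of 2 and pi contribute
  (2 * pi) powr \<alpha>; the cosine quotient is 1 + O(|\<alpha>| + 1 / T). The exponential in front
  bounds the main power and is O(1) for shifts O(1 / ln T).\<close>

lemma chi_ratio_approx_aux:
 assumes T: "T \<ge> 100" and \<alpha>: "norm \<alpha> \<le> 1 / 3000" and z: "z \<in> wide_nbhd T"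
 shows "norm (chi_ratio \<alpha> z - of_real (T / (2 * pi)) powr (- \<alpha>)) \<le> exp (norm \<alpha> * ln T) * (3 * (3000 * norm \<alpha> + 400 / T))"
proof -
 define s where "s = 1/2 + \<i> * z"
 define w where "w = s + \<alpha>"
 note zc = complex_nbhd_coords[OF z]
 have \<alpha>c: "\<bar>Re \<alpha>\<bar> \<le> 1" "\<bar>Im \<alpha>\<bar> \<le> 1" using \<alpha> abs_Re_le_cmod[of \<alpha>] abs_Im_le_cmod[of \<alpha>] by linarith+
 have seg: "Im x \<ge> T / 20 \<and> \<bar>Re x\<bar> \<le> T / 8 \<and> norm x \<le> 6 * T" if x: "x \<in> closed_segment s w" for x
 proof -
  obtain u where u: "0 \<le> u" "u \<le> 1" "x = s + of_real u * \<alpha>"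
   using x by (auto simp: closed_segment_def w_def scaleR_conv_of_real algebra_simps)
  have n: "norm (of_real u * \<alpha>) \<le> 1"
  proof -
   have "norm (of_real u * \<alpha>) = u * norm \<alpha>" using u by (simp add: norm_mult)
   also have "\<dots> \<le> 1 * norm \<alpha>" using u by (intro mult_right_mono) auto
   finally show ?thesis using \<alpha> by simp
  qed
  have "\<bar>Re (of_real u * \<alpha>)\<bar> \<le> 1" "\<bar>Im (of_real u * \<alpha>)\<bar> \<le> 1" using n abs_Re_le_cmod abs_Im_le_cmod order_trans by blast+
  moreover have "Re x = 1/2 - Im z + Re (of_real u * \<alpha>)" "Im x = Re z + Im (of_real u * \<alpha>)" by (simp_all add: u s_def)
  moreover have "norm x \<le> 6 * T"
  proof -
   have "norm x \<le> norm (1/2 :: complex) + norm (\<i> * z) + norm (of_real u * \<alpha>)"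
    unfolding u(3) s_def by (intro order_trans[OF norm_triangle_ineq] add_mono order_refl norm_triangle_ineq)
   also have "\<dots> \<le> 1/2 + 5 * T + 1" using n zc T by (simp add: norm_mult)
   finally show ?thesis using T by simp
  qed
  ultimately show ?thesis using zc T by linarith
 qed
 have ws: "s \<in> closed_segment s w" "w \<in> closed_segment s w" by auto
 have Ims: "Im s > 0" "Im w > 0" using seg[OF ws(1)] seg[OF ws(2)] T by linarith+
 have npR: "x \<notin> \<real>\<^sub>\<le>\<^sub>0" if "x \<in> closed_segment s w" for x using seg[OF that] T by (auto simp: complex_nonpos_Reals_iff)
 \<comment> \<open>The derivative of ln_Gamma x - x * ln T is the digamma function minus ln T, which
   is bounded on the segment.\<close>
 have lg: "norm ((ln_Gamma w - of_real (ln T) * w) - (ln_Gamma s - of_real (ln T) * s)) \<le> 1200 * norm (w - s)"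
 proof (rule field_differentiable_bound[of "closed_segment s w" "\<lambda>x. ln_Gamma x - of_real (ln T) * x" "\<lambda>x. Digamma x - of_real (ln T)"])
  fix x assume x: "x \<in> closed_segment s w"
  show "((\<lambda>x. ln_Gamma x - of_real (ln T) * x) has_field_derivative Digamma x - of_real (ln T)) (at x within closed_segment s w)"
   using npR[OF x] by (auto intro!: derivative_eq_intros)
  show "norm (Digamma x - of_real (ln T)) \<le> 1200" using seg[OF x] T by (intro Digamma_bound) auto
 qed (use ws in auto)
 define \<kappa> where "\<kappa> = (ln_Gamma s - of_real (ln T) * s) - (ln_Gamma w - of_real (ln T) * w)"
 have \<kappa>: "norm \<kappa> \<le> 1200 * norm \<alpha>" using lg unfolding \<kappa>_def by (simp add: w_def norm_minus_commute)
 have npI: "s \<notin> \<int>\<^sub>\<le>\<^sub>0" "w \<notin> \<int>\<^sub>\<le>\<^sub>0" using npR[OF ws(1)] npR[OF ws(2)] nonpos_Ints_subset_nonpos_Reals by blast+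
 have gam: "Gamma s / Gamma w = exp (\<kappa> - of_real (ln T) * \<alpha>)"
 proof -
  have "Gamma s / Gamma w = exp (ln_Gamma s - ln_Gamma w)" using npI by (simp add: Gamma_complex_altdef exp_diff)
  also have "ln_Gamma s - ln_Gamma w = \<kappa> - of_real (ln T) * \<alpha>" by (simp add: \<kappa>_def w_def algebra_simps)
  finally show ?thesis .
 qed
 define a where "a = exp (\<i> * of_real pi * s)"
 define b where "b = exp (\<i> * of_real pi * w)"
 \<comment> \<open>In the upper half plane the second exponential of the cosine is exponentially
   small; the bound O(1 / T) is all that is kept.\<close>
 have ab: "norm (exp (\<i> * of_real pi * x)) \<le> 20 / T" if "Im x \<ge> T / 20" for x
 proof -
  have "norm (exp (\<i> * of_real pi * x)) = exp (- (pi * Im x))" by simp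
  also have "\<dots> \<le> exp (- (T / 20))"
  proof -
   have "1 * (T / 20) \<le> pi * Im x" using that pi_gt3 T by (intro mult_mono) auto
   then show ?thesis by simp
  qed
  also have "\<dots> = 1 / exp (T / 20)" by (simp only: exp_minus inverse_eq_divide)
  also have "\<dots> \<le> 1 / (T / 20)"
  proof (intro divide_left_mono)
   show "T / 20 \<le> exp (T / 20)" using exp_ge_add_one_self[of "T / 20"] by linarith
  qed (use T in auto)
  finally show ?thesis by simp
 qed
 have a: "norm a \<le> 20 / T" and b: "norm b \<le> 20 / T" unfolding a_def b_def using ab seg ws by blast+
 have b2: "norm (1 + b) \<ge> 1 / 2"
 proof -
  have "20 / T \<le> 1 / 2" using T by (simp add: field_simps)
  then have "norm b \<le> 1 / 2" using b by linarith
  moreover have "norm (1 :: complex) \<le> norm (1 + b) + norm b" using norm_triangle_ineq4[of "1 + b" b] by simp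
  ultimately show ?thesis by simp
 qed
 then have b0: "1 + b \<noteq> 0" by auto
 define \<eta> where "\<eta> = (a - b) / (1 + b)"
 have \<eta>: "norm \<eta> \<le> 80 / T"
 proof -
  have "norm \<eta> = norm (a - b) / norm (1 + b)" by (simp add: \<eta>_def norm_divide)
  also have "\<dots> \<le> (20 / T + 20 / T) / (1 / 2)"
   using a b b2 norm_triangle_ineq4[of a b] T by (intro frac_le) auto
  finally show ?thesis by simp
 qed
 have cs: "cos (of_real pi * x / 2) = exp (- (\<i> * of_real pi * x / 2)) * (1 + exp (\<i> * of_real pi * x)) / 2" for x
 proof -
  have "exp (\<i> * of_real pi * x) = exp (\<i> * (of_real pi * x / 2)) * exp (\<i> * (of_real pi * x / 2))"
   by (simp add: mult_exp_exp mult_ac)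
  moreover have "exp (- (\<i> * (of_real pi * x / 2))) * exp (\<i> * (of_real pi * x / 2)) = 1" by (simp add: mult_exp_exp)
  ultimately have "exp (- (\<i> * (of_real pi * x / 2))) * (1 + exp (\<i> * of_real pi * x)) = exp (- (\<i> * (of_real pi * x / 2))) + exp (\<i> * (of_real pi * x / 2))"
   by (simp add: distrib_left mult.assoc[symmetric])
  moreover have e1: "\<i> * of_real pi * x / 2 = \<i> * (of_real pi * x / 2)" by simp
  ultimately show ?thesis unfolding cos_exp_eq e1 by (simp only: add.commute)
 qed
 have cr: "cos (of_real pi * s / 2) / cos (of_real pi * w / 2) = exp (\<i> * of_real pi * \<alpha> / 2) * (1 + \<eta>)"
 proof -
  have "cos (of_real pi * s / 2) / cos (of_real pi * w / 2) = exp (- (\<i> * of_real pi * s / 2)) / exp (- (\<i> * of_real pi * w / 2)) * ((1 + a) / (1 + b))"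
   unfolding cs a_def b_def by simp
  also have "exp (- (\<i> * of_real pi * s / 2)) / exp (- (\<i> * of_real pi * w / 2)) = exp (\<i> * of_real pi * \<alpha> / 2)"
   unfolding exp_diff[symmetric] by (rule arg_cong[of _ _ exp]) (simp add: w_def algebra_simps add_divide_distrib)
  also have "(1 + a) / (1 + b) = 1 + \<eta>" using b0 by (simp add: \<eta>_def field_simps)
  finally show ?thesis .
 qed
 \<comment> \<open>The factor exp (i * pi * \<alpha> / 2) is moved into the error, since it differs
   from 1 only by O(|\<alpha>|).\<close>
 define \<delta> where "\<delta> = \<kappa> + \<i> * of_real pi * \<alpha> / 2"
 have \<delta>: "norm \<delta> \<le> 1205 * norm \<alpha>"
 proof -
  have "norm (\<i> * of_real pi * \<alpha> / 2) = pi / 2 * norm \<alpha>" by (simp add: norm_mult norm_divide)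
  also have "\<dots> \<le> 5 * norm \<alpha>" using pi_less_4 by (intro mult_right_mono) auto
  finally show ?thesis using \<kappa> norm_triangle_ineq[of \<kappa> "\<i> * of_real pi * \<alpha> / 2"] by (simp add: \<delta>_def)
 qed
 have T0: "T / (2 * pi) > 0" using T by simp
 define X where "X = complex_of_real (T / (2 * pi)) powr (- \<alpha>)"
 have X: "X = exp (- (\<alpha> * of_real (ln (T / (2 * pi)))))"
  unfolding X_def powr_def using T0 T by (auto simp: Ln_of_real simp del: of_real_divide)
 have nX: "norm X \<le> exp (norm \<alpha> * ln T)"
 proof -
  have "norm X \<le> exp (norm (- (\<alpha> * of_real (ln (T / (2 * pi))))))" unfolding X by (rule norm_exp)
  also have "norm (- (\<alpha> * of_real (ln (T / (2 * pi))))) = norm \<alpha> * \<bar>ln (T / (2 * pi))\<bar>" by (simp add: norm_mult)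
  also have "\<bar>ln (T / (2 * pi))\<bar> \<le> ln T"
  proof -
   have "1 \<le> T / (2 * pi)" using T pi_less_4 by (simp add: field_simps)
   then have "\<bar>ln (T / (2 * pi))\<bar> = ln (T / (2 * pi))" by simp
   also have "\<dots> \<le> ln T" using T pi_gt3 T0 by (intro ln_mono) (auto simp: field_simps)
   finally show ?thesis .
  qed
  finally show ?thesis by (simp add: mult_left_mono)
 qed
 have pw: "2 powr \<alpha> * of_real pi powr \<alpha> * exp (- (of_real (ln T) * \<alpha>)) = X"
 proof -
  have "2 powr \<alpha> = exp (\<alpha> * of_real (ln 2))" "of_real pi powr \<alpha> = exp (\<alpha> * of_real (ln pi))"
   by (simp_all add: powr_def Ln_of_real flip: Ln_of_real)
  then have "2 powr \<alpha> * of_real pi powr \<alpha> * exp (- (of_real (ln T) * \<alpha>)) = exp (\<alpha> * of_real (ln 2) + \<alpha> * of_real (ln pi) + - (of_real (ln T) * \<alpha>))"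
   by (simp only: exp_add)
  also have "\<alpha> * of_real (ln 2) + \<alpha> * of_real (ln pi) + - (of_real (ln T) * \<alpha>) = - (\<alpha> * of_real (ln (T / (2 * pi))))"
  proof -
   have e: "ln (T / (2 * pi)) = ln T - (ln 2 + ln pi)" using T by (simp add: ln_div ln_mult)
   show ?thesis unfolding e by (simp add: algebra_simps)
  qed
  finally show ?thesis by (simp only: X)
 qed
 have "chi_ratio \<alpha> z = zeta_chi w * zeta_chi (1 - s)"
  by (simp add: chi_ratio_def w_def s_def add_ac)
 also have "\<dots> = 2 powr \<alpha> * of_real pi powr \<alpha> * (exp (\<i> * of_real pi * \<alpha> / 2) * (1 + \<eta>)) * exp (\<kappa> - of_real (ln T) * \<alpha>)"
  unfolding zeta_chi_ratio[OF Ims] cr gam by (simp add: w_def)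
 also have "\<dots> = (2 powr \<alpha> * of_real pi powr \<alpha> * exp (- (of_real (ln T) * \<alpha>))) * (exp \<delta> * (1 + \<eta>))"
 proof -
  have "exp \<delta> = exp (\<i> * of_real pi * \<alpha> / 2) * exp \<kappa>" unfolding \<delta>_def exp_add[symmetric] by (simp add: algebra_simps)
  moreover have "exp (\<kappa> - of_real (ln T) * \<alpha>) = exp \<kappa> * exp (- (of_real (ln T) * \<alpha>))" unfolding exp_add[symmetric] by simp
  ultimately show ?thesis by (simp only: mult_ac)
 qed
 also have "\<dots> = X * (exp \<delta> * (1 + \<eta>))" unfolding pw ..
 finally have "chi_ratio \<alpha> z - X = X * (exp \<delta> * (1 + \<eta>) - 1)" by (simp add: algebra_simps)
 then have "norm (chi_ratio \<alpha> z - X) = norm X * norm (exp \<delta> * (1 + \<eta>) - 1)" by (simp add: norm_mult)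
 also have "\<dots> \<le> exp (norm \<alpha> * ln T) * (3 * (norm \<delta> + norm \<eta>))"
  using nX \<delta> \<alpha> by (intro mult_mono norm_exp_mult_minus_1_le) auto
 also have "\<dots> \<le> exp (norm \<alpha> * ln T) * (3 * (3000 * norm \<alpha> + 400 / T))"
 proof (intro mult_left_mono add_mono)
  show "norm \<delta> \<le> 3000 * norm \<alpha>" using \<delta> norm_ge_zero[of \<alpha>] by linarith
  have "80 / T \<le> 400 / T" using T by (intro divide_right_mono) auto
  then show "norm \<eta> \<le> 400 / T" using \<eta> by linarith
 qed auto
 finally show ?thesis by (simp only: X_def)
qed

text \<open>For large T the shifts are below 1 / 3000, which makes the exponent \<delta> of size at
  most 1205 * |\<alpha>| smaller than 1. The factor exp (|\<alpha>| * ln T) is bounded by exp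
  C.\<close>

lemma chi_ratio_approx:
 assumes C: "C > 0"
 shows "\<exists>K\<ge>0. \<exists>T0\<ge>100. \<forall>T\<ge>T0. \<forall>\<alpha>. norm \<alpha> \<le> C / ln T \<longrightarrow> norm \<alpha> \<le> 1 / 3000 \<and>
  chi_ratio \<alpha> holomorphic_on wide_nbhd T \<and>
  norm (of_real (T / (2 * pi)) powr (- \<alpha>) :: complex) \<le> K \<and>
  (\<forall>z\<in>wide_nbhd T. norm (chi_ratio \<alpha> z - of_real (T / (2 * pi)) powr (- \<alpha>)) \<le> K / ln T)"
proof -
 have "eventually (\<lambda>T. ln T \<ge> 3000 * C) at_top" by real_asymp
 then obtain T1 where T1: "\<And>T. T \<ge> T1 \<Longrightarrow> ln T \<ge> 3000 * C" by (auto simp: eventually_at_top_linorder)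
 define K where "K = exp C * (3 * (3000 * C + 400)) + exp C"
 have "norm \<alpha> \<le> 1 / 3000 \<and> chi_ratio \<alpha> holomorphic_on wide_nbhd T \<and>
  norm (of_real (T / (2 * pi)) powr (- \<alpha>) :: complex) \<le> K \<and>
  (\<forall>z\<in>wide_nbhd T. norm (chi_ratio \<alpha> z - of_real (T / (2 * pi)) powr (- \<alpha>)) \<le> K / ln T)"
  if T: "T \<ge> max 100 T1" and \<alpha>: "norm \<alpha> \<le> C / ln T" for T \<alpha>
 proof -
  have T100: "T \<ge> 100" using T by simp
  have lT: "ln T > 0" "ln T \<ge> 3000 * C" using T T1[of T] by auto
  have \<alpha>T: "norm \<alpha> * ln T \<le> C" using \<alpha> lT by (simp add: field_simps)
  have "C / ln T \<le> 1 / 3000" using lT by (simp add: field_simps)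
  then have \<alpha>s: "norm \<alpha> \<le> 1 / 3000" using \<alpha> by linarith
  have eC: "exp (norm \<alpha> * ln T) \<le> exp C" using \<alpha>T by simp
  have lnT: "ln T \<le> T" using ln_le_minus_one[of T] T100 by simp
  have nb: "norm (chi_ratio \<alpha> z - of_real (T / (2 * pi)) powr (- \<alpha>)) \<le> K / ln T" if z: "z \<in> wide_nbhd T" for z
  proof -
   have "norm (chi_ratio \<alpha> z - of_real (T / (2 * pi)) powr (- \<alpha>)) \<le> exp (norm \<alpha> * ln T) * (3 * (3000 * norm \<alpha> + 400 / T))"
    by (rule chi_ratio_approx_aux[OF T100 \<alpha>s z])
   also have "\<dots> \<le> exp C * (3 * (3000 * (C / ln T) + 400 / ln T))"
    using eC \<alpha> lT lnT T100 by (intro mult_mono add_mono mult_left_mono divide_left_mono) auto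
   also have "\<dots> = exp C * (3 * (3000 * C + 400)) / ln T" by (simp add: add_divide_distrib distrib_left)
   also have "\<dots> \<le> K / ln T" using lT by (intro divide_right_mono) (auto simp: K_def)
   finally show ?thesis .
  qed
  have "norm (complex_of_real (T / (2 * pi)) powr (- \<alpha>)) = (T / (2 * pi)) powr (- Re \<alpha>)"
   using T100 by (subst norm_powr_real_powr) auto
  also have "\<dots> = exp (- Re \<alpha> * ln (T / (2 * pi)))" using T100 by (simp add: powr_def)
  also have "\<dots> \<le> exp C"
  proof -
   have "1 \<le> T / (2 * pi)" using T100 pi_less_4 by (simp add: field_simps)
   then have l0: "0 \<le> ln (T / (2 * pi))" by simp
   have "ln (T / (2 * pi)) \<le> ln T" using T100 pi_gt3 by (intro ln_mono) (auto simp: field_simps)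
   then have "- Re \<alpha> * ln (T / (2 * pi)) \<le> norm \<alpha> * ln T" using l0 abs_Re_le_cmod[of \<alpha>] by (intro mult_mono) auto
   then show ?thesis using \<alpha>T by simp
  qed
  also have "\<dots> \<le> K" using C by (simp add: K_def)
  finally have nX: "norm (complex_of_real (T / (2 * pi)) powr (- \<alpha>)) \<le> K" .
  have "chi_ratio \<alpha> holomorphic_on wide_nbhd T"
   by (rule chi_ratio_holomorphic) (use T100 \<alpha>s in auto)
  then show ?thesis using \<alpha>s nb nX by blast
 qed
 moreover have "K \<ge> 0" using C by (simp add: K_def)
 ultimately show ?thesis by (intro exI[of _ K] conjI exI[of _ "max 100 T1"]) auto
qed

section \<open>The moment\<close>

text \<open>The bound involves v alone: a large u only moves the logarithms further apart. This is
  why the length of the zeta polynomials is unrestricted.\<close>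

lemma abs_ln_nat_diff_ge:
 fixes u v :: nat
 assumes "u \<ge> 1" "v \<ge> 1" "u \<noteq> v"
 shows "1 / (2 * real v) \<le> \<bar>ln (real u) - ln (real v)\<bar>"
proof (cases "u < v")
 case True
 have "real v - real u \<ge> 1" using True by linarith
 then have "1 / real v \<le> (real v - real u) / real v" using assms by (intro divide_right_mono) auto
 also have "\<dots> = 1 - real u / real v" using assms by (simp add: diff_divide_distrib)
 also have "\<dots> \<le> - ln (real u / real v)" using ln_le_minus_one[of "real u / real v"] assms by simp
 also have "\<dots> = ln (real v) - ln (real u)" using assms by (simp add: ln_div)
 finally have *: "1 / real v \<le> ln (real v) - ln (real u)" .
 have "1 / (2 * real v) \<le> 1 / real v" using assms by (simp add: field_simps)
 with * show ?thesis by linarith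
next
 case False
 then have uv: "real u - real v \<ge> 1" using assms by linarith
 have "1 / real u * (real u - real v) \<ge> 1 / (2 * real v)"
 proof -
  have "real u \<le> (real u - real v) * (2 * real v)"
  proof -
   \<comment> \<open>Expanding this product, which is nonnegative since u >= v + 1 and v >= 1, gives
     the polynomial form of 1 - v / u >= 1 / (2 * v).\<close>
   have "(real u - real v - 1) * (real v - 1) \<ge> 0" using uv assms by (intro mult_nonneg_nonneg) auto
   moreover have "real u * real v \<ge> real u * 1" using assms by (intro mult_left_mono) auto
   moreover have "(real u - real v) * (real v) \<ge> 1 * real v" using uv by (intro mult_right_mono) auto
   ultimately show ?thesis using uv assms by (simp add: algebra_simps)
  qed
  then show ?thesis using assms by (simp add: field_simps)
 qed
 also have "1 / real u * (real u - real v) = 1 - real v / real u" using assms by (simp add: field_simps)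
 also have "\<dots> \<le> - ln (real v / real u)" using ln_le_minus_one[of "real v / real u"] assms by simp
 also have "\<dots> = ln (real u) - ln (real v)" using assms by (simp add: ln_div)
 finally show ?thesis by linarith
qed

lemma mollifier_coeff_bounded:
 "\<exists>B\<ge>1. \<forall>y>1. \<forall>n\<ge>1. real n \<le> y \<longrightarrow> \<bar>mollifier_coeff P y n\<bar> \<le> B"
proof -
 obtain B where B: "B \<ge> 1" "\<forall>x\<in>{0..1}. \<bar>poly P x\<bar> \<le> B" using poly_bounded_lipschitz[of P] by blast
 have "\<bar>mollifier_coeff P y n\<bar> \<le> B" if "y > 1" "n \<ge> 1" "real n \<le> y" for y n
 proof -
  have "ln (y / real n) / ln y \<in> {0..1}" using that by (auto simp: ln_div)
  then show ?thesis unfolding mollifier_coeff_def using B(2) by blast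
 qed
 then show ?thesis using B(1) by blast
qed

text \<open>Index \<open>0\<close> is the pole term \<open>N powr (1 - s) / (s - 1)\<close> of the approximation of \<open>zeta s\<close> by its first
 \<open>N\<close> terms, where \<open>s = 1/2 - \<delta> - \<i> * z\<close>; it oscillates with the frequency of \<open>N\<close>.\<close>

definition zeta_term :: "nat \<Rightarrow> complex \<Rightarrow> nat \<Rightarrow> complex \<Rightarrow> complex" where
 "zeta_term N \<delta> n z =
   (if n = 0 then of_nat N powr (1/2 + \<delta>) / (- 1/2 - \<delta> - \<i> * z) else of_nat n powr (\<delta> - 1/2))"

definition term_index :: "nat \<Rightarrow> nat \<Rightarrow> nat" where
 "term_index N n = (if n = 0 then N else n)"

abbreviation zeta_sum :: "nat \<Rightarrow> complex \<Rightarrow> real \<Rightarrow> complex" where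
 "zeta_sum N \<delta> t \<equiv> (\<Sum>n\<in>{0..N}. zeta_term N \<delta> n (of_real t) * exp (\<i> * of_real (ln (real (term_index N n)) * t)))"

lemma of_nat_powr_split:
 "n \<ge> 1 \<Longrightarrow> of_nat n powr (a + \<i> * of_real t) = of_nat n powr a * exp (\<i> * of_real (ln (real n) * t))"
 by (simp add: powr_add) (simp add: powr_def mult_ac flip: Ln_of_nat)

lemma sum_zeta_term:
 assumes "N \<ge> 1"
 shows "zeta_sum N \<delta> t =
  (\<Sum>n=1..N. of_nat n powr (- (1/2 - \<delta> - \<i> * of_real t))) +
   of_nat N powr (1 - (1/2 - \<delta> - \<i> * of_real t)) / ((1/2 - \<delta> - \<i> * of_real t) - 1)"
proof -
 have "{0..N} = insert 0 {1..N}" by auto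
 then have "zeta_sum N \<delta> t =
  zeta_term N \<delta> 0 (of_real t) * exp (\<i> * of_real (ln (real N) * t)) +
  (\<Sum>n=1..N. zeta_term N \<delta> n (of_real t) * exp (\<i> * of_real (ln (real (term_index N n)) * t)))"
  by (simp add: term_index_def)
 moreover have "zeta_term N \<delta> n (of_real t) * exp (\<i> * of_real (ln (real (term_index N n)) * t)) = of_nat n powr (- (1/2 - \<delta> - \<i> * of_real t))"
  if "n \<in> {1..N}" for n
 proof -
  have e: "- (1/2 - \<delta> - \<i> * of_real t) = (\<delta> - 1/2) + \<i> * of_real t" by simp
  have "n \<ge> 1" using that by simp
  then show ?thesis unfolding e by (simp only: of_nat_powr_split[of n "\<delta> - 1/2" t]) (simp add: zeta_term_def term_index_def)
 qed
 moreover have "zeta_term N \<delta> 0 (of_real t) * exp (\<i> * of_real (ln (real N) * t)) =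
   of_nat N powr (1 - (1/2 - \<delta> - \<i> * of_real t)) / ((1/2 - \<delta> - \<i> * of_real t) - 1)"
 proof -
  have e: "1 - (1/2 - \<delta> - \<i> * of_real t) = (1/2 + \<delta>) + \<i> * of_real t" "(1/2 - \<delta> - \<i> * of_real t) - 1 = - 1/2 - \<delta> - \<i> * of_real t" by simp_all
  show ?thesis unfolding e of_nat_powr_split[OF assms] by (simp add: zeta_term_def)
 qed
 ultimately show ?thesis by simp
qed

text \<open>Here Re s >= 1/4 and s and s + 1 have norm at most 3 * T, so the general approximation
  has error at most 19 * T^2 * N powr (-1/4).\<close>

lemma zeta_bounds_shift:
 assumes T: "T \<ge> 100" and t: "t \<in> {T / 4..2 * T}" and \<delta>: "norm \<delta> \<le> 1 / 3000" and N: "N \<ge> 1"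
 shows "norm (zeta (1/2 - \<delta> - \<i> * of_real t)) \<le> 20 * T\<^sup>2"
  and "norm (zeta (1/2 - \<delta> - \<i> * of_real t) -
   zeta_sum N \<delta> t)
   \<le> 20 * T\<^sup>2 * real N powr (- 1/4)"
proof -
 define s where "s = 1/2 - \<delta> - \<i> * of_real t"
 have r: "\<bar>Re \<delta>\<bar> \<le> 1/3000" "\<bar>Im \<delta>\<bar> \<le> 1/3000" using \<delta> abs_Re_le_cmod[of \<delta>] abs_Im_le_cmod[of \<delta>] by linarith+
 have Re: "Re s \<ge> 1/4" using r by (simp add: s_def)
 have Im: "\<bar>Im s\<bar> \<ge> 1"
 proof -
  have "t \<ge> 25" using t T by simp
  then show ?thesis using r unfolding s_def by simp
 qed
 have s1: "s \<noteq> 1" using Im by auto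
 have ns: "norm s \<le> 3 * T"
 proof -
  have "norm s \<le> norm (1/2 - \<delta>) + norm (\<i> * of_real t)" unfolding s_def by (rule norm_triangle_ineq4)
  also have "norm (1/2 - \<delta>) \<le> norm (1/2 :: complex) + norm \<delta>" by (rule norm_triangle_ineq4)
  finally show ?thesis using t T \<delta> by (simp add: norm_mult)
 qed
 have ns1: "norm (s + 1) \<le> 3 * T"
 proof -
  have "norm (s + 1) = norm ((3/2 - \<delta>) - \<i> * of_real t)" by (simp add: s_def algebra_simps)
  also have "\<dots> \<le> norm (3/2 - \<delta>) + norm (\<i> * of_real t)" by (rule norm_triangle_ineq4)
  also have "norm (3/2 - \<delta>) \<le> norm (3/2 :: complex) + norm \<delta>" by (rule norm_triangle_ineq4)
  finally show ?thesis using t T \<delta> by (simp add: norm_mult)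
 qed
 have c: "1 + 2 * norm s * norm (s + 1) \<le> 19 * T\<^sup>2"
 proof -
  have "norm s * norm (s + 1) \<le> (3 * T) * (3 * T)" using ns ns1 T by (intro mult_mono) auto
  moreover have "1 \<le> T\<^sup>2" using T by (simp add: one_le_power)
  ultimately show ?thesis by (simp add: power2_eq_square)
 qed
 have E: "norm (zeta s - ((\<Sum>n=1..M. of_nat n powr (- s)) + of_nat M powr (1 - s) / (s - 1))) \<le> 19 * T\<^sup>2 * real M powr (- 1/4)"
  if M: "M \<ge> 1" for M
 proof -
  obtain M' where M': "M = Suc M'" using M by (cases M) auto
  have "norm (zeta s - ((\<Sum>n=1..M. of_nat n powr (- s)) + of_nat M powr (1 - s) / (s - 1))) \<le> (1 + 2 * norm s * norm (s + 1)) * real M powr (- Re s)"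
   unfolding M' using zeta_approx[of s M'] s1 Re by simp
  also have "\<dots> \<le> (19 * T\<^sup>2) * real M powr (- 1/4)"
   using c Re M by (intro mult_mono powr_mono) auto
  finally show ?thesis .
 qed
 have T1: "1 \<le> T\<^sup>2" using T by (simp add: one_le_power)
 show "norm (zeta (1/2 - \<delta> - \<i> * of_real t)) \<le> 20 * T\<^sup>2"
 proof -
  \<comment> \<open>The crude bound for zeta itself is the case of length 1 of the same
    approximation.\<close>
  have "norm (s - 1) \<ge> 1" using abs_Im_le_cmod[of "s - 1"] Im by simp
  then have p: "norm (1 / (s - 1)) \<le> 1" unfolding norm_divide by (simp add: divide_le_eq)
  have "norm (zeta s - (1 + 1 / (s - 1))) \<le> 19 * T\<^sup>2" using E[of 1] by simp
  then have "norm (zeta s) \<le> 19 * T\<^sup>2 + norm (1 + 1 / (s - 1))" using norm_triangle_sub[of "zeta s" "1 + 1 / (s - 1)"] by simp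
  moreover have "norm (1 + 1 / (s - 1)) \<le> 2" using norm_triangle_ineq[of 1 "1 / (s - 1)"] p by simp
  moreover have "2 \<le> T\<^sup>2" using T power_mono[of 100 T 2] by simp
  ultimately show ?thesis unfolding s_def[symmetric] by linarith
 qed
 show "norm (zeta (1/2 - \<delta> - \<i> * of_real t) -
   zeta_sum N \<delta> t)
   \<le> 20 * T\<^sup>2 * real N powr (- 1/4)"
 proof -
  have "19 * T\<^sup>2 * real N powr (- 1/4) \<le> 20 * T\<^sup>2 * real N powr (- 1/4)" by (intro mult_right_mono) auto
  then show ?thesis unfolding sum_zeta_term[OF N] s_def[symmetric] using E[OF N] by linarith
 qed
qed

lemma norm_mult_diff_le:
 fixes a b c d :: complex
 assumes "norm a \<le> Z" "norm b \<le> Z" "norm (a - c) \<le> e" "norm (b - d) \<le> e" "e \<le> Z"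
 shows "norm (a * b - c * d) \<le> 3 * Z * e"
proof -
 have Z: "0 \<le> Z" "0 \<le> e" using assms norm_ge_zero order_trans by blast+
 have "norm c \<le> 2 * Z" using norm_triangle_sub[of c a] assms by (simp add: norm_minus_commute)
 have "a * b - c * d = (a - c) * b + c * (b - d)" by (simp add: algebra_simps)
 then have "norm (a * b - c * d) \<le> norm (a - c) * norm b + norm c * norm (b - d)"
  by (metis norm_mult norm_triangle_ineq)
 also have "\<dots> \<le> e * Z + 2 * Z * e" using assms Z \<open>norm c \<le> 2 * Z\<close> by (intro add_mono mult_mono) auto
 finally show ?thesis by simp
qed

section \<open>Expansion of the integrand into columns and rows\<close>

definition col_weight :: "nat \<Rightarrow> real poly \<Rightarrow> real \<Rightarrow> (nat \<Rightarrow> nat) \<Rightarrow> complex" where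
 "col_weight k P y a = (\<Prod>j\<in>{1..k+1}. of_real (mollifier_coeff P y (a j)) * of_nat (a j) powr (- 1/2))"

text \<open>Rows i < k come from A(1/2 - i t): there n >= 1, and \<open>zeta_term\<close> with shift
  0 is just n powr (-1/2). This lets all k + 1 factors be treated alike.\<close>

definition row_term :: "nat \<Rightarrow> real poly \<Rightarrow> real \<Rightarrow> nat \<Rightarrow> complex \<Rightarrow> complex \<Rightarrow> nat \<Rightarrow> nat \<Rightarrow> complex \<Rightarrow> complex" where
 "row_term k P y N \<delta>1 \<delta>2 i n z =
   (if i < k then of_real (mollifier_coeff P y n) else 1) * zeta_term N (if i < k then 0 else if i = k then \<delta>1 else \<delta>2) n z"

definition row_range :: "nat \<Rightarrow> nat \<Rightarrow> nat \<Rightarrow> nat \<Rightarrow> nat set" where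
 "row_range k Y N i = (if i < k then {1..Y} else {0..N})"

abbreviation col_sum :: "nat \<Rightarrow> real poly \<Rightarrow> real \<Rightarrow> nat \<Rightarrow> real \<Rightarrow> complex" where
 "col_sum k P y Y t \<equiv> (\<Sum>a\<in>{1..k+1} \<rightarrow>\<^sub>E {1..Y}.
   col_weight k P y a * exp (- (\<i> * of_real ((\<Sum>j\<in>{1..k+1}. ln (real (a j))) * t))))"

abbreviation row_sum :: "nat \<Rightarrow> real poly \<Rightarrow> real \<Rightarrow> nat \<Rightarrow> nat \<Rightarrow> complex \<Rightarrow> complex \<Rightarrow> real \<Rightarrow> complex" where
 "row_sum k P y Y N \<delta>1 \<delta>2 t \<equiv> (\<Sum>c\<in>PiE {1..k+1} (row_range k Y N).
   (\<Prod>i\<in>{1..k+1}. row_term k P y N \<delta>1 \<delta>2 i (c i) (of_real t)) *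
   exp (\<i> * of_real ((\<Sum>i\<in>{1..k+1}. ln (real (term_index N (c i)))) * t)))"

lemma dirichlet_poly_alt:
 assumes "y \<ge> 0"
 shows "dirichlet_poly P y s = (\<Sum>n\<in>{1..nat \<lfloor>y\<rfloor>}. of_real (mollifier_coeff P y n) * of_nat n powr (- s))"
proof -
 have "{n::nat. 1 \<le> n \<and> real n \<le> y} = {1..nat \<lfloor>y\<rfloor>}" using assms by (auto simp: le_nat_floor) (linarith)
 then show ?thesis by (simp add: dirichlet_poly_def)
qed

lemma dirichlet_poly_power_cols:
 assumes "y \<ge> 0"
 shows "dirichlet_poly P y (1/2 + \<i> * of_real t) ^ (k + 1) =
  col_sum k P y (nat \<lfloor>y\<rfloor>) t"
proof -
 have "dirichlet_poly P y (1/2 + \<i> * of_real t) =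
   (\<Sum>n\<in>{1..nat \<lfloor>y\<rfloor>}. of_real (mollifier_coeff P y n) * of_nat n powr (- 1/2) * exp (- (\<i> * of_real (ln (real n) * t))))"
  unfolding dirichlet_poly_alt[OF assms]
 proof (intro sum.cong refl)
  fix n assume "n \<in> {1..nat \<lfloor>y\<rfloor>}"
  then have "of_nat n powr (- (1/2 + \<i> * of_real t)) = of_nat n powr (- 1/2) * exp (\<i> * of_real (ln (real n) * (- t)))"
   using of_nat_powr_split[of n "- 1/2" "- t"] by simp
  then show "of_real (mollifier_coeff P y n) * of_nat n powr (- (1/2 + \<i> * of_real t)) =
   of_real (mollifier_coeff P y n) * of_nat n powr (- 1/2) * exp (- (\<i> * of_real (ln (real n) * t)))" by simp
 qed
 then have "dirichlet_poly P y (1/2 + \<i> * of_real t) ^ (k + 1) = (\<Prod>j\<in>{1..k+1}.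
   (\<Sum>n\<in>{1..nat \<lfloor>y\<rfloor>}. of_real (mollifier_coeff P y n) * of_nat n powr (- 1/2) * exp (- (\<i> * of_real (ln (real n) * t)))))"
  by (simp only: prod_constant card_atLeastAtMost) simp
 also have "\<dots> = (\<Sum>a\<in>{1..k+1} \<rightarrow>\<^sub>E {1..nat \<lfloor>y\<rfloor>}. \<Prod>j\<in>{1..k+1}. of_real (mollifier_coeff P y (a j)) * of_nat (a j) powr (- 1/2) * exp (- (\<i> * of_real (ln (real (a j)) * t))))"
  by (rule prod_sum_PiE) auto
 also have "\<dots> = col_sum k P y (nat \<lfloor>y\<rfloor>) t"
 proof (rule sum.cong[OF refl])
  fix a
  have "(\<Prod>j\<in>{1..k+1}. exp (- (\<i> * of_real (ln (real (a j)) * t)))) = exp (\<Sum>j\<in>{1..k+1}. - (\<i> * of_real (ln (real (a j)) * t)))"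
   by (simp only: exp_sum finite_atLeastAtMost)
  also have "(\<Sum>j\<in>{1..k+1}. - (\<i> * of_real (ln (real (a j)) * t))) = - (\<i> * of_real ((\<Sum>j\<in>{1..k+1}. ln (real (a j))) * t))"
   by (simp only: sum_negf sum_distrib_left[symmetric] sum_distrib_right of_real_sum)
  finally show "(\<Prod>j\<in>{1..k+1}. of_real (mollifier_coeff P y (a j)) * of_nat (a j) powr (- 1/2) * exp (- (\<i> * of_real (ln (real (a j)) * t)))) =
    col_weight k P y a * exp (- (\<i> * of_real ((\<Sum>j\<in>{1..k+1}. ln (real (a j))) * t)))"
   unfolding col_weight_def prod.distrib by simp
 qed
 finally show ?thesis .
qed

lemma dirichlet_poly_power_rows:
 assumes y: "y \<ge> 0" and k: "k \<ge> 1"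
 shows "dirichlet_poly P y (1/2 - \<i> * of_real t) ^ (k - 1) *
   (zeta_sum N \<delta>1 t *
   zeta_sum N \<delta>2 t) =
  row_sum k P y (nat \<lfloor>y\<rfloor>) N \<delta>1 \<delta>2 t"
proof -
 define G where "G = (\<lambda>i. \<Sum>n\<in>row_range k (nat \<lfloor>y\<rfloor>) N i. row_term k P y N \<delta>1 \<delta>2 i n (of_real t) * exp (\<i> * of_real (ln (real (term_index N n)) * t)))"
 have "dirichlet_poly P y (1/2 - \<i> * of_real t) = G i" if i: "i \<in> {1..k-1}" for i
  unfolding dirichlet_poly_alt[OF y] G_def
 proof (rule sum.cong)
  fix n assume "n \<in> row_range k (nat \<lfloor>y\<rfloor>) N i"
  moreover have "i < k" using i k by auto
  ultimately have n: "n \<ge> 1" by (simp add: row_range_def)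
  have "of_nat n powr (- (1/2 - \<i> * of_real t)) = of_nat n powr (- 1/2) * exp (\<i> * of_real (ln (real n) * t))"
   using of_nat_powr_split[OF n, of "- 1/2" "t"] by simp
  moreover have "i < k" using i k by auto
  ultimately show "of_real (mollifier_coeff P y n) * of_nat n powr (- (1/2 - \<i> * of_real t)) =
   row_term k P y N \<delta>1 \<delta>2 i n (of_real t) * exp (\<i> * of_real (ln (real (term_index N n)) * t))"
   using n by (simp add: row_term_def zeta_term_def term_index_def)
 qed (use i in \<open>auto simp: row_range_def\<close>)
 then have "(\<Prod>i\<in>{1..k-1}. G i) = (\<Prod>i\<in>{1..k-1}. dirichlet_poly P y (1/2 - \<i> * of_real t))"
  by (intro prod.cong) auto
 then have "dirichlet_poly P y (1/2 - \<i> * of_real t) ^ (k - 1) = (\<Prod>i\<in>{1..k-1}. G i)" by simp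
 moreover have "G k = zeta_sum N \<delta>1 t"
  by (simp add: G_def row_range_def row_term_def)
 moreover have "G (k+1) = zeta_sum N \<delta>2 t"
  by (simp add: G_def row_range_def row_term_def)
 moreover have "(\<Prod>i\<in>{1..k+1}. G i) = G (k+1) * (G k * (\<Prod>i\<in>{1..k-1}. G i))"
  by (subst index_split(1)[OF k]) (simp only: prod.insert[OF _ index_split(2)[OF k]] prod.insert[OF _ index_split(3)[OF k]] finite_insert finite_atLeastAtMost)
 ultimately have "dirichlet_poly P y (1/2 - \<i> * of_real t) ^ (k - 1) *
   (zeta_sum N \<delta>1 t *
   zeta_sum N \<delta>2 t) = (\<Prod>i\<in>{1..k+1}. G i)"
  by (simp only: mult_ac)
 also have "\<dots> = (\<Sum>c\<in>PiE {1..k+1} (row_range k (nat \<lfloor>y\<rfloor>) N). \<Prod>i\<in>{1..k+1}. row_term k P y N \<delta>1 \<delta>2 i (c i) (of_real t) * exp (\<i> * of_real (ln (real (term_index N (c i))) * t)))"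
  unfolding G_def by (rule prod_sum_PiE) (auto simp: row_range_def)
 also have "\<dots> = row_sum k P y (nat \<lfloor>y\<rfloor>) N \<delta>1 \<delta>2 t"
 proof (rule sum.cong[OF refl])
  fix c
  have "(\<Prod>j\<in>{1..k+1}. exp (\<i> * of_real (ln (real (term_index N (c j))) * t))) = exp (\<Sum>j\<in>{1..k+1}. (\<i> * of_real (ln (real (term_index N (c j))) * t)))"
   by (simp only: exp_sum finite_atLeastAtMost)
  also have "(\<Sum>j\<in>{1..k+1}. (\<i> * of_real (ln (real (term_index N (c j))) * t))) = (\<i> * of_real ((\<Sum>j\<in>{1..k+1}. ln (real (term_index N (c j)))) * t))"
   by (simp only: sum_distrib_left[symmetric] sum_distrib_right of_real_sum)
  finally show "(\<Prod>i\<in>{1..k+1}. row_term k P y N \<delta>1 \<delta>2 i (c i) (of_real t) * exp (\<i> * of_real (ln (real (term_index N (c i))) * t))) =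
   (\<Prod>i\<in>{1..k+1}. row_term k P y N \<delta>1 \<delta>2 i (c i) (of_real t)) * exp (\<i> * of_real ((\<Sum>i\<in>{1..k+1}. ln (real (term_index N (c i)))) * t))"
   unfolding prod.distrib by simp
 qed
 finally show ?thesis .
qed

text \<open>On the diagonal no pole term occurs, so that \<^term>\<open>row_term\<close> depends neither on \<open>N\<close> nor on \<open>z\<close>;
 both are set to \<open>0\<close> in \<open>diag_sum\<close>.\<close>

definition diag_pairs :: "nat \<Rightarrow> nat \<Rightarrow> ((nat \<Rightarrow> nat) \<times> (nat \<Rightarrow> nat)) set" where
 "diag_pairs k Y = {(a, c). a \<in> {1..k+1} \<rightarrow>\<^sub>E {1..Y} \<and> c \<in> {1..k+1} \<rightarrow>\<^sub>E {1..} \<and> (\<forall>i\<in>{1..k-1}. c i \<le> Y) \<and>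
   (\<Prod>j\<in>{1..k+1}. a j) = (\<Prod>i\<in>{1..k+1}. c i)}"

definition diag_sum :: "nat \<Rightarrow> real poly \<Rightarrow> real \<Rightarrow> complex \<Rightarrow> complex \<Rightarrow> complex" where
 "diag_sum k P y \<delta>1 \<delta>2 = (\<Sum>(a, c)\<in>diag_pairs k (nat \<lfloor>y\<rfloor>). col_weight k P y a * (\<Prod>i\<in>{1..k+1}. row_term k P y 0 \<delta>1 \<delta>2 i (c i) 0))"

section \<open>The diagonal and the truncated moment\<close>

text \<open>The product of the a j is at most Y ^ (k + 1) < N. So no pole term, whose frequency
  index is N, meets the diagonal, and truncating the zeta sums at N loses no diagonal term.\<close>

lemma diag_pairs_eq:
 assumes k: "k \<ge> 1" and N: "Y ^ (k + 1) < N"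
 shows "{(a, c) \<in> ({1..k+1} \<rightarrow>\<^sub>E {1..Y}) \<times> PiE {1..k+1} (row_range k Y N).
   (\<Prod>j\<in>{1..k+1}. a j) = (\<Prod>i\<in>{1..k+1}. term_index N (c i))} = diag_pairs k Y" (is "?L = ?R")
proof (intro equalityI subrelI)
 have pa: "(\<Prod>j\<in>{1..k+1}. a j) \<le> Y ^ (k + 1)" if "a \<in> {1..k+1} \<rightarrow>\<^sub>E {1..Y}" for a
 proof -
  have "(\<Prod>j\<in>{1..k+1}. a j) \<le> (\<Prod>j\<in>{1..k+1}. Y)" using PiE_mem[OF that] by (intro prod_mono) auto
  then show ?thesis by simp
 qed
 have N1: "N \<ge> 1" using N by simp
 have le: "f i \<le> (\<Prod>i\<in>{1..k+1}. f i)" if f: "\<forall>i\<in>{1..k+1}. f i \<ge> 1" and i: "i \<in> {1..k+1}" for f :: "nat \<Rightarrow> nat" and i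
 proof -
  have "(\<Prod>i\<in>{1..k+1} - {i}. f i) \<ge> (\<Prod>i\<in>{1..k+1} - {i}. 1)" using f by (intro prod_mono) auto
  then have "f i * 1 \<le> f i * (\<Prod>i\<in>{1..k+1} - {i}. f i)" by (intro mult_left_mono) auto
  then show ?thesis using prod.remove[OF _ i, of f] by simp
 qed
 fix a c
 {
  assume "(a, c) \<in> ?L"
  then have a: "a \<in> {1..k+1} \<rightarrow>\<^sub>E {1..Y}" and c: "c \<in> PiE {1..k+1} (row_range k Y N)"
   and e: "(\<Prod>j\<in>{1..k+1}. a j) = (\<Prod>i\<in>{1..k+1}. term_index N (c i))" by auto
  have c1: "c i \<ge> 1" if i: "i \<in> {1..k+1}" for i
  proof (rule ccontr)
   assume "\<not> c i \<ge> 1"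
   then have "N = term_index N (c i)" by (simp add: term_index_def)
   also have "\<dots> \<le> (\<Prod>i\<in>{1..k+1}. term_index N (c i))" using N1 by (intro le i ballI) (simp add: term_index_def)
   also have "\<dots> \<le> Y ^ (k + 1)" using pa[OF a] e by simp
   finally show False using N by simp
  qed
  then have "(\<Prod>i\<in>{1..k+1}. term_index N (c i)) = (\<Prod>i\<in>{1..k+1}. c i)" by (intro prod.cong) (force simp: term_index_def)+
  moreover have "c \<in> {1..k+1} \<rightarrow>\<^sub>E {1..}" using c1 c by (auto simp: PiE_def Pi_def)
  moreover have "c i \<le> Y" if i: "i \<in> {1..k-1}" for i
  proof -
   have "i \<in> {1..k+1}" "i < k" using i k by auto
   then show ?thesis using PiE_mem[OF c, of i] by (auto simp: row_range_def)
  qed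
  ultimately show "(a, c) \<in> ?R" using a e by (auto simp: diag_pairs_def)
 }
 {
  assume "(a, c) \<in> ?R"
  then have a: "a \<in> {1..k+1} \<rightarrow>\<^sub>E {1..Y}" and c: "c \<in> {1..k+1} \<rightarrow>\<^sub>E {1..}" "\<forall>i\<in>{1..k-1}. c i \<le> Y"
   and e: "(\<Prod>j\<in>{1..k+1}. a j) = (\<Prod>i\<in>{1..k+1}. c i)" by (auto simp: diag_pairs_def)
  have c1: "\<forall>i\<in>{1..k+1}. c i \<ge> 1" using PiE_mem[OF c(1)] by auto
  then have "(\<Prod>i\<in>{1..k+1}. term_index N (c i)) = (\<Prod>i\<in>{1..k+1}. c i)" by (intro prod.cong) (force simp: term_index_def)+
  moreover have "c i \<in> row_range k Y N i" if i: "i \<in> {1..k+1}" for i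
  proof (cases "i < k")
   case True
   then have "i \<in> {1..k-1}" using i by auto
   then show ?thesis using True c c1 i by (auto simp: row_range_def)
  next
   case False
   have "c i \<le> Y ^ (k + 1)" using le[OF c1 i] e pa[OF a] by simp
   then show ?thesis using False N by (auto simp: row_range_def)
  qed
  ultimately show "(a, c) \<in> ?L" using a e c(1) by (auto simp: PiE_def Pi_def)
 }
qed

lemma Re_complex_nbhd_ge:
 assumes "z \<in> wide_nbhd T"
 shows "Re z \<ge> T / 16"
proof -
 obtain t where t: "t \<in> {T / 8..4 * T}" "dist (of_real t) z < 1 / 16 * T" using assms by (auto simp: complex_nbhd_def)
 have "\<bar>Re (of_real t - z)\<bar> < 1 / 16 * T" using abs_Re_le_cmod[of "of_real t - z"] t(2) by (simp add: dist_norm)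
 then have "t - Re z < 1 / 16 * T" by (simp only: minus_complex.sel Re_complex_of_real)
 moreover have "T / 8 \<le> t" using t(1) by simp
 ultimately show ?thesis by linarith
qed

lemma zeta_term_pole_denominator:
 assumes "T \<ge> 100" "z \<in> wide_nbhd T" "norm \<delta> \<le> 1 / 3000"
 shows "norm (- 1/2 - \<delta> - \<i> * z) \<ge> 1"
proof -
 have "\<bar>Im \<delta>\<bar> \<le> 1 / 3000" using abs_Im_le_cmod[of \<delta>] assms by linarith
 then have "\<bar>Im (- 1/2 - \<delta> - \<i> * z)\<bar> \<ge> 1" using Re_complex_nbhd_ge[OF assms(2)] assms(1) by simp
 then show ?thesis using abs_Im_le_cmod[of "- 1/2 - \<delta> - \<i> * z"] by linarith
qed

lemma zeta_term_holomorphic: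
 assumes "T \<ge> 100" "norm \<delta> \<le> 1 / 3000"
 shows "zeta_term N \<delta> n holomorphic_on wide_nbhd T"
proof (cases "n = 0")
 case True
 have "(\<lambda>z. of_nat N powr (1/2 + \<delta>) / (- 1/2 - \<delta> - \<i> * z)) holomorphic_on wide_nbhd T"
  using zeta_term_pole_denominator[OF assms(1) _ assms(2)] by (intro holomorphic_intros) (fastforce)
 then show ?thesis using True by (simp add: zeta_term_def[abs_def])
next
 case False
 then show ?thesis by (simp add: zeta_term_def[abs_def])
qed

lemma norm_zeta_term_le:
 assumes "T \<ge> 100" "norm \<delta> \<le> 1 / 3000" "z \<in> wide_nbhd T" "N \<ge> 1"
 shows "norm (zeta_term N \<delta> n z) \<le> real N"
proof -
 have r: "\<bar>Re \<delta>\<bar> \<le> 1 / 3000" using abs_Re_le_cmod[of \<delta>] assms by linarith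
 show ?thesis
 proof (cases "n = 0")
  case True
  have "norm (zeta_term N \<delta> n z) = real N powr (1/2 + Re \<delta>) / norm (- 1/2 - \<delta> - \<i> * z)"
   using True assms by (simp add: zeta_term_def norm_divide norm_of_nat_powr)
  also have "\<dots> \<le> real N powr 1 / 1"
   using zeta_term_pole_denominator[OF assms(1,3,2)] assms r by (intro frac_le powr_mono) auto
  finally show ?thesis using assms by simp
 next
  case False
  then have "norm (zeta_term N \<delta> n z) = real n powr (Re \<delta> - 1/2)"
   by (simp add: zeta_term_def norm_of_nat_powr)
  also have "\<dots> \<le> real n powr 0" using False r by (intro powr_mono) auto
  finally show ?thesis using False assms by simp
 qed
qed

lemma norm_row_prod_le:
 assumes k: "k \<ge> 1" and T: "T \<ge> 100" and \<delta>: "norm \<delta>1 \<le> 1 / 3000" "norm \<delta>2 \<le> 1 / 3000" and N: "N \<ge> 1"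
  and B: "B \<ge> 1" "\<And>n. n \<in> {1..Y} \<Longrightarrow> \<bar>mollifier_coeff P y n\<bar> \<le> B"
  and c: "c \<in> PiE {1..k+1} (row_range k Y N)"
 shows "(\<lambda>z. \<Prod>i\<in>{1..k+1}. row_term k P y N \<delta>1 \<delta>2 i (c i) z) holomorphic_on wide_nbhd T"
  and "z \<in> wide_nbhd T \<Longrightarrow> norm (\<Prod>i\<in>{1..k+1}. row_term k P y N \<delta>1 \<delta>2 i (c i) z) \<le> (B * real N) ^ (k + 1)"
proof -
 have d: "norm (if i < k then 0 else if i = k then \<delta>1 else \<delta>2) \<le> 1 / 3000" for i using \<delta> by simp
 show "(\<lambda>z. \<Prod>i\<in>{1..k+1}. row_term k P y N \<delta>1 \<delta>2 i (c i) z) holomorphic_on wide_nbhd T"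
  unfolding row_term_def by (intro holomorphic_on_prod holomorphic_on_mult holomorphic_on_const zeta_term_holomorphic T d)
 show "norm (\<Prod>i\<in>{1..k+1}. row_term k P y N \<delta>1 \<delta>2 i (c i) z) \<le> (B * real N) ^ (k + 1)" if z: "z \<in> wide_nbhd T"
 proof -
  have "(\<Prod>i\<in>{1..k+1}. norm (row_term k P y N \<delta>1 \<delta>2 i (c i) z)) \<le> (\<Prod>i\<in>{1..k+1}. B * real N)"
  proof (intro prod_mono conjI norm_ge_zero)
   fix i assume i: "i \<in> {1..k+1}"
   have "norm (if i < k then of_real (mollifier_coeff P y (c i)) else 1 :: complex) \<le> B"
    using PiE_mem[OF c i] B by (auto simp: row_range_def)
   then show "norm (row_term k P y N \<delta>1 \<delta>2 i (c i) z) \<le> B * real N"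
    unfolding row_term_def norm_mult using norm_zeta_term_le[OF T d z N] B(1) by (intro mult_mono) auto
  qed
  then show ?thesis by (simp add: prod_norm)
 qed
qed

lemma norm_col_weight_le:
 assumes B: "B \<ge> 1" "\<And>n. n \<in> {1..Y} \<Longrightarrow> \<bar>mollifier_coeff P y n\<bar> \<le> B" and a: "a \<in> {1..k+1} \<rightarrow>\<^sub>E {1..Y}"
 shows "norm (col_weight k P y a) \<le> B ^ (k + 1)"
proof -
 have "(\<Prod>j\<in>{1..k+1}. norm (of_real (mollifier_coeff P y (a j)) * of_nat (a j) powr (- 1/2) :: complex)) \<le> (\<Prod>j\<in>{1..k+1}. B * 1)"
 proof (intro prod_mono conjI norm_ge_zero)
  fix j assume j: "j \<in> {1..k+1}"
  have aj: "a j \<in> {1..Y}" using PiE_mem[OF a j] .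
  then have "real (a j) powr (- 1/2) \<le> real (a j) powr 0" by (intro powr_mono) auto
  then have "norm (of_nat (a j) powr (- 1/2) :: complex) \<le> 1" using aj by (simp add: norm_of_nat_powr)
  then show "norm (of_real (mollifier_coeff P y (a j)) * of_nat (a j) powr (- 1/2) :: complex) \<le> B * 1"
   unfolding norm_mult using B aj by (intro mult_mono) auto
 qed
 then show ?thesis by (simp add: col_weight_def prod_norm)
qed

lemma card_row_range_PiE_le:
 assumes "Y \<le> N" "N \<ge> 1"
 shows "real (card (PiE {1..k+1} (row_range k Y N))) \<le> (2 * real N) ^ (k + 1)"
proof -
 have "card (PiE {1..k+1} (row_range k Y N)) = (\<Prod>i\<in>{1..k+1}. card (row_range k Y N i))" by (rule card_PiE) simp
 also have "\<dots> \<le> (\<Prod>i\<in>{1..k+1}. 2 * N)" using assms by (intro prod_mono) (auto simp: row_range_def)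
 finally have "card (PiE {1..k+1} (row_range k Y N)) \<le> (2 * N) ^ (k + 1)" by simp
 then have "real (card (PiE {1..k+1} (row_range k Y N))) \<le> real ((2 * N) ^ (k + 1))" by (simp only: of_nat_le_iff)
 then show ?thesis by simp
qed

text \<open>Off the diagonal there are at most T * (2 * N) ^ (k + 1) pairs with amplitudes O(N ^ (k
  + 1)). As N <= 2 * T ^ 24, the total is O(T ^ (48 * (k + 1) + 1)), and the required decay exponent
  is chosen to cancel exactly this.\<close>

lemma truncated_moment:
 assumes k: "k \<ge> 1" and T: "T \<ge> 100" and \<delta>: "norm \<delta>1 \<le> 1 / 3000" "norm \<delta>2 \<le> 1 / 3000"
  and B: "B \<ge> 1" "\<And>n. n \<in> {1..Y} \<Longrightarrow> \<bar>mollifier_coeff P y n\<bar> \<le> B"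
  and Y: "Y = nat \<lfloor>y\<rfloor>" "Y \<ge> 1" "Y ^ (k + 1) < N" "real (Y ^ (k + 1)) \<le> T" "1 / (2 * real (Y ^ (k + 1))) \<ge> T powr (\<epsilon> - 1)"
  and N: "real N \<le> 2 * T ^ 24"
  and \<phi>: "continuous_on UNIV \<phi>"
  and h: "h holomorphic_on wide_nbhd T" "\<And>z. z \<in> wide_nbhd T \<Longrightarrow> norm (h z) \<le> K"
  and osc: "\<And>g M lam. g holomorphic_on wide_nbhd T \<Longrightarrow> (\<And>z. z \<in> wide_nbhd T \<Longrightarrow> norm (g z) \<le> M) \<Longrightarrow> \<bar>lam\<bar> \<ge> T powr (\<epsilon> - 1) \<Longrightarrow>
   norm (osc_integral T \<phi> g lam) \<le> K1 * M * T powr (- real (48 * (k + 1) + 1))"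
  and K1: "K1 \<ge> 0" and K: "K \<ge> 0"
 shows "norm (integral {T / 8..4 * T} (\<lambda>t. of_real (\<phi> t) * h (of_real t) * (
   col_sum k P y Y t *
   row_sum k P y Y N \<delta>1 \<delta>2 t))
   - integral {T / 8..4 * T} (\<lambda>t. of_real (\<phi> t) * h (of_real t)) * diag_sum k P y \<delta>1 \<delta>2)
   \<le> K1 * K * B ^ (2 * (k + 1)) * 8 ^ (k + 1)"
proof -
 define PA where "PA = ({1..k+1} \<rightarrow>\<^sub>E {1..Y})"
 define PC where "PC = PiE {1..k+1} (row_range k Y N)"
 define U where "U = (\<lambda>c. \<Prod>i\<in>{1..k+1}. term_index N (c i))"
 define V where "V = (\<lambda>a::nat \<Rightarrow> nat. \<Prod>j\<in>{1..k+1}. a j)"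
 define lam where "lam = (\<lambda>(a, c). ln (real (U c)) - ln (real (V a)))"
 define g where "g = (\<lambda>(a, c) z. h z * (col_weight k P y a * (\<Prod>i\<in>{1..k+1}. row_term k P y N \<delta>1 \<delta>2 i (c i) z)))"
 define J where "J = (\<lambda>r. integral {T / 8..4 * T} (\<lambda>t. of_real (\<phi> t) * g r (of_real t) * exp (\<i> * of_real (lam r * t))))"
 have N1: "N \<ge> 1" using Y(3) by simp
 have YN: "Y \<le> N"
 proof -
  have "Y ^ 1 \<le> Y ^ (k + 1)" using Y(2) by (intro power_increasing) auto
  then show ?thesis using Y(3) unfolding power_one_right by linarith
 qed
 have fin: "finite PA" "finite PC" unfolding PA_def PC_def by (auto intro!: finite_PiE simp: row_range_def)
 have real_nbhd: "of_real t \<in> wide_nbhd T" if "t \<in> {T / 8..4 * T}" for t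
  using that T by (intro complex_nbhd_of_real) auto
 have V1: "V a \<ge> 1" "V a \<le> Y ^ (k + 1)" if a: "a \<in> PA" for a
 proof -
  have "a j \<in> {1..Y}" if "j \<in> {1..k+1}" for j using PiE_mem[OF a[unfolded PA_def] that] .
  then have "(\<Prod>j\<in>{1..k+1}. 1) \<le> V a" "V a \<le> (\<Prod>j\<in>{1..k+1}. Y)" unfolding V_def by (intro prod_mono; force)+
  then show "V a \<ge> 1" "V a \<le> Y ^ (k + 1)" by simp_all
 qed
 have U1: "U c \<ge> 1" for c
 proof -
  have "(\<Prod>j\<in>{1..k+1}. 1) \<le> U c" unfolding U_def using N1 by (intro prod_mono) (auto simp: term_index_def)
  then show ?thesis by simp
 qed
 have lnV: "(\<Sum>j\<in>{1..k+1}. ln (real (a j))) = ln (real (V a))" if a: "a \<in> PA" for a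
 proof -
  have "a j \<in> {1..Y}" if "j \<in> {1..k+1}" for j using PiE_mem[OF a[unfolded PA_def] that] .
  then have "ln (\<Prod>j\<in>{1..k+1}. real (a j)) = (\<Sum>j\<in>{1..k+1}. ln (real (a j)))" by (intro ln_prod) force+
  then show ?thesis by (simp only: V_def of_nat_prod)
 qed
 have lnU: "(\<Sum>i\<in>{1..k+1}. ln (real (term_index N (c i)))) = ln (real (U c))" for c
 proof -
  have "ln (\<Prod>i\<in>{1..k+1}. real (term_index N (c i))) = (\<Sum>i\<in>{1..k+1}. ln (real (term_index N (c i))))" using N1 by (intro ln_prod) (auto simp: term_index_def)
  then show ?thesis by (simp only: U_def of_nat_prod)
 qed
 have g_hol: "g r holomorphic_on wide_nbhd T" if r: "r \<in> PA \<times> PC" for r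
 proof -
  obtain a c where e: "r = (a, c)" "c \<in> PC" using r by auto
  show ?thesis unfolding e g_def prod.case
   by (intro holomorphic_on_mult holomorphic_on_const h(1) norm_row_prod_le(1)[OF k T \<delta> N1 B e(2)[unfolded PC_def]])
 qed
 have g_bound: "norm (g r z) \<le> K * (B ^ (k + 1) * (B * real N) ^ (k + 1))" if r: "r \<in> PA \<times> PC" and z: "z \<in> wide_nbhd T" for r z
 proof -
  obtain a c where e: "r = (a, c)" "a \<in> PA" "c \<in> PC" using r by auto
  show ?thesis unfolding e g_def prod.case norm_mult
   using h(2)[OF z] norm_col_weight_le[OF B e(2)[unfolded PA_def]] norm_row_prod_le(2)[OF k T \<delta> N1 B e(3)[unfolded PC_def] z] B(1) K
   by (intro mult_mono) auto
 qed
 have int: "(\<lambda>t. of_real (\<phi> t) * g r (of_real t) * exp (\<i> * of_real (lam r * t))) integrable_on {T / 8..4 * T}" if r: "r \<in> PA \<times> PC" for r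
 proof -
  have "continuous_on {T / 8..4 * T} (\<lambda>t. g r (of_real t))"
   by (rule continuous_on_compose2[OF holomorphic_on_imp_continuous_on[OF g_hol[OF r]]]) (auto intro!: continuous_intros real_nbhd)
  then show ?thesis using continuous_on_subset[OF \<phi>] by (intro integrable_continuous_real continuous_intros) auto
 qed
 have "integral {T / 8..4 * T} (\<lambda>t. of_real (\<phi> t) * h (of_real t) * (
   (\<Sum>a\<in>PA. col_weight k P y a * exp (- (\<i> * of_real ((\<Sum>j\<in>{1..k+1}. ln (real (a j))) * t)))) *
   (\<Sum>c\<in>PC. (\<Prod>i\<in>{1..k+1}. row_term k P y N \<delta>1 \<delta>2 i (c i) (of_real t)) *
    exp (\<i> * of_real ((\<Sum>i\<in>{1..k+1}. ln (real (term_index N (c i)))) * t)))))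
   = integral {T / 8..4 * T} (\<lambda>t. \<Sum>r\<in>PA \<times> PC. of_real (\<phi> t) * g r (of_real t) * exp (\<i> * of_real (lam r * t)))"
 proof (rule arg_cong[where f = "integral {T / 8..4 * T}"], rule ext)
  fix t
  have "(\<Sum>r\<in>PA \<times> PC. of_real (\<phi> t) * g r (of_real t) * exp (\<i> * of_real (lam r * t))) =
   (\<Sum>a\<in>PA. \<Sum>c\<in>PC. of_real (\<phi> t) * g (a, c) (of_real t) * exp (\<i> * of_real (lam (a, c) * t)))"
   by (subst sum.cartesian_product) (simp only: case_prod_unfold prod.collapse)
  also have "\<dots> = (\<Sum>a\<in>PA. \<Sum>c\<in>PC. of_real (\<phi> t) * h (of_real t) * (
   (col_weight k P y a * exp (- (\<i> * of_real ((\<Sum>j\<in>{1..k+1}. ln (real (a j))) * t)))) *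
   ((\<Prod>i\<in>{1..k+1}. row_term k P y N \<delta>1 \<delta>2 i (c i) (of_real t)) *
    exp (\<i> * of_real ((\<Sum>i\<in>{1..k+1}. ln (real (term_index N (c i)))) * t)))))"
  proof (intro sum.cong[OF refl])
   fix a c assume a: "a \<in> PA" and c: "c \<in> PC"
   have "exp (\<i> * of_real (lam (a, c) * t)) = exp (- (\<i> * of_real (ln (real (V a)) * t))) * exp (\<i> * of_real (ln (real (U c)) * t))"
    unfolding exp_add[symmetric] by (simp add: lam_def algebra_simps)
   then show "of_real (\<phi> t) * g (a, c) (of_real t) * exp (\<i> * of_real (lam (a, c) * t)) = of_real (\<phi> t) * h (of_real t) * (
   (col_weight k P y a * exp (- (\<i> * of_real ((\<Sum>j\<in>{1..k+1}. ln (real (a j))) * t)))) *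
   ((\<Prod>i\<in>{1..k+1}. row_term k P y N \<delta>1 \<delta>2 i (c i) (of_real t)) *
    exp (\<i> * of_real ((\<Sum>i\<in>{1..k+1}. ln (real (term_index N (c i)))) * t))))"
    unfolding lnV[OF a] lnU g_def prod.case by (simp only: mult_ac)
  qed
  finally show "of_real (\<phi> t) * h (of_real t) * (
   (\<Sum>a\<in>PA. col_weight k P y a * exp (- (\<i> * of_real ((\<Sum>j\<in>{1..k+1}. ln (real (a j))) * t)))) *
   (\<Sum>c\<in>PC. (\<Prod>i\<in>{1..k+1}. row_term k P y N \<delta>1 \<delta>2 i (c i) (of_real t)) *
    exp (\<i> * of_real ((\<Sum>i\<in>{1..k+1}. ln (real (term_index N (c i)))) * t)))) =
   (\<Sum>r\<in>PA \<times> PC. of_real (\<phi> t) * g r (of_real t) * exp (\<i> * of_real (lam r * t)))"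
   unfolding sum_product by (simp only: sum_distrib_left)
 qed
 also have "\<dots> = (\<Sum>r\<in>PA \<times> PC. J r)" unfolding J_def by (rule integral_sum) (use fin int in auto)
 also have "PA \<times> PC = {(a, c) \<in> PA \<times> PC. V a = U c} \<union> {(a, c) \<in> PA \<times> PC. V a \<noteq> U c}" by auto
 also have "(\<Sum>r\<in>\<dots>. J r) = (\<Sum>r\<in>{(a, c) \<in> PA \<times> PC. V a = U c}. J r) + (\<Sum>r\<in>{(a, c) \<in> PA \<times> PC. V a \<noteq> U c}. J r)"
  by (rule sum.union_disjoint) (use fin in \<open>auto intro: finite_subset[of _ "PA \<times> PC"]\<close>)
 also have "{(a, c) \<in> PA \<times> PC. V a = U c} = diag_pairs k Y"
  unfolding V_def U_def PA_def PC_def by (rule diag_pairs_eq[OF k Y(3)])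
 also have "(\<Sum>r\<in>diag_pairs k Y. J r) = integral {T / 8..4 * T} (\<lambda>t. of_real (\<phi> t) * h (of_real t)) * diag_sum k P y \<delta>1 \<delta>2"
  unfolding diag_sum_def Y(1)[symmetric] sum_distrib_left
 proof (intro sum.cong[OF refl], safe)
  fix a c assume ac: "(a, c) \<in> diag_pairs k Y"
  then have "(a, c) \<in> {(a, c) \<in> PA \<times> PC. V a = U c}" unfolding diag_pairs_eq[OF k Y(3), symmetric] V_def U_def PA_def PC_def .
  moreover have "c \<in> {1..k+1} \<rightarrow>\<^sub>E {1..}" using ac unfolding diag_pairs_def by blast
  ultimately have d: "(a, c) \<in> PA \<times> PC" "V a = U c" "c \<in> {1..k+1} \<rightarrow>\<^sub>E {1..}" by blast+
  \<comment> \<open>Diagonal indices are at least 1, so the amplitudes are constant in z and come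
    out of the integral.\<close>
  have row: "(\<Prod>i\<in>{1..k+1}. row_term k P y N \<delta>1 \<delta>2 i (c i) z) = (\<Prod>i\<in>{1..k+1}. row_term k P y 0 \<delta>1 \<delta>2 i (c i) 0)" for z
  proof (rule prod.cong[OF refl])
   fix i assume "i \<in> {1..k+1}"
   then have "c i \<ge> 1" using PiE_mem[OF d(3)] by auto
   then show "row_term k P y N \<delta>1 \<delta>2 i (c i) z = row_term k P y 0 \<delta>1 \<delta>2 i (c i) 0" by (simp add: row_term_def zeta_term_def)
  qed
  have "J (a, c) = integral {T / 8..4 * T} (\<lambda>t. of_real (\<phi> t) * h (of_real t) * (col_weight k P y a * (\<Prod>i\<in>{1..k+1}. row_term k P y 0 \<delta>1 \<delta>2 i (c i) 0)))"
   unfolding J_def g_def lam_def prod.case row d(2) by (simp add: mult_ac)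
  also have "\<dots> = integral {T / 8..4 * T} (\<lambda>t. of_real (\<phi> t) * h (of_real t)) * (col_weight k P y a * (\<Prod>i\<in>{1..k+1}. row_term k P y 0 \<delta>1 \<delta>2 i (c i) 0))"
   by (rule integral_mult_left)
  finally show "J (a, c) = integral {T / 8..4 * T} (\<lambda>t. of_real (\<phi> t) * h (of_real t)) * (col_weight k P y a * (\<Prod>i\<in>{1..k+1}. row_term k P y 0 \<delta>1 \<delta>2 i (c i) 0))" .
 qed
 finally have main: "integral {T / 8..4 * T} (\<lambda>t. of_real (\<phi> t) * h (of_real t) * (
   (\<Sum>a\<in>PA. col_weight k P y a * exp (- (\<i> * of_real ((\<Sum>j\<in>{1..k+1}. ln (real (a j))) * t)))) *
   (\<Sum>c\<in>PC. (\<Prod>i\<in>{1..k+1}. row_term k P y N \<delta>1 \<delta>2 i (c i) (of_real t)) *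
    exp (\<i> * of_real ((\<Sum>i\<in>{1..k+1}. ln (real (term_index N (c i)))) * t)))))
  - integral {T / 8..4 * T} (\<lambda>t. of_real (\<phi> t) * h (of_real t)) * diag_sum k P y \<delta>1 \<delta>2 = (\<Sum>r\<in>{(a, c) \<in> PA \<times> PC. V a \<noteq> U c}. J r)"
  by simp
 define E where "E = K1 * (K * (B ^ (k + 1) * (B * real N) ^ (k + 1))) * T powr (- real (48 * (k + 1) + 1))"
 have E0: "E \<ge> 0" unfolding E_def using K1 K B(1) by (intro mult_nonneg_nonneg) auto
 have "norm (\<Sum>r\<in>{(a, c) \<in> PA \<times> PC. V a \<noteq> U c}. J r) \<le> (\<Sum>r\<in>{(a, c) \<in> PA \<times> PC. V a \<noteq> U c}. E)"
 proof (rule sum_norm_le)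
  fix r assume "r \<in> {(a, c) \<in> PA \<times> PC. V a \<noteq> U c}"
  then obtain a c where e: "r = (a, c)" "a \<in> PA" "c \<in> PC" "V a \<noteq> U c" by auto
  have "T powr (\<epsilon> - 1) \<le> 1 / (2 * real (Y ^ (k + 1)))" by (rule Y(5))
  also have "\<dots> \<le> 1 / (2 * real (V a))"
  proof (rule divide_left_mono)
   show "2 * real (V a) \<le> 2 * real (Y ^ (k + 1))" using V1(2)[OF e(2)] by (simp only: mult_le_cancel_left_pos of_nat_le_iff zero_less_numeral)
   show "0 < 2 * real (Y ^ (k + 1)) * (2 * real (V a))" using V1(1)[OF e(2)] Y(2) by simp
  qed simp
  also have "\<dots> \<le> \<bar>lam r\<bar>" unfolding e lam_def prod.case using abs_ln_nat_diff_ge[OF U1 V1(1)[OF e(2)]] e(4) by auto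
  finally have l: "T powr (\<epsilon> - 1) \<le> \<bar>lam r\<bar>" .
  have r: "r \<in> PA \<times> PC" using e by simp
  show "norm (J r) \<le> E" unfolding J_def E_def by (rule osc[OF g_hol[OF r] g_bound[OF r] l])
 qed
 also have "\<dots> \<le> real (card (PA \<times> PC)) * E"
 proof -
  have "card {(a, c) \<in> PA \<times> PC. V a \<noteq> U c} \<le> card (PA \<times> PC)" by (rule card_mono) (use fin in auto)
  then show ?thesis using E0 by (simp add: mult_right_mono)
 qed
 also have "\<dots> \<le> (T * (2 * real N) ^ (k + 1)) * E"
 proof (rule mult_right_mono[OF _ E0])
  have "card PA = Y ^ (k + 1)" unfolding PA_def by (subst card_PiE) auto
  then have "real (card PA) \<le> T" using Y(4) by simp
  then show "real (card (PA \<times> PC)) \<le> T * (2 * real N) ^ (k + 1)"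
   unfolding card_cartesian_product of_nat_mult using card_row_range_PiE_le[OF YN N1] T unfolding PC_def by (intro mult_mono) auto
 qed
 also have "\<dots> = K1 * K * B ^ (2 * (k + 1)) * 2 ^ (k + 1) * (real N ^ (2 * (k + 1)) * (T * T powr (- real (48 * (k + 1) + 1))))"
  unfolding E_def by (simp only: power_mult_distrib power_mult power_add[symmetric] mult_2 power2_eq_square) (simp add: power_add algebra_simps)
 also have "\<dots> \<le> K1 * K * B ^ (2 * (k + 1)) * 2 ^ (k + 1) * 4 ^ (k + 1)"
 proof (rule mult_left_mono)
  have "real N ^ (2 * (k + 1)) \<le> (2 * T ^ 24) ^ (2 * (k + 1))" using N by (intro power_mono) auto
  also have "\<dots> = 4 ^ (k + 1) * T ^ (48 * (k + 1))"
  proof -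
   have "(2 :: real) ^ (2 * (k + 1)) = 4 ^ (k + 1)" unfolding power_mult by simp
   moreover have "(T ^ 24) ^ (2 * (k + 1)) = T ^ (48 * (k + 1))" unfolding power_mult[symmetric] by (rule arg_cong[where f = "\<lambda>n. T ^ n"]) simp
   ultimately show ?thesis unfolding power_mult_distrib by simp
  qed
  finally have "real N ^ (2 * (k + 1)) * (T * T powr (- real (48 * (k + 1) + 1))) \<le> 4 ^ (k + 1) * T ^ (48 * (k + 1)) * (T * T powr (- real (48 * (k + 1) + 1)))"
   using T by (intro mult_right_mono) auto
  also have "\<dots> = 4 ^ (k + 1) * (T ^ (48 * (k + 1) + 1) * T powr (- real (48 * (k + 1) + 1)))" by (simp only: power_add power_one_right mult_ac)
  also have "T ^ (48 * (k + 1) + 1) * T powr (- real (48 * (k + 1) + 1)) = 1"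
   using T by (simp only: powr_realpow[symmetric] powr_add[symmetric]) simp
  finally show "real N ^ (2 * (k + 1)) * (T * T powr (- real (48 * (k + 1) + 1))) \<le> 4 ^ (k + 1)" by simp
 qed (use K1 K B in auto)
 also have "\<dots> = K1 * K * B ^ (2 * (k + 1)) * 8 ^ (k + 1)"
 proof -
  have "(8 :: real) ^ (k + 1) = 2 ^ (k + 1) * 4 ^ (k + 1)" by (subst power_mult_distrib[symmetric]) simp
  then show ?thesis by simp
 qed
 finally show ?thesis unfolding main[unfolded PA_def PC_def] PA_def PC_def .
qed

lemma weight_integral:
 fixes \<phi> :: "real \<Rightarrow> real" and T :: real
 assumes T: "T > 0" and \<phi>: "continuous_on UNIV (\<lambda>t. \<phi> (t / T))" "\<And>u. u \<notin> {1/4..2} \<Longrightarrow> \<phi> u = 0"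
 shows "integral {T / 8..4 * T} (\<lambda>t. \<phi> (t / T)) = T * (\<integral>u. \<phi> u \<partial>lborel)"
proof -
 have "(\<integral>t. \<phi> (t / T) \<partial>lborel) = integral {T / 8..4 * T} (\<lambda>t. \<phi> (t / T))"
 proof (rule lborel_integral_eq_integral)
  fix t assume "t \<notin> {T / 8..4 * T}"
  then have "t / T \<notin> {1/4..2}" using T by (auto simp: field_simps)
  then show "\<phi> (t / T) = 0" by (rule \<phi>(2))
 qed (use \<phi>(1) continuous_on_subset in blast)
 moreover have "(\<integral>t. \<phi> (t / T) \<partial>lborel) = \<bar>T\<bar> *\<^sub>R (\<integral>u. \<phi> ((0 + T * u) / T) \<partial>lborel)"
  using T by (intro lborel_integral_real_affine) auto
 ultimately show ?thesis using T by simp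
qed

lemma norm_dirichlet_poly_le:
 assumes y: "y \<ge> 0" and B: "\<And>n. n \<in> {1..nat \<lfloor>y\<rfloor>} \<Longrightarrow> \<bar>mollifier_coeff P y n\<bar> \<le> B" and s: "Re s = 1/2" and B0: "B \<ge> 0"
 shows "norm (dirichlet_poly P y s) \<le> B * real (nat \<lfloor>y\<rfloor>)"
proof -
 have "norm (dirichlet_poly P y s) \<le> (\<Sum>n\<in>{1..nat \<lfloor>y\<rfloor>}. B * 1)"
  unfolding dirichlet_poly_alt[OF y]
 proof (rule sum_norm_le)
  fix n assume n: "n \<in> {1..nat \<lfloor>y\<rfloor>}"
  have "real n powr (- 1/2) \<le> real n powr 0" using n by (intro powr_mono) auto
  moreover have "norm (of_nat n powr (- s) :: complex) = real n powr (- Re s)" using n by (simp add: norm_of_nat_powr)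
  ultimately have "norm (of_nat n powr (- s) :: complex) \<le> 1" using n unfolding s by simp
  then show "norm (of_real (mollifier_coeff P y n) * of_nat n powr (- s)) \<le> B * 1"
   unfolding norm_mult using B[OF n] B0 by (intro mult_mono) auto
 qed
 then show ?thesis by (simp add: mult.commute)
qed

lemma dirichlet_poly_continuous:
 assumes "y \<ge> 0" "continuous_on A f"
 shows "continuous_on A (\<lambda>t. dirichlet_poly P y (f t))"
 unfolding dirichlet_poly_alt[OF assms(1)] using assms(2) by (intro continuous_intros) auto

text \<open>Only the zeta factor in + i t is reflected. Afterwards both zeta factors lie on the side
  of A(1/2 - i t), and the two chi factors form the nonoscillating \<open>chi_ratio\<close>.\<close>

lemma moment_integrand_eq:
 assumes "norm \<alpha> \<le> 1 / 3000" "t > 1"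
 shows "zeta (1/2 + \<alpha> + \<i> * of_real t) * zeta_chi (1/2 - \<i> * of_real t) =
  chi_ratio \<alpha> (of_real t) * zeta (1/2 - \<alpha> - \<i> * of_real t)"
proof -
 have r: "\<bar>Re \<alpha>\<bar> \<le> 1 / 3000" "\<bar>Im \<alpha>\<bar> \<le> 1 / 3000" using abs_Re_le_cmod[of \<alpha>] abs_Im_le_cmod[of \<alpha>] assms by linarith+
 have "zeta (1/2 + \<alpha> + \<i> * of_real t) = zeta_chi (1/2 + \<alpha> + \<i> * of_real t) * zeta (1 - (1/2 + \<alpha> + \<i> * of_real t))"
  using r assms(2) by (intro zeta_functional_equation) auto
 moreover have "1 - (1/2 + \<alpha> + \<i> * of_real t) = 1/2 - \<alpha> - \<i> * of_real t" by simp
 ultimately show ?thesis by (simp only: chi_ratio_def mult_ac)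
qed

section \<open>Reduction of the moment to the diagonal sum\<close>

text \<open>The three error terms come from truncating the zeta factors, from the off-diagonal
  frequencies, and from replacing \<open>chi_ratio\<close> by the constant X. The first two are
  bounded, so only the last limits the precision.\<close>

lemma twisted_moment_reduction:
 assumes k: "k \<ge> 1" and T: "T \<ge> 100" and \<alpha>: "norm \<alpha>1 \<le> 1 / 3000" "norm \<alpha>2 \<le> 1 / 3000"
  and B: "B \<ge> 1" "\<And>n. n \<in> {1..Y} \<Longrightarrow> \<bar>mollifier_coeff P y n\<bar> \<le> B"
  and y: "y \<ge> 0" and Y: "Y = nat \<lfloor>y\<rfloor>" "Y \<ge> 1" "Y ^ (k + 1) < N" "real (Y ^ (k + 1)) \<le> T" "1 / (2 * real (Y ^ (k + 1))) \<ge> T powr (\<epsilon> - 1)"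
   "real Y ^ (2 * k) \<le> T"
  and N: "real N \<le> 2 * T ^ 24" "T ^ 24 \<le> real N"
  and \<phi>: "continuous_on UNIV (\<lambda>t. \<phi> (t / T))" "\<And>u. u \<notin> {1/4..2} \<Longrightarrow> \<phi> u = 0" "\<And>u. 0 \<le> \<phi> u \<and> \<phi> u \<le> 1"
  and h: "chi_ratio \<alpha>1 holomorphic_on wide_nbhd T" "\<And>z. z \<in> wide_nbhd T \<Longrightarrow> norm (chi_ratio \<alpha>1 z - X) \<le> K / ln T" "norm X \<le> K"
  and osc: "\<And>g M lam. g holomorphic_on wide_nbhd T \<Longrightarrow> (\<And>z. z \<in> wide_nbhd T \<Longrightarrow> norm (g z) \<le> M) \<Longrightarrow> \<bar>lam\<bar> \<ge> T powr (\<epsilon> - 1) \<Longrightarrow>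
   norm (osc_integral T (\<lambda>t. \<phi> (t / T)) g lam) \<le> K1 * M * T powr (- real (48 * (k + 1) + 1))"
  and K1: "K1 \<ge> 0" and K: "K \<ge> 0"
 shows "norm (twisted_moment k P y \<phi> T \<alpha>1 \<alpha>2 - of_real (T * (\<integral>u. \<phi> u \<partial>lborel)) * X * diag_sum k P y \<alpha>1 (- \<alpha>2))
   \<le> 2 * K * B ^ (2 * k) * 4800 + K1 * (2 * K) * B ^ (2 * (k + 1)) * 8 ^ (k + 1) + 4 * (K * T / ln T) * norm (diag_sum k P y \<alpha>1 (- \<alpha>2))"
proof -
 define Ap where "Ap = (\<lambda>t. dirichlet_poly P y (1/2 + \<i> * of_real t) ^ (k + 1))"
 define Am where "Am = (\<lambda>t. dirichlet_poly P y (1/2 - \<i> * of_real t) ^ (k - 1))"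
 define z where "z = (\<lambda>\<delta> t. zeta (1/2 - \<delta> - \<i> * of_real t))"
 define D where "D = (\<lambda>\<delta> t. zeta_sum N \<delta> t)"
 define I where "I = {T / 8..4 * T}"
 define G where "G = (\<lambda>t. of_real (\<phi> (t / T)) * chi_ratio \<alpha>1 (of_real t) * (Ap t * (Am t * (z \<alpha>1 t * z (- \<alpha>2) t))))"
 define H where "H = (\<lambda>t. of_real (\<phi> (t / T)) * chi_ratio \<alpha>1 (of_real t) * (Ap t * (Am t * (D \<alpha>1 t * D (- \<alpha>2) t))))"
 have \<alpha>': "norm (- \<alpha>2) \<le> 1 / 3000" using \<alpha> by simp
 have T1: "exp 1 \<le> T" using exp_le T by linarith
 have lnT: "1 \<le> ln T" using T1 T by (simp add: ln_ge_iff)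
 have N1: "N \<ge> 1" using Y(3) by simp
 have real_nbhd: "of_real t \<in> wide_nbhd T" if "t \<in> I" for t
  using that T unfolding I_def by (intro complex_nbhd_of_real) auto
 have hb: "norm (chi_ratio \<alpha>1 z) \<le> 2 * K" if "z \<in> wide_nbhd T" for z
 proof -
  have "norm (chi_ratio \<alpha>1 z) \<le> norm X + norm (chi_ratio \<alpha>1 z - X)" by (rule norm_triangle_sub)
  moreover have "K / ln T \<le> K / 1" using K lnT by (intro divide_left_mono) auto
  ultimately show ?thesis using h(2)[OF that] h(3) by linarith
 qed
 have \<phi>0: "\<phi> (t / T) = 0" if "t \<notin> {T / 4..2 * T}" for t
  using that T by (intro \<phi>(2)) (auto simp: field_simps)
 have cA: "continuous_on I Ap" "continuous_on I Am"
  unfolding Ap_def Am_def using y by (auto intro!: continuous_intros dirichlet_poly_continuous)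
 have cphi: "continuous_on I (\<lambda>t. of_real (\<phi> (t / T)) :: complex)"
  using continuous_on_subset[OF \<phi>(1)] by (intro continuous_intros) auto
 have cchi: "continuous_on I (\<lambda>t. chi_ratio \<alpha>1 (of_real t))"
  by (rule continuous_on_compose2[OF holomorphic_on_imp_continuous_on[OF h(1)]]) (auto intro!: continuous_intros real_nbhd)
 have cz: "continuous_on I (z \<delta>)" if \<delta>: "norm \<delta> \<le> 1 / 3000" for \<delta>
  unfolding z_def
 proof (rule continuous_on_compose2[OF holomorphic_on_imp_continuous_on[OF zeta_holomorphic]])
  have "1/2 - \<delta> - \<i> * of_real t \<noteq> 1" if "t \<in> I" for t
  proof -
   have "T / 8 \<le> t" using that by (simp add: I_def)
   then have "Im (1/2 - \<delta> - \<i> * of_real t) < 0" using T abs_Im_le_cmod[of \<delta>] \<delta> by simp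
   then show ?thesis by (metis one_complex.sel(2) less_irrefl)
  qed
  then show "(\<lambda>t. 1/2 - \<delta> - \<i> * of_real t) ` I \<subseteq> - {1}" by auto
 qed (intro continuous_intros)
 have cD: "continuous_on I (D \<delta>)" if \<delta>: "norm \<delta> \<le> 1 / 3000" for \<delta>
  unfolding D_def
 proof (intro continuous_intros)
  fix n
  show "continuous_on I (\<lambda>t. zeta_term N \<delta> n (of_real t))"
   by (rule continuous_on_compose2[OF holomorphic_on_imp_continuous_on[OF zeta_term_holomorphic[OF T \<delta>]]]) (auto intro!: continuous_intros real_nbhd)
 qed
 have cG: "continuous_on I G" unfolding G_def by (intro continuous_on_mult cA cphi cchi cz \<alpha> \<alpha>')
 have cH: "continuous_on I H" unfolding H_def by (intro continuous_on_mult cA cphi cchi cD \<alpha> \<alpha>')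
 have "twisted_moment k P y \<phi> T \<alpha>1 \<alpha>2 = (\<integral>t. G t \<partial>lborel)"
  unfolding twisted_moment_def
 proof (rule arg_cong[where f = "\<lambda>f. integral\<^sup>L lborel f"], rule ext)
  fix t
  show "zeta (1/2 + \<alpha>1 + \<i> * of_real t) * zeta (1/2 + \<alpha>2 - \<i> * of_real t) *
     dirichlet_poly P y (1/2 + \<i> * of_real t) ^ (k + 1) *
     dirichlet_poly P y (1/2 - \<i> * of_real t) ^ (k - 1) *
     zeta_chi (1/2 - \<i> * of_real t) * of_real (\<phi> (t / T)) = G t"
  \<comment> \<open>Outside the support both integrands vanish; inside, t is large and positive and
    the functional equation applies.\<close>
  proof (cases "t \<in> {T / 4..2 * T}")
   case True
   then have "zeta (1/2 + \<alpha>1 + \<i> * of_real t) * zeta_chi (1/2 - \<i> * of_real t) = chi_ratio \<alpha>1 (of_real t) * z \<alpha>1 t"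
    unfolding z_def using T by (intro moment_integrand_eq \<alpha>) auto
   moreover have "zeta (1/2 + \<alpha>2 - \<i> * of_real t) = z (- \<alpha>2) t" by (simp add: z_def)
   moreover have "G t = (chi_ratio \<alpha>1 (of_real t) * z \<alpha>1 t) * z (- \<alpha>2) t * Ap t * Am t * of_real (\<phi> (t / T))"
    unfolding G_def by (simp only: mult_ac)
   ultimately have "G t = (zeta (1/2 + \<alpha>1 + \<i> * of_real t) * zeta_chi (1/2 - \<i> * of_real t)) * zeta (1/2 + \<alpha>2 - \<i> * of_real t) * Ap t * Am t * of_real (\<phi> (t / T))"
    by (simp only:)
   then show ?thesis unfolding Ap_def Am_def by (simp only: mult_ac)
  qed (simp add: G_def \<phi>0)
 qed
 also have "\<dots> = integral I G"
  unfolding I_def by (rule lborel_integral_eq_integral[OF cG[unfolded I_def]]) (use T in \<open>auto simp: G_def \<phi>0\<close>)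
 finally have tw: "twisted_moment k P y \<phi> T \<alpha>1 \<alpha>2 = integral I G" .
 have Abound: "norm (Ap t * Am t) \<le> B ^ (2 * k) * T" for t
 proof -
  have d: "norm (dirichlet_poly P y (1/2 + \<i> * of_real t)) \<le> B * real Y" "norm (dirichlet_poly P y (1/2 - \<i> * of_real t)) \<le> B * real Y"
   unfolding Y(1) using B(1) by (intro norm_dirichlet_poly_le y B(2)[unfolded Y(1)]; simp)+
  have "norm (Ap t * Am t) \<le> (B * real Y) ^ (k + 1) * (B * real Y) ^ (k - 1)"
   unfolding Ap_def Am_def norm_mult norm_power using d B(1) by (intro mult_mono power_mono) auto
  also have "\<dots> = (B * real Y) ^ (2 * k)" using k by (simp only: power_add[symmetric]) (simp add: mult_2)
  also have "\<dots> \<le> B ^ (2 * k) * T" unfolding power_mult_distrib using Y(6) B(1) by (intro mult_left_mono) auto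
  finally show ?thesis .
 qed
 define e where "e = 20 * T\<^sup>2 * real N powr (- 1/4)"
 \<comment> \<open>The exponent 24: N powr (-1/4) <= T powr (-6) cancels T^2 from zeta, T^2 from its
   approximation error, T from the Dirichlet polynomials and T from the length of the
   interval.\<close>
 have Np: "real N powr (- 1/4) \<le> T powr (- 6)"
 proof -
  have "real N powr (- 1/4) \<le> (T ^ 24) powr (- 1/4)" using N T by (intro powr_mono2') auto
  also have "(T ^ 24) powr (- 1/4) = T powr (- 6)" using T by (simp add: powr_powr flip: powr_numeral)
  finally show ?thesis .
 qed
 have e: "e \<le> 20 * T\<^sup>2" unfolding e_def
 proof -
  have "real N powr (- 1/4) \<le> real N powr 0" using N1 by (intro powr_mono) auto
  then show "20 * T\<^sup>2 * real N powr (- 1/4) \<le> 20 * T\<^sup>2" using N1 by (simp add: mult_left_le)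
 qed
 have GH: "norm (G t - H t) \<le> 2 * K * (B ^ (2 * k) * T * (3 * (20 * T\<^sup>2) * e))" if t: "t \<in> I" for t
 proof (cases "t \<in> {T / 4..2 * T}")
  case True
  have zz: "norm (z \<alpha>1 t * z (- \<alpha>2) t - D \<alpha>1 t * D (- \<alpha>2) t) \<le> 3 * (20 * T\<^sup>2) * e"
   unfolding z_def D_def e_def
   by (intro norm_mult_diff_le zeta_bounds_shift(1)[OF T True _ N1] zeta_bounds_shift(2)[OF T True _ N1] \<alpha> \<alpha>' e[unfolded e_def])
  have "G t - H t = of_real (\<phi> (t / T)) * chi_ratio \<alpha>1 (of_real t) * ((Ap t * Am t) * (z \<alpha>1 t * z (- \<alpha>2) t - D \<alpha>1 t * D (- \<alpha>2) t))"
   by (simp add: G_def H_def algebra_simps)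
  also have "norm \<dots> = (\<bar>\<phi> (t / T)\<bar> * norm (chi_ratio \<alpha>1 (of_real t))) * (norm (Ap t * Am t) * norm (z \<alpha>1 t * z (- \<alpha>2) t - D \<alpha>1 t * D (- \<alpha>2) t))"
   by (simp add: norm_mult)
  also have "\<dots> \<le> (1 * (2 * K)) * (B ^ (2 * k) * T * (3 * (20 * T\<^sup>2) * e))"
   using \<phi>(3) hb[OF real_nbhd[OF t]] Abound zz K B(1) T by (intro mult_mono mult_nonneg_nonneg) auto
  finally show ?thesis by simp
 next
  case False
  have "0 \<le> 2 * K * (B ^ (2 * k) * T * (3 * (20 * T\<^sup>2) * e))" using K B(1) T by (simp add: e_def)
  then show ?thesis using \<phi>0[OF False] by (simp add: G_def H_def)
 qed
 have d1: "norm (integral I G - integral I H) \<le> 2 * K * B ^ (2 * k) * 4800"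
 proof -
  have "integral I G - integral I H = integral I (\<lambda>t. G t - H t)"
   using cG cH unfolding I_def by (intro Henstock_Kurzweil_Integration.integral_diff[symmetric] integrable_continuous_real)
  also have "norm \<dots> \<le> 2 * K * (B ^ (2 * k) * T * (3 * (20 * T\<^sup>2) * e)) * (4 * T - T / 8)"
   using T GH cG cH unfolding I_def by (intro integral_bound continuous_on_diff) auto
  also have "\<dots> \<le> 2 * K * (B ^ (2 * k) * T * (3 * (20 * T\<^sup>2) * (20 * T\<^sup>2 * T powr (- 6)))) * (4 * T)"
   unfolding e_def using K B(1) T Np by (intro mult_mono mult_nonneg_nonneg) auto
  also have "\<dots> = 2 * K * B ^ (2 * k) * 4800 * (T ^ 6 * T powr (- 6))" by (simp add: power2_eq_square eval_nat_numeral)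
  also have "T ^ 6 * T powr (- 6) = 1" using T by (simp add: powr_minus powr_numeral)
  finally show ?thesis by simp
 qed
 have d2: "norm (integral I H - integral I (\<lambda>t. of_real (\<phi> (t / T)) * chi_ratio \<alpha>1 (of_real t)) * diag_sum k P y \<alpha>1 (- \<alpha>2))
   \<le> K1 * (2 * K) * B ^ (2 * (k + 1)) * 8 ^ (k + 1)"
 proof -
  have "norm (integral {T / 8..4 * T} (\<lambda>t. of_real (\<phi> (t / T)) * chi_ratio \<alpha>1 (of_real t) * (
   col_sum k P y Y t *
   row_sum k P y Y N \<alpha>1 (- \<alpha>2) t))
   - integral {T / 8..4 * T} (\<lambda>t. of_real (\<phi> (t / T)) * chi_ratio \<alpha>1 (of_real t)) * diag_sum k P y \<alpha>1 (- \<alpha>2))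
   \<le> K1 * (2 * K) * B ^ (2 * (k + 1)) * 8 ^ (k + 1)"
   by (rule truncated_moment[where \<epsilon> = \<epsilon>]) (use k T \<alpha> B Y N \<phi>(1) h(1) hb osc K1 K in auto)
  moreover have "H = (\<lambda>t. of_real (\<phi> (t / T)) * chi_ratio \<alpha>1 (of_real t) * (
   col_sum k P y Y t *
   row_sum k P y Y N \<alpha>1 (- \<alpha>2) t))"
   unfolding H_def Ap_def Am_def D_def Y(1) dirichlet_poly_power_cols[OF y] dirichlet_poly_power_rows[OF y k] ..
  ultimately show ?thesis unfolding I_def by simp
 qed
 \<comment> \<open>On the diagonal the oscillation is gone, so the integral of the weight times X is
   T times the mass of the weight, up to the relative error O(1 / ln T) of the ratio.\<close>
 have d3: "norm (integral I (\<lambda>t. of_real (\<phi> (t / T)) * chi_ratio \<alpha>1 (of_real t)) - of_real (T * (\<integral>u. \<phi> u \<partial>lborel)) * X) \<le> 4 * (K * T / ln T)"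
 proof -
  have "integral I (\<lambda>t. of_real (\<phi> (t / T)) :: complex) = of_real (integral I (\<lambda>t. \<phi> (t / T)))"
   unfolding I_def using continuous_on_subset[OF \<phi>(1)] by (intro integral_unique has_integral_of_real integrable_integral integrable_continuous_real) auto
  then have "of_real (T * (\<integral>u. \<phi> u \<partial>lborel)) * X = integral I (\<lambda>t. of_real (\<phi> (t / T)) * X)"
   using weight_integral[of T \<phi>, OF _ \<phi>(1,2)] T by (simp add: I_def integral_mult_left)
  then have "integral I (\<lambda>t. of_real (\<phi> (t / T)) * chi_ratio \<alpha>1 (of_real t)) - of_real (T * (\<integral>u. \<phi> u \<partial>lborel)) * X =
    integral I (\<lambda>t. of_real (\<phi> (t / T)) * chi_ratio \<alpha>1 (of_real t)) - integral I (\<lambda>t. of_real (\<phi> (t / T)) * X)" by simp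
  also have "\<dots> = integral I (\<lambda>t. of_real (\<phi> (t / T)) * chi_ratio \<alpha>1 (of_real t) - of_real (\<phi> (t / T)) * X)"
  proof (rule Henstock_Kurzweil_Integration.integral_diff[symmetric])
   show "(\<lambda>t. of_real (\<phi> (t / T)) * chi_ratio \<alpha>1 (of_real t)) integrable_on I"
    using continuous_on_mult[OF cphi cchi] unfolding I_def by (rule integrable_continuous_real)
   show "(\<lambda>t. of_real (\<phi> (t / T)) * X) integrable_on I"
    using continuous_on_mult[OF cphi continuous_on_const] unfolding I_def by (rule integrable_continuous_real)
  qed
  also have "norm \<dots> \<le> (K / ln T) * (4 * T - T / 8)"
   unfolding I_def
  proof (rule integral_bound)
   show "continuous_on {T / 8..4 * T} (\<lambda>t. of_real (\<phi> (t / T)) * chi_ratio \<alpha>1 (of_real t) - of_real (\<phi> (t / T)) * X)"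
    by (intro continuous_on_diff continuous_on_mult continuous_on_const cphi[unfolded I_def] cchi[unfolded I_def])
   fix t assume t: "t \<in> {T / 8..4 * T}"
   have "of_real (\<phi> (t / T)) * chi_ratio \<alpha>1 (of_real t) - of_real (\<phi> (t / T)) * X = of_real (\<phi> (t / T)) * (chi_ratio \<alpha>1 (of_real t) - X)"
    by (simp add: algebra_simps)
   also have "norm \<dots> \<le> 1 * (K / ln T)" unfolding norm_mult using \<phi>(3) h(2)[OF real_nbhd] t by (intro mult_mono) (auto simp: I_def)
   finally show "norm (of_real (\<phi> (t / T)) * chi_ratio \<alpha>1 (of_real t) - of_real (\<phi> (t / T)) * X) \<le> K / ln T" by simp
  qed (use T in auto)
  also have "\<dots> \<le> (K / ln T) * (4 * T)" using K lnT T by (intro mult_left_mono) auto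
  finally show ?thesis by (simp add: mult_ac)
 qed
 define Q where "Q = integral I (\<lambda>t. of_real (\<phi> (t / T)) * chi_ratio \<alpha>1 (of_real t))"
 define Q' where "Q' = of_real (T * (\<integral>u. \<phi> u \<partial>lborel)) * X"
 define S where "S = diag_sum k P y \<alpha>1 (- \<alpha>2)"
 have d4: "norm ((Q - Q') * S) \<le> 4 * (K * T / ln T) * norm S"
  unfolding norm_mult Q_def Q'_def by (rule mult_right_mono[OF d3 norm_ge_zero])
 have eq: "integral I G - Q' * S = (integral I G - integral I H) + (integral I H - Q * S) + (Q - Q') * S"
  by (simp add: algebra_simps)
 have "norm (integral I G - Q' * S) \<le> norm (integral I G - integral I H) + norm (integral I H - Q * S) + norm ((Q - Q') * S)"
  unfolding eq by (rule order_trans[OF norm_triangle_ineq add_right_mono[OF norm_triangle_ineq]])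
 then show ?thesis using d1 d2[folded Q_def S_def] d4 unfolding tw S_def[symmetric] Q'_def[symmetric] by linarith
qed

section \<open>The diagonal sum as a sum over matrices\<close>

definition matrix_weight :: "nat \<Rightarrow> real poly \<Rightarrow> real \<Rightarrow> complex \<Rightarrow> complex \<Rightarrow> (nat \<times> nat \<Rightarrow> real) \<Rightarrow> complex" where
 "matrix_weight k P y \<delta>1 \<delta>2 = polytope_fun (grid (k+1)) ({1..k+1} <+> {1..k-1}) (margin (k+1)) P
   (scaled_shift k y \<delta>1 \<delta>2)"

lemma sum_log_margin:
 assumes d: "d \<in> grid m \<rightarrow>\<^sub>E {1::nat..}" and y: "y > 1"
 shows "j \<in> {1..m} \<Longrightarrow> sum (\<lambda>v\<in>grid m. ln (real (d v)) / ln y) (margin m (Inl j)) = ln (real (col_prods m m d j)) / ln y"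
  and "i \<in> {1..m} \<Longrightarrow> sum (\<lambda>v\<in>grid m. ln (real (d v)) / ln y) (margin m (Inr i)) = ln (real (row_prods m m d i)) / ln y"
proof -
 have pos: "0 < real (d (i, j))" if "i \<in> {1..m}" "j \<in> {1..m}" for i j
  using PiE_mem[OF d, of "(i, j)"] that by auto
 show "sum (\<lambda>v\<in>grid m. ln (real (d v)) / ln y) (margin m (Inl j)) = ln (real (col_prods m m d j)) / ln y" if j: "j \<in> {1..m}"
 proof -
  have "ln (\<Prod>i\<in>{1..m}. real (d (i, j))) = (\<Sum>i\<in>{1..m}. ln (real (d (i, j))))" using pos j by (intro ln_prod) auto
  then show ?thesis using j unfolding sum_margin by (simp add: col_prods_def sum_divide_distrib)
 qed
 show "sum (\<lambda>v\<in>grid m. ln (real (d v)) / ln y) (margin m (Inr i)) = ln (real (row_prods m m d i)) / ln y" if i: "i \<in> {1..m}"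
 proof -
  have "ln (\<Prod>j\<in>{1..m}. real (d (i, j))) = (\<Sum>j\<in>{1..m}. ln (real (d (i, j))))" using pos i by (intro ln_prod) auto
  then show ?thesis using i unfolding sum_margin by (simp add: row_prods_def sum_divide_distrib)
 qed
qed

lemma prods_pos:
 assumes d: "d \<in> grid m \<rightarrow>\<^sub>E {1::nat..}"
 shows "j \<in> {1..m} \<Longrightarrow> col_prods m m d j \<ge> 1" "i \<in> {1..m} \<Longrightarrow> row_prods m m d i \<ge> 1"
  and "i \<in> {1..m} \<Longrightarrow> j \<in> {1..m} \<Longrightarrow> d (i, j) \<le> col_prods m m d j"
proof -
 have d1: "d (i, j) \<ge> 1" if "i \<in> {1..m}" "j \<in> {1..m}" for i j
  using PiE_mem[OF d, of "(i, j)"] that by auto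
 show "col_prods m m d j \<ge> 1" if j: "j \<in> {1..m}"
  using j d1 prod_mono[of "{1..m}" "\<lambda>_. 1" "\<lambda>i. d (i, j)"] by (simp add: col_prods_def)
 show "row_prods m m d i \<ge> 1" if i: "i \<in> {1..m}"
  using i d1 prod_mono[of "{1..m}" "\<lambda>_. 1" "\<lambda>j. d (i, j)"] by (simp add: row_prods_def)
 show "d (i, j) \<le> col_prods m m d j" if i: "i \<in> {1..m}" and j: "j \<in> {1..m}"
 proof -
  have "1 \<le> (\<Prod>i\<in>{1..m} - {i}. d (i, j))" using d1 j prod_mono[of "{1..m} - {i}" "\<lambda>_. 1" "\<lambda>i. d (i, j)"] by simp
  then have "d (i, j) * 1 \<le> d (i, j) * (\<Prod>i\<in>{1..m} - {i}. d (i, j))" by (intro mult_left_mono) auto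
  also have "\<dots> = (\<Prod>i\<in>{1..m}. d (i, j))" using prod.remove[of "{1..m}" i "\<lambda>i. d (i, j)"] i by simp
  finally show ?thesis using j by (simp add: col_prods_def)
 qed
qed

lemma prod_powr_half:
 fixes f :: "nat \<Rightarrow> nat"
 shows "(\<Prod>j\<in>{1..n}. of_nat (f j) powr (- 1/2) :: complex) = of_real (real (\<Prod>j\<in>{1..n}. f j) powr (- 1/2))"
proof -
 have "of_nat (f j) powr (- 1/2 :: complex) = of_real (real (f j) powr (- 1/2))" for j
  using powr_of_real[of "real (f j)" "- 1/2"] by simp
 moreover have "real (\<Prod>j\<in>{1..n}. f j) powr (- 1/2) = (\<Prod>j\<in>{1..n}. real (f j) powr (- 1/2))"
  unfolding of_nat_prod by (rule prod_powr_distrib)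
 ultimately show ?thesis by simp
qed

text \<open>Both margins have the same product p, the product of all entries. The half powers
  therefore combine to 1 / p, and the mollifier coefficients and shifts are functions of the row and
  column sums of logarithms.\<close>

lemma diag_term_eq:
 assumes k: "k \<ge> 1" and y: "y > 1" and d: "d \<in> grid (k+1) \<rightarrow>\<^sub>E {1::nat..}"
  and ok: "\<forall>j\<in>{1..k+1}. real (col_prods (k+1) (k+1) d j) \<le> y" "\<forall>i\<in>{1..k-1}. real (row_prods (k+1) (k+1) d i) \<le> y"
 shows "col_weight k P y (col_prods (k+1) (k+1) d) * (\<Prod>i\<in>{1..k+1}. row_term k P y 0 \<delta>1 \<delta>2 i (row_prods (k+1) (k+1) d i) 0)
   = (\<Prod>v\<in>grid (k+1). 1 / of_nat (d v)) * matrix_weight k P y \<delta>1 \<delta>2 (\<lambda>v\<in>grid (k+1). ln (real (d v)) / ln y)"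
proof -
 define a where "a = col_prods (k+1) (k+1) d"
 define c where "c = row_prods (k+1) (k+1) d"
 define z where "z = (\<lambda>v\<in>grid (k+1). ln (real (d v)) / ln y)"
 define p where "p = (\<Prod>v\<in>grid (k+1). d v)"
 define \<delta> where "\<delta> = (\<lambda>i. if i < k then 0 else if i = k then \<delta>1 else \<delta>2)"
 have L: "ln y > 0" using y by simp
 have a1: "a j \<ge> 1" if "j \<in> {1..k+1}" for j unfolding a_def by (rule prods_pos(1)[OF d that])
 have c1: "c j \<ge> 1" if "j \<in> {1..k+1}" for j unfolding c_def by (rule prods_pos(2)[OF d that])
 have za: "sum z (margin (k+1) (Inl j)) = ln (real (a j)) / ln y" if "j \<in> {1..k+1}" for j
  unfolding z_def a_def by (rule sum_log_margin(1)[OF d y that])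
 have zc: "sum z (margin (k+1) (Inr i)) = ln (real (c i)) / ln y" if "i \<in> {1..k+1}" for i
  unfolding z_def c_def by (rule sum_log_margin(2)[OF d y that])
 have pa: "(\<Prod>j\<in>{1..k+1}. a j) = p"
 proof -
  have "p = (\<Prod>i\<in>{1..k+1}. \<Prod>j\<in>{1..k+1}. d (i, j))" unfolding p_def by (subst prod.cartesian_product) (simp only: case_prod_unfold prod.collapse)
  also have "\<dots> = (\<Prod>j\<in>{1..k+1}. \<Prod>i\<in>{1..k+1}. d (i, j))" by (rule prod.swap)
  also have "\<dots> = (\<Prod>j\<in>{1..k+1}. a j)" by (intro prod.cong[OF refl]) (simp only: a_def col_prods_def restrict_apply' if_True)
  finally show ?thesis ..
 qed
 have pc: "(\<Prod>i\<in>{1..k+1}. c i) = p"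
 proof -
  have "p = (\<Prod>i\<in>{1..k+1}. \<Prod>j\<in>{1..k+1}. d (i, j))" unfolding p_def by (subst prod.cartesian_product) (simp only: case_prod_unfold prod.collapse)
  also have "\<dots> = (\<Prod>j\<in>{1..k+1}. c j)" by (intro prod.cong[OF refl]) (simp only: c_def row_prods_def restrict_apply' if_True)
  finally show ?thesis ..
 qed
 have p1: "p \<ge> 1" unfolding pa[symmetric] using prod_mono[of "{1..k+1}" "\<lambda>_. 1" a] a1 by auto
 have Ik: "i \<in> {1..k+1}" "i < k" if "i \<in> {1..k-1}" for i using that k by auto
 have mc: "mollifier_coeff P y n = poly P (1 - ln (real n) / ln y)" if "n \<ge> 1" for n
  unfolding mollifier_coeff_def using that y L by (simp add: ln_div diff_divide_distrib)
 have dom: "(\<forall>v\<in>grid (k+1). 0 \<le> z v) \<and> (\<forall>i\<in>{1..k+1} <+> {1..k-1}. sum z (margin (k+1) i) \<le> 1)"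
 proof (intro conjI ballI)
  fix v assume v: "v \<in> grid (k+1)"
  have "d v \<ge> 1" using PiE_mem[OF d v] by simp
  then have "0 \<le> ln (real (d v)) / ln y" using L by simp
  then show "0 \<le> z v" using v by (simp only: z_def restrict_apply' if_True)
 next
  fix i assume "i \<in> {1..k+1} <+> {1..k-1}"
  then show "sum z (margin (k+1) i) \<le> 1"
  proof
   fix j assume j: "j \<in> {1..k+1}" "i = Inl j"
   have "ln (real (a j)) \<le> ln y" using ok(1) j a1 y unfolding a_def by (intro ln_mono) (auto simp: Suc_le_eq)
   then show ?thesis unfolding j(2) za[OF j(1)] using L by simp
  next
   fix j assume j: "j \<in> {1..k-1}" "i = Inr j"
   have "ln (real (c j)) \<le> ln y" using ok(2) j c1[OF Ik(1)[OF j(1)]] y unfolding c_def by (intro ln_mono) (auto simp: Suc_le_eq)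
   then show ?thesis unfolding j(2) zc[OF Ik(1)[OF j(1)]] using L by simp
  qed
 qed
 have polys: "(\<Prod>i\<in>{1..k+1} <+> {1..k-1}. poly P (1 - sum z (margin (k+1) i))) =
   (\<Prod>j\<in>{1..k+1}. mollifier_coeff P y (a j)) * (\<Prod>i\<in>{1..k-1}. mollifier_coeff P y (c i))"
 proof -
  have "(\<Prod>i\<in>{1..k+1} <+> {1..k-1}. poly P (1 - sum z (margin (k+1) i))) =
    (\<Prod>j\<in>{1..k+1}. poly P (1 - sum z (margin (k+1) (Inl j)))) * (\<Prod>i\<in>{1..k-1}. poly P (1 - sum z (margin (k+1) (Inr i))))"
   by (simp only: prod.Plus finite_atLeastAtMost o_def)
  also have "(\<Prod>j\<in>{1..k+1}. poly P (1 - sum z (margin (k+1) (Inl j)))) = (\<Prod>j\<in>{1..k+1}. mollifier_coeff P y (a j))"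
   by (intro prod.cong refl) (simp only: za mc[OF a1])
  also have "(\<Prod>i\<in>{1..k-1}. poly P (1 - sum z (margin (k+1) (Inr i)))) = (\<Prod>i\<in>{1..k-1}. mollifier_coeff P y (c i))"
   by (intro prod.cong refl) (simp only: zc[OF Ik(1)] mc[OF c1[OF Ik(1)]])
  finally show ?thesis .
 qed
 have expo: "(\<Sum>v\<in>grid (k+1). scaled_shift k y \<delta>1 \<delta>2 v * of_real (z v)) = (\<Sum>i\<in>{1..k+1}. \<delta> i * of_real (ln (real (c i))))"
 proof -
  have "(\<Sum>v\<in>grid (k+1). scaled_shift k y \<delta>1 \<delta>2 v * of_real (z v)) =
    (\<Sum>i\<in>{1..k+1}. \<Sum>j\<in>{1..k+1}. scaled_shift k y \<delta>1 \<delta>2 (i, j) * of_real (z (i, j)))"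
   by (subst sum.cartesian_product) (simp only: case_prod_unfold prod.collapse)
  also have "\<dots> = (\<Sum>i\<in>{1..k+1}. \<delta> i * of_real (ln (real (c i))))"
  proof (rule sum.cong[OF refl])
   fix i assume i: "i \<in> {1..k+1}"
   have "scaled_shift k y \<delta>1 \<delta>2 (i, j) = \<delta> i * of_real (ln y)" for j
    using i by (auto simp: shift_weight_def \<delta>_def)
   then have "(\<Sum>j\<in>{1..k+1}. scaled_shift k y \<delta>1 \<delta>2 (i, j) * of_real (z (i, j)))
    = \<delta> i * of_real (ln y) * of_real (\<Sum>j\<in>{1..k+1}. z (i, j))" by (simp only: sum_distrib_left of_real_sum)
   also have "(\<Sum>j\<in>{1..k+1}. z (i, j)) = ln (real (c i)) / ln y" using zc[OF i] unfolding sum_margin .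
   finally show "(\<Sum>j\<in>{1..k+1}. scaled_shift k y \<delta>1 \<delta>2 (i, j) * of_real (z (i, j))) = \<delta> i * of_real (ln (real (c i)))"
    using L by simp
  qed
  finally show ?thesis .
 qed
 have rows: "(\<Prod>i\<in>{1..k+1}. row_term k P y 0 \<delta>1 \<delta>2 i (c i) 0) = of_real (\<Prod>i\<in>{1..k-1}. mollifier_coeff P y (c i)) *
   (exp (\<Sum>i\<in>{1..k+1}. \<delta> i * of_real (ln (real (c i)))) * (\<Prod>i\<in>{1..k+1}. of_nat (c i) powr (- 1/2)))"
 proof -
  have "(\<Prod>i\<in>{1..k+1}. row_term k P y 0 \<delta>1 \<delta>2 i (c i) 0) = (\<Prod>i\<in>{1..k+1}. (if i < k then of_real (mollifier_coeff P y (c i)) else 1) *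
    (exp (\<delta> i * of_real (ln (real (c i)))) * of_nat (c i) powr (- 1/2)))"
  proof (rule prod.cong[OF refl])
   fix i assume i: "i \<in> {1..k+1}"
   have ci: "c i \<ge> 1" by (rule c1[OF i])
   have "of_nat (c i) powr (\<delta> i - 1/2) = of_nat (c i) powr (\<delta> i + (- 1/2))" by simp
   also have "\<dots> = of_nat (c i) powr (\<delta> i) * of_nat (c i) powr (- 1/2)" by (rule powr_add)
   also have "of_nat (c i) powr (\<delta> i) = exp (\<delta> i * of_real (ln (real (c i))))" using ci by (simp add: powr_def flip: Ln_of_nat)
   finally show "row_term k P y 0 \<delta>1 \<delta>2 i (c i) 0 = (if i < k then of_real (mollifier_coeff P y (c i)) else 1) *
    (exp (\<delta> i * of_real (ln (real (c i)))) * of_nat (c i) powr (- 1/2))"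
    using ci unfolding row_term_def zeta_term_def \<delta>_def[symmetric] by (simp add: \<delta>_def)
  qed
  also have "\<dots> = (\<Prod>i\<in>{1..k+1}. if i < k then of_real (mollifier_coeff P y (c i)) else 1) *
    (exp (\<Sum>i\<in>{1..k+1}. \<delta> i * of_real (ln (real (c i)))) * (\<Prod>i\<in>{1..k+1}. of_nat (c i) powr (- 1/2)))"
   by (simp only: prod.distrib exp_sum finite_atLeastAtMost)
  also have "(\<Prod>i\<in>{1..k+1}. if i < k then of_real (mollifier_coeff P y (c i)) else 1 :: complex) = (\<Prod>i\<in>{1..k-1}. of_real (mollifier_coeff P y (c i)))"
  proof -
   have "(\<Prod>i\<in>{1..k+1}. if i < k then of_real (mollifier_coeff P y (c i)) else 1 :: complex) = (\<Prod>i\<in>{1..k-1}. if i < k then of_real (mollifier_coeff P y (c i)) else 1)"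
    by (rule prod.mono_neutral_right) (use k in auto)
   also have "\<dots> = (\<Prod>i\<in>{1..k-1}. of_real (mollifier_coeff P y (c i)))" by (rule prod.cong[OF refl]) (use Ik in auto)
   finally show ?thesis .
  qed
  finally show ?thesis by (simp only: of_real_prod)
 qed
 have half: "(\<Prod>j\<in>{1..k+1}. of_nat (a j) powr (- 1/2)) * (\<Prod>i\<in>{1..k+1}. of_nat (c i) powr (- 1/2)) = (\<Prod>v\<in>grid (k+1). 1 / of_nat (d v) :: complex)"
 proof -
  have "real p powr (- 1/2) * real p powr (- 1/2) = 1 / real p"
  proof -
   have "real p powr (- 1/2) * real p powr (- 1/2) = real p powr (- 1)" unfolding powr_add[symmetric] by simp
   also have "\<dots> = 1 / real p" using p1 by (intro powr_neg_one) simp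
   finally show ?thesis .
  qed
  then have "of_real (real p powr (- 1/2)) * of_real (real p powr (- 1/2)) = (1 / of_nat p :: complex)"
   by (metis of_real_1 of_real_divide of_real_mult of_real_of_nat_eq)
  also have "\<dots> = (\<Prod>v\<in>grid (k+1). 1 / of_nat (d v))" unfolding p_def by (simp add: prod_dividef)
  finally show ?thesis unfolding prod_powr_half pa pc .
 qed
 have "matrix_weight k P y \<delta>1 \<delta>2 z = exp (\<Sum>i\<in>{1..k+1}. \<delta> i * of_real (ln (real (c i)))) * of_real ((\<Prod>j\<in>{1..k+1}. mollifier_coeff P y (a j)) * (\<Prod>i\<in>{1..k-1}. mollifier_coeff P y (c i)))"
  unfolding matrix_weight_def polytope_fun_def expo polys by (rule if_P[OF dom])
 moreover have "col_weight k P y a = of_real (\<Prod>j\<in>{1..k+1}. mollifier_coeff P y (a j)) * (\<Prod>j\<in>{1..k+1}. of_nat (a j) powr (- 1/2))"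
  unfolding col_weight_def by (simp only: prod.distrib of_real_prod)
 ultimately show ?thesis unfolding a_def[symmetric] c_def[symmetric] z_def[symmetric] rows half[symmetric] by (simp only: of_real_mult mult_ac)
qed

text \<open>The margins parametrize the diagonal. The cutoffs on the margins turn into membership in
  the polytope, so the sum may run over all staircase matrices with entries up to y.\<close>

lemma diag_sum_eq_matrix_sum:
 assumes k: "k \<ge> 1" and y: "y > 1"
 shows "diag_sum k P y \<delta>1 \<delta>2 = (\<Sum>d\<in>{d \<in> grid (k+1) \<rightarrow>\<^sub>E {1..nat \<lfloor>y\<rfloor>}. staircase (k+1) (k+1) d}.
   (\<Prod>v\<in>grid (k+1). 1 / of_nat (d v)) * matrix_weight k P y \<delta>1 \<delta>2 (\<lambda>v\<in>grid (k+1). ln (real (d v)) / ln y))"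
proof -
 define Y where "Y = nat \<lfloor>y\<rfloor>"
 have Yy: "n \<le> Y \<longleftrightarrow> real n \<le> y" for n using y unfolding Y_def by (simp add: le_nat_floor le_nat_iff le_floor_iff)
 define V where "V = grid (k+1)"
 define S where "S = {d \<in> V \<rightarrow>\<^sub>E {1::nat..}. staircase (k+1) (k+1) d}"
 define ok where "ok = (\<lambda>d. (\<forall>j\<in>{1..k+1}. col_prods (k+1) (k+1) d j \<le> Y) \<and> (\<forall>i\<in>{1..k-1}. row_prods (k+1) (k+1) d i \<le> Y))"
 define f where "f = (\<lambda>d. (col_prods (k+1) (k+1) d, row_prods (k+1) (k+1) d))"
 define g where "g = (\<lambda>d. (\<Prod>v\<in>V. 1 / of_nat (d v)) * matrix_weight k P y \<delta>1 \<delta>2 (\<lambda>v\<in>V. ln (real (d v)) / ln y))"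
 have bij: "bij_betw f S {(a,c). a \<in> {1..k+1} \<rightarrow>\<^sub>E {1..} \<and> c \<in> {1..k+1} \<rightarrow>\<^sub>E {1..} \<and> (\<Prod>j\<in>{1..k+1}. a j) = (\<Prod>i\<in>{1..k+1}. c i)}"
  unfolding f_def S_def V_def by (rule bij_betw_staircase_margins)
 have img: "f ` {d\<in>S. ok d} = diag_pairs k Y"
 proof (intro equalityI subsetI)
  fix p assume "p \<in> f ` {d\<in>S. ok d}"
  then obtain d where d: "d \<in> S" "ok d" "p = f d" by blast
  have "f d \<in> {(a,c). a \<in> {1..k+1} \<rightarrow>\<^sub>E {1..} \<and> c \<in> {1..k+1} \<rightarrow>\<^sub>E {1..} \<and> (\<Prod>j\<in>{1..k+1}. a j) = (\<Prod>i\<in>{1..k+1}. c i)}"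
   using bij d(1) by (rule bij_betw_apply)
  then have m: "col_prods (k+1) (k+1) d \<in> {1..k+1} \<rightarrow>\<^sub>E {1..}" "row_prods (k+1) (k+1) d \<in> {1..k+1} \<rightarrow>\<^sub>E {1..}"
   "(\<Prod>j\<in>{1..k+1}. col_prods (k+1) (k+1) d j) = (\<Prod>i\<in>{1..k+1}. row_prods (k+1) (k+1) d i)" unfolding f_def by blast+
  have "col_prods (k+1) (k+1) d \<in> {1..k+1} \<rightarrow>\<^sub>E {1..Y}" using m(1) d(2) unfolding ok_def PiE_def Pi_def by fastforce
  then show "p \<in> diag_pairs k Y" using m d(2,3) unfolding f_def diag_pairs_def ok_def by blast
 next
  fix p assume p: "p \<in> diag_pairs k Y"
  obtain a c where e: "p = (a, c)" by (cases p)
  have a: "a \<in> {1..k+1} \<rightarrow>\<^sub>E {1..Y}" and c: "c \<in> {1..k+1} \<rightarrow>\<^sub>E {1..}" "\<forall>i\<in>{1..k-1}. c i \<le> Y" "(\<Prod>j\<in>{1..k+1}. a j) = (\<Prod>i\<in>{1..k+1}. c i)"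
   using p unfolding e diag_pairs_def by blast+
  have "a \<in> {1..k+1} \<rightarrow>\<^sub>E {1..}" using a unfolding PiE_def Pi_def by fastforce
  then have "p \<in> f ` S" unfolding bij_betw_imp_surj_on[OF bij] e using c by blast
  then obtain d where d: "d \<in> S" "f d = (a, c)" using e by (metis imageE)
  have "ok d" unfolding ok_def using d(2) c(2) PiE_mem[OF a] unfolding f_def by auto
  then show "p \<in> f ` {d\<in>S. ok d}" using d e by (intro image_eqI[of _ _ d]) auto
 qed
 have dV: "d \<in> grid (k+1) \<rightarrow>\<^sub>E {1..}" if "d \<in> S" for d using that unfolding S_def V_def by blast
 have "diag_sum k P y \<delta>1 \<delta>2 = (\<Sum>p\<in>f ` {d\<in>S. ok d}. case p of (a, c) \<Rightarrow> col_weight k P y a * (\<Prod>i\<in>{1..k+1}. row_term k P y 0 \<delta>1 \<delta>2 i (c i) 0))"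
  unfolding diag_sum_def img Y_def by simp
 also have "\<dots> = (\<Sum>d\<in>{d\<in>S. ok d}. g d)"
 proof (subst sum.reindex)
  show "inj_on f {d\<in>S. ok d}" using bij unfolding bij_betw_def by (auto intro: inj_on_subset)
  show "(\<Sum>x\<in>{d\<in>S. ok d}. ((\<lambda>p. case p of (a, c) \<Rightarrow> col_weight k P y a * (\<Prod>i\<in>{1..k+1}. row_term k P y 0 \<delta>1 \<delta>2 i (c i) 0)) \<circ> f) x) = (\<Sum>d\<in>{d\<in>S. ok d}. g d)"
  proof (rule sum.cong[OF refl])
   fix d assume d: "d \<in> {d\<in>S. ok d}"
   then have o: "\<forall>j\<in>{1..k+1}. real (col_prods (k+1) (k+1) d j) \<le> y" "\<forall>i\<in>{1..k-1}. real (row_prods (k+1) (k+1) d i) \<le> y"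
    unfolding ok_def Yy by blast+
   have "d \<in> S" using d by blast
   then show "((\<lambda>p. case p of (a, c) \<Rightarrow> col_weight k P y a * (\<Prod>i\<in>{1..k+1}. row_term k P y 0 \<delta>1 \<delta>2 i (c i) 0)) \<circ> f) d = g d"
    unfolding g_def V_def o_apply f_def prod.case by (intro diag_term_eq[OF k y dV o])
  qed
 qed
 also have "\<dots> = (\<Sum>d\<in>{d \<in> V \<rightarrow>\<^sub>E {1..Y}. staircase (k+1) (k+1) d}. g d)"
 proof (rule sum.mono_neutral_left)
  show "finite {d \<in> V \<rightarrow>\<^sub>E {1..Y}. staircase (k+1) (k+1) d}"
   by (rule finite_subset[of _ "V \<rightarrow>\<^sub>E {1..Y}"]) (auto simp: V_def intro!: finite_PiE)
  show "{d\<in>S. ok d} \<subseteq> {d \<in> V \<rightarrow>\<^sub>E {1..Y}. staircase (k+1) (k+1) d}"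
  proof
   fix d assume d: "d \<in> {d\<in>S. ok d}"
   have dS: "d \<in> V \<rightarrow>\<^sub>E {1..}" "staircase (k+1) (k+1) d" using d unfolding S_def by blast+
   \<comment> \<open>Rows k and k + 1 carry no cutoff of their own; every entry is bounded through
     its column.\<close>
   have "d v \<in> {1..Y}" if v: "v \<in> V" for v
   proof -
    obtain i j where ij: "v = (i, j)" "i \<in> {1..k+1}" "j \<in> {1..k+1}" using v unfolding V_def by blast
    have "d (i, j) \<le> col_prods (k+1) (k+1) d j" using ij dS(1) unfolding V_def by (intro prods_pos(3))
    also have "\<dots> \<le> Y" using d ij(3) unfolding ok_def by blast
    finally show ?thesis using PiE_mem[OF dS(1) v] ij(1) by simp
   qed
   then have "d \<in> V \<rightarrow>\<^sub>E {1..Y}" using dS(1) unfolding PiE_def Pi_def by blast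
   then show "d \<in> {d \<in> V \<rightarrow>\<^sub>E {1..Y}. staircase (k+1) (k+1) d}" using dS(2) by blast
  qed
  show "\<forall>d\<in>{d \<in> V \<rightarrow>\<^sub>E {1..Y}. staircase (k+1) (k+1) d} - {d\<in>S. ok d}. g d = 0"
  proof
   fix d assume d: "d \<in> {d \<in> V \<rightarrow>\<^sub>E {1..Y}. staircase (k+1) (k+1) d} - {d\<in>S. ok d}"
   have dS: "d \<in> grid (k+1) \<rightarrow>\<^sub>E {1..}" using d unfolding V_def[symmetric] PiE_def Pi_def by fastforce
   then have "\<not> ok d" using d unfolding S_def V_def by blast
   have L: "ln y > 0" using y by simp
   define z where "z = (\<lambda>v\<in>V. ln (real (d v)) / ln y)"
   have big: "\<not> ln (real n) / ln y \<le> 1" if "\<not> n \<le> Y" for n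
   proof -
    have "y < real n" using that Yy by auto
    then have "ln y < ln (real n)" using y by simp
    then show ?thesis using L by simp
   qed
   \<comment> \<open>A margin exceeding Y exceeds y, so its scaled logarithm violates a constraint
     and the weight is 0.\<close>
   have "\<exists>i\<in>{1..k+1} <+> {1..k-1}. \<not> sum z (margin (k+1) i) \<le> 1"
    using \<open>\<not> ok d\<close> unfolding ok_def de_Morgan_conj
   proof
    assume "\<not> (\<forall>j\<in>{1..k+1}. col_prods (k+1) (k+1) d j \<le> Y)"
    then obtain j where j: "j \<in> {1..k+1}" "\<not> col_prods (k+1) (k+1) d j \<le> Y" by blast
    have "sum z (margin (k+1) (Inl j)) = ln (real (col_prods (k+1) (k+1) d j)) / ln y"
     unfolding z_def V_def by (rule sum_log_margin(1)[OF dS y j(1)])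
    then have "\<not> sum z (margin (k+1) (Inl j)) \<le> 1" using big[OF j(2)] by metis
    then show ?thesis by (rule bexI[OF _ InlI[OF j(1)]])
   next
    assume "\<not> (\<forall>i\<in>{1..k-1}. row_prods (k+1) (k+1) d i \<le> Y)"
    then obtain j where j: "j \<in> {1..k-1}" "\<not> row_prods (k+1) (k+1) d j \<le> Y" by blast
    have j': "j \<in> {1..k+1}" using j(1) by auto
    have "sum z (margin (k+1) (Inr j)) = ln (real (row_prods (k+1) (k+1) d j)) / ln y"
     unfolding z_def V_def by (rule sum_log_margin(2)[OF dS y j'])
    then have "\<not> sum z (margin (k+1) (Inr j)) \<le> 1" using big[OF j(2)] by metis
    then show ?thesis by (rule bexI[OF _ InrI[OF j(1)]])
   qed
   then have "matrix_weight k P y \<delta>1 \<delta>2 z = 0" unfolding matrix_weight_def polytope_fun_def by (intro if_not_P) blast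
   then show "g d = 0" unfolding g_def z_def by simp
  qed
 qed
 finally show ?thesis unfolding g_def V_def Y_def .
qed

text \<open>Shifts O(1 / ln y) make the exponents in the scaled coordinates bounded by b0, so one
  pair B, K serves all of them and the matrix asymptotics hold uniformly. Columns alone already
  cover the grid.\<close>

lemma diag_sum_asymptotic:
 assumes k: "k \<ge> 1" and b0: "b0 \<ge> 0"
 shows "\<exists>B\<ge>0. \<exists>C\<ge>0. \<forall>y \<delta>1 \<delta>2. ln y \<ge> 1 \<and> norm \<delta>1 * ln y \<le> b0 \<and> norm \<delta>2 * ln y \<le> b0 \<and> y > 1 \<longrightarrow>
  norm (\<integral>z. matrix_weight k P y \<delta>1 \<delta>2 z \<partial>lborel_on (grid (k+1))) \<le> B \<and>
  norm (diag_sum k P y \<delta>1 \<delta>2 - of_real (arith_factor (k+1) * ln y ^ ((k+1)\<^sup>2)) *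
   (\<integral>z. matrix_weight k P y \<delta>1 \<delta>2 z \<partial>lborel_on (grid (k+1)))) \<le> C * ln y ^ ((k+1)\<^sup>2 - 1)"
proof -
 define V where "V = grid (k+1)"
 define I where "I = {1..k+1} <+> {1..k-1}"
 have mV: "margin (k+1) i \<subseteq> V" if "i \<in> I" for i
  using that unfolding I_def V_def margin_def by auto
 have cov: "\<exists>i\<in>I. v \<in> margin (k+1) i" if v: "v \<in> V" for v
 proof -
  obtain i j where ij: "v = (i, j)" "i \<in> {1..k+1}" "j \<in> {1..k+1}" using v unfolding V_def by blast
  have "v \<in> margin (k+1) (Inl j)" unfolding ij(1) margin_def sum.case using ij(2) by (rule imageI)
  then show ?thesis unfolding I_def by (rule bexI[OF _ InlI[OF ij(3)]])
 qed
 have "finite V" "finite I" unfolding V_def I_def by auto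
 from box_lipschitz_polytope_fun[OF this mV cov b0, of P] obtain B K where B: "B \<ge> 0" and K: "K \<ge> 0" and
  BK: "\<And>\<beta>. \<forall>v\<in>V. norm (\<beta> v) \<le> b0 \<Longrightarrow> box_lipschitz V (polytope_fun V I (margin (k+1)) P \<beta>) B K" by blast
 have k1: "k + 1 \<ge> 1" by simp
 from matrix_sum_asymptotic[OF k1 B K] obtain C where C: "C \<ge> 0" and
  asym: "\<And>L Y H. L \<ge> 1 \<Longrightarrow> L < ln (real (Suc Y)) \<Longrightarrow> box_lipschitz V H B K \<Longrightarrow>
  norm ((\<Sum>d\<in>{d \<in> V \<rightarrow>\<^sub>E {1..Y}. staircase (k+1) (k+1) d}. (\<Prod>v\<in>V. 1 / of_nat (d v)) * H (\<lambda>v\<in>V. ln (real (d v)) / L))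
   - of_real (arith_factor (k+1) * L ^ ((k+1)\<^sup>2)) * (\<integral>x. H x \<partial>lborel_on V)) \<le> C * L ^ ((k+1)\<^sup>2 - 1)"
  unfolding V_def by blast
 have "norm (\<integral>z. matrix_weight k P y \<delta>1 \<delta>2 z \<partial>lborel_on V) \<le> B \<and>
  norm (diag_sum k P y \<delta>1 \<delta>2 - of_real (arith_factor (k+1) * ln y ^ ((k+1)\<^sup>2)) * (\<integral>z. matrix_weight k P y \<delta>1 \<delta>2 z \<partial>lborel_on V)) \<le> C * ln y ^ ((k+1)\<^sup>2 - 1)"
  if L: "ln y \<ge> 1" and \<delta>: "norm \<delta>1 * ln y \<le> b0" "norm \<delta>2 * ln y \<le> b0" and y: "y > 1" for y \<delta>1 \<delta>2
 proof -
  have "norm (scaled_shift k y \<delta>1 \<delta>2 v) \<le> b0" for v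
   unfolding shift_weight_def using \<delta> L b0 by (auto simp: norm_mult split: prod.split)
  then have H: "box_lipschitz V (matrix_weight k P y \<delta>1 \<delta>2) B K"
   unfolding matrix_weight_def V_def[symmetric] I_def[symmetric] by (intro BK ballI)
  \<comment> \<open>Strictness matters: it is the inequality L < ln (Y + 1) that
    \<open>matrix_sum_asymptotic\<close> demands.\<close>
  have "y < real (Suc (nat \<lfloor>y\<rfloor>))" using y by linarith
  then have "ln y < ln (real (Suc (nat \<lfloor>y\<rfloor>)))" using y by simp
  from asym[OF L this H] have "norm (diag_sum k P y \<delta>1 \<delta>2 - of_real (arith_factor (k+1) * ln y ^ ((k+1)\<^sup>2)) * (\<integral>z. matrix_weight k P y \<delta>1 \<delta>2 z \<partial>lborel_on V)) \<le> C * ln y ^ ((k+1)\<^sup>2 - 1)"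
   unfolding diag_sum_eq_matrix_sum[OF k y] V_def .
  moreover have "norm (\<integral>z. matrix_weight k P y \<delta>1 \<delta>2 z \<partial>lborel_on V) \<le> B"
  proof (rule integral_PiM_box(2)[OF \<open>finite V\<close>])
   show "matrix_weight k P y \<delta>1 \<delta>2 \<in> borel_measurable (lborel_on V)" using H unfolding box_lipschitz_def by blast
   show "norm (matrix_weight k P y \<delta>1 \<delta>2 x) \<le> B" if "x \<in> V \<rightarrow>\<^sub>E UNIV" for x using H that unfolding box_lipschitz_def by blast
   show "matrix_weight k P y \<delta>1 \<delta>2 x = 0" if "x \<in> V \<rightarrow>\<^sub>E UNIV" "x \<notin> V \<rightarrow>\<^sub>E {0..1}" for x using box_lipschitz_outside[OF H that] .
  qed
  ultimately show ?thesis by blast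
 qed
 then show ?thesis unfolding V_def[symmetric] using B C by blast
qed

lemma main_term_eq:
 assumes k: "k \<ge> 1" and y: "y > 0"
 shows "main_term k P y \<phi> T \<alpha>1 \<alpha>2 = of_real (T * (\<integral>u. \<phi> u \<partial>lborel)) * of_real (T / (2 * pi)) powr (- \<alpha>1) *
   (of_real (arith_factor (k+1) * ln y ^ ((k+1)\<^sup>2)) * (\<integral>z. matrix_weight k P y \<alpha>1 (- \<alpha>2) z \<partial>lborel_on (grid (k+1))))"
 unfolding main_term_def integral_polytope_fun[OF k y] matrix_weight_def by (simp only: of_real_mult mult_ac)

section \<open>Choice of parameters and assembly\<close>

theorem theorem14:
 fixes k :: nat and P :: "real poly" and \<theta> :: real and \<Phi> :: "real \<Rightarrow> real \<Rightarrow> real"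
 assumes "k \<ge> 1"
  and "0 < \<theta>" and "\<theta> < 1 / (2 * real k)"
  and "weight_family \<Phi>"
 shows "\<forall>C>0. \<exists>K T0. \<forall>T\<ge>T0. \<forall>\<alpha>1 \<alpha>2 :: complex.
      norm \<alpha>1 \<le> C / ln T \<and> norm \<alpha>2 \<le> C / ln T \<longrightarrow>
      norm (twisted_moment k P (T powr \<theta>) (\<Phi> T) T \<alpha>1 \<alpha>2
         - main_term k P (T powr \<theta>) (\<Phi> T) T \<alpha>1 \<alpha>2)
       \<le> K * (T * ln T ^ ((k + 1)\<^sup>2 - 1))"
proof (intro allI impI)
 fix C :: real assume C: "C > 0"
 \<comment> \<open>So that (k + 1) * \<theta> = 1 - 2 * \<epsilon>. One \<epsilon> is spent on the
   factor 2 in the frequency gap, the other is the exponent of the oscillatory estimate.\<close>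
 define \<epsilon> where "\<epsilon> = (1 - (real k + 1) * \<theta>) / 2"
 have k\<theta>: "2 * real k * \<theta> < 1" using assms(1,3) by (simp add: field_simps)
 have "(real k + 1) * \<theta> \<le> 2 * real k * \<theta>" using assms(1,2) by (intro mult_right_mono) auto
 then have \<epsilon>: "\<epsilon> > 0" using k\<theta> by (simp add: \<epsilon>_def)
 have \<theta>1: "\<theta> \<le> 1"
 proof -
  have "1 * \<theta> \<le> (2 * real k) * \<theta>" using assms(1,2) by (intro mult_right_mono) auto
  then show ?thesis using k\<theta> by simp
 qed
 obtain c TA where TA: "\<And>T. T \<ge> TA \<Longrightarrow> good_weight c T (\<lambda>t. \<Phi> T (t / T)) \<and> (\<forall>u. 0 \<le> \<Phi> T u \<and> \<Phi> T u \<le> 1) \<and> smooth_fun (\<Phi> T) \<and>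
  (\<forall>u. u \<notin> {1/4..2} \<longrightarrow> \<Phi> T u = 0)" using good_weight_of_family[OF assms(4)] by blast
 have "(1 / 16 :: real) > 0" by simp
 from oscillatory_integral_negligible[OF \<epsilon> this, of c "real (48 * (k + 1) + 1)"]
 obtain K1 TB where K1: "K1 \<ge> 0" and TB0: "\<forall>T\<ge>TB. \<forall>\<phi> g M lam. good_weight c T \<phi> \<and> g holomorphic_on wide_nbhd T \<and>
   (\<forall>z\<in>wide_nbhd T. norm (g z) \<le> M) \<and> \<bar>lam\<bar> \<ge> T powr (\<epsilon> - 1) \<longrightarrow>
   norm (osc_integral T \<phi> g lam) \<le> K1 * M * T powr (- real (48 * (k + 1) + 1))"
  by blast
 have TB: "norm (osc_integral T \<phi> g lam) \<le> K1 * M * T powr (- real (48 * (k + 1) + 1))"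
  if "T \<ge> TB" "good_weight c T \<phi>" "g holomorphic_on wide_nbhd T" "\<And>z. z\<in>wide_nbhd T \<Longrightarrow> norm (g z) \<le> M" "\<bar>lam\<bar> \<ge> T powr (\<epsilon> - 1)"
  for T \<phi> g M lam
  using TB0[rule_format, of T \<phi> g M lam] that by blast
 obtain K2 TC where K2: "K2 \<ge> 0" and TC: "TC \<ge> 100" "\<And>T \<alpha>. T \<ge> TC \<Longrightarrow> norm \<alpha> \<le> C / ln T \<Longrightarrow> norm \<alpha> \<le> 1 / 3000 \<and>
  chi_ratio \<alpha> holomorphic_on wide_nbhd T \<and> norm (of_real (T / (2 * pi)) powr (- \<alpha>) :: complex) \<le> K2 \<and>
  (\<forall>z\<in>wide_nbhd T. norm (chi_ratio \<alpha> z - of_real (T / (2 * pi)) powr (- \<alpha>)) \<le> K2 / ln T)"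
  using chi_ratio_approx[OF C] by blast
 obtain B where B: "B \<ge> 1" "\<And>y n. y > 1 \<Longrightarrow> n \<ge> 1 \<Longrightarrow> real n \<le> y \<Longrightarrow> \<bar>mollifier_coeff P y n\<bar> \<le> B"
  using mollifier_coeff_bounded[of P] by blast
 obtain B3 C3 where B3: "B3 \<ge> 0" and C3: "C3 \<ge> 0" and diag: "\<And>y \<delta>1 \<delta>2. ln y \<ge> 1 \<Longrightarrow> norm \<delta>1 * ln y \<le> C \<Longrightarrow> norm \<delta>2 * ln y \<le> C \<Longrightarrow> y > 1 \<Longrightarrow>
  norm (\<integral>z. matrix_weight k P y \<delta>1 \<delta>2 z \<partial>lborel_on (grid (k+1))) \<le> B3 \<and>
  norm (diag_sum k P y \<delta>1 \<delta>2 - of_real (arith_factor (k+1) * ln y ^ ((k+1)\<^sup>2)) *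
   (\<integral>z. matrix_weight k P y \<delta>1 \<delta>2 z \<partial>lborel_on (grid (k+1)))) \<le> C3 * ln y ^ ((k+1)\<^sup>2 - 1)"
  using diag_sum_asymptotic[OF assms(1), of C P] C by (metis less_imp_le)
 define m where "m = (k + 1)\<^sup>2"
 have m1: "m \<ge> 1" unfolding m_def by simp
 \<comment> \<open>Bound for the two errors of the reduction that do not grow with T.\<close>
 define Z where "Z = 2 * K2 * B ^ (2 * k) * 4800 + K1 * (2 * K2) * B ^ (2 * (k + 1)) * 8 ^ (k + 1)"
 define W where "W = \<bar>arith_factor (k+1)\<bar> * B3 + C3"
 define K where "K = Z + 4 * K2 * W + 4 * K2 * C3"
 have Z0: "Z \<ge> 0" unfolding Z_def using K1 K2 B(1) by simp
 have W0: "W \<ge> 0" unfolding W_def using B3 C3 by simp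
 have "norm (twisted_moment k P (T powr \<theta>) (\<Phi> T) T \<alpha>1 \<alpha>2 - main_term k P (T powr \<theta>) (\<Phi> T) T \<alpha>1 \<alpha>2) \<le> K * (T * ln T ^ (m - 1))"
  \<comment> \<open>exp (1 / \<theta>) ensures ln y >= 1, and 2 powr (1 / \<epsilon>) ensures 2 <= T
    powr \<epsilon>, which the frequency gap uses.\<close>
  if T: "T \<ge> max (max TA TB) (max TC (max (exp (1 / \<theta>)) (2 powr (1 / \<epsilon>))))" and \<alpha>: "norm \<alpha>1 \<le> C / ln T" "norm \<alpha>2 \<le> C / ln T" for T \<alpha>1 \<alpha>2
 proof -
  have Ts: "T \<ge> TA" "T \<ge> TB" "T \<ge> TC" "T \<ge> exp (1 / \<theta>)" "T \<ge> 2 powr (1 / \<epsilon>)" "T \<ge> 100" using T TC(1) by auto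
  define y where "y = T powr \<theta>"
  define Y where "Y = nat \<lfloor>y\<rfloor>"
  \<comment> \<open>An integer strictly above T ^ 24 and at most 2 * T ^ 24; being above T, it also
    exceeds Y ^ (k + 1).\<close>
  define N where "N = Suc (nat \<lfloor>T ^ 24\<rfloor>)"
  define X where "X = (of_real (T / (2 * pi)) powr (- \<alpha>1) :: complex)"
  define M where "M = (\<integral>u. \<Phi> T u \<partial>lborel)"
  define J where "J = (\<integral>z. matrix_weight k P y \<alpha>1 (- \<alpha>2) z \<partial>lborel_on (grid (k+1)))"
  define D where "D = diag_sum k P y \<alpha>1 (- \<alpha>2)"
  have ln1: "ln T \<ge> 1"
  proof -
   have "exp 1 \<le> T" using exp_le Ts(6) by linarith
   then show ?thesis using Ts(6) by (simp add: ln_ge_iff)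
  qed
  have lny: "ln y = \<theta> * ln T" unfolding y_def using Ts(6) by simp
  have L1: "ln y \<ge> 1"
  proof -
   have "1 / \<theta> \<le> ln T" using Ts(4,6) by (simp add: ln_ge_iff)
   then show ?thesis unfolding lny using assms(2) by (simp add: field_simps)
  qed
  have LT: "ln y \<le> ln T" unfolding lny using \<theta>1 ln1 by (simp add: mult_left_le_one_le assms(2) less_imp_le)
  have y1: "y > 1"
  proof (rule ccontr)
   assume "\<not> y > 1"
   moreover have "y > 0" unfolding y_def using Ts(6) by simp
   ultimately have "ln y \<le> 0" by simp
   then show False using L1 by simp
  qed
  have Y1: "Y \<ge> 1" unfolding Y_def using y1 by linarith
  have Yy: "real Y \<le> y" unfolding Y_def using y1 by (simp add: of_nat_floor)
  have Yp: "real Y ^ n \<le> T powr (\<theta> * real n)" for n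
  proof -
   have "real Y ^ n \<le> y ^ n" using Yy by (intro power_mono) auto
   also have "\<dots> = T powr (\<theta> * real n)" unfolding y_def using Ts(6) by (simp add: powr_powr flip: powr_realpow)
   finally show ?thesis .
  qed
  have e2: "\<theta> * real (k + 1) = 1 - 2 * \<epsilon>" unfolding \<epsilon>_def by (simp add: field_simps)
  have YT: "real (Y ^ (k + 1)) \<le> T powr (1 - 2 * \<epsilon>)" using Yp[of "k + 1"] unfolding e2 of_nat_power .
  have "T powr (1 - 2 * \<epsilon>) \<le> T powr 1" using \<epsilon> Ts(6) by (intro powr_mono) auto
  then have YT1: "real (Y ^ (k + 1)) \<le> T" using YT Ts(6) by simp
  have gap: "1 / (2 * real (Y ^ (k + 1))) \<ge> T powr (\<epsilon> - 1)"
  proof -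
   have "2 = (2 powr (1 / \<epsilon>)) powr \<epsilon>" using \<epsilon> by (simp add: powr_powr)
   also have "\<dots> \<le> T powr \<epsilon>" using Ts(5) \<epsilon> by (intro powr_mono2) auto
   finally have "2 * real (Y ^ (k + 1)) \<le> T powr \<epsilon> * T powr (1 - 2 * \<epsilon>)" using YT by (intro mult_mono) auto
   also have "\<dots> = T powr (1 - \<epsilon>)" unfolding powr_add[symmetric] by simp
   finally have "1 / T powr (1 - \<epsilon>) \<le> 1 / (2 * real (Y ^ (k + 1)))" using Y1 Ts(6) by (intro divide_left_mono) auto
   also have "1 / T powr (1 - \<epsilon>) = T powr (- (1 - \<epsilon>))" by (rule powr_minus_divide[symmetric])
   finally show ?thesis by simp
  qed
  have Y2k: "real Y ^ (2 * k) \<le> T"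
  proof -
   have "T powr (\<theta> * real (2 * k)) \<le> T powr 1" using k\<theta> Ts(6) by (intro powr_mono) (auto simp: mult_ac)
   then show ?thesis using Yp[of "2 * k"] Ts(6) by simp
  qed
  have T24: "T ^ 24 \<ge> 1" "T \<le> T ^ 24" using Ts(6) power_increasing[of 1 24 T] by (auto simp: one_le_power)
  have N24: "T ^ 24 < real N" "real N \<le> 2 * T ^ 24" unfolding N_def using T24 by linarith+
  have YN: "Y ^ (k + 1) < N" using YT1 T24(2) N24(1) by (simp only: of_nat_less_iff[where 'a = real, symmetric])
  have mc: "\<bar>mollifier_coeff P y n\<bar> \<le> B" if "n \<in> {1..Y}" for n
  proof (rule B(2)[OF y1])
   have "real n \<le> real Y" using that by simp
   then show "real n \<le> y" using Yy by linarith
  qed (use that in simp)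
  note w = TA[OF Ts(1)]
  have cw: "continuous_on UNIV (\<lambda>t. \<Phi> T (t / T))" using good_weight_continuous[of c T "\<lambda>t. \<Phi> T (t / T)" UNIV 0] w by simp
  note a1 = TC(2)[OF Ts(3) \<alpha>(1)] and a2 = TC(2)[OF Ts(3) \<alpha>(2)]
  have XK: "norm X \<le> K2" unfolding X_def using a1 by blast
  have red: "norm (twisted_moment k P y (\<Phi> T) T \<alpha>1 \<alpha>2 - of_real (T * M) * X * D) \<le> Z + 4 * (K2 * T / ln T) * norm D"
   unfolding Z_def D_def M_def
  proof (rule twisted_moment_reduction[where \<epsilon> = \<epsilon> and N = N and Y = Y])
   show "norm (osc_integral T (\<lambda>t. \<Phi> T (t / T)) g lam) \<le> K1 * M * T powr (- real (48 * (k + 1) + 1))"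
    if "g holomorphic_on wide_nbhd T" "\<And>z. z \<in> wide_nbhd T \<Longrightarrow> norm (g z) \<le> M" "\<bar>lam\<bar> \<ge> T powr (\<epsilon> - 1)" for g M lam
    by (rule TB[OF Ts(2) _ that]) (use w in blast)+
   show "norm (chi_ratio \<alpha>1 z - X) \<le> K2 / ln T" if "z \<in> wide_nbhd T" for z unfolding X_def using a1 that by blast
   show "\<bar>mollifier_coeff P y n\<bar> \<le> B" if "n \<in> {1..Y}" for n by (rule mc[OF that])
   show "norm \<alpha>1 \<le> 1 / 3000" "norm \<alpha>2 \<le> 1 / 3000" "chi_ratio \<alpha>1 holomorphic_on wide_nbhd T" using a1 a2 by blast+
   show "y \<ge> 0" "T ^ 24 \<le> real N" using y1 N24 by simp_all
   show "0 \<le> \<Phi> T u \<and> \<Phi> T u \<le> 1" for u using w by blast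
   show "\<Phi> T u = 0" if "u \<notin> {1/4..2}" for u using w that by blast
  qed (fact assms(1) Ts(6) B(1) Y_def Y1 YN YT1 gap Y2k N24(2) cw XK K1 K2)+
  have M4: "\<bar>M\<bar> \<le> 4"
  proof -
   have "T * M = integral {T / 8..4 * T} (\<lambda>t. \<Phi> T (t / T))"
    unfolding M_def by (rule weight_integral[symmetric]) (use Ts(6) cw w in auto)
   also have "norm \<dots> \<le> 1 * (4 * T - T / 8)"
    by (rule integral_bound) (use Ts(6) w continuous_on_subset[OF cw] in auto)
   finally have "T * \<bar>M\<bar> \<le> T * 4" using Ts(6) by (simp add: abs_mult)
   then show ?thesis using Ts(6) by simp
  qed
  have bd: "norm \<alpha> * ln y \<le> C" if "norm \<alpha> \<le> C / ln T" for \<alpha> :: complex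
  proof -
   have "norm \<alpha> * ln y \<le> (C / ln T) * ln T" using that LT L1 C ln1 by (intro mult_mono) auto
   then show ?thesis using ln1 by simp
  qed
  have "norm (- \<alpha>2) \<le> C / ln T" using \<alpha>(2) by simp
  from diag[OF L1 bd[OF \<alpha>(1)] bd[OF this] y1]
  have JB: "norm J \<le> B3" and DJ: "norm (D - of_real (arith_factor (k+1) * ln y ^ m) * J) \<le> C3 * ln y ^ (m - 1)"
   unfolding J_def D_def m_def by blast+
  have pw: "ln y ^ (m - 1) \<le> ln T ^ (m - 1)" "ln y ^ m \<le> ln T ^ m" using LT L1 by (auto intro!: power_mono)
  have DW: "norm D \<le> W * ln T ^ m"
  proof -
   have "norm D \<le> norm (of_real (arith_factor (k+1) * ln y ^ m) * J) + norm (D - of_real (arith_factor (k+1) * ln y ^ m) * J)"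
    by (rule norm_triangle_sub)
   moreover have "norm (of_real (arith_factor (k+1) * ln y ^ m) * J) = \<bar>arith_factor (k+1)\<bar> * ln y ^ m * norm J"
    using L1 by (simp add: norm_mult norm_power)
   moreover have "\<bar>arith_factor (k+1)\<bar> * ln y ^ m * norm J \<le> \<bar>arith_factor (k+1)\<bar> * ln T ^ m * B3"
    using JB pw L1 ln1 by (intro mult_mono) auto
   moreover have "C3 * ln y ^ (m - 1) \<le> C3 * ln T ^ m"
    using pw(1) power_increasing[of "m - 1" m "ln T"] ln1 by (intro mult_left_mono C3) simp
   ultimately have "norm D \<le> \<bar>arith_factor (k+1)\<bar> * ln T ^ m * B3 + C3 * ln T ^ m" using DJ by linarith
   then show ?thesis by (simp add: W_def algebra_simps)
  qed
  \<comment> \<open>The diagonal sum has order ln T ^ m, so the relative error 1 / ln T of the chi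
    ratio produces exactly the admissible exponent m - 1.\<close>
  have lm: "ln T ^ m = ln T * ln T ^ (m - 1)" using m1 by (metis Suc_diff_1 less_le_trans power_Suc zero_less_one)
  \<comment> \<open>The first difference is the reduction to the diagonal sum, the second the error
    in the asymptotics of that sum.\<close>
  have "twisted_moment k P y (\<Phi> T) T \<alpha>1 \<alpha>2 - main_term k P y (\<Phi> T) T \<alpha>1 \<alpha>2 =
    (twisted_moment k P y (\<Phi> T) T \<alpha>1 \<alpha>2 - of_real (T * M) * X * D) + of_real (T * M) * X * (D - of_real (arith_factor (k+1) * ln y ^ m) * J)"
   using y1 unfolding main_term_eq[OF assms(1) less_trans[OF zero_less_one y1]] m_def M_def X_def J_def by (simp only: right_diff_distrib) simp
  then have split: "norm (twisted_moment k P y (\<Phi> T) T \<alpha>1 \<alpha>2 - main_term k P y (\<Phi> T) T \<alpha>1 \<alpha>2) \<le>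
    norm (twisted_moment k P y (\<Phi> T) T \<alpha>1 \<alpha>2 - of_real (T * M) * X * D) + norm (of_real (T * M) * X * (D - of_real (arith_factor (k+1) * ln y ^ m) * J))"
   by (simp only: norm_triangle_ineq)
  have e1: "norm (of_real (T * M) * X * (D - of_real (arith_factor (k+1) * ln y ^ m) * J)) \<le> (T * 4) * K2 * (C3 * ln T ^ (m - 1))"
  proof -
   have "norm (of_real (T * M) :: complex) \<le> T * 4" using M4 Ts(6) by (simp add: norm_mult)
   moreover have "norm (D - of_real (arith_factor (k+1) * ln y ^ m) * J) \<le> C3 * ln T ^ (m - 1)"
    using DJ mult_left_mono[OF pw(1) C3] by linarith
   ultimately show ?thesis unfolding norm_mult[of _ "D - _"] norm_mult[of _ X] using XK Ts(6) K2 by (intro mult_mono) auto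
  qed
  have "4 * (K2 * T / ln T) * norm D \<le> 4 * (K2 * T / ln T) * (W * ln T ^ m)"
   using DW K2 Ts(6) ln1 by (intro mult_left_mono) auto
  also have "\<dots> = 4 * K2 * W * (T * ln T ^ (m - 1))" unfolding lm using ln1 by simp
  finally have e2: "4 * (K2 * T / ln T) * norm D \<le> 4 * K2 * W * (T * ln T ^ (m - 1))" .
  have "1 * 1 \<le> T * ln T ^ (m - 1)" using Ts(6) ln1 by (intro mult_mono) auto
  then have e3: "Z \<le> Z * (T * ln T ^ (m - 1))" using Z0 mult_left_mono[of 1 "T * ln T ^ (m - 1)" Z] by simp
  have "K * (T * ln T ^ (m - 1)) = Z * (T * ln T ^ (m - 1)) + 4 * K2 * W * (T * ln T ^ (m - 1)) + (T * 4) * K2 * (C3 * ln T ^ (m - 1))"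
   by (simp add: K_def algebra_simps)
  then show ?thesis unfolding y_def[symmetric] using split red e1 e2 e3 by linarith
 qed
 then show "\<exists>K T0. \<forall>T\<ge>T0. \<forall>\<alpha>1 \<alpha>2 :: complex. norm \<alpha>1 \<le> C / ln T \<and> norm \<alpha>2 \<le> C / ln T \<longrightarrow>
      norm (twisted_moment k P (T powr \<theta>) (\<Phi> T) T \<alpha>1 \<alpha>2 - main_term k P (T powr \<theta>) (\<Phi> T) T \<alpha>1 \<alpha>2)
       \<le> K * (T * ln T ^ ((k + 1)\<^sup>2 - 1))"
  unfolding m_def by blast
qed

end
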